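(* Let $\mathcal U=(\mathcal U(\mathbb R),\tau_{\rm vague},d_{\mathcal U},\pi)$ be the configuration space over $\mathbb R$ with the vague topology, the $\ell_2$-matching extended distance and the Poisson measure of unit intensity, and let $\bar{\mathcal U}_n=(\bar{\mathcal U}_n,\bar d_n,\bar\pi_n)$, $n\in\mathbb N$, be the mm-spaces obtained from the window $(-n,n)$ as described in the context. Then: \begin{itemize} \item $\overline{\mathcal P_{\mathcal U}}^{\square}=\overline{\bigcup_{n\in\mathbb N}\mathcal P_{\bar{\mathcal U}_n}}^{\square}$; \item $(\mathcal U,\tau_{\rm vague},d_{\mathcal U},\pi)$ is not concentrated, i.e. $\mathcal L_1(\mathcal U)$ is not compact. \end{itemize}
   Context: For a locally compact Polish subspace $X\subset\mathbb R$ (similarly for $X\times X$), $\mathcal U(X)$ is the set of measures $\gamma=\sum_{i=1}^N\delta_{x_i}$, $N\in\mathbb N_0\cup\{\infty\}$, $x_i\in X$, with $\gamma(K)<\infty$ for compact $K\subset X$. $\mathcal U:=\mathcal U(\mathbb R)$. $\tau_{\rm vague}$ is the topology of duality with compactly supported continuous functions. For $\gamma,\eta\in\mathcal U(X)$, $$d_{\mathcal U(X)}(\gamma,\eta)^2=\inf_{c\in\mathrm{Cpl}(\gamma,\eta)}\int_{X\times X}|x-y|^2\,dc(x,y),\qquad\inf\emptyset=+\infty,$$ $\mathrm{Cpl}(\gamma,\eta)=\{c\in\mathcal U(X\times X):c(A\times X)=\gamma(A),\ c(X\times A)=\eta(A)\text{ for all Borel }A\}$; $d_{\mathcal U}:=d_{\mathcal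 U(\mathbb R)}$. Let $B_n=(-n,n)$, $\bar B_n=[-n,n]$, $\partial B_n=\{-n,n\}$ and, for $\gamma,\eta\in\mathcal U$, $$d_n(\gamma,\eta)=\inf_{\alpha,\beta\in\mathcal U(\partial B_n)}d_{\mathcal U(\bar B_n)}(\gamma|_{B_n}+\alpha,\eta|_{B_n}+\beta),$$ a semidistance with $d_n(\gamma,\eta)=0$ iff $\gamma|_{B_n}=\eta|_{B_n}$. $\mathcal U_n$ is the quotient of $\mathcal U$ by the relation $d_n(\gamma,\eta)=0$, with quotient distance $\tilde d_n$. $\pi^{(n)}$ is the Poisson probability on $\mathcal U(\bar B_n)$: $\int F\,d\pi^{(n)}=e^{-|\bar B_n|}\sum_{k=0}^\infty\frac1{k!}\int_{\bar B_n^{k}}F(\sum_{i=1}^k\delta_{x_i})\,dx_1\cdots dx_k$ for nonnegative Borel $F$. $\pi$ is the Poisson measure on $\mathcal U$ of unit intensity, i.e. the unique Borel probability whose image under $\gamma\mapsto\gamma|_{\bar B_n}$ is $\pi^{(n)}$ for every $n$. Regarding $\mathcal U(\bar B_n)\subset\mathcal U$, $\pi_n$ is the image of $\pi^{(n)}$ in $\mathcal U_n$; $(\bar{\mathcal U}_n,\bar d_n)$ is the completion of $(\mathcal U_n,\tilde d_n)$ and $\bar\pi_n$ the push-forward of $\pi_n$ to it. An mm-space is a complete separable metric space with a Borel probability measure; $\mathcal X$ is the set of mm-isomorphism classes (isomorphism: measure-preserving map that is distance-preserving on the support). An emm-space is $(X,\tau,d,m)$ with $(X,\tau)$ Polish,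 $d:X\times X\to[0,+\infty]$ a complete, $\tau\times\tau$-lower semicontinuous extended distance whose induced topology is finer than or equal to $\tau$, and $m$ a $\tau$-Borel probability measure. $Y\prec X$: there are a measurable $\varphi:X\to Y$ with $\varphi_\#m_X=m_Y$ and $E$ with $m_X(E)=1$ such that $d_Y(\varphi(x),\varphi(y))\le d_X(x,y)$ on $E\times E$. $\mathcal P_X=\{Y\in\mathcal X:Y\prec X\}$. Box distance on $\mathcal X$: with parameters (Borel maps $\iota_X:[0,1)\to X$ with $(\iota_X)_\#\mathrm{Leb}=m_X$), $\square(X,Y)$ is the infimum over parameters of the infimum of $\varepsilon\ge0$ such that some Borel $I_0\subset[0,1)$ has $\mathrm{Leb}(I_0)\ge1-\varepsilon$ and $|d_X(\iota_X(s),\iota_X(t))-d_Y(\iota_Y(s),\iota_Y(t))|\le\varepsilon$ on $I_0\times I_0$; $\overline{\,\cdot\,}^\square$ is closure in $(\mathcal X,\square)$. $\mathrm{Lip}_1(X,m_X)$ is the set of $m_X$-classes of real measurable $f$ with $|f(x)-f(y)|\le d_X(x,y)$ on $E\times E$ for some $E$ of full measure; $\mathcal L_1(X)=\mathrm{Lip}_1(X,m_X)/\mathbb R$ (quotient by constants) with the quotient of the Ky Fan distance $d_{L^0}(f,g)=\inf\{\varepsilon>0:m_X(|f-g|>\varepsilon)\le\varepsilon\}$. $X$ is concentrated if $\mathcal L_1(X)$ is compact. *)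

theory Defs
  imports "HOL-Probability.Probability"
begin

section \<open>Classes and quotients\<close>

text \<open>
  The distance induced by \<open>d\<close> on classes. For a semidistance \<open>d\<close> and classes of points at distance
  zero the infimum is over a constant family, hence just the common value of \<open>d\<close>; for the quotient
  by a group of isometries it is the usual quotient distance.
\<close>

definition class_dist :: "('a \<Rightarrow> 'a \<Rightarrow> real) \<Rightarrow> 'a set \<Rightarrow> 'a set \<Rightarrow> real" where
  "class_dist d P Q = (INF (x, y)\<in>P \<times> Q. d x y)"

text \<open>The value outside the carrier is set to 0 because \<^locale>\<open>Metric_space\<close> asks for nonnegativity
  and symmetry on the whole type.\<close>

definition quotient_metric :: "'a set \<Rightarrow> ('a \<times> 'a) set \<Rightarrow> ('a \<Rightarrow> 'a \<Rightarrow> real) \<Rightarrow> 'a set metric" where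
  "quotient_metric S r d =
     metric (S // r, \<lambda>P Q. if P \<in> S // r \<and> Q \<in> S // r then class_dist d P Q else 0)"

text \<open>Completion of a metric space: Cauchy sequences modulo asymptotic coincidence.\<close>

definition cauchy_seqs :: "'a metric \<Rightarrow> (nat \<Rightarrow> 'a) set" where
  "cauchy_seqs m = {\<sigma>. Metric_space.MCauchy (mspace m) (mdist m) \<sigma>}"

definition cauchy_rel :: "'a metric \<Rightarrow> ((nat \<Rightarrow> 'a) \<times> (nat \<Rightarrow> 'a)) set" where
  "cauchy_rel m = {(\<sigma>, \<rho>). \<sigma> \<in> cauchy_seqs m \<and> \<rho> \<in> cauchy_seqs m \<and>
                          (\<lambda>k. mdist m (\<sigma> k) (\<rho> k)) \<longlonglongrightarrow> 0}"

definition completion :: "'a metric \<Rightarrow> (nat \<Rightarrow> 'a) set metric" where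
  "completion m =
     quotient_metric (cauchy_seqs m) (cauchy_rel m) (\<lambda>\<sigma> \<rho>. lim (\<lambda>k. mdist m (\<sigma> k) (\<rho> k)))"

definition completion_embed :: "'a metric \<Rightarrow> 'a \<Rightarrow> (nat \<Rightarrow> 'a) set" where
  "completion_embed m x = cauchy_rel m `` {\<lambda>_. x}"

definition borel_on :: "'a topology \<Rightarrow> 'a measure" where
  "borel_on T = sigma (topspace T) {U. openin T U}"

section \<open>Metric measure spaces, the Lipschitz order and the box distance\<close>

type_synonym 'a mm = "'a metric \<times> 'a measure"

definition mm_space :: "'a mm \<Rightarrow> bool" where
  "mm_space X \<longleftrightarrow> mcomplete_of (fst X) \<and> separable_space (mtopology_of (fst X)) \<and>
     sets (snd X) = sets (borel_on (mtopology_of (fst X))) \<and> prob_space (snd X)"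

record 'a emm =
  emm_top :: "'a topology"
  emm_dist :: "'a \<Rightarrow> 'a \<Rightarrow> ennreal"
  emm_meas :: "'a measure"

definition emm_of_mm :: "'a mm \<Rightarrow> 'a emm" where
  "emm_of_mm X = \<lparr>emm_top = mtopology_of (fst X),
                  emm_dist = (\<lambda>x y. ennreal (mdist (fst X) x y)),
                  emm_meas = snd X\<rparr>"

definition top_support :: "'a topology \<Rightarrow> 'a measure \<Rightarrow> 'a set" where
  "top_support T \<mu> = {x \<in> topspace T. \<forall>U. openin T U \<and> x \<in> U \<longrightarrow> emeasure \<mu> U > 0}"

definition mm_iso :: "'a mm \<Rightarrow> 'b mm \<Rightarrow> bool" where
  "mm_iso X Y \<longleftrightarrow> (\<exists>\<phi>. \<phi> \<in> measurable (snd X) (snd Y) \<and> distr (snd X) (snd Y) \<phi> = snd Y \<and>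
     (\<forall>x \<in> top_support (mtopology_of (fst X)) (snd X).
      \<forall>y \<in> top_support (mtopology_of (fst X)) (snd X).
        mdist (fst Y) (\<phi> x) (\<phi> y) = mdist (fst X) x y))"

text \<open>
  A nonempty complete separable metric space has at most the cardinality of the continuum, so every
  mm-space is isomorphic to one whose points are real numbers (with an arbitrary metric, unrelated
  to the usual one). Hence the isomorphism classes of mm-spaces on subsets of \<^typ>\<open>real\<close> represent
  all isomorphism classes.
\<close>

definition mm_rel :: "(real mm \<times> real mm) set" where
  "mm_rel = {(X, Y). mm_space X \<and> mm_space Y \<and> mm_iso X Y}"

definition mm_classes :: "real mm set set" where
  "mm_classes = {X. mm_space X} // mm_rel"

definition lip_dominated :: "'b emm \<Rightarrow> 'a emm \<Rightarrow> bool"  (infix "\<prec>\<^sub>L" 50) where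
  "Y \<prec>\<^sub>L X \<longleftrightarrow> (\<exists>\<phi> E. \<phi> \<in> measurable (emm_meas X) (emm_meas Y) \<and>
     distr (emm_meas X) (emm_meas Y) \<phi> = emm_meas Y \<and>
     E \<in> sets (emm_meas X) \<and> emeasure (emm_meas X) E = 1 \<and>
     (\<forall>x\<in>E. \<forall>y\<in>E. emm_dist Y (\<phi> x) (\<phi> y) \<le> emm_dist X x y))"

definition pyramid :: "'a emm \<Rightarrow> real mm set set" where
  "pyramid X = {mm_rel `` {Y} |Y. mm_space Y \<and> emm_of_mm Y \<prec>\<^sub>L X}"

abbreviation unit_leb :: "real measure" where
  "unit_leb \<equiv> restrict_space lborel {0..<1}"

definition mm_parameters :: "'a mm \<Rightarrow> (real \<Rightarrow> 'a) set" where
  "mm_parameters X = {\<iota> \<in> measurable unit_leb (snd X). distr unit_leb (snd X) \<iota> = snd X}"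

definition box_mm :: "'a mm \<Rightarrow> 'b mm \<Rightarrow> real" where
  "box_mm X Y = Inf {\<epsilon>. \<epsilon> \<ge> 0 \<and>
     (\<exists>\<iota>\<in>mm_parameters X. \<exists>\<kappa>\<in>mm_parameters Y. \<exists>I\<in>sets unit_leb. measure unit_leb I \<ge> 1 - \<epsilon> \<and>
        (\<forall>s\<in>I. \<forall>t\<in>I. \<bar>mdist (fst X) (\<iota> s) (\<iota> t) - mdist (fst Y) (\<kappa> s) (\<kappa> t)\<bar> \<le> \<epsilon>))}"

definition box_dist :: "real mm set \<Rightarrow> real mm set \<Rightarrow> real" where
  "box_dist = class_dist box_mm"

definition box_closure :: "real mm set set \<Rightarrow> real mm set set" where
  "box_closure A = {P \<in> mm_classes. \<forall>\<epsilon>>0. \<exists>Q\<in>A. box_dist P Q < \<epsilon>}"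

section \<open>Observables and concentration\<close>

definition Lip1 :: "'a emm \<Rightarrow> ('a \<Rightarrow> real) set" where
  "Lip1 X = {f \<in> borel_measurable (emm_meas X).
     \<exists>E \<in> sets (emm_meas X). emeasure (emm_meas X) E = 1 \<and>
       (\<forall>x\<in>E. \<forall>y\<in>E. ennreal \<bar>f x - f y\<bar> \<le> emm_dist X x y)}"

definition ky_fan :: "'a measure \<Rightarrow> ('a \<Rightarrow> real) \<Rightarrow> ('a \<Rightarrow> real) \<Rightarrow> real" where
  "ky_fan \<mu> f g = Inf {\<epsilon>. \<epsilon> > 0 \<and> measure \<mu> {x \<in> space \<mu>. \<bar>f x - g x\<bar> > \<epsilon>} \<le> \<epsilon>}"

text \<open>The two identifications (equality almost everywhere, and then addition of constants) are made
  in one step.\<close>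

definition ae_const_rel :: "'a emm \<Rightarrow> (('a \<Rightarrow> real) \<times> ('a \<Rightarrow> real)) set" where
  "ae_const_rel X = {(f, g). f \<in> Lip1 X \<and> g \<in> Lip1 X \<and>
                            (\<exists>c. AE x in emm_meas X. f x = g x + c)}"

definition L1_space :: "'a emm \<Rightarrow> ('a \<Rightarrow> real) set metric" where
  "L1_space X = quotient_metric (Lip1 X) (ae_const_rel X) (ky_fan (emm_meas X))"

definition concentrated :: "'a emm \<Rightarrow> bool" where
  "concentrated X \<longleftrightarrow> compact_space (mtopology_of (L1_space X))"

section \<open>Configurations and the matching distance\<close>

definition dirac_sum :: "enat \<Rightarrow> (nat \<Rightarrow> 'a::topological_space) \<Rightarrow> 'a measure" where
  \<comment> \<open>the image of counting measure, i.e. \<open>\<Sum>i<N. \<delta>(x i)\<close>\<close>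
  "dirac_sum N x = distr (count_space {i. enat i < N}) borel x"

text \<open>
  A configuration on \<open>X\<close> is represented by its extension by zero to the Borel sets of the ambient
  type. In particular configurations on a closed window are configurations on the line.
\<close>

definition configs :: "'a::topological_space set \<Rightarrow> 'a measure set" where
  "configs X = {\<gamma>. (\<exists>N x. (\<forall>i. enat i < N \<longrightarrow> x i \<in> X) \<and> \<gamma> = dirac_sum N x) \<and>
                  (\<forall>K. compact K \<and> K \<subseteq> X \<longrightarrow> emeasure \<gamma> K < \<infinity>)}"

definition vague_test :: "real set \<Rightarrow> (real \<Rightarrow> real) set" where
  \<comment> \<open>continuous compactly supported functions on \<open>X\<close>, extended by zero\<close>
  "vague_test X = {f. continuous_on X f \<and> (\<exists>K. compact K \<and> K \<subseteq> X \<and> (\<forall>x. x \<notin> K \<longrightarrow> f x = 0))}"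

definition vague_topology :: "real set \<Rightarrow> real measure topology" where
  "vague_topology X = topology_generated_by
     {{\<gamma> \<in> configs X. integral\<^sup>L \<gamma> f \<in> V} |f V. f \<in> vague_test X \<and> open V}"

definition couplings :: "real set \<Rightarrow> real measure \<Rightarrow> real measure \<Rightarrow> (real \<times> real) measure set" where
  "couplings X \<gamma> \<eta> = {c \<in> configs (X \<times> X). \<forall>A \<in> sets borel. A \<subseteq> X \<longrightarrow>
     emeasure c (A \<times> X) = emeasure \<gamma> A \<and> emeasure c (X \<times> A) = emeasure \<eta> A}"

definition ennreal_sqrt :: "ennreal \<Rightarrow> ennreal" where
  "ennreal_sqrt x = (if x = \<infinity> then \<infinity> else ennreal (sqrt (enn2real x)))"

definition config_dist :: "real set \<Rightarrow> real measure \<Rightarrow> real measure \<Rightarrow> ennreal" where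
  "config_dist X \<gamma> \<eta> = ennreal_sqrt
     (INF c \<in> couplings X \<gamma> \<eta>. \<integral>\<^sup>+ z. ennreal (\<bar>fst z - snd z\<bar>\<^sup>2) \<partial>c)"

section \<open>Windows and the Poisson measure\<close>

abbreviation owin :: "nat \<Rightarrow> real set" where "owin n \<equiv> {- real n <..< real n}"
abbreviation cwin :: "nat \<Rightarrow> real set" where "cwin n \<equiv> {- real n .. real n}"
abbreviation bwin :: "nat \<Rightarrow> real set" where "bwin n \<equiv> {- real n, real n}"

definition restrict_config :: "real set \<Rightarrow> real measure \<Rightarrow> real measure" where
  "restrict_config B \<gamma> = density \<gamma> (indicator B)"

definition add_config :: "real measure \<Rightarrow> real measure \<Rightarrow> real measure" where
  "add_config \<gamma> \<alpha> = measure_of UNIV (sets borel) (\<lambda>A. emeasure \<gamma> A + emeasure \<alpha> A)"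

definition window_dist :: "nat \<Rightarrow> real measure \<Rightarrow> real measure \<Rightarrow> ennreal" where
  "window_dist n \<gamma> \<eta> = (INF (\<alpha>, \<beta>) \<in> configs (bwin n) \<times> configs (bwin n).
     config_dist (cwin n) (add_config (restrict_config (owin n) \<gamma>) \<alpha>)
                          (add_config (restrict_config (owin n) \<eta>) \<beta>))"

definition window_rel :: "nat \<Rightarrow> (real measure \<times> real measure) set" where
  "window_rel n = {(\<gamma>, \<eta>). \<gamma> \<in> configs UNIV \<and> \<eta> \<in> configs UNIV \<and> window_dist n \<gamma> \<eta> = 0}"

text \<open>The semidistance \<^const>\<open>window_dist\<close> is finite on configurations, since boundary points may be
  added on both sides.\<close>

definition window_metric :: "nat \<Rightarrow> real measure set metric" where
  "window_metric n =
     quotient_metric (configs UNIV) (window_rel n) (\<lambda>\<gamma> \<eta>. enn2real (window_dist n \<gamma> \<eta>))"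

text \<open>The defining formula of the Poisson law on a window, for \<open>F\<close> the indicator of \<open>A\<close>. The summand
  \<open>k = 0\<close> is the integral over a one-point space and gives the empty configuration.\<close>

definition poisson_window :: "nat \<Rightarrow> real measure measure" where
  "poisson_window n = measure_of (configs (cwin n)) (sets (borel_on (vague_topology (cwin n))))
     (\<lambda>A. ennreal (exp (- measure lborel (cwin n))) *
        (\<Sum>k. ennreal (1 / fact k) *
           (\<integral>\<^sup>+ x. indicator A (dirac_sum (enat k) x)
              \<partial>(PiM {..<k} (\<lambda>_. restrict_space lborel (cwin n))))))"

definition poisson_measure :: "real measure measure \<Rightarrow> bool" where
  "poisson_measure \<pi> \<longleftrightarrow> prob_space \<pi> \<and> sets \<pi> = sets (borel_on (vague_topology UNIV)) \<and>
     (\<forall>n\<ge>1. distr \<pi> (borel_on (vague_topology (cwin n))) (restrict_config (cwin n)) = poisson_window n)"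

definition window_poisson :: "nat \<Rightarrow> real measure set measure" where
  "window_poisson n = distr (poisson_window n) (borel_on (mtopology_of (window_metric n)))
     (\<lambda>\<gamma>. window_rel n `` {\<gamma>})"

definition window_mm :: "nat \<Rightarrow> (nat \<Rightarrow> real measure set) set mm" where
  "window_mm n = (completion (window_metric n),
     distr (window_poisson n) (borel_on (mtopology_of (completion (window_metric n))))
       (completion_embed (window_metric n)))"

definition config_emm :: "real measure measure \<Rightarrow> real measure emm" where
  "config_emm \<pi> = \<lparr>emm_top = vague_topology UNIV, emm_dist = config_dist UNIV, emm_meas = \<pi>\<rparr>"

end

(*
  The clamp onto a window is 1-Lipschitz, so d_n <= d_m <= d_U for n <= m, and gamma |-> [gamma]
  dominates every window space by U; this is one inclusion. Conversely d_U = sup_n d_n: window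
  matchings of bounded cost pair each point with one of finitely many partners, so they converge
  along a subsequence. For Y dominated by U, a compactness argument on a vaguely compact set K of
  large measure, on which the dominating map is almost continuous, makes this map 1-Lipschitz for
  some d_n up to a small error. The distances to a finite net of its image, corrected by McShane's
  extension formula, then define a space Z dominated by a window and box-close to Y. As the box
  distance satisfies the triangle inequality, every point of the closure of P_U is reached.

  The distances from the points 3j to the configuration, cut off at 1/2, are 1-Lipschitz. The void
  probabilities of the Poisson measure show that two of them differ, modulo constants, by a fixed
  amount in the Ky Fan distance, so the space of observables is not totally bounded.
*)
theory Submission
  imports Defs
begin

section \<open>Quotient metrics, completions and Borel structures\<close>

text \<open>The distance d_U is extended, so the bound on the dominating map may be void on many
  pairs and no single window need control it exactly. The box distance forgives a small exceptional
  set and a small additive error; the compactness argument spends both. The limit of violating pairs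
  must remain where the Lipschitz bound holds, so \<open>K\<close> is cut from sets that lie inside
  that set of full measure and are closed under limits; this is the purpose of inner regularity.
  Limits of configurations are taken in the sense of \<open>vconv\<close>, semicontinuity of counts
  on intervals, and vague Borel sets are reduced to such counts, so that no metric for the vague
  topology has to be constructed. Isomorphism classes are formed on subsets of the reals; hence the
  coding of complete separable spaces by real numbers, which yields parameters on the unit interval
  as well as real copies of the spaces that are constructed. For the second claim, centres at mutual
  distance at least 3 make intervals of radius 1/2 and 1/4 disjoint, and an additive constant cannot
  help because the two observables can be exchanged.\<close>

lemma
  assumes r: "equiv S r"
    and cls: "\<And>x y. x \<in> S \<Longrightarrow> y \<in> S \<Longrightarrow> class_dist d (r `` {x}) (r `` {y}) = D x y"
    and nonneg: "\<And>x y. x \<in> S \<Longrightarrow> y \<in> S \<Longrightarrow> 0 \<le> D x y"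
    and comm: "\<And>x y. x \<in> S \<Longrightarrow> y \<in> S \<Longrightarrow> D x y = D y x"
    and tri: "\<And>x y z. x \<in> S \<Longrightarrow> y \<in> S \<Longrightarrow> z \<in> S \<Longrightarrow> D x z \<le> D x y + D y z"
    and zero: "\<And>x y. x \<in> S \<Longrightarrow> y \<in> S \<Longrightarrow> D x y = 0 \<longleftrightarrow> (x, y) \<in> r"
  shows mspace_quotient_metric: "mspace (quotient_metric S r d) = S // r"
    and mdist_quotient_metric:
      "x \<in> S \<Longrightarrow> y \<in> S \<Longrightarrow> mdist (quotient_metric S r d) (r `` {x}) (r `` {y}) = D x y"
proof -
  let ?e = "\<lambda>P Q. if P \<in> S // r \<and> Q \<in> S // r then class_dist d P Q else 0"
  have M: "Metric_space (S // r) ?e"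
  proof
    fix P Q
    show "0 \<le> ?e P Q"
      by (auto elim!: quotientE simp: cls nonneg)
    show "?e P Q = ?e Q P"
      by (auto elim!: quotientE simp: cls) (metis comm)
    show "(?e P Q = 0) = (P = Q)" if PQ: "P \<in> S // r" "Q \<in> S // r"
    proof -
      from PQ obtain x y where "x \<in> S" "y \<in> S" "P = r `` {x}" "Q = r `` {y}"
        by (auto elim!: quotientE)
      with PQ show ?thesis
        using zero cls eq_equiv_class_iff[OF r] by auto
    qed
    fix R assume "P \<in> S // r" "Q \<in> S // r" "R \<in> S // r"
    then show "?e P R \<le> ?e P Q + ?e Q R"
      by (auto elim!: quotientE simp: cls tri)
  qed
  then show "mspace (quotient_metric S r d) = S // r"
    unfolding quotient_metric_def by (simp add: Metric_space.mspace_metric)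
  show "mdist (quotient_metric S r d) (r `` {x}) (r `` {y}) = D x y" if "x \<in> S" "y \<in> S"
    using that M unfolding quotient_metric_def
    by (simp add: Metric_space.mdist_metric quotientI cls)
qed

lemma class_dist_pseudo:
  fixes d :: "'a \<Rightarrow> 'a \<Rightarrow> real"
  assumes S: "x \<in> S" "y \<in> S"
    and nonneg: "\<And>x y. x \<in> S \<Longrightarrow> y \<in> S \<Longrightarrow> 0 \<le> d x y"
    and comm: "\<And>x y. x \<in> S \<Longrightarrow> y \<in> S \<Longrightarrow> d x y = d y x"
    and tri: "\<And>x y z. x \<in> S \<Longrightarrow> y \<in> S \<Longrightarrow> z \<in> S \<Longrightarrow> d x z \<le> d x y + d y z"
    and refl: "\<And>x. x \<in> S \<Longrightarrow> d x x = 0"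
    and r: "r = {(x, y). x \<in> S \<and> y \<in> S \<and> d x y = 0}"
  shows "class_dist d (r `` {x}) (r `` {y}) = d x y"
proof -
  have "d u v = d x y" if "(x, u) \<in> r" "(y, v) \<in> r" for u v
  proof -
    from that have *: "u \<in> S" "v \<in> S" "d x u = 0" "d y v = 0" by (auto simp: r)
    have "d u v \<le> d u x + d x v" "d x v \<le> d x y + d y v"
      "d x y \<le> d x u + d u y" "d u y \<le> d u v + d v y"
      using * S by (blast intro: tri)+
    moreover have "d u x = 0" "d v y = 0" using * S comm by auto
    ultimately show ?thesis using * by linarith
  qed
  then have "class_dist d (r `` {x}) (r `` {y}) = (INF p\<in>r `` {x} \<times> r `` {y}. d x y)"
    unfolding class_dist_def by (intro INF_cong) auto
  also have "\<dots> = d x y"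
    using S refl by (intro cINF_const) (auto simp: r)
  finally show ?thesis .
qed

lemma equiv_pseudo:
  fixes d :: "'a \<Rightarrow> 'a \<Rightarrow> real"
  assumes nonneg: "\<And>x y. x \<in> S \<Longrightarrow> y \<in> S \<Longrightarrow> 0 \<le> d x y"
    and comm: "\<And>x y. x \<in> S \<Longrightarrow> y \<in> S \<Longrightarrow> d x y = d y x"
    and tri: "\<And>x y z. x \<in> S \<Longrightarrow> y \<in> S \<Longrightarrow> z \<in> S \<Longrightarrow> d x z \<le> d x y + d y z"
    and refl: "\<And>x. x \<in> S \<Longrightarrow> d x x = 0"
    and r: "r = {(x, y). x \<in> S \<and> y \<in> S \<and> d x y = 0}"
  shows "equiv S r"
proof (rule equivI)
  show "r \<subseteq> S \<times> S" "refl_on S r" "sym r"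
    using comm refl by (auto simp: r refl_on_def sym_def)
  show "trans r"
    unfolding trans_def
  proof (intro allI impI)
    fix x y z assume "(x, y) \<in> r" "(y, z) \<in> r"
    then show "(x, z) \<in> r"
      using tri[of x y z] nonneg[of x z] by (auto simp: r)
  qed
qed

text \<open>For a semidistance the infimum over two classes runs over a constant family, so the
  quotient distance is \<open>d\<close> itself. Completions and windows are of this kind. For
  observables modulo constants the infimum does real work, and there the general form with a
  separate \<open>D\<close> is used.\<close>

lemma quotient_metric_pseudo:
  fixes d :: "'a \<Rightarrow> 'a \<Rightarrow> real"
  assumes "\<And>x y. x \<in> S \<Longrightarrow> y \<in> S \<Longrightarrow> 0 \<le> d x y"
    and "\<And>x y. x \<in> S \<Longrightarrow> y \<in> S \<Longrightarrow> d x y = d y x"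
    and "\<And>x y z. x \<in> S \<Longrightarrow> y \<in> S \<Longrightarrow> z \<in> S \<Longrightarrow> d x z \<le> d x y + d y z"
    and "\<And>x. x \<in> S \<Longrightarrow> d x x = 0"
    and "r = {(x, y). x \<in> S \<and> y \<in> S \<and> d x y = 0}"
  shows "mspace (quotient_metric S r d) = S // r"
    and "x \<in> S \<Longrightarrow> y \<in> S \<Longrightarrow> mdist (quotient_metric S r d) (r `` {x}) (r `` {y}) = d x y"
proof -
  note e = equiv_pseudo[OF assms]
  have c: "class_dist d (r `` {x}) (r `` {y}) = d x y" if "x \<in> S" "y \<in> S" for x y
    by (rule class_dist_pseudo[OF that assms])
  show "mspace (quotient_metric S r d) = S // r"
    by (rule mspace_quotient_metric[OF e c]) (use assms in auto)
  show "mdist (quotient_metric S r d) (r `` {x}) (r `` {y}) = d x y" if "x \<in> S" "y \<in> S"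
    by (rule mdist_quotient_metric[OF e c]) (use assms that in auto)
qed

section \<open>Completion by Cauchy sequences\<close>

lemma cauchy_seqs_mdist_convergent:
  assumes "\<sigma> \<in> cauchy_seqs m" "\<rho> \<in> cauchy_seqs m"
  shows "convergent (\<lambda>k. mdist m (\<sigma> k) (\<rho> k))"
proof -
  interpret Metric_space "mspace m" "mdist m" by simp
  have in_m: "\<sigma> k \<in> mspace m" "\<rho> k \<in> mspace m" for k
    using assms by (auto simp: cauchy_seqs_def MCauchy_def)
  have "Cauchy (\<lambda>k. mdist m (\<sigma> k) (\<rho> k))"
  proof (rule metric_CauchyI)
    fix e :: real assume e: "e > 0"
    then have e2: "e / 2 > 0" by simp
    have C: "MCauchy \<sigma>" "MCauchy \<rho>" using assms by (auto simp: cauchy_seqs_def)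
    obtain N1 where 1: "\<And>n n'. N1 \<le> n \<Longrightarrow> N1 \<le> n' \<Longrightarrow> mdist m (\<sigma> n) (\<sigma> n') < e / 2"
      using C(1) e2 unfolding MCauchy_def by meson
    obtain N2 where 2: "\<And>n n'. N2 \<le> n \<Longrightarrow> N2 \<le> n' \<Longrightarrow> mdist m (\<rho> n) (\<rho> n') < e / 2"
      using C(2) e2 unfolding MCauchy_def by meson
    have "dist (mdist m (\<sigma> n) (\<rho> n)) (mdist m (\<sigma> n') (\<rho> n')) < e"
      if "n \<ge> max N1 N2" "n' \<ge> max N1 N2" for n n'
    proof -
      have "mdist m (\<sigma> n) (\<sigma> n') < e / 2" "mdist m (\<rho> n) (\<rho> n') < e / 2"
        using 1 2 that by auto
      moreover have "\<bar>mdist m (\<sigma> n) (\<rho> n) - mdist m (\<sigma> n') (\<rho> n')\<bar>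
          \<le> mdist m (\<sigma> n) (\<sigma> n') + mdist m (\<rho> n) (\<rho> n')"
        using triangle[of "\<sigma> n" "\<sigma> n'" "\<rho> n"] triangle[of "\<sigma> n'" "\<rho> n'" "\<rho> n"]
          triangle[of "\<sigma> n'" "\<sigma> n" "\<rho> n'"] triangle[of "\<sigma> n" "\<rho> n" "\<rho> n'"] in_m
        by (simp add: commute abs_le_iff)
      ultimately show ?thesis by (simp add: dist_real_def)
    qed
    then show "\<exists>M. \<forall>n\<ge>M. \<forall>n'\<ge>M. dist (mdist m (\<sigma> n) (\<rho> n)) (mdist m (\<sigma> n') (\<rho> n')) < e"
      by blast
  qed
  then show ?thesis by (simp add: Cauchy_convergent_iff)
qed

lemma completion_pseudo:
  fixes m :: "'a metric"
  defines "d \<equiv> \<lambda>\<sigma> \<rho>. lim (\<lambda>k. mdist m (\<sigma> k) (\<rho> k))"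
  shows "\<And>x y. x \<in> cauchy_seqs m \<Longrightarrow> y \<in> cauchy_seqs m \<Longrightarrow> 0 \<le> d x y"
    and "\<And>x y. x \<in> cauchy_seqs m \<Longrightarrow> y \<in> cauchy_seqs m \<Longrightarrow> d x y = d y x"
    and "\<And>x y z. x \<in> cauchy_seqs m \<Longrightarrow> y \<in> cauchy_seqs m \<Longrightarrow> z \<in> cauchy_seqs m \<Longrightarrow>
          d x z \<le> d x y + d y z"
    and "\<And>x. x \<in> cauchy_seqs m \<Longrightarrow> d x x = 0"
    and "cauchy_rel m = {(x, y). x \<in> cauchy_seqs m \<and> y \<in> cauchy_seqs m \<and> d x y = 0}"
proof -
  interpret Metric_space "mspace m" "mdist m" by simp
  have in_m: "x k \<in> mspace m" if "x \<in> cauchy_seqs m" for x k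
    using that by (auto simp: cauchy_seqs_def MCauchy_def)
  have lim: "(\<lambda>k. mdist m (x k) (y k)) \<longlonglongrightarrow> d x y"
    if "x \<in> cauchy_seqs m" "y \<in> cauchy_seqs m" for x y
    using cauchy_seqs_mdist_convergent[OF that] unfolding d_def convergent_LIMSEQ_iff .
  show "0 \<le> d x y" if "x \<in> cauchy_seqs m" "y \<in> cauchy_seqs m" for x y
    by (rule LIMSEQ_le_const[OF lim[OF that]]) auto
  show "d x y = d y x" for x y
    by (simp add: d_def commute)
  show "d x z \<le> d x y + d y z"
    if "x \<in> cauchy_seqs m" "y \<in> cauchy_seqs m" "z \<in> cauchy_seqs m" for x y z
    by (rule LIMSEQ_le[OF lim[OF that(1,3)] tendsto_add[OF lim[OF that(1,2)] lim[OF that(2,3)]]])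
      (use that in_m in \<open>auto intro!: triangle\<close>)
  show "d x x = 0" if "x \<in> cauchy_seqs m" for x
    using that in_m by (simp add: d_def)
  show "cauchy_rel m = {(x, y). x \<in> cauchy_seqs m \<and> y \<in> cauchy_seqs m \<and> d x y = 0}"
  proof -
    have 1: "((\<lambda>k. mdist m (x k) (y k)) \<longlonglongrightarrow> 0) = (d x y = 0)"
      if "x \<in> cauchy_seqs m" "y \<in> cauchy_seqs m" for x y
    proof
      show "d x y = 0" if "(\<lambda>k. mdist m (x k) (y k)) \<longlonglongrightarrow> 0"
        unfolding d_def using that by (rule limI)
      show "(\<lambda>k. mdist m (x k) (y k)) \<longlonglongrightarrow> 0" if "d x y = 0"
        using lim[OF \<open>x \<in> cauchy_seqs m\<close> \<open>y \<in> cauchy_seqs m\<close>] that by (simp only:)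
    qed
    have "(x \<in> cauchy_seqs m \<and> y \<in> cauchy_seqs m \<and> (\<lambda>k. mdist m (x k) (y k)) \<longlonglongrightarrow> 0) =
        (x \<in> cauchy_seqs m \<and> y \<in> cauchy_seqs m \<and> d x y = 0)" for x y
      using 1[of x y] by argo
    then show ?thesis
      unfolding cauchy_rel_def by presburger
  qed
qed

lemmas quotient_metric_completion =
  quotient_metric_pseudo[where S = "cauchy_seqs m" and r = "cauchy_rel m"
    and d = "\<lambda>\<sigma> \<rho>. lim (\<lambda>k. mdist m (\<sigma> k) (\<rho> k))" for m,
    OF completion_pseudo, folded completion_def]

lemma mspace_completion: "mspace (completion m) = cauchy_seqs m // cauchy_rel m"
  by (rule quotient_metric_completion(1))

lemma const_cauchy_seqs:
  assumes "x \<in> mspace m" shows "(\<lambda>_. x) \<in> cauchy_seqs m"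
proof -
  have "mdist m x x = 0" using assms by simp
  then show ?thesis
    using assms by (auto simp: cauchy_seqs_def Metric_space.MCauchy_def simp del: mdist_zero)
qed

lemma completion_embed_in_mspace:
  "x \<in> mspace m \<Longrightarrow> completion_embed m x \<in> mspace (completion m)"
  unfolding completion_embed_def mspace_completion
  by (rule quotientI[OF const_cauchy_seqs])

lemma mdist_completion_embed:
  assumes "x \<in> mspace m" "y \<in> mspace m"
  shows "mdist (completion m) (completion_embed m x) (completion_embed m y) = mdist m x y"
  unfolding completion_embed_def
  by (subst quotient_metric_completion(2)) (auto simp: const_cauchy_seqs assms)

section \<open>Sigma-algebras generated by topologies\<close>

lemma space_borel_on [simp]: "space (borel_on T) = topspace T"
  unfolding borel_on_def by (rule space_measure_of) (auto dest: openin_subset)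

lemma sets_borel_on: "sets (borel_on T) = sigma_sets (topspace T) {U. openin T U}"
  unfolding borel_on_def by (rule sets_measure_of) (auto dest: openin_subset)

lemma openin_in_sets_borel_on: "openin T U \<Longrightarrow> U \<in> sets (borel_on T)"
  by (simp add: sets_borel_on)

lemma measurable_borel_onI:
  assumes "\<And>x. x \<in> space M \<Longrightarrow> f x \<in> topspace T"
    and "\<And>U. openin T U \<Longrightarrow> f -` U \<inter> space M \<in> sets M"
  shows "f \<in> measurable M (borel_on T)"
  unfolding borel_on_def
  by (rule measurable_measure_of) (use assms in \<open>auto dest: openin_subset\<close>)

lemma measurable_borel_on_continuous:
  assumes "continuous_map T T' f"
  shows "f \<in> measurable (borel_on T) (borel_on T')"
proof (rule measurable_borel_onI)
  show "f x \<in> topspace T'" if "x \<in> space (borel_on T)" for x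
    using that assms by (auto simp: continuous_map)
  show "f -` U \<inter> space (borel_on T) \<in> sets (borel_on T)" if "openin T' U" for U
  proof -
    have "f -` U \<inter> space (borel_on T) = {x \<in> topspace T. f x \<in> U}" by auto
    then show ?thesis
      using openin_continuous_map_preimage[OF assms that] by (simp add: openin_in_sets_borel_on)
  qed
qed

lemma continuous_map_nonexpansive:
  assumes "\<And>x. x \<in> mspace m \<Longrightarrow> f x \<in> mspace m'"
    and "\<And>x y. x \<in> mspace m \<Longrightarrow> y \<in> mspace m \<Longrightarrow> mdist m' (f x) (f y) \<le> mdist m x y"
  shows "continuous_map (mtopology_of m) (mtopology_of m') f"
proof -
  have "Lipschitz_continuous_map m m' f"
    unfolding Lipschitz_continuous_map_def using assms
    by (auto intro!: exI[of _ 1])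
  then show ?thesis
    by (simp add: Lipschitz_continuous_imp_continuous_map)
qed

section \<open>Parameters and the box distance\<close>

primrec bit_rem :: "real \<Rightarrow> nat \<Rightarrow> real" where
  "bit_rem t 0 = t"
| "bit_rem t (Suc k) = bit_rem t k - (if (1/3)^k \<le> bit_rem t k then (1/3)^k else 0)"

definition tbit :: "real \<Rightarrow> nat \<Rightarrow> bool" where
  "tbit t k \<longleftrightarrow> (1/3)^k \<le> bit_rem t k"

text \<open>Binary digits are written in base 3 because the digits behind place k then weigh at most
  half of \<open>(1/3)^k\<close>. The remainder therefore determines the digit at place k, and the
  greedy expansion in \<open>bit_rem\<close> reads the digits back by a Borel map.\<close>

definition bcode :: "(nat \<Rightarrow> bool) \<Rightarrow> real" where
  "bcode b = (\<Sum>k. of_bool (b k) * (1/3)^k)"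

lemma summable_bcode: "summable (\<lambda>k. of_bool (b k) * (1/3::real)^k)"
  by (rule summable_comparison_test'[where g = "\<lambda>k. (1/3)^k" and N = 0])
    (auto intro: summable_geometric)

lemma tbit_bcode: "tbit (bcode b) k = b k"
proof -
  \<comment> \<open>The tail of the series from place k on. It turns out to be the greedy remainder
    \<open>bit_rem (bcode b) k\<close>; \<open>b_iff\<close> carries the induction.\<close>
  define R where "R k = (\<Sum>j. of_bool (b (j + k)) * (1/3::real)^(j + k))" for k
  have smm: "summable (\<lambda>j. of_bool (b (j + k)) * (1/3::real)^(j + k))" for k
    using summable_ignore_initial_segment[OF summable_bcode] .
  have R_Suc: "R (Suc k) = R k - (if b k then (1/3)^k else 0)" for k
    unfolding R_def using suminf_split_head[OF smm[of k]] by simp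
  have R_nonneg: "0 \<le> R k" for k
    unfolding R_def by (intro suminf_nonneg smm) simp
  have R_le: "R (Suc k) \<le> (1/3)^k / 2" for k
  proof -
    have "R (Suc k) \<le> (\<Sum>j. (1/3)^(Suc k) * (1/3)^j)"
      unfolding R_def
      by (intro suminf_le smm summable_mult summable_geometric) (auto simp: power_add)
    also have "\<dots> = (1/3)^(Suc k) * (3/2)"
      by (subst suminf_mult) (auto simp: suminf_geometric summable_geometric)
    finally show ?thesis by simp
  qed
  have b_iff: "(1/3)^k \<le> R k \<longleftrightarrow> b k" for k
  proof -
    define c where "c = (1/3::real)^k"
    have "0 < c" by (simp add: c_def)
    with R_Suc[of k] R_nonneg[of "Suc k"] R_le[of k] show ?thesis
      unfolding c_def[symmetric] by (cases "b k") auto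
  qed
  have "bit_rem (bcode b) k = R k" for k
    by (induction k) (auto simp: R_Suc b_iff, simp add: R_def bcode_def)
  then show ?thesis by (simp add: tbit_def b_iff)
qed

lemma measurable_bit_rem [measurable]: "(\<lambda>t. bit_rem t k) \<in> borel_measurable borel"
  by (induction k) auto

lemma measurable_tbit [measurable]: "Measurable.pred borel (\<lambda>t. tbit t k)"
  unfolding tbit_def by measurable

lemma dense_sequence:
  assumes "separable_space (mtopology_of m)" "mspace m \<noteq> {}"
  obtains y :: "nat \<Rightarrow> 'a" where "\<And>i. y i \<in> mspace m"
    "\<And>x e. x \<in> mspace m \<Longrightarrow> e > 0 \<Longrightarrow> \<exists>i. mdist m (y i) x < e"
proof -
  interpret Metric_space "mspace m" "mdist m" by simp
  obtain C where C: "countable C" "C \<subseteq> mspace m" "mtopology closure_of C = mspace m"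
    using assms(1) unfolding separable_space_def mtopology_of_def by auto
  then have "C \<noteq> {}" using assms(2) by auto
  then have r: "range (from_nat_into C) = C" using C(1) by (simp add: range_from_nat_into)
  show ?thesis
  proof
    show "from_nat_into C i \<in> mspace m" for i using r C(2) by auto
    show "\<exists>i. mdist m (from_nat_into C i) x < e" if "x \<in> mspace m" "e > 0" for x e
    proof -
      from that C(3) obtain y where "y \<in> C" "y \<in> mball x e"
        unfolding metric_closure_of by auto
      then show ?thesis using r by (auto simp: commute) (metis imageE)
    qed
  qed
qed

lemma mball_in_sets:
  assumes "y \<in> mspace m"
  shows "{x \<in> mspace m. mdist m y x < e} \<in> sets (borel_on (mtopology_of m))"
proof -
  interpret Metric_space "mspace m" "mdist m" by simp
  have "{x \<in> mspace m. mdist m y x < e} = mball y e" using assms by (auto simp: mball_def)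
  then show ?thesis by (simp add: openin_in_sets_borel_on mtopology_of_def)
qed

text \<open>For divergent sequences the value \<open>p 0\<close> keeps this a total map into the
  space. Every real number has to be decoded to some point, whether or not it is a code.\<close>

definition seq_limit :: "'a metric \<Rightarrow> (nat \<Rightarrow> 'a) \<Rightarrow> 'a" where
  "seq_limit m p = (if \<exists>l. limitin (mtopology_of m) p l sequentially
     then THE l. limitin (mtopology_of m) p l sequentially else p 0)"

lemma seq_limit_eq:
  assumes "limitin (mtopology_of m) p l sequentially"
  shows "seq_limit m p = l"
proof -
  interpret Metric_space "mspace m" "mdist m" by simp
  have "l' = l" if "limitin (mtopology_of m) p l' sequentially" for l'
    using limitin_metric_unique[OF that[unfolded mtopology_of_def] assms[unfolded mtopology_of_def]]
    by simp
  then show ?thesis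
    unfolding seq_limit_def using assms the_equality[of "\<lambda>l. limitin (mtopology_of m) p l sequentially" l] by metis
qed

text \<open>By completeness, convergence is the Cauchy condition with radii
  \<open>1 / real (Suc e)\<close>, and the limit lies in an open \<open>U\<close> iff the balls of
  one such radius about all late terms lie in \<open>U\<close>. Both are countable combinations of
  conditions on the indices \<open>ix j\<close>.\<close>

lemma measurable_seq_limit:
  assumes compl: "mcomplete_of m"
    and y: "\<And>i. y i \<in> mspace m"
    and ix [measurable]: "\<And>j. ix j \<in> measurable M (count_space (UNIV :: nat set))"
  shows "(\<lambda>t. seq_limit m (\<lambda>j. y (ix j t))) \<in> measurable M (borel_on (mtopology_of m))"
proof -
  interpret Metric_space "mspace m" "mdist m" by simp
  let ?p = "\<lambda>t j. y (ix j t)"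
  let ?C = "\<lambda>t. \<forall>e. \<exists>N. \<forall>j\<ge>N. \<forall>j'\<ge>N. mdist m (y (ix j t)) (y (ix j' t)) < 1 / real (Suc e)"
  have Cauchy: "MCauchy (?p t) \<longleftrightarrow> ?C t" for t
  proof
    assume "MCauchy (?p t)" then show "?C t"
      unfolding MCauchy_def by (auto simp del: of_nat_Suc)
  next
    assume C: "?C t"
    show "MCauchy (?p t)"
      unfolding MCauchy_def
    proof (intro conjI allI impI)
      fix e :: real assume "e > 0"
      then obtain k where k: "1 / real (Suc k) < e" by (metis nat_approx_posE)
      from C obtain N where "\<forall>j\<ge>N. \<forall>j'\<ge>N. mdist m (?p t j) (?p t j') < 1 / real (Suc k)"
        by blast
      with k show "\<exists>N. \<forall>n n'. N \<le> n \<longrightarrow> N \<le> n' \<longrightarrow> mdist m (?p t n) (?p t n') < e"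
        by (meson less_trans)
    qed (use y in auto)
  qed
  have conv: "(\<exists>l. limitin (mtopology_of m) (?p t) l sequentially) \<longleftrightarrow> ?C t" for t
  proof -
    have "range (?p t) \<subseteq> mspace m" using y by auto
    then have "(\<exists>l. limitin mtopology (?p t) l sequentially) \<longleftrightarrow> MCauchy (?p t)"
      using compl convergent_imp_MCauchy unfolding mcomplete_of_def mcomplete_def by blast
    then show ?thesis using Cauchy by (simp add: mtopology_of_def)
  qed
  have lim_in: "seq_limit m (?p t) \<in> mspace m" for t
  proof (cases "\<exists>l. limitin (mtopology_of m) (?p t) l sequentially")
    case True
    then obtain l where l: "limitin (mtopology_of m) (?p t) l sequentially" by blast
    then have "l \<in> mspace m" by (simp add: limitin_def)
    then show ?thesis using seq_limit_eq[OF l] by simp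
  qed (simp add: seq_limit_def y)
  have "(\<lambda>t. seq_limit m (?p t)) -` U \<inter> space M \<in> sets M" if U: "openin (mtopology_of m) U" for U
  proof -
    let ?B = "\<lambda>e i. mball (y i) (1 / real (Suc e)) \<subseteq> U"
    have *: "seq_limit m (?p t) \<in> U \<longleftrightarrow> (\<exists>e. \<exists>N. \<forall>j\<ge>N. ?B e (ix j t))" if "?C t" for t
    proof -
      from that conv obtain l where l: "limitin (mtopology_of m) (?p t) l sequentially" by blast
      note l' = seq_limit_eq[OF l]
      from l have lm: "l \<in> mspace m"
        and lim: "\<And>e. e > 0 \<Longrightarrow> \<exists>N. \<forall>n\<ge>N. mdist m (?p t n) l < e"
        unfolding mtopology_of_def limit_metric_sequentially by (blast, meson)
      show ?thesis
      proof
        assume "seq_limit m (?p t) \<in> U"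
        then have "l \<in> U" using l' by simp
        then obtain r where r: "r > 0" "mball l r \<subseteq> U"
          using U unfolding mtopology_of_def openin_mtopology by blast
        then obtain k where k: "1 / real (Suc k) < r / 2" by (metis nat_approx_posE half_gt_zero)
        obtain N where N: "\<forall>n\<ge>N. mdist m (?p t n) l < r / 2" using lim[of "r / 2"] r by auto
        have "?B k (ix j t)" if "j \<ge> N" for j
        proof
          fix x assume x: "x \<in> mball (?p t j) (1 / real (Suc k))"
          then have "mdist m l x \<le> mdist m l (?p t j) + mdist m (?p t j) x"
            using lm y by (intro triangle) auto
          also have "\<dots> < r / 2 + r / 2"
            using N that x k by (intro add_strict_mono) (auto simp: commute)
          finally show "x \<in> U" using r x lm by auto
        qed
        then show "\<exists>e. \<exists>N. \<forall>j\<ge>N. ?B e (ix j t)" by blast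
      next
        assume "\<exists>e. \<exists>N. \<forall>j\<ge>N. ?B e (ix j t)"
        then obtain e N where N: "\<forall>j\<ge>N. ?B e (ix j t)" by blast
        obtain N' where "\<forall>n\<ge>N'. mdist m (?p t n) l < 1 / real (Suc e)"
          using lim[of "1 / real (Suc e)"] by auto
        then have "l \<in> mball (?p t (max N N')) (1 / real (Suc e))" using lm y by auto
        moreover have "?B e (ix (max N N') t)" using N by simp
        ultimately show "seq_limit m (?p t) \<in> U" using l' by (metis subsetD)
      qed
    qed
    have "seq_limit m (?p t) \<in> U \<longleftrightarrow>
        (if ?C t then (\<exists>e. \<exists>N. \<forall>j\<ge>N. ?B e (ix j t)) else y (ix 0 t) \<in> U)" for t
    proof (cases "?C t")
      case True then show ?thesis using *[OF True] by simp
    next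
      case False
      then have "\<not> (\<exists>l. limitin (mtopology_of m) (?p t) l sequentially)"
        by (simp only: conv not_False_eq_True)
      then have "seq_limit m (?p t) = y (ix 0 t)"
        unfolding seq_limit_def by (rule if_not_P)
      then show ?thesis by (simp only: if_not_P[OF False])
    qed
    then have "(\<lambda>t. seq_limit m (?p t)) -` U \<inter> space M =
      {t \<in> space M. if ?C t then (\<exists>e. \<exists>N. \<forall>j\<ge>N. ?B e (ix j t)) else y (ix 0 t) \<in> U}"
      by (simp only: vimage_def Int_def mem_Collect_eq conj_commute)
    also have "\<dots> \<in> sets M"
    proof -
      \<comment> \<open>Any predicate of a natural number is measurable, so the condition that a
        ball lies in \<open>U\<close> needs no analysis of its own.\<close>
      have nat_pred: "Measurable.pred M (\<lambda>t. P (ix j t))" for P j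
        by (rule measurable_compose[OF ix]) simp
      have [measurable]: "Measurable.pred M (\<lambda>t. mdist m (y (ix j t)) (y (ix j' t)) < r)" for j j' r
        by (rule measurable_compose_countable[where f = "\<lambda>i t. mdist m (y i) (y (ix j' t)) < r" and g = "ix j"])
          (auto intro: nat_pred)
      have [measurable]: "Measurable.pred M (\<lambda>t. ?B e (ix j t))" "Measurable.pred M (\<lambda>t. y (ix j t) \<in> U)" for e j
        by (rule nat_pred)+
      have [measurable]: "Measurable.pred M ?C" "Measurable.pred M (\<lambda>t. \<exists>e. \<exists>N. \<forall>j\<ge>N. ?B e (ix j t))"
        by measurable
      show ?thesis by measurable
    qed
    finally show ?thesis .
  qed
  with lim_in show ?thesis by (intro measurable_borel_onI) auto
qed

text \<open>
  A point of a complete separable space is coded by the base 3 number whose digits record the basic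
  balls containing it; the decoder follows centres of smaller and smaller balls named by the digits.
\<close>

lemma metric_code:
  fixes m :: "'a metric"
  assumes compl: "mcomplete_of m" and sep: "separable_space (mtopology_of m)" and "mspace m \<noteq> {}"
  obtains c D where "c \<in> borel_measurable (borel_on (mtopology_of m))"
    "D \<in> measurable borel (borel_on (mtopology_of m))"
    "\<And>x. x \<in> mspace m \<Longrightarrow> D (c x :: real) = x"
proof -
  interpret Metric_space "mspace m" "mdist m" by simp
  let ?B = "borel_on (mtopology_of m)"
  obtain y :: "nat \<Rightarrow> 'a" where y: "\<And>i. y i \<in> mspace m"
    and dense: "\<And>x e. x \<in> mspace m \<Longrightarrow> e > 0 \<Longrightarrow> \<exists>i. mdist m (y i) x < e"
    using dense_sequence[OF sep] assms(3) by blast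
  \<comment> \<open>\<open>prod_decode\<close> splits the digit place k into an accuracy j and an
    index i; the digit records whether the i-th dense point is within \<open>(1/2)^j\<close> of
    \<open>x\<close>.\<close>
  define b where "b x k = (mdist m (y (snd (prod_decode k))) x < (1/2)^fst (prod_decode k))" for x k
  define c where "c x = bcode (b x)" for x
  \<comment> \<open>At a real number that is no code there may be no such index and
    \<open>LEAST\<close> is some unspecified number. \<open>D\<close> is total and measurable all
    the same, and only its values at codes matter.\<close>
  define ix where "ix j t = (LEAST i. tbit t (prod_encode (j, i)))" for j t
  define D where "D t = seq_limit m (\<lambda>j. y (ix j t))" for t
  have [measurable]: "Measurable.pred ?B (\<lambda>x. b x k)" for k
    unfolding pred_def b_def using mball_in_sets[OF y] by simp
  have 1: "c \<in> borel_measurable ?B"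
    unfolding c_def bcode_def by measurable
  have [measurable]: "ix j \<in> measurable borel (count_space UNIV)" for j
    unfolding ix_def by measurable
  have 2: "D \<in> measurable borel ?B"
    unfolding D_def by (rule measurable_seq_limit[OF compl y]) simp
  have 3: "D (c x) = x" if x: "x \<in> mspace m" for x
  proof -
    have d: "mdist m (y (ix j (c x))) x < (1/2)^j" for j
    proof -
      obtain i where "mdist m (y i) x < (1/2)^j" using dense[OF x, of "(1/2)^j"] by auto
      then have "tbit (c x) (prod_encode (j, i))" by (simp add: c_def tbit_bcode b_def)
      then have "tbit (c x) (prod_encode (j, ix j (c x)))" unfolding ix_def by (rule LeastI)
      then show ?thesis by (simp add: c_def tbit_bcode b_def)
    qed
    have "limitin (mtopology_of m) (\<lambda>j. y (ix j (c x))) x sequentially"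
      unfolding mtopology_of_def limit_metric_sequentially
    proof (intro conjI x allI impI)
      fix e :: real assume "e > 0"
      then obtain N where N: "(1/2::real)^N < e"
        using real_arch_pow_inv[of e "1/2"] by auto
      have "mdist m (y (ix j (c x))) x < e" if "j \<ge> N" for j
      proof -
        have "(1/2::real)^j \<le> (1/2)^N" using that by (intro power_decreasing) auto
        then show ?thesis using d[of j] N by linarith
      qed
      then show "\<exists>N. \<forall>n\<ge>N. y (ix n (c x)) \<in> mspace m \<and> mdist m (y (ix n (c x))) x < e"
        using y by blast
    qed
    then show ?thesis unfolding D_def by (rule seq_limit_eq)
  qed
  from 1 2 3 show ?thesis by (rule that)
qed

section \<open>Realising laws on the unit interval\<close>

lemma space_unit_leb [simp]: "space unit_leb = {0..<1}"
  by (simp add: space_restrict_space)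

lemma prob_space_unit_leb: "prob_space unit_leb"
  by (rule prob_spaceI) (simp add: emeasure_restrict_space)

text \<open>The pseudo-inverse of the distribution function, \<open>I\<close> of the locale
  \<open>cdf_distribution\<close>, carries Lebesgue measure on the open unit interval to
  \<open>M\<close>.\<close>

lemma exists_parameter_real:
  assumes "prob_space M" "sets M = sets borel"
  obtains I :: "real \<Rightarrow> real" where "I \<in> borel_measurable unit_leb" "distr unit_leb borel I = M"
proof -
  let ?L = "restrict_space lborel {0<..<1::real}"
  interpret prob_space M by fact
  interpret cdf_distribution M
    using assms(2) by (intro cdf_distribution.intro real_distribution.intro real_distribution_axioms.intro)
      (auto simp: prob_space_axioms)
  \<comment> \<open>Parameters are defined at 0 as well, where the pseudo-inverse is of no use.
    Moving this null point to 1/2 passes from the half-open to the open interval without changing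
    the measure.\<close>
  define T where "T t = (if t = 0 then 1/2 else t :: real)" for t
  have T [measurable]: "T \<in> measurable unit_leb ?L"
  proof (rule measurable_restrict_space2)
    show "T \<in> space unit_leb \<rightarrow> {0<..<1}" by (auto simp: T_def)
    have "T \<in> borel_measurable borel" unfolding T_def by measurable
    then show "T \<in> measurable unit_leb lborel"
      by (simp add: measurable_restrict_space1)
  qed
  have "distr unit_leb ?L T = ?L"
  proof (rule measure_eqI)
    fix A assume A: "A \<in> sets (distr unit_leb ?L T)"
    then have A': "A \<in> sets ?L" "A \<in> sets borel" "A \<subseteq> {0<..<1}"
      by (auto simp: sets_restrict_space)
    have m: "T -` A \<inter> {0..<1} \<in> sets borel"
      using measurable_sets[OF T A'(1)] by (auto simp: sets_restrict_space)
    have "emeasure (distr unit_leb ?L T) A = emeasure lborel (T -` A \<inter> {0..<1})"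
      using A' measurable_sets[OF T A'(1)] by (simp add: emeasure_distr emeasure_restrict_space)
    also have "\<dots> = emeasure lborel A"
    proof (rule emeasure_eq_AE)
      show "AE x in lborel. x \<in> T -` A \<inter> {0..<1} \<longleftrightarrow> x \<in> A"
        using AE_lborel_singleton[of 0] by eventually_elim (use A' in \<open>auto simp: T_def\<close>)
    qed (use m A' in auto)
    finally show "emeasure (distr unit_leb ?L T) A = emeasure ?L A"
      using A' by (simp add: emeasure_restrict_space)
  qed simp
  have I: "I \<in> borel_measurable ?L"
    using measurable_CI by (simp cong: measurable_cong_sets add: sets_restrict_space)
  have "distr unit_leb borel (I \<circ> T) = distr (distr unit_leb ?L T) borel I"
    using I by (subst distr_distr) (auto simp: comp_def)
  also have "\<dots> = M" using \<open>distr unit_leb ?L T = ?L\<close> distr_I_eq_M by simp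
  finally have "distr unit_leb borel (I \<circ> T) = M" .
  moreover have "I \<circ> T \<in> borel_measurable unit_leb"
    using T I by (rule measurable_comp)
  ultimately show ?thesis using that by blast
qed


lemma mm_space_nonempty:
  assumes "mm_space X" shows "mspace (fst X) \<noteq> {}"
proof -
  have "space (snd X) \<noteq> {}"
    using assms prob_space.not_empty unfolding mm_space_def by blast
  moreover have "space (snd X) = mspace (fst X)"
    using assms sets_eq_imp_space_eq[of "snd X" "borel_on (mtopology_of (fst X))"]
    by (simp add: mm_space_def)
  ultimately show ?thesis by simp
qed

lemma space_mm_space:
  assumes "mm_space X" shows "space (snd X) = mspace (fst X)"
  using assms sets_eq_imp_space_eq[of "snd X" "borel_on (mtopology_of (fst X))"]
  by (simp add: mm_space_def)

lemma mm_code: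
  assumes "mm_space X"
  obtains c D where "c \<in> borel_measurable (snd X)" "D \<in> measurable borel (snd X)"
    "\<And>x. x \<in> mspace (fst X) \<Longrightarrow> D (c x :: real) = x"
proof -
  have "mcomplete_of (fst X)" "separable_space (mtopology_of (fst X))"
    "sets (snd X) = sets (borel_on (mtopology_of (fst X)))"
    using assms by (auto simp: mm_space_def)
  then show ?thesis
    using metric_code[OF _ _ mm_space_nonempty[OF assms]] that
    by (metis measurable_cong_sets)
qed

text \<open>Two real codes are packed into one, so that the joint law of a pair of points becomes a
  law on the line and can be realised by a single map of the unit interval.\<close>

lemma real_pair_code:
  obtains c :: "real \<times> real \<Rightarrow> real" and D :: "real \<Rightarrow> real \<times> real"
  where "c \<in> borel_measurable borel" "D \<in> borel_measurable borel" "\<And>x. D (c x) = x"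
proof -
  let ?m = "euclidean_metric :: (real \<times> real) metric"
  have 1: "mcomplete_of ?m" "mspace ?m = UNIV" "mtopology_of ?m = euclidean"
    by (auto simp: mcomplete_of_def)
  obtain C :: "(real \<times> real) set" where C: "countable C" "\<And>U. open U \<Longrightarrow> U \<noteq> {} \<Longrightarrow> \<exists>d\<in>C. d \<in> U"
    by (rule countable_dense_setE) blast
  have "closure C = UNIV"
    using C(2)[of "- closure C"] closure_subset[of C] by blast
  then have 2: "separable_space (euclidean :: (real \<times> real) topology)"
    using C(1) unfolding separable_space_def by (intro exI[of _ C]) simp
  have "sets (borel_on (euclidean :: (real \<times> real) topology)) = sets borel"
    by (simp add: sets_borel_on borel_def)
  then show ?thesis
    using metric_code[of ?m] 1 2 that by (simp, metis measurable_cong_sets)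
qed

text \<open>For every pair of basic balls met by some point of \<open>J\<close>, one such point is
  selected. Countability makes the closure of the image of \<open>J\<close> a countable intersection
  of countable unions of balls, hence Borel, which the image itself need not be.\<close>

lemma countable_jointly_dense_subset:
  assumes X: "separable_space (mtopology_of X)" and Y: "separable_space (mtopology_of Y)"
    and a: "\<And>w. w \<in> J \<Longrightarrow> a w \<in> mspace X" and b: "\<And>w. w \<in> J \<Longrightarrow> b w \<in> mspace Y"
  obtains J0 where "countable J0" "J0 \<subseteq> J"
    "\<And>w e. w \<in> J \<Longrightarrow> e > 0 \<Longrightarrow> \<exists>v\<in>J0. mdist X (a v) (a w) < e \<and> mdist Y (b v) (b w) < e"
proof (cases "J = {}")
  case False
  then have "mspace X \<noteq> {}" "mspace Y \<noteq> {}" using a b by auto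
  obtain y where y: "\<And>i::nat. y i \<in> mspace X"
    "\<And>x e. x \<in> mspace X \<Longrightarrow> e > 0 \<Longrightarrow> \<exists>i. mdist X (y i) x < e"
    using dense_sequence[OF X \<open>mspace X \<noteq> {}\<close>] by blast
  obtain z where z: "\<And>i::nat. z i \<in> mspace Y"
    "\<And>x e. x \<in> mspace Y \<Longrightarrow> e > 0 \<Longrightarrow> \<exists>i. mdist Y (z i) x < e"
    using dense_sequence[OF Y \<open>mspace Y \<noteq> {}\<close>] by blast
  define P where "P = (\<lambda>(i, k, n) w. w \<in> J \<and> mdist X (y i) (a w) < 1 / real (Suc n) \<and>
    mdist Y (z k) (b w) < 1 / real (Suc n))"
  define g where "g t = (SOME w. P t w)" for t
  define J0 where "J0 = g ` {t. \<exists>w. P t w}"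
  have gP: "P t (g t)" if "P t w" for t w
    unfolding g_def using that by (rule someI)
  show ?thesis
  proof
    show "countable J0" unfolding J0_def by (intro countable_image uncountable_def countableI_type)
    show "J0 \<subseteq> J" using gP by (auto simp: J0_def P_def)
    fix w e assume w: "w \<in> J" and e: "(e::real) > 0"
    then obtain n where n: "1 / real (Suc n) < e / 2" by (metis nat_approx_posE half_gt_zero)
    obtain i where i: "mdist X (y i) (a w) < 1 / real (Suc n)"
      using y(2)[OF a[OF w]] by (meson of_nat_0_less_iff zero_less_Suc zero_less_divide_1_iff)
    obtain k where k: "mdist Y (z k) (b w) < 1 / real (Suc n)"
      using z(2)[OF b[OF w]] by (meson of_nat_0_less_iff zero_less_Suc zero_less_divide_1_iff)
    let ?v = "g (i, k, n)"
    have "P (i, k, n) w" using w i k by (simp add: P_def)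
    note v = gP[OF this]
    have "?v \<in> J0" using \<open>P (i, k, n) w\<close> by (auto simp: J0_def)
    have vJ: "?v \<in> J" using v by (simp add: P_def)
    have "mdist X (a ?v) (a w) \<le> mdist X (a ?v) (y i) + mdist X (y i) (a w)"
      using a[OF vJ] a[OF w] y(1) by (intro mdist_triangle)
    moreover have "mdist X (a ?v) (y i) < 1 / real (Suc n)"
      using v by (simp add: P_def mdist_commute)
    moreover have "mdist Y (b ?v) (b w) \<le> mdist Y (b ?v) (z k) + mdist Y (z k) (b w)"
      using b[OF vJ] b[OF w] z(1) by (intro mdist_triangle)
    moreover have "mdist Y (b ?v) (z k) < 1 / real (Suc n)"
      using v by (simp add: P_def mdist_commute)
    ultimately have "mdist X (a ?v) (a w) < e \<and> mdist Y (b ?v) (b w) < e"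
      using i k n by linarith
    then show "\<exists>v\<in>J0. mdist X (a v) (a w) < e \<and> mdist Y (b v) (b w) < e"
      using \<open>?v \<in> J0\<close> by blast
  qed
next
  case True
  then show ?thesis using that[of "{}"] by simp
qed

lemma mdist_perturb:
  assumes "x \<in> mspace m" "x' \<in> mspace m" "u \<in> mspace m" "u' \<in> mspace m"
    and "mdist m u x \<le> e" "mdist m u' x' \<le> e"
  shows "\<bar>mdist m x x' - mdist m u u'\<bar> \<le> 2 * e"
proof -
  have "mdist m x x' \<le> mdist m x u + mdist m u x'" "mdist m u x' \<le> mdist m u u' + mdist m u' x'"
    "mdist m u u' \<le> mdist m u x + mdist m x u'" "mdist m x u' \<le> mdist m x x' + mdist m x' u'"
    using assms by (auto intro: mdist_triangle)
  then show ?thesis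
    using assms(5,6) mdist_commute[of m x u] mdist_commute[of m x' u'] by linarith
qed

text \<open>
  The law of \<open>(a, b)\<close> is realised on the unit interval through codes. The exceptional set is replaced
  by the preimage of the closure of the image of \<open>J\<close>, to which the bound extends by continuity.
\<close>

lemma box_parameters_of_coupling:
  fixes X :: "'a mm" and Y :: "'b mm"
  assumes X: "mm_space X" and Y: "mm_space Y" and M: "prob_space M"
    and a: "a \<in> measurable M (snd X)" "distr M (snd X) a = snd X"
    and b: "b \<in> measurable M (snd Y)" "distr M (snd Y) b = snd Y"
    and J: "J \<in> sets M" "measure M J \<ge> 1 - e"
    and close: "\<And>v w. v \<in> J \<Longrightarrow> w \<in> J \<Longrightarrow>
      \<bar>mdist (fst X) (a v) (a w) - mdist (fst Y) (b v) (b w)\<bar> \<le> e"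
  shows "\<exists>\<iota>\<in>mm_parameters X. \<exists>\<kappa>\<in>mm_parameters Y. \<exists>I\<in>sets unit_leb. measure unit_leb I \<ge> 1 - e \<and>
    (\<forall>s\<in>I. \<forall>t\<in>I. \<bar>mdist (fst X) (\<iota> s) (\<iota> t) - mdist (fst Y) (\<kappa> s) (\<kappa> t)\<bar> \<le> e)"
proof -
  interpret M: prob_space M by fact
  obtain cX DX where cX [measurable]: "cX \<in> borel_measurable (snd X)"
    and DX [measurable]: "DX \<in> measurable borel (snd X)"
    and DcX: "\<And>x. x \<in> mspace (fst X) \<Longrightarrow> DX (cX x :: real) = x"
    using mm_code[OF X] by blast
  obtain cY DY where cY [measurable]: "cY \<in> borel_measurable (snd Y)"
    and DY [measurable]: "DY \<in> measurable borel (snd Y)"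
    and DcY: "\<And>x. x \<in> mspace (fst Y) \<Longrightarrow> DY (cY x :: real) = x"
    using mm_code[OF Y] by blast
  obtain c2 :: "real \<times> real \<Rightarrow> real" and D2 where c2 [measurable]: "c2 \<in> borel_measurable borel"
    and D2 [measurable]: "D2 \<in> borel_measurable borel" and Dc2: "\<And>x. D2 (c2 x) = x"
    using real_pair_code by blast
  have [measurable]: "D2 \<in> measurable borel (borel \<Otimes>\<^sub>M borel)"
      "c2 \<in> borel_measurable (borel \<Otimes>\<^sub>M borel)"
    using D2 c2 by (simp_all add: borel_prod)
  note a(1) [measurable] b(1) [measurable]
  have aX: "a w \<in> mspace (fst X)" and bY: "b w \<in> mspace (fst Y)" if "w \<in> space M" for w
    using that measurable_space[OF a(1)] measurable_space[OF b(1)]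
      space_mm_space[OF X] space_mm_space[OF Y] by auto
  have JM: "w \<in> space M" if "w \<in> J" for w using that J(1) sets.sets_into_space by blast
  define h where "h w = c2 (cX (a w), cY (b w))" for w
  define fX where "fX t = DX (fst (D2 t))" for t
  define fY where "fY t = DY (snd (D2 t))" for t
  have h [measurable]: "h \<in> borel_measurable M" unfolding h_def by measurable
  have fX [measurable]: "fX \<in> measurable borel (snd X)" unfolding fX_def by measurable
  have fY [measurable]: "fY \<in> measurable borel (snd Y)" unfolding fY_def by measurable
  have fXh: "fX (h w) = a w" and fYh: "fY (h w) = b w" if "w \<in> space M" for w
    using aX[OF that] bY[OF that] by (auto simp: fX_def fY_def h_def Dc2 DcX DcY)
  have fXm: "fX t \<in> mspace (fst X)" and fYm: "fY t \<in> mspace (fst Y)" for t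
    using measurable_space[OF fX, of t] measurable_space[OF fY, of t]
      space_mm_space[OF X] space_mm_space[OF Y] by auto
  \<comment> \<open>The joint law of \<open>(a, b)\<close> in coded form. Composing one map of the
    unit interval with the two decoders gives parameters of both spaces that preserve the
    coupling.\<close>
  let ?N = "distr M borel h"
  have "prob_space ?N" by (rule M.prob_space_distr) simp
  then obtain I where I [measurable]: "I \<in> borel_measurable unit_leb" and dI: "distr unit_leb borel I = ?N"
    using exists_parameter_real[of ?N] by auto
  have "distr unit_leb (snd X) (fX \<circ> I) = distr (distr unit_leb borel I) (snd X) fX"
    by (subst distr_distr) auto
  also have "\<dots> = distr M (snd X) (fX \<circ> h)"
    unfolding dI by (subst distr_distr) auto
  also have "\<dots> = distr M (snd X) a"
    by (rule distr_cong) (auto simp: fXh)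
  finally have pX: "fX \<circ> I \<in> mm_parameters X"
    using a by (auto simp: mm_parameters_def intro: measurable_comp[OF I fX])
  have "distr unit_leb (snd Y) (fY \<circ> I) = distr (distr unit_leb borel I) (snd Y) fY"
    by (subst distr_distr) auto
  also have "\<dots> = distr M (snd Y) (fY \<circ> h)"
    unfolding dI by (subst distr_distr) auto
  also have "\<dots> = distr M (snd Y) b"
    by (rule distr_cong) (auto simp: fYh)
  finally have pY: "fY \<circ> I \<in> mm_parameters Y"
    using b by (auto simp: mm_parameters_def intro: measurable_comp[OF I fY])
  have sep: "separable_space (mtopology_of (fst X))" "separable_space (mtopology_of (fst Y))"
    using X Y by (auto simp: mm_space_def)
  obtain J0 where J0: "countable J0" "J0 \<subseteq> J"
    "\<And>w e. w \<in> J \<Longrightarrow> e > 0 \<Longrightarrow> \<exists>v\<in>J0. mdist (fst X) (a v) (a w) < e \<and> mdist (fst Y) (b v) (b w) < e"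
    using countable_jointly_dense_subset[OF sep, of J a b] aX bY JM by blast
  define S where "S = {t. \<forall>n. \<exists>v\<in>J0. mdist (fst X) (a v) (fX t) < 1 / real (Suc n) \<and>
    mdist (fst Y) (b v) (fY t) < 1 / real (Suc n)}"
  have ball: "{t. mdist (fst X) (a v) (fX t) < r} \<in> sets borel"
      "{t. mdist (fst Y) (b v) (fY t) < r} \<in> sets borel" if "v \<in> J0" for v r
  proof -
    have v: "a v \<in> mspace (fst X)" "b v \<in> mspace (fst Y)" using that J0(2) JM aX bY by auto
    have "fX -` {x \<in> mspace (fst X). mdist (fst X) (a v) x < r} \<inter> space borel \<in> sets borel"
      using mball_in_sets[OF v(1)] X by (intro measurable_sets[OF fX]) (auto simp: mm_space_def)
    moreover have "fY -` {x \<in> mspace (fst Y). mdist (fst Y) (b v) x < r} \<inter> space borel \<in> sets borel"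
      using mball_in_sets[OF v(2)] Y by (intro measurable_sets[OF fY]) (auto simp: mm_space_def)
    ultimately show "{t. mdist (fst X) (a v) (fX t) < r} \<in> sets borel"
      "{t. mdist (fst Y) (b v) (fY t) < r} \<in> sets borel"
      by (auto simp: fXm fYm vimage_def)
  qed
  have "S = (\<Inter>n. \<Union>v\<in>J0. {t. mdist (fst X) (a v) (fX t) < 1 / real (Suc n)} \<inter>
    {t. mdist (fst Y) (b v) (fY t) < 1 / real (Suc n)})"
    by (auto simp: S_def)
  also have "\<dots> \<in> sets borel"
    using ball J0(1) by (intro sets.countable_INT'' sets.countable_UN' sets.Int) auto
  finally have S: "S \<in> sets borel" .
  have hS: "h w \<in> S" if "w \<in> J" for w
    using J0(3)[OF that] fXh fYh JM[OF that] by (simp add: S_def del: of_nat_Suc)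
  let ?I = "I -` S \<inter> space unit_leb"
  have mI: "?I \<in> sets unit_leb" using I S by (rule measurable_sets)
  have "1 - e \<le> measure M J" by fact
  also have "\<dots> \<le> measure M (h -` S \<inter> space M)"
    using hS JM S by (intro M.finite_measure_mono measurable_sets[OF h]) auto
  also have "\<dots> = measure ?N S"
    using S by (simp add: measure_distr)
  also have "\<dots> = measure unit_leb ?I"
    unfolding dI[symmetric] using S by (subst measure_distr) auto
  finally have "1 - e \<le> measure unit_leb ?I" .
  moreover have "\<bar>mdist (fst X) (fX s) (fX t) - mdist (fst Y) (fY s) (fY t)\<bar> \<le> e"
    if "s \<in> S" "t \<in> S" for s t
  proof (rule field_le_epsilon)
    fix d :: real assume "d > 0"
    then have "d / 4 > 0" by simp
    then obtain n where n: "1 / real (Suc n) < d / 4" by (metis nat_approx_posE)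
    have "\<exists>v\<in>J0. mdist (fst X) (a v) (fX s) < 1 / real (Suc n) \<and>
        mdist (fst Y) (b v) (fY s) < 1 / real (Suc n)"
      using \<open>s \<in> S\<close> unfolding S_def by blast
    then obtain v where v: "v \<in> J0" "mdist (fst X) (a v) (fX s) \<le> 1 / real (Suc n)"
      "mdist (fst Y) (b v) (fY s) \<le> 1 / real (Suc n)" using less_imp_le by blast
    have "\<exists>v\<in>J0. mdist (fst X) (a v) (fX t) < 1 / real (Suc n) \<and>
        mdist (fst Y) (b v) (fY t) < 1 / real (Suc n)"
      using \<open>t \<in> S\<close> unfolding S_def by blast
    then obtain w where w: "w \<in> J0" "mdist (fst X) (a w) (fX t) \<le> 1 / real (Suc n)"
      "mdist (fst Y) (b w) (fY t) \<le> 1 / real (Suc n)" using less_imp_le by blast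
    have vw: "v \<in> J" "w \<in> J" using v w J0(2) by auto
    have "\<bar>mdist (fst X) (fX s) (fX t) - mdist (fst X) (a v) (a w)\<bar> \<le> 2 * (1 / real (Suc n))"
      using vw JM aX v w by (intro mdist_perturb fXm) auto
    moreover have "\<bar>mdist (fst Y) (fY s) (fY t) - mdist (fst Y) (b v) (b w)\<bar> \<le> 2 * (1 / real (Suc n))"
      using vw JM bY v w by (intro mdist_perturb fYm) auto
    ultimately show "\<bar>mdist (fst X) (fX s) (fX t) - mdist (fst Y) (fY s) (fY t)\<bar> \<le> e + d"
      using close[OF vw] n by linarith
  qed
  ultimately show ?thesis
    using pX pY mI by (intro bexI[of _ "fX \<circ> I"] bexI[of _ "fY \<circ> I"] bexI[of _ ?I]) auto
qed


section \<open>The box distance and its triangle inequality\<close>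

lemma box_set_bdd_below: "bdd_below {e::real. e \<ge> 0 \<and> P e}"
  by (rule bdd_belowI[of _ 0]) auto

lemma box_mm_le:
  assumes "mm_space X" "mm_space Y" "prob_space M"
    and "a \<in> measurable M (snd X)" "distr M (snd X) a = snd X"
    and "b \<in> measurable M (snd Y)" "distr M (snd Y) b = snd Y"
    and "J \<in> sets M" "measure M J \<ge> 1 - e"
    and "\<And>v w. v \<in> J \<Longrightarrow> w \<in> J \<Longrightarrow>
      \<bar>mdist (fst X) (a v) (a w) - mdist (fst Y) (b v) (b w)\<bar> \<le> e"
    and "e \<ge> 0"
  shows "box_mm X Y \<le> e"
  unfolding box_mm_def
  using box_parameters_of_coupling[OF assms(1-10)] \<open>e \<ge> 0\<close>
  by (intro cInf_lower box_set_bdd_below) auto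

text \<open>The space is coupled with itself by the identity; for error 1 the empty good set is
  admissible, so the coupling lemma applies and its parameters are what is wanted.\<close>

lemma mm_parameters_nonempty:
  assumes "mm_space X" shows "mm_parameters X \<noteq> {}"
  using box_parameters_of_coupling[OF assms assms, of "snd X" "\<lambda>x. x" "\<lambda>x. x" "{}" 1] assms
  by (auto simp: mm_space_def distr_id)

lemma
  assumes "mm_space X" "mm_space Y"
  shows box_mm_nonneg: "0 \<le> box_mm X Y"
    and box_mm_lessD: "box_mm X Y < e \<Longrightarrow> \<exists>e'. 0 \<le> e' \<and> e' < e \<and>
     (\<exists>\<iota>\<in>mm_parameters X. \<exists>\<kappa>\<in>mm_parameters Y. \<exists>I\<in>sets unit_leb. measure unit_leb I \<ge> 1 - e' \<and>
        (\<forall>s\<in>I. \<forall>t\<in>I. \<bar>mdist (fst X) (\<iota> s) (\<iota> t) - mdist (fst Y) (\<kappa> s) (\<kappa> t)\<bar> \<le> e'))"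
proof -
  let ?P = "\<lambda>e'. \<exists>\<iota>\<in>mm_parameters X. \<exists>\<kappa>\<in>mm_parameters Y. \<exists>I\<in>sets unit_leb. measure unit_leb I \<ge> 1 - e' \<and>
        (\<forall>s\<in>I. \<forall>t\<in>I. \<bar>mdist (fst X) (\<iota> s) (\<iota> t) - mdist (fst Y) (\<kappa> s) (\<kappa> t)\<bar> \<le> e')"
  have "?P 1"
  proof -
    obtain \<iota> \<kappa> where *: "\<iota> \<in> mm_parameters X" "\<kappa> \<in> mm_parameters Y"
      using mm_parameters_nonempty[OF assms(1)] mm_parameters_nonempty[OF assms(2)] by blast
    show ?thesis
      by (intro bexI[OF _ *(1)] bexI[OF _ *(2)] bexI[of _ "{}"]) auto
  qed
  then have ne: "{e'. e' \<ge> 0 \<and> ?P e'} \<noteq> {}" by (intro ex_in_conv[THEN iffD1] exI[of _ 1]) simp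
  show "0 \<le> box_mm X Y"
    unfolding box_mm_def by (rule cInf_greatest[OF ne]) auto
  show "\<exists>e'. 0 \<le> e' \<and> e' < e \<and> ?P e'" if "box_mm X Y < e"
    using that unfolding box_mm_def cInf_less_iff[OF ne box_set_bdd_below] by blast
qed

lemma box_mm_commute:
  assumes "mm_space X" "mm_space Y"
  shows "box_mm Y X = box_mm X Y"
proof -
  have "(\<exists>\<iota>\<in>mm_parameters Y. \<exists>\<kappa>\<in>mm_parameters X. \<exists>I\<in>sets unit_leb. measure unit_leb I \<ge> 1 - e \<and>
        (\<forall>s\<in>I. \<forall>t\<in>I. \<bar>mdist (fst Y) (\<iota> s) (\<iota> t) - mdist (fst X) (\<kappa> s) (\<kappa> t)\<bar> \<le> e)) \<longleftrightarrow>
    (\<exists>\<iota>\<in>mm_parameters X. \<exists>\<kappa>\<in>mm_parameters Y. \<exists>I\<in>sets unit_leb. measure unit_leb I \<ge> 1 - e \<and>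
        (\<forall>s\<in>I. \<forall>t\<in>I. \<bar>mdist (fst X) (\<iota> s) (\<iota> t) - mdist (fst Y) (\<kappa> s) (\<kappa> t)\<bar> \<le> e))" for e
    by (subst abs_minus_commute) blast
  then show ?thesis unfolding box_mm_def by simp
qed

text \<open>The coordinates are drawn independently, conditioned on equal labels: the product
  measure is weighted by the inverse probability of the common label. That both labels have the same
  law makes both marginals equal to \<open>U\<close>.\<close>

lemma conditionally_independent_coupling:
  fixes f g :: "'a \<Rightarrow> nat"
  assumes U: "prob_space U"
    and f [measurable]: "f \<in> measurable U (count_space UNIV)"
    and g [measurable]: "g \<in> measurable U (count_space UNIV)"
    and same: "\<And>i. emeasure U {x \<in> space U. f x = i} = emeasure U {x \<in> space U. g x = i}"
  obtains M where "prob_space M" "sets M = sets (U \<Otimes>\<^sub>M U)" "distr M U fst = U" "distr M U snd = U"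
    "AE z in M. f (fst z) = g (snd z)"
proof -
  interpret U: prob_space U by fact
  interpret UU: pair_prob_space U U ..
  define p where "p i = emeasure U {x \<in> space U. f x = i}" for i
  define k where "k x y = (if f x = g y then inverse (p (f x)) else 0)" for x y
  define M where "M = density (U \<Otimes>\<^sub>M U) (\<lambda>z. k (fst z) (snd z))"
  have p_fin: "p i \<noteq> \<infinity>" for i unfolding p_def by simp
  have [measurable]: "(\<lambda>x. p (f x)) \<in> borel_measurable U"
    by (rule measurable_compose[OF f]) simp
  have [measurable]: "Measurable.pred (U \<Otimes>\<^sub>M U) (\<lambda>z. f (fst z) = g (snd z))"
    by (rule measurable_compose_countable[where f = "\<lambda>i z. i = g (snd z)" and g = "\<lambda>z. f (fst z)"])
      measurable
  have pp: "p i * inverse (p i) = 1" if "p i \<noteq> 0" for i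
    using that p_fin[of i] by (simp add: divide_ennreal_def[symmetric] ennreal_divide_self top.not_eq_extremum)
  have k [measurable]: "(\<lambda>z. k (fst z) (snd z)) \<in> borel_measurable (U \<Otimes>\<^sub>M U)"
    unfolding k_def by measurable
  \<comment> \<open>The weight is infinite at labels of probability zero. There are countably many
    labels, so such labels occur only on a null set, for \<open>f\<close> and for
    \<open>g\<close>.\<close>
  have p_pos: "AE x in U. p (h x) \<noteq> 0" if [measurable]: "h \<in> measurable U (count_space UNIV)"
    and "\<And>i. p i = emeasure U {x \<in> space U. h x = i}" for h
  proof -
    have "AE x in U. h x = i \<longrightarrow> p i \<noteq> 0" for i
    proof (cases "p i = 0")
      case True
      then have "{x \<in> space U. h x = i} \<in> null_sets U" using that by (intro null_setsI) auto
      then show ?thesis by (rule AE_I') auto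
    qed simp
    then have "AE x in U. \<forall>i. h x = i \<longrightarrow> p i \<noteq> 0" by (subst AE_all_countable) (rule allI)
    then show ?thesis by eventually_elim simp
  qed
  have p_f: "AE x in U. p (f x) \<noteq> 0" by (rule p_pos[OF f]) (simp add: p_def)
  have p_g: "AE x in U. p (g x) \<noteq> 0" by (rule p_pos[OF g]) (simp add: p_def same)
  have int1: "(\<integral>\<^sup>+ y. k x y \<partial>U) = (if p (f x) \<noteq> 0 then 1 else 0)" if "x \<in> space U" for x
  proof -
    have "(\<integral>\<^sup>+ y. k x y \<partial>U) = (\<integral>\<^sup>+ y. inverse (p (f x)) * indicator {y \<in> space U. g y = f x} y \<partial>U)"
      by (intro nn_integral_cong) (auto simp: k_def)
    also have "\<dots> = inverse (p (f x)) * p (f x)"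
      by (subst nn_integral_cmult_indicator) (auto simp: p_def same)
    finally show ?thesis
      using pp by (auto simp: mult.commute)
  qed
  have int2: "(\<integral>\<^sup>+ x. k x y \<partial>U) = (if p (g y) \<noteq> 0 then 1 else 0)" if "y \<in> space U" for y
  proof -
    have "(\<integral>\<^sup>+ x. k x y \<partial>U) = (\<integral>\<^sup>+ x. inverse (p (g y)) * indicator {x \<in> space U. f x = g y} x \<partial>U)"
      by (intro nn_integral_cong) (auto simp: k_def)
    also have "\<dots> = inverse (p (g y)) * p (g y)"
      by (subst nn_integral_cmult_indicator) (auto simp: p_def)
    finally show ?thesis
      using pp by (auto simp: mult.commute)
  qed
  have d1: "distr M U fst = U"
  proof (rule measure_eqI)
    fix A assume "A \<in> sets (distr M U fst)"
    then have A [measurable]: "A \<in> sets U" by simp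
    have "emeasure (distr M U fst) A = emeasure M (fst -` A \<inter> space (U \<Otimes>\<^sub>M U))"
      by (subst emeasure_distr) (auto simp: M_def)
    also have "\<dots> = (\<integral>\<^sup>+ z. k (fst z) (snd z) * indicator (fst -` A \<inter> space (U \<Otimes>\<^sub>M U)) z \<partial>(U \<Otimes>\<^sub>M U))"
      unfolding M_def by (subst emeasure_density) auto
    also have "\<dots> = (\<integral>\<^sup>+ z. k (fst z) (snd z) * indicator A (fst z) \<partial>(U \<Otimes>\<^sub>M U))"
      by (intro nn_integral_cong) (auto simp: indicator_def)
    also have "\<dots> = (\<integral>\<^sup>+ x. \<integral>\<^sup>+ y. k x y * indicator A x \<partial>U \<partial>U)"
      by (subst U.nn_integral_fst[symmetric]) auto
    also have "\<dots> = (\<integral>\<^sup>+ x. indicator A x \<partial>U)"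
    proof (rule nn_integral_cong_AE)
      show "AE x in U. (\<integral>\<^sup>+ y. k x y * indicator A x \<partial>U) = indicator A x"
        using p_f AE_space
      proof eventually_elim
        fix x assume "p (f x) \<noteq> 0" "x \<in> space U"
        have "(\<lambda>y. k x y) \<in> borel_measurable U"
          using measurable_compose[OF measurable_Pair1'[OF \<open>x \<in> space U\<close>] k] by simp
        then show "(\<integral>\<^sup>+ y. k x y * indicator A x \<partial>U) = indicator A x"
          using int1[OF \<open>x \<in> space U\<close>] \<open>p (f x) \<noteq> 0\<close> by (simp add: nn_integral_multc)
      qed
    qed
    also have "\<dots> = emeasure U A" by simp
    finally show "emeasure (distr M U fst) A = emeasure U A" .
  qed simp
  have d2: "distr M U snd = U"
  proof (rule measure_eqI)
    fix A assume "A \<in> sets (distr M U snd)"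
    then have A [measurable]: "A \<in> sets U" by simp
    have "emeasure (distr M U snd) A = emeasure M (snd -` A \<inter> space (U \<Otimes>\<^sub>M U))"
      by (subst emeasure_distr) (auto simp: M_def)
    also have "\<dots> = (\<integral>\<^sup>+ z. k (fst z) (snd z) * indicator (snd -` A \<inter> space (U \<Otimes>\<^sub>M U)) z \<partial>(U \<Otimes>\<^sub>M U))"
      unfolding M_def by (subst emeasure_density) auto
    also have "\<dots> = (\<integral>\<^sup>+ z. k (fst z) (snd z) * indicator A (snd z) \<partial>(U \<Otimes>\<^sub>M U))"
      by (intro nn_integral_cong) (auto simp: indicator_def)
    also have "\<dots> = (\<integral>\<^sup>+ y. \<integral>\<^sup>+ x. k x y * indicator A y \<partial>U \<partial>U)"
      by (subst UU.nn_integral_snd[symmetric]) auto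
    also have "\<dots> = (\<integral>\<^sup>+ y. indicator A y \<partial>U)"
    proof (rule nn_integral_cong_AE)
      show "AE y in U. (\<integral>\<^sup>+ x. k x y * indicator A y \<partial>U) = indicator A y"
        using p_g AE_space
      proof eventually_elim
        fix y assume "p (g y) \<noteq> 0" "y \<in> space U"
        have "(\<lambda>x. k x y) \<in> borel_measurable U"
          using measurable_compose[OF measurable_Pair2'[OF \<open>y \<in> space U\<close>] k] by simp
        then show "(\<integral>\<^sup>+ x. k x y * indicator A y \<partial>U) = indicator A y"
          using int2[OF \<open>y \<in> space U\<close>] \<open>p (g y) \<noteq> 0\<close> by (simp add: nn_integral_multc)
      qed
    qed
    also have "\<dots> = emeasure U A" by simp
    finally show "emeasure (distr M U snd) A = emeasure U A" .
  qed simp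
  have sM: "sets M = sets (U \<Otimes>\<^sub>M U)" by (simp add: M_def)
  have "prob_space M"
  proof (rule prob_spaceI)
    have "emeasure (distr M U fst) (space U) = emeasure M (space M)"
      by (subst emeasure_distr) (auto simp: M_def space_pair_measure intro!: arg_cong[where f = "emeasure _"])
    then show "emeasure M (space M) = 1" unfolding d1 by (simp add: U.emeasure_space_1)
  qed
  moreover have "AE z in M. f (fst z) = g (snd z)"
    unfolding M_def by (subst AE_density) (auto simp: k_def)
  ultimately show ?thesis using that sM d1 d2 by blast
qed


lemma parameter_measure:
  assumes "\<iota> \<in> mm_parameters X" "A \<in> sets (snd X)"
  shows "emeasure unit_leb (\<iota> -` A \<inter> {0..<1}) = emeasure (snd X) A"
proof -
  have "emeasure (snd X) A = emeasure (distr unit_leb (snd X) \<iota>) A"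
    using assms by (simp add: mm_parameters_def)
  also have "\<dots> = emeasure unit_leb (\<iota> -` A \<inter> {0..<1})"
    using assms by (subst emeasure_distr) (auto simp: mm_parameters_def)
  finally show ?thesis by simp
qed

text \<open>
  The two parameters of the middle space need not agree; they are coupled so that both lie in the
  same piece of a countable partition into pieces of small diameter.
\<close>

lemma box_mm_triangle_less:
  assumes X: "mm_space X" and Y: "mm_space Y" and Z: "mm_space Z"
    and XY: "box_mm X Y < e1" and YZ: "box_mm Y Z < e2"
  shows "box_mm X Z < e1 + e2"
proof -
  let ?dX = "mdist (fst X)" and ?dY = "mdist (fst Y)" and ?dZ = "mdist (fst Z)"
  obtain a \<iota> \<kappa> I where a: "0 \<le> a" "a < e1" and \<iota>: "\<iota> \<in> mm_parameters X" and \<kappa>: "\<kappa> \<in> mm_parameters Y"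
    and I: "I \<in> sets unit_leb" "measure unit_leb I \<ge> 1 - a"
    and cI: "\<And>s t. s \<in> I \<Longrightarrow> t \<in> I \<Longrightarrow> \<bar>?dX (\<iota> s) (\<iota> t) - ?dY (\<kappa> s) (\<kappa> t)\<bar> \<le> a"
    using box_mm_lessD[OF X Y XY] by blast
  obtain b \<kappa>' l I' where b: "0 \<le> b" "b < e2" and \<kappa>': "\<kappa>' \<in> mm_parameters Y" and l: "l \<in> mm_parameters Z"
    and I': "I' \<in> sets unit_leb" "measure unit_leb I' \<ge> 1 - b"
    and cI': "\<And>s t. s \<in> I' \<Longrightarrow> t \<in> I' \<Longrightarrow> \<bar>?dY (\<kappa>' s) (\<kappa>' t) - ?dZ (l s) (l t)\<bar> \<le> b"
    using box_mm_lessD[OF Y Z YZ] by blast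
  \<comment> \<open>Half of the slack is spent. Each middle point is replaced by one at distance at
    most \<open>2 * d\<close>, which changes a distance between two of them by at most
    \<open>4 * d\<close>.\<close>
  define d where "d = (e1 + e2 - a - b) / 8"
  have d: "d > 0" "a + b + 4 * d < e1 + e2" using a b by (auto simp: d_def field_simps)
  have "separable_space (mtopology_of (fst Y))" using Y by (simp add: mm_space_def)
  then obtain y :: "nat \<Rightarrow> _" where y: "\<And>i. y i \<in> mspace (fst Y)"
    and dense: "\<And>x e. x \<in> mspace (fst Y) \<Longrightarrow> e > 0 \<Longrightarrow> \<exists>i. ?dY (y i) x < e"
    using dense_sequence mm_space_nonempty[OF Y] by metis
  define n where "n x = (LEAST i. ?dY (y i) x < d)" for x
  have n: "?dY (y (n x)) x < d" if "x \<in> mspace (fst Y)" for x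
    unfolding n_def using dense[OF that d(1)] by (rule LeastI_ex)
  have [measurable]: "Measurable.pred (snd Y) (\<lambda>x. ?dY (y i) x < d)" for i
    using mball_in_sets[OF y] Y by (simp add: pred_def space_mm_space mm_space_def)
  have nm [measurable]: "n \<in> measurable (snd Y) (count_space UNIV)" unfolding n_def by measurable
  have [measurable]: "\<kappa> \<in> measurable unit_leb (snd Y)" "\<kappa>' \<in> measurable unit_leb (snd Y)"
    "\<iota> \<in> measurable unit_leb (snd X)" "l \<in> measurable unit_leb (snd Z)"
    using \<iota> \<kappa> \<kappa>' l by (auto simp: mm_parameters_def)
  have \<kappa>Y: "\<kappa> s \<in> mspace (fst Y)" "\<kappa>' s \<in> mspace (fst Y)" if "s \<in> {0..<1}" for s
    using that measurable_space[of \<kappa> unit_leb "snd Y" s] measurable_space[of \<kappa>' unit_leb "snd Y" s]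
      \<kappa> \<kappa>' by (auto simp: mm_parameters_def space_mm_space[OF Y])
  have law: "emeasure unit_leb {x \<in> space unit_leb. n (\<kappa>\<^sub>0 x) = i} = emeasure (snd Y) {x \<in> space (snd Y). n x = i}"
    if "\<kappa>\<^sub>0 \<in> mm_parameters Y" for \<kappa>\<^sub>0 i
  proof -
    have "{x \<in> space unit_leb. n (\<kappa>\<^sub>0 x) = i} = \<kappa>\<^sub>0 -` {x \<in> space (snd Y). n x = i} \<inter> {0..<1}"
      using that measurable_space[of \<kappa>\<^sub>0 unit_leb "snd Y"] by (auto simp: mm_parameters_def)
    then show ?thesis by (subst parameter_measure[OF that, symmetric]) (auto intro: nm)
  qed
  obtain M where M: "prob_space M" and sM: "sets M = sets (unit_leb \<Otimes>\<^sub>M unit_leb)"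
    and M1: "distr M unit_leb fst = unit_leb" and M2: "distr M unit_leb snd = unit_leb"
    and AE: "AE z in M. n (\<kappa> (fst z)) = n (\<kappa>' (snd z))"
    using conditionally_independent_coupling[OF prob_space_unit_leb, of "\<lambda>s. n (\<kappa> s)" "\<lambda>s. n (\<kappa>' s)"]
      law[OF \<kappa>] law[OF \<kappa>'] by (auto simp: measurable_compose[OF _ nm])
  interpret M: prob_space M by fact
  interpret L: prob_space unit_leb by (rule prob_space_unit_leb)
  note sM [measurable_cong]
  have fs [measurable]: "fst \<in> measurable M unit_leb" "snd \<in> measurable M unit_leb"
    by measurable
  have spM: "space M = {0..<1} \<times> {0..<1}"
    using sets_eq_imp_space_eq[OF sM] by (simp add: space_pair_measure)
  let ?J1 = "fst -` I \<inter> space M" and ?J2 = "snd -` I' \<inter> space M"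
  have [measurable]: "Measurable.pred M (\<lambda>z. n (\<kappa> (fst z)) = n (\<kappa>' (snd z)))"
    by (rule measurable_compose_countable[where f = "\<lambda>i z. i = n (\<kappa>' (snd z))" and g = "\<lambda>z. n (\<kappa> (fst z))"])
      measurable
  let ?J3 = "{z \<in> space M. n (\<kappa> (fst z)) = n (\<kappa>' (snd z))}"
  let ?J = "?J1 \<inter> ?J2 \<inter> ?J3"
  have mJ: "?J1 \<in> sets M" "?J2 \<in> sets M" "?J3 \<in> sets M"
    using I(1) I'(1) measurable_sets[OF fs(1)] measurable_sets[OF fs(2)] by auto
  have "1 - a \<le> measure M ?J1"
    using I M1 measure_distr[OF fs(1) I(1)] by simp
  moreover have "1 - b \<le> measure M ?J2"
    using I' M2 measure_distr[OF fs(2) I'(1)] by simp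
  moreover have "measure M ?J = measure M (?J1 \<inter> ?J2)"
    using AE mJ by (intro M.finite_measure_eq_AE) (auto elim: eventually_mono)
  moreover have "measure M (?J1 \<inter> ?J2) = measure M ?J1 + measure M ?J2 - measure M (?J1 \<union> ?J2)"
    using M.finite_measure_Union'[of ?J1 ?J2] M.finite_measure_Diff'[of ?J2 ?J1] mJ
    by (simp add: Int_commute)
  moreover have "measure M (?J1 \<union> ?J2) \<le> 1" by simp
  ultimately have J: "1 - (a + b + 4 * d) \<le> measure M ?J" using d by linarith
  have "box_mm X Z \<le> a + b + 4 * d"
  proof (rule box_mm_le[OF X Z M, of "\<iota> \<circ> fst" "l \<circ> snd" ?J])
    show "distr M (snd X) (\<iota> \<circ> fst) = snd X"
      using \<iota> M1 distr_distr[of \<iota> unit_leb "snd X" fst M] fs by (auto simp: mm_parameters_def)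
    show "distr M (snd Z) (l \<circ> snd) = snd Z"
      using l M2 distr_distr[of l unit_leb "snd Z" snd M] fs by (auto simp: mm_parameters_def)
    show "?J \<in> sets M" using mJ by auto
    show "1 - (a + b + 4 * d) \<le> measure M ?J" by (rule J)
    show "0 \<le> a + b + 4 * d" using a b d by simp
    fix v w assume v: "v \<in> ?J" and w: "w \<in> ?J"
    have near: "?dY (\<kappa>' (snd z)) (\<kappa> (fst z)) \<le> 2 * d" if "z \<in> ?J" for z
    proof -
      have z: "\<kappa>' (snd z) \<in> mspace (fst Y)" "\<kappa> (fst z) \<in> mspace (fst Y)"
        using that \<kappa>Y spM by auto
      have "?dY (\<kappa>' (snd z)) (\<kappa> (fst z)) \<le> ?dY (\<kappa>' (snd z)) (y (n (\<kappa> (fst z)))) + ?dY (y (n (\<kappa> (fst z)))) (\<kappa> (fst z))"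
        using z y by (intro mdist_triangle)
      moreover have "?dY (y (n (\<kappa> (fst z)))) (\<kappa>' (snd z)) < d"
        using n[OF z(1)] that by simp
      ultimately show ?thesis
        using n[OF z(2)] mdist_commute[of "fst Y" "\<kappa>' (snd z)" "y (n (\<kappa> (fst z)))"] by linarith
    qed
    have "\<bar>?dY (\<kappa> (fst v)) (\<kappa> (fst w)) - ?dY (\<kappa>' (snd v)) (\<kappa>' (snd w))\<bar> \<le> 2 * (2 * d)"
      using near[OF v] near[OF w] \<kappa>Y v w spM by (intro mdist_perturb) auto
    moreover have "\<bar>?dX (\<iota> (fst v)) (\<iota> (fst w)) - ?dY (\<kappa> (fst v)) (\<kappa> (fst w))\<bar> \<le> a"
      by (rule cI) (use v w in simp_all)
    moreover have "\<bar>?dY (\<kappa>' (snd v)) (\<kappa>' (snd w)) - ?dZ (l (snd v)) (l (snd w))\<bar> \<le> b"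
      by (rule cI') (use v w in simp_all)
    ultimately show "\<bar>?dX ((\<iota> \<circ> fst) v) ((\<iota> \<circ> fst) w) - ?dZ ((l \<circ> snd) v) ((l \<circ> snd) w)\<bar> \<le> a + b + 4 * d"
      unfolding comp_apply by argo
  qed (auto intro!: measurable_comp[OF fs(1)] measurable_comp[OF fs(2)])
  with d show ?thesis by simp
qed

text \<open>The complement of the support is the union of the null balls with centres in a dense
  sequence and radii \<open>1 / real (Suc k)\<close>, a countable union of null sets. This lets the
  box distance see an isomorphism, which is required to be isometric on the support only.\<close>

lemma top_support_full:
  assumes X: "mm_space X"
  defines "S \<equiv> top_support (mtopology_of (fst X)) (snd X)"
  shows "S \<in> sets (snd X)" "measure (snd X) S = 1"
proof -
  interpret Metric_space "mspace (fst X)" "mdist (fst X)" by simp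
  interpret P: prob_space "snd X" using X by (simp add: mm_space_def)
  have sX: "sets (snd X) = sets (borel_on (mtopology_of (fst X)))"
    and sep: "separable_space (mtopology_of (fst X))" using X by (auto simp: mm_space_def)
  obtain y :: "nat \<Rightarrow> _" where y: "\<And>i. y i \<in> mspace (fst X)"
    and dense: "\<And>x e. x \<in> mspace (fst X) \<Longrightarrow> e > 0 \<Longrightarrow> \<exists>i. mdist (fst X) (y i) x < e"
    using dense_sequence[OF sep] mm_space_nonempty[OF X] by blast
  define B where "B i k = mball (y i) (1 / real (Suc k))" for i k
  have Bo: "openin (mtopology_of (fst X)) (B i k)" for i k
    by (simp add: B_def mtopology_of_def)
  then have Bs: "B i k \<in> sets (snd X)" for i k
    by (simp add: sX openin_in_sets_borel_on)
  define N where "N = (\<Union>(i, k)\<in>{(i, k). emeasure (snd X) (B i k) = 0}. B i k)"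
  have N: "N \<in> null_sets (snd X)"
    unfolding N_def using Bs by (intro null_sets_UN') (auto simp: null_sets_def)
  have "S = space (snd X) - N"
  proof (intro set_eqI iffI)
    fix x assume x: "x \<in> S"
    then have "x \<in> space (snd X)" by (simp add: S_def top_support_def space_mm_space[OF X])
    moreover have "0 < emeasure (snd X) (B i k)" if "x \<in> B i k" for i k
      using x Bo that unfolding S_def top_support_def by blast
    then have "x \<notin> N" unfolding N_def by force
    ultimately show "x \<in> space (snd X) - N" by blast
  next
    fix x assume x: "x \<in> space (snd X) - N"
    then have xm: "x \<in> mspace (fst X)" by (simp add: space_mm_space[OF X])
    have "emeasure (snd X) U > 0" if U: "openin (mtopology_of (fst X)) U" "x \<in> U" for U
    proof -
      obtain r where r: "r > 0" "mball x r \<subseteq> U"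
        using U unfolding mtopology_of_def openin_mtopology by blast
      then obtain k where k: "1 / real (Suc k) < r / 2" by (metis nat_approx_posE half_gt_zero)
      obtain i where i: "mdist (fst X) (y i) x < 1 / real (Suc k)"
        using dense[OF xm, of "1 / real (Suc k)"] by auto
      have "B i k \<subseteq> U"
      proof
        fix z assume z: "z \<in> B i k"
        then have "mdist (fst X) x z \<le> mdist (fst X) x (y i) + mdist (fst X) (y i) z"
          using xm y by (intro triangle) (auto simp: B_def)
        also have "\<dots> < r / 2 + r / 2"
          using z i k by (intro add_strict_mono) (auto simp: B_def commute)
        finally show "z \<in> U" using r z xm by (auto simp: B_def)
      qed
      have "x \<in> B i k" using i xm y by (simp add: B_def)
      then have "emeasure (snd X) (B i k) > 0" using x by (auto simp: N_def zero_less_iff_neq_zero)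
      also have "\<dots> \<le> emeasure (snd X) U"
        using \<open>B i k \<subseteq> U\<close> U sX by (intro emeasure_mono) (auto simp: openin_in_sets_borel_on)
      finally show ?thesis .
    qed
    then show "x \<in> S" using xm by (simp add: S_def top_support_def)
  qed
  then show "S \<in> sets (snd X)" "measure (snd X) S = 1"
    using N P.prob_compl[of N] by (auto simp: null_sets_def measure_def)
qed

text \<open>The graph of the isomorphism is a coupling without distortion on the support, a set of
  full measure.\<close>

lemma mm_iso_box:
  assumes X: "mm_space X" and Y: "mm_space Y" and iso: "mm_iso X Y"
  shows "box_mm X Y \<le> 0"
proof -
  obtain \<phi> where \<phi>: "\<phi> \<in> measurable (snd X) (snd Y)" "distr (snd X) (snd Y) \<phi> = snd Y"
    and isom: "\<And>x y. x \<in> top_support (mtopology_of (fst X)) (snd X) \<Longrightarrow>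
      y \<in> top_support (mtopology_of (fst X)) (snd X) \<Longrightarrow> mdist (fst Y) (\<phi> x) (\<phi> y) = mdist (fst X) x y"
    using iso unfolding mm_iso_def by blast
  show ?thesis
    by (rule box_mm_le[OF X Y, of "snd X" "\<lambda>x. x" \<phi> "top_support (mtopology_of (fst X)) (snd X)"])
      (use X \<phi> isom top_support_full[OF X] in \<open>auto simp: mm_space_def distr_id\<close>)
qed

section \<open>Configurations as sums of Dirac masses\<close>

text \<open>\<open>dirac_sum\<close> with an arbitrary index set. Matchings, restrictions and
  disjoint sums then keep their own labels, and no renumbering by natural numbers is needed.\<close>

definition csum :: "'i set \<Rightarrow> ('i \<Rightarrow> 'a::topological_space) \<Rightarrow> 'a measure" where
  "csum I x = distr (count_space I) borel x"

lemma sets_csum [simp]: "sets (csum I x) = sets borel"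
  and space_csum [simp]: "space (csum I x) = UNIV"
  by (simp_all add: csum_def)

lemma emeasure_csum:
  assumes "A \<in> sets borel"
  shows "emeasure (csum I x) A = emeasure (count_space UNIV) {i \<in> I. x i \<in> A}"
proof -
  have "emeasure (csum I x) A = emeasure (count_space I) {i \<in> I. x i \<in> A}"
    unfolding csum_def using assms by (subst emeasure_distr) (auto intro!: arg_cong[where f = "emeasure _"])
  then show ?thesis by (simp add: emeasure_count_space)
qed

lemma emeasure_csum_finite_iff:
  assumes "A \<in> sets borel"
  shows "emeasure (csum I x) A < \<infinity> \<longleftrightarrow> finite {i \<in> I. x i \<in> A}"
  using assms by (simp add: emeasure_csum emeasure_count_space less_top[symmetric])

lemma csum_reindex:
  assumes "bij_betw h J I" "\<And>j. j \<in> J \<Longrightarrow> y j = x (h j)"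
  shows "csum J y = csum I x"
proof -
  have "csum I x = distr (distr (count_space J) (count_space I) h) borel x"
    unfolding csum_def distr_bij_count_space[OF assms(1)] ..
  also have "\<dots> = distr (count_space J) borel (x \<circ> h)"
    using bij_betwE[OF assms(1)] by (intro distr_distr) auto
  also have "\<dots> = csum J y"
    unfolding csum_def using assms(2) by (intro distr_cong) auto
  finally show ?thesis ..
qed

lemma csum_cong: "(\<And>i. i \<in> I \<Longrightarrow> x i = y i) \<Longrightarrow> csum I x = csum I y"
  unfolding csum_def by (intro distr_cong) auto

lemma measure_eq_csumI:
  assumes "sets \<gamma> = sets borel"
    and "\<And>A. A \<in> sets borel \<Longrightarrow> emeasure \<gamma> A = emeasure (count_space UNIV) {i \<in> I. x i \<in> A}"
  shows "\<gamma> = csum I x"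
  by (rule measure_eqI) (use assms in \<open>auto simp: emeasure_csum\<close>)

lemma config_sets [simp]: "\<gamma> \<in> configs X \<Longrightarrow> sets \<gamma> = sets borel"
  by (auto simp: configs_def dirac_sum_def)

lemma dirac_sum_csum: "dirac_sum N x = csum {i. enat i < N} x"
  by (simp add: dirac_sum_def csum_def)

lemma config_csumE:
  assumes "\<gamma> \<in> configs X"
  obtains I :: "nat set" and x where "\<And>i. i \<in> I \<Longrightarrow> x i \<in> X" "\<gamma> = csum I x"
proof -
  from assms obtain N x where "\<forall>i. enat i < N \<longrightarrow> x i \<in> X" "\<gamma> = dirac_sum N x"
    unfolding configs_def by blast
  then show ?thesis using that[of "{i. enat i < N}" x] by (auto simp: dirac_sum_csum)
qed

text \<open>A countable index set is in bijection with an initial segment of the natural numbers or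
  with all of them, which restores the form demanded by \<open>configs\<close>.\<close>

lemma csum_configI:
  fixes x :: "'i \<Rightarrow> 'a::t2_space"
  assumes "countable I" "\<And>i. i \<in> I \<Longrightarrow> x i \<in> X"
    and "\<And>K. compact K \<Longrightarrow> K \<subseteq> X \<Longrightarrow> finite {i \<in> I. x i \<in> K}"
  shows "csum I x \<in> configs X"
proof -
  have "\<exists>N h. bij_betw h {i. enat i < N} I"
  proof (cases "finite I")
    case True
    then obtain h where "bij_betw h {0..<card I} I" using ex_bij_betw_nat_finite by blast
    moreover have "{0..<card I} = {i. enat i < enat (card I)}" by auto
    ultimately show ?thesis by metis
  next
    case False
    with assms(1) have "bij_betw (from_nat_into I) UNIV I" by (rule bij_betw_from_nat_into)
    moreover have "UNIV = {i. enat i < \<infinity>}" by auto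
    ultimately show ?thesis by metis
  qed
  then obtain N h where h: "bij_betw h {i. enat i < N} I" by blast
  then have eq: "csum I x = dirac_sum N (x \<circ> h)"
    unfolding dirac_sum_csum by (intro csum_reindex[symmetric]) auto
  have "\<forall>i. enat i < N \<longrightarrow> (x \<circ> h) i \<in> X"
    using bij_betwE[OF h] assms(2) by auto
  moreover have "emeasure (csum I x) K < \<infinity>" if "compact K" "K \<subseteq> X" for K
    using assms(3)[OF that] that(1)
    by (subst emeasure_csum_finite_iff) (auto intro: borel_closed compact_imp_closed)
  ultimately show ?thesis unfolding configs_def eq[symmetric] using eq by blast
qed

lemma csum_config_finite:
  fixes x :: "'i \<Rightarrow> 'a::t2_space"
  assumes "finite I" "\<And>i. i \<in> I \<Longrightarrow> x i \<in> X"
  shows "csum I x \<in> configs X"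
  using assms by (intro csum_configI) (auto intro: countable_finite)

lemma config_finite_compact:
  fixes x :: "'i \<Rightarrow> 'a::t2_space"
  assumes "csum I x \<in> configs X" "compact K" "K \<subseteq> X"
  shows "finite {i \<in> I. x i \<in> K}"
proof -
  have "emeasure (csum I x) K < \<infinity>" using assms by (auto simp: configs_def)
  then show ?thesis
    using assms(2) emeasure_csum_finite_iff[of K I x] by (auto intro: borel_closed compact_imp_closed)
qed

lemma exists_bij_fibers:
  assumes "\<And>p. finite {i \<in> I. f i = p}" "\<And>p. finite {j \<in> J. g j = p}"
    and "\<And>p. card {i \<in> I. f i = p} = card {j \<in> J. g j = p}"
  obtains h where "bij_betw h I J" "\<And>i. i \<in> I \<Longrightarrow> g (h i) = f i"
proof -
  have "\<exists>h. bij_betw h {i \<in> I. f i = p} {j \<in> J. g j = p}" for p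
    using assms by (intro finite_same_card_bij) auto
  then obtain H where H: "\<And>p. bij_betw (H p) {i \<in> I. f i = p} {j \<in> J. g j = p}" by metis
  define h where "h i = H (f i) i" for i
  have h: "h i \<in> J \<and> g (h i) = f i" if "i \<in> I" for i
    using bij_betwE[OF H[of "f i"]] that by (auto simp: h_def)
  have "bij_betw h I J"
  proof (rule bij_betwI')
    fix i i' assume i: "i \<in> I" "i' \<in> I"
    show "(h i = h i') = (i = i')"
    proof
      assume eq: "h i = h i'"
      then have "f i = f i'" using h[OF i(1)] h[OF i(2)] by simp
      then have "H (f i) i = H (f i) i'" using eq by (simp add: h_def)
      then show "i = i'"
        using bij_betw_imp_inj_on[OF H[of "f i"]] i \<open>f i = f i'\<close> by (auto dest: inj_onD)
    qed simp
  next
    fix j assume j: "j \<in> J"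
    then have "j \<in> H (g j) ` {i \<in> I. f i = g j}"
      using bij_betw_imp_surj_on[OF H[of "g j"]] by simp
    then show "\<exists>i\<in>I. j = h i" unfolding h_def by force
  qed (use h in auto)
  then show ?thesis using h that by blast
qed

text \<open>The mass of a single point is its multiplicity, so the two labellings have fibres of
  equal finite size over each point, and bijections of the fibres are glued. This is how different
  labellings of one configuration are compared throughout.\<close>

lemma csum_eq_bij:
  fixes x :: "'i \<Rightarrow> 'a::t1_space" and y :: "'j \<Rightarrow> 'a"
  assumes "finite I" "csum I x = csum J y"
  obtains h where "bij_betw h I J" "\<And>i. i \<in> I \<Longrightarrow> y (h i) = x i"
proof -
  have "emeasure (csum J y) {p} = emeasure (csum I x) {p}" for p using assms(2) by simp
  then have *: "emeasure (count_space UNIV) {j \<in> J. y j = p} = emeasure (count_space UNIV) {i \<in> I. x i = p}" for p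
    by (simp add: emeasure_csum)
  have fI: "finite {i \<in> I. x i = p}" for p using assms(1) by simp
  have fJ: "finite {j \<in> J. y j = p}" for p
    using *[of p] fI[of p] by (auto simp: emeasure_count_space split: if_splits)
  have "card {i \<in> I. x i = p} = card {j \<in> J. y j = p}" for p
    using *[of p] fI[of p] fJ[of p] by (simp add: emeasure_count_space)
  with fI fJ show ?thesis using exists_bij_fibers[of I x J y] that by blast
qed

lemma emeasure_restrict_config:
  assumes "sets \<gamma> = sets borel" "B \<in> sets borel" "A \<in> sets borel"
  shows "emeasure (restrict_config B \<gamma>) A = emeasure \<gamma> (B \<inter> A)"
  unfolding restrict_config_def using assms by (subst emeasure_restricted) auto

lemma sets_restrict_config [simp]: "sets (restrict_config B \<gamma>) = sets \<gamma>"
  by (simp add: restrict_config_def)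

lemma restrict_config_csum:
  fixes x :: "'i \<Rightarrow> real"
  assumes "B \<in> sets borel"
  shows "restrict_config B (csum I x) = csum {i \<in> I. x i \<in> B} x"
proof (rule measure_eq_csumI)
  fix A :: "real set" assume "A \<in> sets borel"
  with assms show "emeasure (restrict_config B (csum I x)) A =
      emeasure (count_space UNIV) {i \<in> {i \<in> I. x i \<in> B}. x i \<in> A}"
    by (simp add: emeasure_restrict_config emeasure_csum conj_assoc)
qed simp

lemma restrict_restrict_config:
  assumes "sets \<gamma> = sets borel" "B \<in> sets borel" "C \<in> sets borel" "B \<subseteq> C"
  shows "restrict_config B (restrict_config C \<gamma>) = restrict_config B \<gamma>"
proof (rule measure_eqI)
  fix A assume "A \<in> sets (restrict_config B (restrict_config C \<gamma>))"
  with assms show "emeasure (restrict_config B (restrict_config C \<gamma>)) A = emeasure (restrict_config B \<gamma>) A"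
    using Int_absorb1[of "B \<inter> A" C] by (simp add: emeasure_restrict_config le_infI1)
qed simp

lemma add_config_measure:
  fixes \<gamma> \<alpha> :: "real measure"
  assumes "sets \<gamma> = sets borel" "sets \<alpha> = sets borel"
  shows "sets (add_config \<gamma> \<alpha>) = sets borel"
    and "A \<in> sets borel \<Longrightarrow> emeasure (add_config \<gamma> \<alpha>) A = emeasure \<gamma> A + emeasure \<alpha> A"
proof -
  have sa: "sigma_algebra UNIV (sets (borel :: real measure))"
    using sets.sigma_algebra_axioms[of "borel :: real measure"] by simp
  show s: "sets (add_config \<gamma> \<alpha>) = sets borel"
    unfolding add_config_def using sigma_algebra.sets_measure_of_eq[OF sa] by simp
  show "emeasure (add_config \<gamma> \<alpha>) A = emeasure \<gamma> A + emeasure \<alpha> A" if "A \<in> sets borel"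
  proof (rule emeasure_measure_of_sigma[OF sa, of "\<lambda>A. emeasure \<gamma> A + emeasure \<alpha> A", folded add_config_def])
    show "countably_additive (sets borel) (\<lambda>A. emeasure \<gamma> A + emeasure \<alpha> A)"
      unfolding countably_additive_def
      using assms by (auto simp: suminf_add[symmetric] suminf_emeasure)
  qed (use that in \<open>auto simp: positive_def\<close>)
qed

lemma add_config_csum_split:
  assumes "\<And>i. i \<in> I \<Longrightarrow> P i \<noteq> Q i"
  shows "add_config (csum {i \<in> I. P i} x) (csum {i \<in> I. Q i} x) = csum I x"
proof (rule measure_eq_csumI)
  fix A :: "real set" assume A: "A \<in> sets borel"
  have "{i \<in> I. x i \<in> A} = {i \<in> {i \<in> I. P i}. x i \<in> A} \<union> {i \<in> {i \<in> I. Q i}. x i \<in> A}"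
    using assms by auto
  moreover have "{i \<in> {i \<in> I. P i}. x i \<in> A} \<inter> {i \<in> {i \<in> I. Q i}. x i \<in> A} = {}"
    using assms by auto
  ultimately have "emeasure (count_space UNIV) {i \<in> I. x i \<in> A} =
      emeasure (count_space UNIV) {i \<in> {i \<in> I. P i}. x i \<in> A} +
      emeasure (count_space UNIV) {i \<in> {i \<in> I. Q i}. x i \<in> A}"
    by (simp add: plus_emeasure)
  with A show "emeasure (add_config (csum {i \<in> I. P i} x) (csum {i \<in> I. Q i} x)) A =
      emeasure (count_space UNIV) {i \<in> I. x i \<in> A}"
    by (simp add: add_config_measure emeasure_csum)
qed (simp add: add_config_measure)

section \<open>Couplings as pairs of labelled configurations\<close>

lemma ennreal_sqrt_mono: "x \<le> y \<Longrightarrow> ennreal_sqrt x \<le> ennreal_sqrt y"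
  unfolding ennreal_sqrt_def
  by (auto simp: top_unique top.not_eq_extremum intro!: ennreal_leI enn2real_mono)

lemma ennreal_sqrt_ennreal: "0 \<le> r \<Longrightarrow> ennreal_sqrt (ennreal r) = ennreal (sqrt r)"
  by (simp add: ennreal_sqrt_def)

lemma ennreal_sqrt_lessD:
  assumes "ennreal_sqrt x < ennreal r"
  shows "x < ennreal (r\<^sup>2)"
proof (rule ccontr)
  assume "\<not> x < ennreal (r\<^sup>2)"
  then have "ennreal_sqrt (ennreal (r\<^sup>2)) \<le> ennreal_sqrt x" by (intro ennreal_sqrt_mono) simp
  then have "ennreal \<bar>r\<bar> \<le> ennreal_sqrt x" by (simp add: ennreal_sqrt_ennreal)
  moreover have "ennreal r \<le> ennreal \<bar>r\<bar>" by (intro ennreal_leI) simp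
  ultimately show False using assms by order
qed

text \<open>A common index set for both configurations is itself a coupling, sending the i-th point
  of one to the i-th point of the other. It is locally finite because the projection of a compact
  set is compact.\<close>

lemma config_dist_le:
  assumes X: "closed X" and I: "countable I"
    and x: "\<And>i. i \<in> I \<Longrightarrow> x i \<in> X" and y: "\<And>i. i \<in> I \<Longrightarrow> y i \<in> X"
    and conf: "csum I x \<in> configs X" "csum I y \<in> configs X"
  shows "config_dist X (csum I x) (csum I y) \<le> ennreal_sqrt (\<integral>\<^sup>+ i. ennreal (\<bar>x i - y i\<bar>\<^sup>2) \<partial>count_space I)"
proof -
  let ?c = "csum I (\<lambda>i. (x i, y i))"
  have "?c \<in> configs (X \<times> X)"
  proof (rule csum_configI[OF I])
    fix K :: "(real \<times> real) set" assume K: "compact K" "K \<subseteq> X \<times> X"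
    then have "finite {i \<in> I. x i \<in> fst ` K}"
      by (intro config_finite_compact[OF conf(1)])
        (auto intro!: compact_continuous_image continuous_intros)
    then show "finite {i \<in> I. (x i, y i) \<in> K}"
      by (rule rev_finite_subset) force
  qed (use x y in auto)
  moreover have "emeasure ?c (A \<times> X) = emeasure (csum I x) A \<and> emeasure ?c (X \<times> A) = emeasure (csum I y) A"
    if "A \<in> sets borel" "A \<subseteq> X" for A
  proof -
    have "X \<in> sets borel" using X by simp
    then have "A \<times> X \<in> sets borel" "X \<times> A \<in> sets borel"
      using that by (simp_all add: borel_prod[symmetric])
    moreover have "{i \<in> I. x i \<in> A \<and> y i \<in> X} = {i \<in> I. x i \<in> A}"
      "{i \<in> I. x i \<in> X \<and> y i \<in> A} = {i \<in> I. y i \<in> A}" using x y by auto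
    ultimately show ?thesis using that by (simp add: emeasure_csum)
  qed
  ultimately have "?c \<in> couplings X (csum I x) (csum I y)"
    unfolding couplings_def by blast
  then have "(INF c \<in> couplings X (csum I x) (csum I y). \<integral>\<^sup>+ z. ennreal (\<bar>fst z - snd z\<bar>\<^sup>2) \<partial>c)
      \<le> (\<integral>\<^sup>+ z. ennreal (\<bar>fst z - snd z\<bar>\<^sup>2) \<partial>?c)"
    by (rule INF_lower)
  also have "\<dots> = (\<integral>\<^sup>+ i. ennreal (\<bar>x i - y i\<bar>\<^sup>2) \<partial>count_space I)"
  proof -
    have "(\<lambda>z. ennreal (\<bar>fst z - snd z\<bar>\<^sup>2)) \<in> borel_measurable (borel :: (real \<times> real) measure)"
      by (simp add: borel_prod[symmetric])
    then show ?thesis unfolding csum_def by (subst nn_integral_distr) auto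
  qed
  finally show ?thesis unfolding config_dist_def by (rule ennreal_sqrt_mono)
qed

lemma config_inter:
  assumes "\<gamma> \<in> configs X" "X \<in> sets borel" "A \<in> sets borel"
  shows "emeasure \<gamma> A = emeasure \<gamma> (A \<inter> X)"
proof -
  obtain I :: "nat set" and x where *: "\<And>i. i \<in> I \<Longrightarrow> x i \<in> X" "\<gamma> = csum I x"
    using config_csumE[OF assms(1)] by blast
  then have "{i \<in> I. x i \<in> A} = {i \<in> I. x i \<in> A \<and> x i \<in> X}" by auto
  then show ?thesis using assms * by (simp add: emeasure_csum)
qed

text \<open>A coupling is a sum of Dirac masses at pairs, so its two projections label both
  configurations by the same index set. All later arguments on the matching distance start from such
  a labelling.\<close>

lemma config_dist_lessE:
  assumes X: "closed X" and conf: "\<gamma> \<in> configs X" "\<eta> \<in> configs X"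
    and less: "config_dist X \<gamma> \<eta> < ennreal r"
  obtains I :: "nat set" and x y where "\<And>i. i \<in> I \<Longrightarrow> x i \<in> X" "\<And>i. i \<in> I \<Longrightarrow> y i \<in> X"
    "\<gamma> = csum I x" "\<eta> = csum I y"
    "(\<integral>\<^sup>+ i. ennreal (\<bar>x i - y i\<bar>\<^sup>2) \<partial>count_space I) < ennreal (r\<^sup>2)"
proof -
  have Xb: "X \<in> sets borel" using X by simp
  from ennreal_sqrt_lessD[OF less[unfolded config_dist_def]]
  obtain c where c: "c \<in> couplings X \<gamma> \<eta>" "(\<integral>\<^sup>+ z. ennreal (\<bar>fst z - snd z\<bar>\<^sup>2) \<partial>c) < ennreal (r\<^sup>2)"
    by (auto simp: INF_less_iff)
  then have "c \<in> configs (X \<times> X)" by (simp add: couplings_def)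
  then obtain I :: "nat set" and z where z: "\<And>i. i \<in> I \<Longrightarrow> z i \<in> X \<times> X" and cz: "c = csum I z"
    using config_csumE by blast
  have "emeasure \<gamma> A = emeasure (count_space UNIV) {i \<in> I. fst (z i) \<in> A} \<and>
    emeasure \<eta> A = emeasure (count_space UNIV) {i \<in> I. snd (z i) \<in> A}" if A: "A \<in> sets borel" for A
  proof -
    have AX: "A \<inter> X \<in> sets borel" using A Xb by simp
    have b: "(A \<inter> X) \<times> X \<in> sets borel" "X \<times> (A \<inter> X) \<in> sets borel"
      using A Xb by (simp_all add: borel_prod[symmetric])
    have "emeasure \<gamma> A = emeasure c ((A \<inter> X) \<times> X)" "emeasure \<eta> A = emeasure c (X \<times> (A \<inter> X))"
      using c(1) AX config_inter[OF conf(1) Xb A] config_inter[OF conf(2) Xb A]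
      unfolding couplings_def by auto
    moreover have "{i \<in> I. z i \<in> (A \<inter> X) \<times> X} = {i \<in> I. fst (z i) \<in> A}"
      "{i \<in> I. z i \<in> X \<times> (A \<inter> X)} = {i \<in> I. snd (z i) \<in> A}"
      using z by (auto simp: mem_Times_iff)
    ultimately show ?thesis using b unfolding cz by (simp add: emeasure_csum)
  qed
  then have "\<gamma> = csum I (\<lambda>i. fst (z i))" "\<eta> = csum I (\<lambda>i. snd (z i))"
    using conf by (auto intro!: measure_eq_csumI)
  moreover have "(\<integral>\<^sup>+ i. ennreal (\<bar>fst (z i) - snd (z i)\<bar>\<^sup>2) \<partial>count_space I) < ennreal (r\<^sup>2)"
  proof -
    have "(\<lambda>z. ennreal (\<bar>fst z - snd z\<bar>\<^sup>2)) \<in> borel_measurable (borel :: (real \<times> real) measure)"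
      by (simp add: borel_prod[symmetric])
    then show ?thesis using c(2) unfolding cz csum_def by (subst (asm) nn_integral_distr) auto
  qed
  ultimately show ?thesis
    using z that[of I "\<lambda>i. fst (z i)" "\<lambda>i. snd (z i)"] by (auto simp: mem_Times_iff)
qed

section \<open>Window matchings\<close>

text \<open>
  Only the points in the open window are prescribed: the choice of the boundary points absorbs the
  infimum over \<open>\<alpha>\<close> and \<open>\<beta>\<close> in the definition of the window distance.
\<close>

definition window_matching ::
    "nat \<Rightarrow> real measure \<Rightarrow> real measure \<Rightarrow> 'i set \<Rightarrow> ('i \<Rightarrow> real) \<Rightarrow> ('i \<Rightarrow> real) \<Rightarrow> bool" where
  "window_matching n \<gamma> \<eta> F a b \<longleftrightarrow> finite F \<and> a ` F \<subseteq> cwin n \<and> b ` F \<subseteq> cwin n \<and>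
     restrict_config (owin n) \<gamma> = csum {i \<in> F. a i \<in> owin n} a \<and>
     restrict_config (owin n) \<eta> = csum {i \<in> F. b i \<in> owin n} b"

lemma nn_integral_sq_finite:
  assumes "finite F"
  shows "(\<integral>\<^sup>+ i. ennreal (\<bar>a i - b i\<bar>\<^sup>2) \<partial>count_space F) = ennreal ((L2_set (\<lambda>i. a i - b i) F)\<^sup>2)"
  using assms by (simp add: nn_integral_count_space_finite L2_set_def sum_nonneg)

lemma cwin_split: "x \<in> cwin n \<Longrightarrow> (x \<in> owin n) \<noteq> (x \<in> bwin n)"
  by auto

lemma owin_borel [simp]: "owin n \<in> sets borel" by simp

lemma window_dist_le:
  assumes "window_matching n \<gamma> \<eta> F a b"
  shows "window_dist n \<gamma> \<eta> \<le> ennreal (L2_set (\<lambda>i. a i - b i) F)"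
proof -
  have F: "finite F" and a: "\<And>i. i \<in> F \<Longrightarrow> a i \<in> cwin n" and b: "\<And>i. i \<in> F \<Longrightarrow> b i \<in> cwin n"
    and ra: "restrict_config (owin n) \<gamma> = csum {i \<in> F. a i \<in> owin n} a"
    and rb: "restrict_config (owin n) \<eta> = csum {i \<in> F. b i \<in> owin n} b"
    using assms unfolding window_matching_def by blast+
  let ?\<alpha> = "csum {i \<in> F. a i \<in> bwin n} a" and ?\<beta> = "csum {i \<in> F. b i \<in> bwin n} b"
  have "?\<alpha> \<in> configs (bwin n)" "?\<beta> \<in> configs (bwin n)"
    using F by (auto intro!: csum_config_finite)
  then have "window_dist n \<gamma> \<eta> \<le> config_dist (cwin n)
      (add_config (restrict_config (owin n) \<gamma>) ?\<alpha>) (add_config (restrict_config (owin n) \<eta>) ?\<beta>)"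
    unfolding window_dist_def by (intro INF_lower2[of "(?\<alpha>, ?\<beta>)"]) auto
  also have "\<dots> = config_dist (cwin n) (csum F a) (csum F b)"
  proof -
    have "add_config (csum {i \<in> F. z i \<in> owin n} z) (csum {i \<in> F. z i \<in> bwin n} z) = csum F z"
      if "\<And>i. i \<in> F \<Longrightarrow> z i \<in> cwin n" for z
      by (rule add_config_csum_split) (rule cwin_split[OF that])
    from this[of a, OF a] this[of b, OF b] show ?thesis unfolding ra rb by simp
  qed
  also have "\<dots> \<le> ennreal_sqrt (\<integral>\<^sup>+ i. ennreal (\<bar>a i - b i\<bar>\<^sup>2) \<partial>count_space F)"
    using F a b by (intro config_dist_le csum_config_finite) (auto intro: countable_finite)
  also have "\<dots> = ennreal (L2_set (\<lambda>i. a i - b i) F)"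
    by (simp only: nn_integral_sq_finite[OF F]) (simp add: ennreal_sqrt_ennreal L2_set_nonneg)
  finally show ?thesis .
qed

lemma config_window_finite:
  assumes "csum I x \<in> configs UNIV"
  shows "finite {i \<in> I. x i \<in> cwin n}" "finite {i \<in> I. x i \<in> owin n}"
proof -
  show "finite {i \<in> I. x i \<in> cwin n}" using assms by (rule config_finite_compact) auto
  then show "finite {i \<in> I. x i \<in> owin n}" by (rule rev_finite_subset) auto
qed

text \<open>With boundary points added, both configurations live in the compact closed window and
  are finite, so a cheap coupling is a finite matching. Restricting to the open window removes the
  added points again.\<close>

lemma window_dist_lessE:
  assumes conf: "\<gamma> \<in> configs UNIV" "\<eta> \<in> configs UNIV" and less: "window_dist n \<gamma> \<eta> < ennreal r"
  obtains F :: "nat set" and a b where "window_matching n \<gamma> \<eta> F a b" "L2_set (\<lambda>i. a i - b i) F < r"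
proof -
  obtain \<alpha> \<beta> where \<alpha>: "\<alpha> \<in> configs (bwin n)" and \<beta>: "\<beta> \<in> configs (bwin n)"
    and d: "config_dist (cwin n) (add_config (restrict_config (owin n) \<gamma>) \<alpha>)
                          (add_config (restrict_config (owin n) \<eta>) \<beta>) < ennreal r"
    using less unfolding window_dist_def INF_less_iff by auto
  have add: "add_config (restrict_config (owin n) \<delta>) \<epsilon> \<in> configs (cwin n) \<and>
      restrict_config (owin n) (add_config (restrict_config (owin n) \<delta>) \<epsilon>) = restrict_config (owin n) \<delta>"
    if \<delta>: "\<delta> \<in> configs UNIV" and \<epsilon>: "\<epsilon> \<in> configs (bwin n)" for \<delta> \<epsilon>
  proof -
    obtain I :: "nat set" and x where x: "\<delta> = csum I x" using config_csumE[OF \<delta>] by blast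
    obtain J :: "nat set" and y where yb: "\<And>j. j \<in> J \<Longrightarrow> y j \<in> bwin n" and y: "\<epsilon> = csum J y"
      using config_csumE[OF \<epsilon>] by blast
    have "compact (bwin n)" by (intro finite_imp_compact) simp
    then have "finite {j \<in> J. y j \<in> bwin n}"
      using \<epsilon> config_finite_compact[of J y "bwin n" "bwin n"] unfolding y by blast
    moreover have "{j \<in> J. y j \<in> bwin n} = J" using yb by auto
    ultimately have J: "finite J" by simp
    have I: "finite {i \<in> I. x i \<in> owin n}" using \<delta> config_window_finite(2) unfolding x by blast
    \<comment> \<open>The disjoint sum keeps the labels of inner points apart from those of the
      added boundary points.\<close>
    let ?K = "{i \<in> I. x i \<in> owin n} <+> J"
    have eq: "add_config (restrict_config (owin n) \<delta>) \<epsilon> = csum ?K (case_sum x y)"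
    proof -
      have 1: "restrict_config (owin n) \<delta> = csum {k \<in> ?K. isl k} (case_sum x y)"
        unfolding x restrict_config_csum[OF owin_borel]
        by (rule csum_reindex[of Inl]) (auto simp: bij_betw_def)
      have 2: "\<epsilon> = csum {k \<in> ?K. \<not> isl k} (case_sum x y)"
        unfolding y by (rule csum_reindex[of Inr]) (auto simp: bij_betw_def)
      show ?thesis unfolding 1 2 by (rule add_config_csum_split) simp
    qed
    have c: "case_sum x y k \<in> cwin n" if "k \<in> ?K" for k
      using that yb by fastforce
    have o: "csum {k \<in> ?K. case_sum x y k \<in> owin n} (case_sum x y) = restrict_config (owin n) \<delta>"
      unfolding x restrict_config_csum[OF owin_borel]
      by (rule csum_reindex[of Inl, symmetric]) (use yb in \<open>force simp: bij_betw_def\<close>)+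
    show ?thesis
      unfolding eq restrict_config_csum[OF owin_borel] o
    proof
      show "csum ?K (case_sum x y) \<in> configs (cwin n)"
        by (rule csum_config_finite[OF _ c]) (simp_all add: I[simplified] J)
    qed (rule refl)
  qed
  obtain I :: "nat set" and a b where a: "\<And>i. i \<in> I \<Longrightarrow> a i \<in> cwin n" and b: "\<And>i. i \<in> I \<Longrightarrow> b i \<in> cwin n"
    and eq: "add_config (restrict_config (owin n) \<gamma>) \<alpha> = csum I a" "add_config (restrict_config (owin n) \<eta>) \<beta> = csum I b"
    and i: "(\<integral>\<^sup>+ i. ennreal (\<bar>a i - b i\<bar>\<^sup>2) \<partial>count_space I) < ennreal (r\<^sup>2)"
    using config_dist_lessE[OF _ add[OF conf(1) \<alpha>, THEN conjunct1] add[OF conf(2) \<beta>, THEN conjunct1] d]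
    by auto
  have "finite {i \<in> I. a i \<in> cwin n}"
    using add[OF conf(1) \<alpha>] unfolding eq by (intro config_finite_compact[of _ _ _ "cwin n"]) auto
  moreover have "{i \<in> I. a i \<in> cwin n} = I" using a by auto
  ultimately have I: "finite I" by simp
  have "window_matching n \<gamma> \<eta> I a b"
    unfolding window_matching_def
    using I a b add[OF conf(1) \<alpha>] add[OF conf(2) \<beta>] unfolding eq restrict_config_csum[OF owin_borel]
    by (auto simp del: greaterThanLessThan_iff atLeastAtMost_iff)
  moreover have "L2_set (\<lambda>i. a i - b i) I < r"
  proof -
    have "r > 0" using less by (auto simp: ennreal_neg not_less intro: ccontr)
    have "(L2_set (\<lambda>i. a i - b i) I)\<^sup>2 < r\<^sup>2"
      using i unfolding nn_integral_sq_finite[OF I] by (subst (asm) ennreal_less_iff) auto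
    then show ?thesis using \<open>r > 0\<close> by (simp add: power2_less_imp_less)
  qed
  ultimately show ?thesis using that by blast
qed

text \<open>Every inner point, on either side, is matched with a copy of the boundary point
  n.\<close>

lemma window_dist_finite:
  assumes conf: "\<gamma> \<in> configs UNIV" "\<eta> \<in> configs UNIV"
  shows "window_dist n \<gamma> \<eta> < \<infinity>"
proof -
  obtain I :: "nat set" and x where x: "\<gamma> = csum I x" using config_csumE[OF conf(1)] by blast
  obtain J :: "nat set" and y where y: "\<eta> = csum J y" using config_csumE[OF conf(2)] by blast
  let ?I = "{i \<in> I. x i \<in> owin n}" and ?J = "{j \<in> J. y j \<in> owin n}"
  let ?a = "case_sum x (\<lambda>_. real n)" and ?b = "case_sum (\<lambda>_. real n) y"
  have "finite ?I" "finite ?J"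
    using conf config_window_finite(2) unfolding x y by blast+
  moreover have "csum {k \<in> ?I <+> ?J. ?a k \<in> owin n} ?a = csum ?I x"
    by (rule csum_reindex[of Inl, symmetric]) (force simp: bij_betw_def)+
  moreover have "csum {k \<in> ?I <+> ?J. ?b k \<in> owin n} ?b = csum ?J y"
    by (rule csum_reindex[of Inr, symmetric]) (force simp: bij_betw_def)+
  ultimately have "window_matching n \<gamma> \<eta> (?I <+> ?J) ?a ?b"
    unfolding window_matching_def x y restrict_config_csum[OF owin_borel] by (auto split: sum.splits)
  from window_dist_le[OF this] show ?thesis
    by (rule order.strict_trans1) simp
qed

section \<open>The window semidistances\<close>

definition wdist :: "nat \<Rightarrow> real measure \<Rightarrow> real measure \<Rightarrow> real" where
  "wdist n \<gamma> \<eta> = enn2real (window_dist n \<gamma> \<eta>)"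

lemma window_dist_eq_wdist:
  assumes "\<gamma> \<in> configs UNIV" "\<eta> \<in> configs UNIV"
  shows "window_dist n \<gamma> \<eta> = ennreal (wdist n \<gamma> \<eta>)"
  using window_dist_finite[OF assms] by (simp add: wdist_def)

lemma wdist_nonneg [simp]: "0 \<le> wdist n \<gamma> \<eta>"
  by (simp add: wdist_def)

lemma wdist_le:
  assumes "window_matching n \<gamma> \<eta> F a b"
  shows "wdist n \<gamma> \<eta> \<le> L2_set (\<lambda>i. a i - b i) F"
  unfolding wdist_def using window_dist_le[OF assms] by (intro enn2real_leI L2_set_nonneg)

lemma wdist_lessE:
  assumes "\<gamma> \<in> configs UNIV" "\<eta> \<in> configs UNIV" "wdist n \<gamma> \<eta> < r"
  obtains F :: "nat set" and a b where "window_matching n \<gamma> \<eta> F a b" "L2_set (\<lambda>i. a i - b i) F < r"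
  using window_dist_lessE[OF assms(1,2), of n r] assms window_dist_eq_wdist[OF assms(1,2), of n]
    that by (auto simp: ennreal_less_iff)

lemma window_matching_commute:
  "window_matching n \<gamma> \<eta> F a b \<Longrightarrow> window_matching n \<eta> \<gamma> F b a"
  by (auto simp: window_matching_def)

lemma L2_set_minus_commute: "L2_set (\<lambda>i. a i - b i) F = L2_set (\<lambda>i. b i - a i) F"
  by (simp add: L2_set_def power2_commute)

lemma wdist_commute:
  assumes "\<gamma> \<in> configs UNIV" "\<eta> \<in> configs UNIV"
  shows "wdist n \<gamma> \<eta> = wdist n \<eta> \<gamma>"
proof -
  have "wdist n \<gamma> \<eta> \<le> wdist n \<eta> \<gamma>" if conf: "\<gamma> \<in> configs UNIV" "\<eta> \<in> configs UNIV" for \<gamma> \<eta>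
  proof (rule dense_ge)
    fix r assume "wdist n \<eta> \<gamma> < r"
    then obtain F :: "nat set" and a b where "window_matching n \<eta> \<gamma> F a b" "L2_set (\<lambda>i. a i - b i) F < r"
      by (rule wdist_lessE[OF conf(2,1)])
    then show "wdist n \<gamma> \<eta> \<le> r"
      using wdist_le[OF window_matching_commute] L2_set_minus_commute[of a b F] by fastforce
  qed
  then show ?thesis using assms by (meson order_antisym)
qed

lemma wdist_refl:
  assumes "\<gamma> \<in> configs UNIV"
  shows "wdist n \<gamma> \<gamma> = 0"
proof -
  obtain I :: "nat set" and x where x: "\<gamma> = csum I x" using config_csumE[OF assms] by blast
  have "finite {i \<in> I. x i \<in> owin n}" using assms config_window_finite(2) unfolding x by blast
  then have "window_matching n \<gamma> \<gamma> {i \<in> I. x i \<in> owin n} x x"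
    unfolding window_matching_def x restrict_config_csum[OF owin_borel] by auto
  from wdist_le[OF this] show ?thesis by (simp add: L2_set_def order_antisym)
qed

text \<open>Two matchings are glued along the inner points of the middle configuration, whose labels
  are identified by \<open>h\<close>. A pair of \<open>F\<close> whose middle point is on the
  boundary ends there, and a pair of \<open>G\<close> whose middle point is on the boundary starts
  there: boundary points may be added freely. The costs combine by Minkowski's inequality.\<close>

lemma wdist_triangle:
  assumes conf: "\<gamma> \<in> configs UNIV" "\<eta> \<in> configs UNIV" "\<zeta> \<in> configs UNIV"
  shows "wdist n \<gamma> \<zeta> \<le> wdist n \<gamma> \<eta> + wdist n \<eta> \<zeta>"
proof (rule field_le_epsilon)
  fix e :: real assume e: "e > 0"
  obtain F :: "nat set" and a b where F: "window_matching n \<gamma> \<eta> F a b"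
    and lF: "L2_set (\<lambda>i. a i - b i) F < wdist n \<gamma> \<eta> + e / 2"
    using wdist_lessE[OF conf(1,2), of n "wdist n \<gamma> \<eta> + e / 2"] e by auto
  obtain G :: "nat set" and b' c where G: "window_matching n \<eta> \<zeta> G b' c"
    and lG: "L2_set (\<lambda>i. b' i - c i) G < wdist n \<eta> \<zeta> + e / 2"
    using wdist_lessE[OF conf(2,3), of n "wdist n \<eta> \<zeta> + e / 2"] e by auto
  let ?Fi = "{i \<in> F. b i \<in> owin n}" and ?Gi = "{j \<in> G. b' j \<in> owin n}"
  let ?Gb = "{j \<in> G. b' j \<notin> owin n}"
  have fin: "finite F" "finite G" using F G by (auto simp: window_matching_def)
  have "csum ?Fi b = csum ?Gi b'" using F G by (simp add: window_matching_def)
  then obtain h where h: "bij_betw h ?Fi ?Gi" "\<And>i. i \<in> ?Fi \<Longrightarrow> b' (h i) = b i"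
    using csum_eq_bij[of ?Fi b ?Gi b'] fin by auto
  let ?H = "F <+> ?Gb"
  \<comment> \<open>\<open>A\<close> and \<open>C\<close> are the ends of the glued pairs.
    \<open>u\<close> and \<open>v\<close> are the lengths of the two legs, with 0 for a leg that is
    missing.\<close>
  define A where "A = case_sum a b'"
  define C where "C = case_sum (\<lambda>i. if i \<in> ?Fi then c (h i) else b i) c"
  define u where "u = case_sum (\<lambda>i. \<bar>a i - b i\<bar>) (\<lambda>_::nat. 0)"
  define v where "v = case_sum (\<lambda>i. if i \<in> ?Fi then \<bar>b' (h i) - c (h i)\<bar> else 0) (\<lambda>j. \<bar>b' j - c j\<bar>)"
  have hG: "h i \<in> G" "b' (h i) \<in> owin n" if "i \<in> ?Fi" for i
    using bij_betwE[OF h(1)] that by auto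
  have inw: "\<And>i. i \<in> F \<Longrightarrow> a i \<in> cwin n" "\<And>i. i \<in> F \<Longrightarrow> b i \<in> cwin n"
    "\<And>i. i \<in> G \<Longrightarrow> b' i \<in> cwin n" "\<And>i. i \<in> G \<Longrightarrow> c i \<in> cwin n"
    using F G unfolding window_matching_def by blast+
  have "window_matching n \<gamma> \<zeta> ?H A C"
    unfolding window_matching_def
  proof (intro conjI)
    show "finite ?H" using fin by simp
    show "A ` ?H \<subseteq> cwin n" using inw(1,3) by (auto simp: A_def simp del: atLeastAtMost_iff)
    show "C ` ?H \<subseteq> cwin n"
      using inw(2,4) hG by (auto simp: C_def simp del: atLeastAtMost_iff greaterThanLessThan_iff)
    have "csum {i \<in> F. a i \<in> owin n} a = csum {k \<in> ?H. A k \<in> owin n} A"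
      by (rule csum_reindex[of Inl])
        (auto simp: bij_betw_def A_def simp del: greaterThanLessThan_iff)
    then show "restrict_config (owin n) \<gamma> = csum {k \<in> ?H. A k \<in> owin n} A"
      using F by (simp add: window_matching_def)
    let ?g = "case_sum h (\<lambda>j. j)"
    \<comment> \<open>A glued pair that ends inside the open window goes either through an inner
      middle point or comes from \<open>G\<close> alone; a pair of \<open>F\<close> that stops at
      the boundary is excluded.\<close>
    have K: "(\<exists>i. i \<in> ?Fi \<and> k = Inl i \<and> c (h i) \<in> owin n) \<or> (\<exists>j. j \<in> ?Gb \<and> k = Inr j \<and> c j \<in> owin n)"
      if "k \<in> {k \<in> ?H. C k \<in> owin n}" for k
    proof (cases k)
      case (Inl i)
      then have "i \<in> F" "C (Inl i) \<in> owin n" using that by auto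
      have "b i \<in> owin n"
      proof (rule ccontr)
        assume "b i \<notin> owin n"
        then have "C (Inl i) = b i" by (simp add: C_def del: greaterThanLessThan_iff)
        with \<open>C (Inl i) \<in> owin n\<close> \<open>b i \<notin> owin n\<close> show False by (simp only: simp_thms)
      qed
      with \<open>i \<in> F\<close> have "i \<in> ?Fi" by blast
      then show ?thesis using \<open>C (Inl i) \<in> owin n\<close> Inl unfolding C_def by simp
    next
      case (Inr j)
      then have "j \<in> ?Gb" "c j \<in> owin n"
        using that by (auto simp: C_def simp del: greaterThanLessThan_iff)
      then show ?thesis using Inr by blast
    qed
    have "bij_betw ?g {k \<in> ?H. C k \<in> owin n} {j \<in> G. c j \<in> owin n}"
    proof (rule bij_betwI')
      fix k k' assume k: "k \<in> {k \<in> ?H. C k \<in> owin n}" "k' \<in> {k \<in> ?H. C k \<in> owin n}"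
      have inj: "h i = h i' \<longleftrightarrow> i = i'" if "i \<in> ?Fi" "i' \<in> ?Fi" for i i'
        using inj_on_eq_iff[OF bij_betw_imp_inj_on[OF h(1)] that] .
      have dis: "h i \<noteq> j" if "i \<in> ?Fi" "j \<in> ?Gb" for i j
        using hG(2)[OF that(1)] that(2) by blast
      from K[OF k(1)] K[OF k(2)] show "(?g k = ?g k') = (k = k')"
        by (elim disjE exE conjE) (simp_all only: sum.case inj dis dis[symmetric] sum.inject sum.distinct)
    next
      fix k assume k: "k \<in> {k \<in> ?H. C k \<in> owin n}"
      from K[OF this] show "?g k \<in> {j \<in> G. c j \<in> owin n}"
        using hG(1) by (elim disjE exE conjE) simp_all
    next
      fix j assume j: "j \<in> {j \<in> G. c j \<in> owin n}"
      show "\<exists>k\<in>{k \<in> ?H. C k \<in> owin n}. j = ?g k"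
      proof (cases "b' j \<in> owin n")
        case True
        then have "j \<in> h ` ?Fi" using j bij_betw_imp_surj_on[OF h(1)] by simp
        then obtain i where "i \<in> ?Fi" "j = h i" by blast
        then show ?thesis using j by (intro bexI[of _ "Inl i"]) (auto simp: C_def simp del: greaterThanLessThan_iff)
      next
        case False
        then show ?thesis using j by (intro bexI[of _ "Inr j"]) (auto simp: C_def simp del: greaterThanLessThan_iff)
      qed
    qed
    then have "csum {k \<in> ?H. C k \<in> owin n} C = csum {j \<in> G. c j \<in> owin n} c"
    proof (rule csum_reindex)
      fix k assume "k \<in> {k \<in> ?H. C k \<in> owin n}"
      from K[OF this] show "C k = c (?g k)"
        unfolding C_def by (elim disjE exE conjE) simp_all
    qed
    then show "restrict_config (owin n) \<zeta> = csum {k \<in> ?H. C k \<in> owin n} C"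
      using G by (simp add: window_matching_def)
  qed
  then have "wdist n \<gamma> \<zeta> \<le> L2_set (\<lambda>k. A k - C k) ?H" by (rule wdist_le)
  also have "\<dots> = L2_set (\<lambda>k. \<bar>A k - C k\<bar>) ?H" by (simp add: L2_set_def)
  also have "\<dots> \<le> L2_set (\<lambda>k. u k + v k) ?H"
  proof (rule L2_set_mono)
    fix k assume "k \<in> ?H"
    then show "\<bar>A k - C k\<bar> \<le> u k + v k"
      using h(2) by (cases k) (auto simp: A_def C_def u_def v_def simp del: greaterThanLessThan_iff)
  qed simp
  also have "\<dots> \<le> L2_set u ?H + L2_set v ?H" by (rule L2_set_triangle_ineq)
  also have "L2_set u ?H = L2_set (\<lambda>i. a i - b i) F"
    using fin by (simp add: L2_set_def u_def sum.Plus)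
  also have "L2_set v ?H = L2_set (\<lambda>j. b' j - c j) G"
  proof -
    have "(\<Sum>k\<in>?H. (v k)\<^sup>2) = (\<Sum>i\<in>F. if i \<in> ?Fi then (b' (h i) - c (h i))\<^sup>2 else 0) + (\<Sum>j\<in>?Gb. (b' j - c j)\<^sup>2)"
      using fin by (simp add: v_def sum.Plus if_distrib[of "\<lambda>x. x\<^sup>2"] cong: if_cong)
    also have "(\<Sum>i\<in>F. if i \<in> ?Fi then (b' (h i) - c (h i))\<^sup>2 else 0) = (\<Sum>i\<in>?Fi. (b' (h i) - c (h i))\<^sup>2)"
      using fin by (intro sum.mono_neutral_cong_right) auto
    also have "\<dots> = (\<Sum>j\<in>?Gi. (b' j - c j)\<^sup>2)"
      using sum.reindex_bij_betw[OF h(1)] by simp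
    also have "\<dots> + (\<Sum>j\<in>?Gb. (b' j - c j)\<^sup>2) = (\<Sum>j\<in>?Gi \<union> ?Gb. (b' j - c j)\<^sup>2)"
      using fin by (intro sum.union_disjoint[symmetric]) auto
    also have "?Gi \<union> ?Gb = G" by auto
    finally show ?thesis by (simp add: L2_set_def)
  qed
  finally show "wdist n \<gamma> \<zeta> \<le> wdist n \<gamma> \<eta> + wdist n \<eta> \<zeta> + e" using lF lG by simp
qed

definition clamp_win :: "nat \<Rightarrow> real \<Rightarrow> real" where
  "clamp_win n t = max (- real n) (min (real n) t)"

lemma clamp_win: "clamp_win n t \<in> cwin n" "t \<in> cwin n \<Longrightarrow> clamp_win n t = t"
  "clamp_win n t \<in> owin n \<longleftrightarrow> t \<in> owin n \<and> n > 0" "\<bar>clamp_win n s - clamp_win n t\<bar> \<le> \<bar>s - t\<bar>"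
  by (auto simp: clamp_win_def max_def min_def)

text \<open>Pairs with at least one point in the open window are kept. A partner outside is moved to
  the boundary, where a window matching may have any points, and pairs that miss the window are
  dropped.\<close>

lemma clamp_matching:
  assumes \<gamma>: "restrict_config (owin m) \<gamma> = csum {i \<in> I. x i \<in> owin m} x"
    and \<eta>: "restrict_config (owin m) \<eta> = csum {i \<in> I. y i \<in> owin m} y"
    and fin: "finite {i \<in> I. x i \<in> owin m \<or> y i \<in> owin m}"
  shows "window_matching m \<gamma> \<eta> {i \<in> I. x i \<in> owin m \<or> y i \<in> owin m}
    (\<lambda>i. clamp_win m (x i)) (\<lambda>i. clamp_win m (y i))"
proof -
  let ?F = "{i \<in> I. x i \<in> owin m \<or> y i \<in> owin m}"
  have c: "clamp_win m t \<in> owin m \<longleftrightarrow> t \<in> owin m" for t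
    using clamp_win(3)[of m t] by auto
  have e: "csum {i \<in> ?F. clamp_win m (z i) \<in> owin m} (\<lambda>i. clamp_win m (z i)) = csum {i \<in> I. z i \<in> owin m} z"
    if "\<And>i. i \<in> I \<Longrightarrow> z i \<in> owin m \<Longrightarrow> i \<in> ?F" for z
  proof -
    have "{i \<in> ?F. clamp_win m (z i) \<in> owin m} = {i \<in> I. z i \<in> owin m}"
      unfolding c using that by blast
    moreover have "clamp_win m (z i) = z i" if "z i \<in> owin m" for i
      using that by (intro clamp_win(2)) auto
    ultimately show ?thesis by (auto intro: csum_cong)
  qed
  show ?thesis
    unfolding window_matching_def \<gamma> \<eta>
  proof (intro conjI)
    show "csum {i \<in> I. x i \<in> owin m} x = csum {i \<in> ?F. clamp_win m (x i) \<in> owin m} (\<lambda>i. clamp_win m (x i))"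
      by (rule e[symmetric]) simp
    show "csum {i \<in> I. y i \<in> owin m} y = csum {i \<in> ?F. clamp_win m (y i) \<in> owin m} (\<lambda>i. clamp_win m (y i))"
      by (rule e[symmetric]) simp
  qed (use fin clamp_win(1) in blast)+
qed

lemma wdist_le_window:
  assumes conf: "\<gamma> \<in> configs UNIV" "\<eta> \<in> configs UNIV" and mn: "m \<le> n"
  shows "wdist m \<gamma> \<eta> \<le> wdist n \<gamma> \<eta>"
proof (rule dense_ge)
  fix r assume "wdist n \<gamma> \<eta> < r"
  then obtain F :: "nat set" and a b where F: "window_matching n \<gamma> \<eta> F a b" "L2_set (\<lambda>i. a i - b i) F < r"
    by (rule wdist_lessE[OF conf])
  let ?F = "{i \<in> F. a i \<in> owin m \<or> b i \<in> owin m}"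
  have fin: "finite F" using F by (simp add: window_matching_def)
  have sub: "owin m \<subseteq> owin n" using mn by auto
  have r: "restrict_config (owin m) \<delta> = csum {i \<in> F. d i \<in> owin m} d"
    if "restrict_config (owin n) \<delta> = csum {i \<in> F. d i \<in> owin n} d" "\<delta> \<in> configs UNIV" for \<delta> d
  proof -
    have "restrict_config (owin m) \<delta> = restrict_config (owin m) (restrict_config (owin n) \<delta>)"
      by (rule restrict_restrict_config[symmetric]) (use that(2) sub in simp_all)
    also have "\<dots> = csum {i \<in> {i \<in> F. d i \<in> owin n}. d i \<in> owin m} d"
      unfolding that(1) by (rule restrict_config_csum) simp
    also have "{i \<in> {i \<in> F. d i \<in> owin n}. d i \<in> owin m} = {i \<in> F. d i \<in> owin m}"
      using sub by blast
    finally show ?thesis .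
  qed
  have "wdist m \<gamma> \<eta> \<le> L2_set (\<lambda>i. clamp_win m (a i) - clamp_win m (b i)) ?F"
    using F conf fin by (intro wdist_le clamp_matching r) (auto simp: window_matching_def)
  also have "\<dots> = L2_set (\<lambda>i. \<bar>clamp_win m (a i) - clamp_win m (b i)\<bar>) ?F" by (simp add: L2_set_def)
  also have "\<dots> \<le> L2_set (\<lambda>i. \<bar>a i - b i\<bar>) ?F"
    by (rule L2_set_mono) (auto intro: clamp_win)
  also have "\<dots> \<le> L2_set (\<lambda>i. \<bar>a i - b i\<bar>) F"
    using fin unfolding L2_set_def by (intro real_sqrt_le_mono sum_mono2) auto
  also have "\<dots> = L2_set (\<lambda>i. a i - b i) F" by (simp add: L2_set_def)
  finally show "wdist m \<gamma> \<eta> \<le> r" using F by simp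
qed

lemma window_dist_le_config_dist:
  assumes conf: "\<gamma> \<in> configs UNIV" "\<eta> \<in> configs UNIV"
  shows "window_dist n \<gamma> \<eta> \<le> config_dist UNIV \<gamma> \<eta>"
proof (rule ccontr)
  assume "\<not> window_dist n \<gamma> \<eta> \<le> config_dist UNIV \<gamma> \<eta>"
  then have less: "config_dist UNIV \<gamma> \<eta> < ennreal (wdist n \<gamma> \<eta>)"
    using conf by (simp add: window_dist_eq_wdist)
  obtain I :: "nat set" and x y where xy: "\<gamma> = csum I x" "\<eta> = csum I y"
    and cost: "(\<integral>\<^sup>+ i. ennreal (\<bar>x i - y i\<bar>\<^sup>2) \<partial>count_space I) < ennreal ((wdist n \<gamma> \<eta>)\<^sup>2)"
    using config_dist_lessE[OF _ conf less] by auto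
  let ?F = "{i \<in> I. x i \<in> owin n \<or> y i \<in> owin n}"
  have "?F = {i \<in> I. x i \<in> owin n} \<union> {i \<in> I. y i \<in> owin n}" by auto
  then have fin: "finite ?F"
    using conf config_window_finite(2)[of I x n] config_window_finite(2)[of I y n] unfolding xy by simp
  have "wdist n \<gamma> \<eta> \<le> L2_set (\<lambda>i. clamp_win n (x i) - clamp_win n (y i)) ?F"
    using fin by (intro wdist_le clamp_matching) (auto simp: xy restrict_config_csum)
  also have "\<dots> = L2_set (\<lambda>i. \<bar>clamp_win n (x i) - clamp_win n (y i)\<bar>) ?F" by (simp add: L2_set_def)
  also have "\<dots> \<le> L2_set (\<lambda>i. \<bar>x i - y i\<bar>) ?F"
    by (rule L2_set_mono) (auto intro: clamp_win)
  also have "\<dots> = L2_set (\<lambda>i. x i - y i) ?F" by (simp add: L2_set_def)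
  finally have "(wdist n \<gamma> \<eta>)\<^sup>2 \<le> (L2_set (\<lambda>i. x i - y i) ?F)\<^sup>2" by (intro power_mono) auto
  then have "ennreal ((wdist n \<gamma> \<eta>)\<^sup>2) \<le> (\<integral>\<^sup>+ i. ennreal (\<bar>x i - y i\<bar>\<^sup>2) \<partial>count_space ?F)"
    unfolding nn_integral_sq_finite[OF fin] by (rule ennreal_leI)
  also have "\<dots> \<le> (\<integral>\<^sup>+ i. ennreal (\<bar>x i - y i\<bar>\<^sup>2) \<partial>count_space I)"
  proof -
    have "(\<integral>\<^sup>+ i. ennreal (\<bar>x i - y i\<bar>\<^sup>2) \<partial>count_space ?F) =
        (\<integral>\<^sup>+ i. ennreal (\<bar>x i - y i\<bar>\<^sup>2) * indicator ?F i \<partial>count_space UNIV)"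
      by (subst nn_integral_count_space_indicator) auto
    also have "\<dots> \<le> (\<integral>\<^sup>+ i. ennreal (\<bar>x i - y i\<bar>\<^sup>2) * indicator I i \<partial>count_space UNIV)"
      by (intro nn_integral_mono) (auto simp: indicator_def)
    also have "\<dots> = (\<integral>\<^sup>+ i. ennreal (\<bar>x i - y i\<bar>\<^sup>2) \<partial>count_space I)"
      by (subst nn_integral_count_space_indicator) auto
    finally show ?thesis .
  qed
  finally show False using cost by simp
qed

lemma wdist_le_config_dist:
  assumes "\<gamma> \<in> configs UNIV" "\<eta> \<in> configs UNIV"
  shows "ennreal (wdist n \<gamma> \<eta>) \<le> config_dist UNIV \<gamma> \<eta>"
  using window_dist_le_config_dist[OF assms] window_dist_eq_wdist[OF assms] by simp

section \<open>Assembling a global matching from window matchings\<close>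

lemma pointwise_convergent_subsequence:
  fixes f :: "nat \<Rightarrow> 'k::countable \<Rightarrow> real"
  assumes "\<And>n k. \<bar>f n k\<bar> \<le> B k"
  obtains r l where "strict_mono (r :: nat \<Rightarrow> nat)" "\<And>k. (\<lambda>n. f (r n) k) \<longlonglongrightarrow> l k"
proof -
  \<comment> \<open>The diagonal argument in the form of Tychonoff's theorem: a countable product of
    compact intervals is compact, hence sequentially compact. It is used for matchings, coded by
    indicators, and later for configurations, coded by their points.\<close>
  let ?K = "PiE UNIV (\<lambda>k. {- B k..B k})"
  have "compactin (product_topology (\<lambda>_::'k. euclidean :: real topology) UNIV) ?K"
    unfolding compactin_PiE by simp
  then have "compact ?K"
    by (simp add: euclidean_product_topology)
  then have "seq_compact ?K" by (rule compact_imp_seq_compact)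
  moreover have "\<forall>n. f n \<in> ?K" using assms by (auto simp: abs_le_iff) (metis minus_le_iff)
  ultimately obtain l r where r: "strict_mono r" and l: "(f \<circ> r) \<longlonglongrightarrow> l"
    unfolding seq_compact_def by blast
  have "(\<lambda>n. f (r n) k) \<longlonglongrightarrow> l k" for k
  proof -
    have "isCont (\<lambda>g::'k \<Rightarrow> real. g k) l"
      using continuous_on_product_coordinates[of k] continuous_on_eq_continuous_at[OF open_UNIV]
      by blast
    from isCont_tendsto_compose[OF this l] show ?thesis by (simp add: comp_def)
  qed
  with r show ?thesis by (rule that)
qed

lemma indicator_limit:
  fixes P :: "nat \<Rightarrow> bool"
  assumes "(\<lambda>n. of_bool (P n) :: real) \<longlonglongrightarrow> l"
  shows "\<forall>\<^sub>F n in sequentially. P n \<longleftrightarrow> l = 1"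
proof -
  have "\<forall>\<^sub>F n in sequentially. dist (of_bool (P n)) l < 1/2"
    using tendstoD[OF assms, of "1/2"] by simp
  moreover have "l = 0 \<or> l = 1"
  proof (rule ccontr)
    assume "\<not> ?thesis"
    then have "min \<bar>l\<bar> \<bar>l - 1\<bar> > 0" by auto
    from tendstoD[OF assms this] have "\<forall>\<^sub>F n in sequentially. False"
      by (rule eventually_mono) (auto simp: dist_real_def of_bool_def split: if_splits)
    then show False by simp
  qed
  ultimately show ?thesis
    by (auto elim!: eventually_mono simp: dist_real_def of_bool_def split: if_splits)
qed

text \<open>Only pairs with both points in the open window survive as pairs of labels. A point whose
  distance to the boundary exceeds the cost has its partner inside, since a single displacement is
  at most the whole cost; so near the centre nothing is lost.\<close>

lemma window_pairing:
  assumes m: "window_matching m (csum I x) (csum J y) F a b"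
  obtains S where "S \<subseteq> {i \<in> I. x i \<in> owin m} \<times> {j \<in> J. y j \<in> owin m}"
    "\<And>i j j'. (i, j) \<in> S \<Longrightarrow> (i, j') \<in> S \<Longrightarrow> j = j'" "\<And>i i' j. (i, j) \<in> S \<Longrightarrow> (i', j) \<in> S \<Longrightarrow> i = i'"
    "\<And>T. finite T \<Longrightarrow> T \<subseteq> S \<Longrightarrow> (\<Sum>(i, j)\<in>T. (x i - y j)\<^sup>2) \<le> (L2_set (\<lambda>k. a k - b k) F)\<^sup>2"
    "\<And>i. i \<in> I \<Longrightarrow> \<bar>x i\<bar> + L2_set (\<lambda>k. a k - b k) F < m \<Longrightarrow>
      \<exists>j. (i, j) \<in> S \<and> \<bar>x i - y j\<bar> \<le> L2_set (\<lambda>k. a k - b k) F"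
    "\<And>j. j \<in> J \<Longrightarrow> \<bar>y j\<bar> + L2_set (\<lambda>k. a k - b k) F < m \<Longrightarrow>
      \<exists>i. (i, j) \<in> S \<and> \<bar>x i - y j\<bar> \<le> L2_set (\<lambda>k. a k - b k) F"
proof -
  let ?I = "{i \<in> I. x i \<in> owin m}" and ?J = "{j \<in> J. y j \<in> owin m}"
  let ?Fa = "{k \<in> F. a k \<in> owin m}" and ?Fb = "{k \<in> F. b k \<in> owin m}"
  let ?L = "L2_set (\<lambda>k. a k - b k) F"
  have F: "finite F" and eq: "csum ?Fa a = csum ?I x" "csum ?Fb b = csum ?J y"
    using m by (auto simp: window_matching_def restrict_config_csum)
  obtain p where p: "bij_betw p ?Fa ?I" "\<And>k. k \<in> ?Fa \<Longrightarrow> x (p k) = a k"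
    using csum_eq_bij[OF _ eq(1)] F by auto
  obtain q where q: "bij_betw q ?Fb ?J" "\<And>k. k \<in> ?Fb \<Longrightarrow> y (q k) = b k"
    using csum_eq_bij[OF _ eq(2)] F by auto
  \<comment> \<open>The pairs with both ends inside; \<open>p\<close> and \<open>q\<close> translate
    their labels into those of the two given configurations.\<close>
  let ?G = "?Fa \<inter> ?Fb"
  define S where "S = (\<lambda>k. (p k, q k)) ` ?G"
  have pi: "p k = p k' \<longleftrightarrow> k = k'" if "k \<in> ?Fa" "k' \<in> ?Fa" for k k'
    using inj_on_eq_iff[OF bij_betw_imp_inj_on[OF p(1)] that] .
  have qi: "q k = q k' \<longleftrightarrow> k = k'" if "k \<in> ?Fb" "k' \<in> ?Fb" for k k'
    using inj_on_eq_iff[OF bij_betw_imp_inj_on[OF q(1)] that] .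
  have dist: "\<bar>a k - b k\<bar> \<le> ?L" if "k \<in> F" for k
  proof -
    have "\<bar>a k - b k\<bar> = sqrt ((a k - b k)\<^sup>2)" by simp
    also have "\<dots> \<le> ?L"
      unfolding L2_set_def using F that by (intro real_sqrt_le_mono member_le_sum) auto
    finally show ?thesis .
  qed
  show ?thesis
  proof
    show "S \<subseteq> ?I \<times> ?J"
      using bij_betwE[OF p(1)] bij_betwE[OF q(1)] unfolding S_def by blast
    show "j = j'" if ij: "(i, j) \<in> S" "(i, j') \<in> S" for i j j'
    proof -
      obtain k where k: "k \<in> ?G" "i = p k" "j = q k" using ij(1) unfolding S_def by blast
      obtain k' where k': "k' \<in> ?G" "i = p k'" "j' = q k'" using ij(2) unfolding S_def by blast
      have "k = k'" using pi[of k k'] k k' by blast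
      then show ?thesis using k k' by simp
    qed
    show "i = i'" if ij: "(i, j) \<in> S" "(i', j) \<in> S" for i i' j
    proof -
      obtain k where k: "k \<in> ?G" "i = p k" "j = q k" using ij(1) unfolding S_def by blast
      obtain k' where k': "k' \<in> ?G" "i' = p k'" "j = q k'" using ij(2) unfolding S_def by blast
      have "k = k'" using qi[of k k'] k k' by blast
      then show ?thesis using k k' by simp
    qed
    show "(\<Sum>(i, j)\<in>T. (x i - y j)\<^sup>2) \<le> ?L\<^sup>2" if T: "finite T" "T \<subseteq> S" for T
    proof -
      have "(\<Sum>(i, j)\<in>T. (x i - y j)\<^sup>2) \<le> (\<Sum>(i, j)\<in>S. (x i - y j)\<^sup>2)"
        using T F by (intro sum_mono2) (auto simp: S_def)
      also have "\<dots> = (\<Sum>k\<in>?G. (x (p k) - y (q k))\<^sup>2)"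
        unfolding S_def using pi by (subst sum.reindex) (auto simp: inj_on_def)
      also have "\<dots> = (\<Sum>k\<in>?G. (a k - b k)\<^sup>2)"
        using p(2) q(2) by (intro sum.cong) auto
      also have "\<dots> \<le> (\<Sum>k\<in>F. (a k - b k)\<^sup>2)"
        using F by (intro sum_mono2) auto
      also have "\<dots> = ?L\<^sup>2" by (simp add: L2_set_def sum_nonneg)
      finally show ?thesis .
    qed
    show "\<exists>j. (i, j) \<in> S \<and> \<bar>x i - y j\<bar> \<le> ?L" if i: "i \<in> I" "\<bar>x i\<bar> + ?L < m" for i
    proof -
      have "?L \<ge> 0" by simp
      then have "\<bar>x i\<bar> < m" using i(2) by linarith
      then have "x i \<in> owin m" by auto
      then have "i \<in> p ` ?Fa" using i(1) bij_betw_imp_surj_on[OF p(1)] by blast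
      then obtain k where k: "k \<in> ?Fa" "i = p k" by blast
      have "\<bar>a k - b k\<bar> \<le> ?L" using dist k by blast
      moreover have "a k = x i" using p(2) k by simp
      ultimately have "\<bar>b k\<bar> < m" using i(2) by linarith
      then have "b k \<in> owin m" by auto
      then have "k \<in> ?G" using k by blast
      then have "(i, q k) \<in> S" "y (q k) = b k" using k q(2) unfolding S_def by blast+
      then show ?thesis using \<open>\<bar>a k - b k\<bar> \<le> ?L\<close> \<open>a k = x i\<close> by auto
    qed
    show "\<exists>i. (i, j) \<in> S \<and> \<bar>x i - y j\<bar> \<le> ?L" if j: "j \<in> J" "\<bar>y j\<bar> + ?L < m" for j
    proof -
      have "?L \<ge> 0" by simp
      then have "\<bar>y j\<bar> < m" using j(2) by linarith
      then have "y j \<in> owin m" by auto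
      then have "j \<in> q ` ?Fb" using j(1) bij_betw_imp_surj_on[OF q(1)] by blast
      then obtain k where k: "k \<in> ?Fb" "j = q k" by blast
      have "\<bar>a k - b k\<bar> \<le> ?L" using dist k by blast
      moreover have "b k = y j" using q(2) k by simp
      ultimately have "\<bar>a k\<bar> < m" using j(2) by linarith
      then have "a k \<in> owin m" by auto
      then have "k \<in> ?G" using k by blast
      then have "(p k, j) \<in> S" "x (p k) = a k" using k p(2) unfolding S_def by blast+
      then show ?thesis using \<open>\<bar>a k - b k\<bar> \<le> ?L\<close> \<open>b k = y j\<close> by auto
    qed
  qed
qed

lemma nn_integral_count_space_le:
  fixes f :: "'i::countable \<Rightarrow> real"
  assumes "\<And>i. 0 \<le> f i" and "\<And>T. finite T \<Longrightarrow> T \<subseteq> S \<Longrightarrow> (\<Sum>i\<in>T. f i) \<le> c"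
  shows "(\<integral>\<^sup>+ i. ennreal (f i) \<partial>count_space S) \<le> ennreal c"
proof -
  let ?T = "\<lambda>n. {i \<in> S. to_nat i < n}"
  have fin: "finite (?T n)" for n
  proof -
    have "finite (to_nat ` ?T n)" by (rule finite_subset[of _ "{..<n}"]) auto
    then show ?thesis by (rule finite_imageD) (simp add: inj_on_def)
  qed
  have "(\<integral>\<^sup>+ i. ennreal (f i) \<partial>count_space S) = (\<integral>\<^sup>+ i. (SUP n. ennreal (f i) * indicator (?T n) i) \<partial>count_space S)"
  proof (rule nn_integral_cong)
    fix i assume "i \<in> space (count_space S)"
    then have i: "i \<in> S" by simp
    show "ennreal (f i) = (SUP n. ennreal (f i) * indicator (?T n) i)"
    proof (rule antisym)
      show "ennreal (f i) \<le> (SUP n. ennreal (f i) * indicator (?T n) i)"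
        by (rule SUP_upper2[of "Suc (to_nat i)"]) (use i in auto)
      show "(SUP n. ennreal (f i) * indicator (?T n) i) \<le> ennreal (f i)"
        by (rule SUP_least) (auto simp: indicator_def)
    qed
  qed
  also have "\<dots> = (SUP n. \<integral>\<^sup>+ i. ennreal (f i) * indicator (?T n) i \<partial>count_space S)"
    by (intro nn_integral_monotone_convergence_SUP) (auto simp: incseq_def le_fun_def indicator_def)
  also have "\<dots> \<le> ennreal c"
  proof (rule SUP_least)
    fix n
    have "(\<integral>\<^sup>+ i. ennreal (f i) * indicator (?T n) i \<partial>count_space S) = (\<Sum>i\<in>?T n. ennreal (f i) * indicator (?T n) i)"
      using fin by (intro nn_integral_count_space') auto
    also have "\<dots> = (\<Sum>i\<in>?T n. ennreal (f i))"
      by (intro sum.cong) auto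
    also have "\<dots> = ennreal (\<Sum>i\<in>?T n. f i)" using assms(1) by simp
    also have "\<dots> \<le> ennreal c" using assms(2)[OF fin] by (intro ennreal_leI) auto
    finally show "(\<integral>\<^sup>+ i. ennreal (f i) * indicator (?T n) i \<partial>count_space S) \<le> ennreal c" .
  qed
  finally show ?thesis .
qed

text \<open>
  Near-optimal window matchings pair interior points at bounded distance, so along a subsequence
  they converge to a global matching.
\<close>

lemma config_dist_le_of_wdist_le:
  assumes conf: "\<gamma> \<in> configs UNIV" "\<eta> \<in> configs UNIV" and C: "\<And>m. wdist m \<gamma> \<eta> \<le> C"
  shows "config_dist UNIV \<gamma> \<eta> \<le> ennreal C"
proof -
  have C0: "0 \<le> C" using C[of 0] wdist_nonneg[of 0 \<gamma> \<eta>] by linarith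
  obtain I :: "nat set" and x where x: "\<gamma> = csum I x" using config_csumE[OF conf(1)] by blast
  obtain J :: "nat set" and y where y: "\<eta> = csum J y" using config_csumE[OF conf(2)] by blast
  \<comment> \<open>Slack for the existence of near-optimal matchings. It vanishes along the
    sequence, and \<open>e m \<le> 1\<close> gives the displacement bound \<open>C + 1\<close>
    uniformly in the window.\<close>
  define e where "e m = 1 / real (Suc m)" for m
  have e: "0 < e m" "e m \<le> 1" for m by (auto simp: e_def)
  define P where "P m S \<longleftrightarrow> S \<subseteq> I \<times> J \<and> (\<forall>i j j'. (i, j) \<in> S \<longrightarrow> (i, j') \<in> S \<longrightarrow> j = j') \<and>
    (\<forall>i i' j. (i, j) \<in> S \<longrightarrow> (i', j) \<in> S \<longrightarrow> i = i') \<and>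
    (\<forall>T. finite T \<longrightarrow> T \<subseteq> S \<longrightarrow> (\<Sum>(i, j)\<in>T. (x i - y j)\<^sup>2) \<le> (C + e m)\<^sup>2) \<and>
    (\<forall>i\<in>I. \<bar>x i\<bar> + (C + 1) < real m \<longrightarrow> (\<exists>j. (i, j) \<in> S \<and> \<bar>x i - y j\<bar> \<le> C + 1)) \<and>
    (\<forall>j\<in>J. \<bar>y j\<bar> + (C + 1) < real m \<longrightarrow> (\<exists>i. (i, j) \<in> S \<and> \<bar>x i - y j\<bar> \<le> C + 1))" for m S
  have "\<exists>S. P m S" for m
  proof -
    have "wdist m \<gamma> \<eta> < C + e m" using C[of m] e(1)[of m] by linarith
    then obtain F :: "nat set" and a b where F: "window_matching m \<gamma> \<eta> F a b"
      and L: "L2_set (\<lambda>i. a i - b i) F < C + e m"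
      by (rule wdist_lessE[OF conf])
    let ?L = "L2_set (\<lambda>i. a i - b i) F"
    have L1: "?L < C + 1" using L e(2)[of m] by linarith
    have L2: "?L\<^sup>2 \<le> (C + e m)\<^sup>2" using L by (intro power_mono) auto
    obtain S where S: "S \<subseteq> {i \<in> I. x i \<in> owin m} \<times> {j \<in> J. y j \<in> owin m}"
      "\<And>i j j'. (i, j) \<in> S \<Longrightarrow> (i, j') \<in> S \<Longrightarrow> j = j'" "\<And>i i' j. (i, j) \<in> S \<Longrightarrow> (i', j) \<in> S \<Longrightarrow> i = i'"
      "\<And>T. finite T \<Longrightarrow> T \<subseteq> S \<Longrightarrow> (\<Sum>(i, j)\<in>T. (x i - y j)\<^sup>2) \<le> ?L\<^sup>2"
      "\<And>i. i \<in> I \<Longrightarrow> \<bar>x i\<bar> + ?L < m \<Longrightarrow> \<exists>j. (i, j) \<in> S \<and> \<bar>x i - y j\<bar> \<le> ?L"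
      "\<And>j. j \<in> J \<Longrightarrow> \<bar>y j\<bar> + ?L < m \<Longrightarrow> \<exists>i. (i, j) \<in> S \<and> \<bar>x i - y j\<bar> \<le> ?L"
      subgoal premises that by (rule window_pairing[OF F[unfolded x y]]) (rule that)
      done
    show ?thesis
      unfolding P_def
    proof (intro exI[of _ S] conjI allI impI ballI)
      show "S \<subseteq> I \<times> J" using S(1) by blast
      show "(\<Sum>(i, j)\<in>T. (x i - y j)\<^sup>2) \<le> (C + e m)\<^sup>2" if "finite T" "T \<subseteq> S" for T
        using S(4)[OF that] L2 by linarith
      show "\<exists>j. (i, j) \<in> S \<and> \<bar>x i - y j\<bar> \<le> C + 1" if i: "i \<in> I" "\<bar>x i\<bar> + (C + 1) < m" for i
      proof -
        have "\<bar>x i\<bar> + ?L < m" using i(2) L1 by linarith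
        from S(5)[OF i(1) this] show ?thesis using L1 by force
      qed
      show "\<exists>i. (i, j) \<in> S \<and> \<bar>x i - y j\<bar> \<le> C + 1" if j: "j \<in> J" "\<bar>y j\<bar> + (C + 1) < m" for j
      proof -
        have "\<bar>y j\<bar> + ?L < m" using j(2) L1 by linarith
        from S(6)[OF j(1) this] show ?thesis using L1 by force
      qed
    qed (use S(2,3) in blast)+
  qed
  then obtain S where "\<And>m. P m (S m)" by metis
  then have PS: "P m (S m)" for m by blast
  have S1: "S m \<subseteq> I \<times> J" for m using PS[of m] unfolding P_def by (elim conjE)
  have S2: "j = j'" if "(i, j) \<in> S m" "(i, j') \<in> S m" for m i j j'
  proof -
    have "\<forall>i j j'. (i, j) \<in> S m \<longrightarrow> (i, j') \<in> S m \<longrightarrow> j = j'"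
      using PS[of m] unfolding P_def by (elim conjE)
    then show ?thesis using that by blast
  qed
  have S3: "i = i'" if "(i, j) \<in> S m" "(i', j) \<in> S m" for m i i' j
  proof -
    have "\<forall>i i' j. (i, j) \<in> S m \<longrightarrow> (i', j) \<in> S m \<longrightarrow> i = i'"
      using PS[of m] unfolding P_def by (elim conjE)
    then show ?thesis using that by blast
  qed
  have S4: "(\<Sum>(i, j)\<in>T. (x i - y j)\<^sup>2) \<le> (C + e m)\<^sup>2" if "finite T" "T \<subseteq> S m" for m T
  proof -
    have "\<forall>T. finite T \<longrightarrow> T \<subseteq> S m \<longrightarrow> (\<Sum>(i, j)\<in>T. (x i - y j)\<^sup>2) \<le> (C + e m)\<^sup>2"
      using PS[of m] unfolding P_def by (elim conjE)
    then show ?thesis using that by blast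
  qed
  have S5: "\<exists>j. (i, j) \<in> S m \<and> \<bar>x i - y j\<bar> \<le> C + 1" if "i \<in> I" "\<bar>x i\<bar> + (C + 1) < real m" for m i
  proof -
    have "\<forall>i\<in>I. \<bar>x i\<bar> + (C + 1) < real m \<longrightarrow> (\<exists>j. (i, j) \<in> S m \<and> \<bar>x i - y j\<bar> \<le> C + 1)"
      using PS[of m] unfolding P_def by (elim conjE)
    then show ?thesis using that by blast
  qed
  have S6: "\<exists>i. (i, j) \<in> S m \<and> \<bar>x i - y j\<bar> \<le> C + 1" if "j \<in> J" "\<bar>y j\<bar> + (C + 1) < real m" for m j
  proof -
    have "\<forall>j\<in>J. \<bar>y j\<bar> + (C + 1) < real m \<longrightarrow> (\<exists>i. (i, j) \<in> S m \<and> \<bar>x i - y j\<bar> \<le> C + 1)"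
      using PS[of m] unfolding P_def by (elim conjE)
    then show ?thesis using that by blast
  qed
  obtain r l where r: "strict_mono (r :: nat \<Rightarrow> nat)"
    and l: "\<And>k. (\<lambda>n. of_bool (k \<in> S (r n)) :: real) \<longlonglongrightarrow> l k"
    using pointwise_convergent_subsequence[of "\<lambda>n k. of_bool (k \<in> S n)" "\<lambda>_. 1"] by auto
  \<comment> \<open>The limit matching consists of the pairs that belong to the matchings for all
    large indices of the subsequence.\<close>
  define R where "R = {k. l k = 1}"
  have ev: "\<forall>\<^sub>F n in sequentially. k \<in> S (r n) \<longleftrightarrow> k \<in> R" for k
    using indicator_limit[OF l[of k]] by (simp add: R_def)
  have ev_fin: "\<forall>\<^sub>F n in sequentially. \<forall>k\<in>T. k \<in> S (r n) \<longleftrightarrow> k \<in> R" if "finite T" for T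
    using that ev by (simp add: eventually_ball_finite)
  have ev_large: "\<forall>\<^sub>F n in sequentially. c < real (r n)" for c
  proof -
    have "filterlim (\<lambda>n. real (r n)) at_top sequentially"
      using filterlim_compose[OF filterlim_real_sequentially filterlim_subseq[OF r]] .
    then show ?thesis by (simp add: filterlim_at_top_dense)
  qed
  have R1: "R \<subseteq> I \<times> J"
  proof
    fix k assume "k \<in> R"
    have "\<forall>\<^sub>F n in sequentially. k \<in> I \<times> J"
      using ev[of k] by (rule eventually_mono) (use \<open>k \<in> R\<close> S1 in blast)
    then show "k \<in> I \<times> J" by simp
  qed
  have R2: "j = j'" if "(i, j) \<in> R" "(i, j') \<in> R" for i j j'
  proof -
    have "\<forall>\<^sub>F n in sequentially. j = j'"
      using ev[of "(i, j)"] ev[of "(i, j')"] by eventually_elim (use that S2 in blast)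
    then show ?thesis by simp
  qed
  have R3: "i = i'" if "(i, j) \<in> R" "(i', j) \<in> R" for i i' j
  proof -
    have "\<forall>\<^sub>F n in sequentially. i = i'"
      using ev[of "(i, j)"] ev[of "(i', j)"] by eventually_elim (use that S3 in blast)
    then show ?thesis by simp
  qed
  \<comment> \<open>Local finiteness leaves finitely many candidates within \<open>C + 1\<close> for
    the partner. Their memberships stabilise together, so the partner cannot change forever or
    escape to infinity.\<close>
  have R4: "\<exists>j. (i, j) \<in> R" if i: "i \<in> I" for i
  proof -
    let ?N = "{j \<in> J. y j \<in> {x i - (C + 1)..x i + (C + 1)}}"
    have "finite ?N" using conf(2) unfolding y by (rule config_finite_compact) auto
    then have "\<forall>\<^sub>F n in sequentially. \<forall>k\<in>Pair i ` ?N. k \<in> S (r n) \<longleftrightarrow> k \<in> R" by (intro ev_fin) simp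
    then have "\<forall>\<^sub>F n in sequentially. \<exists>j. (i, j) \<in> R"
      using ev_large[of "\<bar>x i\<bar> + (C + 1)"]
    proof eventually_elim
      case (elim n)
      obtain j where j: "(i, j) \<in> S (r n)" "\<bar>x i - y j\<bar> \<le> C + 1" using S5[OF i elim(2)] by blast
      moreover have "j \<in> J" using j(1) S1 by blast
      ultimately have "j \<in> ?N" by (auto simp: abs_le_iff)
      then show ?case using elim(1) j(1) by blast
    qed
    then show ?thesis by simp
  qed
  have R5: "\<exists>i. (i, j) \<in> R" if j: "j \<in> J" for j
  proof -
    let ?N = "{i \<in> I. x i \<in> {y j - (C + 1)..y j + (C + 1)}}"
    have "finite ?N" using conf(1) unfolding x by (rule config_finite_compact) auto
    then have "\<forall>\<^sub>F n in sequentially. \<forall>k\<in>(\<lambda>i. (i, j)) ` ?N. k \<in> S (r n) \<longleftrightarrow> k \<in> R" by (intro ev_fin) simp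
    then have "\<forall>\<^sub>F n in sequentially. \<exists>i. (i, j) \<in> R"
      using ev_large[of "\<bar>y j\<bar> + (C + 1)"]
    proof eventually_elim
      case (elim n)
      obtain i where i: "(i, j) \<in> S (r n)" "\<bar>x i - y j\<bar> \<le> C + 1" using S6[OF j elim(2)] by blast
      moreover have "i \<in> I" using i(1) S1 by blast
      ultimately have "i \<in> ?N" by (auto simp: abs_le_iff)
      then show ?case using elim(1) i(1) by blast
    qed
    then show ?thesis by simp
  qed
  \<comment> \<open>Finite partial costs pass to the limit, and bounds for all finite subsets bound
    the whole cost.\<close>
  have R6: "(\<Sum>(i, j)\<in>T. (x i - y j)\<^sup>2) \<le> C\<^sup>2" if T: "finite T" "T \<subseteq> R" for T
  proof (rule LIMSEQ_le_const)
    have "(\<lambda>n. e (r n)) \<longlonglongrightarrow> 0"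
      using LIMSEQ_subseq_LIMSEQ[OF LIMSEQ_inverse_real_of_nat r]
      by (simp add: e_def inverse_eq_divide comp_def)
    then have "(\<lambda>n. (C + e (r n))\<^sup>2) \<longlonglongrightarrow> (C + 0)\<^sup>2" by (intro tendsto_intros)
    then show "(\<lambda>n. (C + e (r n))\<^sup>2) \<longlonglongrightarrow> C\<^sup>2" by simp
    have "\<forall>\<^sub>F n in sequentially. (\<Sum>(i, j)\<in>T. (x i - y j)\<^sup>2) \<le> (C + e (r n))\<^sup>2"
      using ev_fin[OF T(1)] by eventually_elim (rule S4[OF T(1)], use T(2) in blast)
    then show "\<exists>N. \<forall>n\<ge>N. (\<Sum>(i, j)\<in>T. (x i - y j)\<^sup>2) \<le> (C + e (r n))\<^sup>2"
      by (simp add: eventually_sequentially)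
  qed
  have "bij_betw fst R I"
    unfolding bij_betw_def
  proof
    show "inj_on fst R" unfolding inj_on_def using R2 by (metis prod.collapse)
    show "fst ` R = I"
    proof
      show "fst ` R \<subseteq> I" using R1 by auto
      show "I \<subseteq> fst ` R" using R4 by (metis fst_conv imageI subsetI)
    qed
  qed
  then have xR: "csum R (\<lambda>k. x (fst k)) = \<gamma>" unfolding x by (rule csum_reindex) simp
  have "bij_betw snd R J"
    unfolding bij_betw_def
  proof
    show "inj_on snd R" unfolding inj_on_def using R3 by (metis prod.collapse)
    show "snd ` R = J"
    proof
      show "snd ` R \<subseteq> J" using R1 by auto
      show "J \<subseteq> snd ` R" using R5 by (metis snd_conv imageI subsetI)
    qed
  qed
  then have yR: "csum R (\<lambda>k. y (snd k)) = \<eta>" unfolding y by (rule csum_reindex) simp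
  have "config_dist UNIV (csum R (\<lambda>k. x (fst k))) (csum R (\<lambda>k. y (snd k)))
      \<le> ennreal_sqrt (\<integral>\<^sup>+ k. ennreal (\<bar>x (fst k) - y (snd k)\<bar>\<^sup>2) \<partial>count_space R)"
    by (rule config_dist_le) (use conf xR yR in auto)
  also have "(\<integral>\<^sup>+ k. ennreal (\<bar>x (fst k) - y (snd k)\<bar>\<^sup>2) \<partial>count_space R) \<le> ennreal (C\<^sup>2)"
    using R6 by (intro nn_integral_count_space_le) (auto simp: case_prod_beta)
  then have "ennreal_sqrt (\<integral>\<^sup>+ k. ennreal (\<bar>x (fst k) - y (snd k)\<bar>\<^sup>2) \<partial>count_space R) \<le> ennreal_sqrt (ennreal (C\<^sup>2))"
    by (rule ennreal_sqrt_mono)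
  also have "\<dots> = ennreal C" using C0 by (simp add: ennreal_sqrt_ennreal)
  finally show ?thesis unfolding xR yR .
qed

section \<open>Measurability on configuration spaces\<close>

text \<open>The common outcome of arguments by counting. It controls integrals of test functions and
  window distances alike.\<close>

definition near_on :: "real set \<Rightarrow> real \<Rightarrow> real measure \<Rightarrow> real measure \<Rightarrow> nat set \<Rightarrow> (nat \<Rightarrow> real) \<Rightarrow> (nat \<Rightarrow> real) \<Rightarrow> bool" where
  "near_on W \<delta> \<gamma> \<eta> F a b \<longleftrightarrow> finite F \<and> restrict_config W \<gamma> = csum F a \<and> restrict_config W \<eta> = csum F b \<and>
     (\<forall>i\<in>F. a i \<in> W \<and> b i \<in> W \<and> \<bar>a i - b i\<bar> < \<delta>)"

text \<open>The counts of the disjoint small sets \<open>T p\<close> add up to the count of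
  \<open>W\<close>, which leaves no point of \<open>W\<close> outside them. Equal counts then allow
  matching inside each \<open>T p\<close>, where displacements are below
  \<open>\<delta>\<close>.\<close>

lemma near_on_of_counts:
  assumes conf: "\<gamma> \<in> configs X" "\<eta> \<in> configs Y" and W: "W \<in> sets borel" "finite P"
    and T: "\<And>p. p \<in> P \<Longrightarrow> T p \<in> sets borel" "\<And>p. p \<in> P \<Longrightarrow> T p \<subseteq> W" "disjoint_family_on T P"
    and small: "\<And>p s t. p \<in> P \<Longrightarrow> s \<in> T p \<Longrightarrow> t \<in> T p \<Longrightarrow> \<bar>s - t\<bar> < \<delta>"
    and k: "\<And>p. p \<in> P \<Longrightarrow> emeasure \<gamma> (T p) = of_nat (k p)" "\<And>p. p \<in> P \<Longrightarrow> emeasure \<eta> (T p) = of_nat (k p)"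
      "emeasure \<gamma> W = of_nat (\<Sum>p\<in>P. k p)" "emeasure \<eta> W = of_nat (\<Sum>p\<in>P. k p)"
  shows "\<exists>F a b. near_on W \<delta> \<gamma> \<eta> F a b"
proof -
  obtain I :: "nat set" and x where x: "\<gamma> = csum I x" using config_csumE[OF conf(1)] by blast
  obtain J :: "nat set" and y where y: "\<eta> = csum J y" using config_csumE[OF conf(2)] by blast
  define \<kappa> where "\<kappa> t = (SOME p. p \<in> P \<and> t \<in> T p)" for t
  have \<kappa>: "\<kappa> t = p" if "p \<in> P" "t \<in> T p" for p t
  proof -
    have "\<kappa> t \<in> P \<and> t \<in> T (\<kappa> t)" unfolding \<kappa>_def by (rule someI[of _ p]) (use that in blast)
    then show ?thesis using that T(3) unfolding disjoint_family_on_def by blast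
  qed
  have main: "finite {i \<in> I. x i \<in> W} \<and> (\<forall>i\<in>I. x i \<in> W \<longrightarrow> (\<exists>p\<in>P. x i \<in> T p)) \<and>
      (\<forall>p\<in>P. {i \<in> {i \<in> I. x i \<in> W}. \<kappa> (x i) = p} = {i \<in> I. x i \<in> T p} \<and> card {i \<in> I. x i \<in> T p} = k p)"
    if c1: "\<And>p. p \<in> P \<Longrightarrow> emeasure (csum I x) (T p) = of_nat (k p)"
      and c2: "emeasure (csum I x) W = of_nat (\<Sum>p\<in>P. k p)" for I :: "nat set" and x
  proof -
    have nat_card: "finite S \<and> card S = m" if "emeasure (count_space UNIV) S = of_nat m" for S :: "nat set" and m
      using that by (cases "finite S") (auto simp: emeasure_count_space)
    have 1: "finite {i \<in> I. x i \<in> T p} \<and> card {i \<in> I. x i \<in> T p} = k p" if "p \<in> P" for p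
      by (rule nat_card) (use c1[OF that] T(1)[OF that] in \<open>simp add: emeasure_csum\<close>)
    have 2: "finite {i \<in> I. x i \<in> W} \<and> card {i \<in> I. x i \<in> W} = (\<Sum>p\<in>P. k p)"
      by (rule nat_card) (use c2 W in \<open>simp add: emeasure_csum\<close>)
    have "card (\<Union>p\<in>P. {i \<in> I. x i \<in> T p}) = (\<Sum>p\<in>P. card {i \<in> I. x i \<in> T p})"
      using W(2) 1 T(3) by (intro card_UN_disjoint) (auto simp: disjoint_family_on_def)
    also have "\<dots> = card {i \<in> I. x i \<in> W}" using 1 2 by simp
    finally have "(\<Union>p\<in>P. {i \<in> I. x i \<in> T p}) = {i \<in> I. x i \<in> W}"
      using 2 T(2) by (intro card_subset_eq) auto
    then have 3: "\<exists>p\<in>P. x i \<in> T p" if "i \<in> I" "x i \<in> W" for i using that by blast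
    have "{i \<in> {i \<in> I. x i \<in> W}. \<kappa> (x i) = p} = {i \<in> I. x i \<in> T p}" if "p \<in> P" for p
      using 3 \<kappa> T(2) that by blast
    then show ?thesis using 1 2 3 by blast
  qed
  note A = main[OF k(1,3)[unfolded x]] and B = main[OF k(2,4)[unfolded y]]
  let ?I = "{i \<in> I. x i \<in> W}" and ?J = "{j \<in> J. y j \<in> W}"
  have out: "{i \<in> ?I. \<kappa> (x i) = p} = {}" "{j \<in> ?J. \<kappa> (y j) = p} = {}" if "p \<notin> P" for p
    using A B \<kappa> that by blast+
  have card: "card {i \<in> ?I. \<kappa> (x i) = p} = card {j \<in> ?J. \<kappa> (y j) = p}" for p
  proof (cases "p \<in> P")
    case True
    have "{i \<in> ?I. \<kappa> (x i) = p} = {i \<in> I. x i \<in> T p}" "card {i \<in> I. x i \<in> T p} = k p"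
      "{j \<in> ?J. \<kappa> (y j) = p} = {j \<in> J. y j \<in> T p}" "card {j \<in> J. y j \<in> T p} = k p"
      using A B True by blast+
    then show ?thesis by (simp only:)
  next
    case False
    show ?thesis unfolding out[OF False] ..
  qed
  have fin: "finite ?I" "finite ?J" using A B by blast+
  have fib: "finite {i \<in> ?I. \<kappa> (x i) = p}" "finite {j \<in> ?J. \<kappa> (y j) = p}" for p
    by (rule finite_subset[OF _ fin(1)], blast) (rule finite_subset[OF _ fin(2)], blast)
  obtain h where h: "bij_betw h ?I ?J" "\<And>i. i \<in> ?I \<Longrightarrow> \<kappa> (y (h i)) = \<kappa> (x i)"
    by (rule exists_bij_fibers[OF fib card]) blast
  have "near_on W \<delta> \<gamma> \<eta> ?I x (\<lambda>i. y (h i))"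
    unfolding near_on_def
  proof (intro conjI ballI)
    show "finite ?I" using A by blast
    show "restrict_config W \<gamma> = csum ?I x" unfolding x using W(1) by (rule restrict_config_csum)
    show "restrict_config W \<eta> = csum ?I (\<lambda>i. y (h i))"
      unfolding y restrict_config_csum[OF W(1)] by (rule csum_reindex[OF h(1), symmetric]) simp
    fix i assume i: "i \<in> ?I"
    then have hi: "h i \<in> ?J" using bij_betwE[OF h(1)] by blast
    show "x i \<in> W" "y (h i) \<in> W" using i hi by auto
    obtain p where p: "p \<in> P" "x i \<in> T p" using A i by blast
    obtain q where q: "q \<in> P" "y (h i) \<in> T q" using B hi by blast
    have "q = p" using h(2)[OF i] \<kappa>[OF p] \<kappa>[OF q] by simp
    then show "\<bar>x i - y (h i)\<bar> < \<delta>" using small p q by blast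
  qed
  then show ?thesis by blast
qed

lemma finite_real_separated:
  fixes P :: "real set" assumes "finite P"
  obtains s where "s > 0" "\<And>p q. p \<in> P \<Longrightarrow> q \<in> P \<Longrightarrow> p \<noteq> q \<Longrightarrow> s \<le> \<bar>p - q\<bar>"
proof -
  let ?D = "insert 1 ((\<lambda>(p, q). \<bar>p - q\<bar>) ` {(p, q) \<in> P \<times> P. p \<noteq> q})"
  have "finite {(p, q) \<in> P \<times> P. p \<noteq> q}" by (rule finite_subset[of _ "P \<times> P"]) (use assms in auto)
  then have fin: "finite ?D" by (intro finite.insertI finite_imageI)
  show ?thesis
  proof
    show "Min ?D > 0" using fin by (subst Min_gr_iff) auto
    show "Min ?D \<le> \<bar>p - q\<bar>" if "p \<in> P" "q \<in> P" "p \<noteq> q" for p q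
      using fin that by (intro Min_le) auto
  qed
qed

type_synonym cell_code = "nat \<times> (rat \<times> rat \<times> nat) list"

text \<open>Rational end points and natural counts leave only countably many cells, which makes
  vague open sets countable unions. The condition on the total count forbids further points between
  the intervals.\<close>

definition cell :: "real set \<Rightarrow> cell_code \<Rightarrow> real measure set" where
  "cell X c = {\<eta> \<in> configs X.
     (\<forall>(q, r, k)\<in>set (snd c). emeasure \<eta> ({real_of_rat q<..<real_of_rat r} \<inter> (X \<inter> cwin (fst c))) = of_nat k) \<and>
     emeasure \<eta> (X \<inter> cwin (fst c)) = of_nat (\<Sum>(q, r, k)\<leftarrow>snd c. k)}"

lemma cell_neighbourhood:
  assumes X: "closed X" and \<gamma>: "\<gamma> \<in> configs X" and \<delta>: "\<delta> > 0"
  obtains L where "\<gamma> \<in> cell X (R, L)"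
    "\<And>\<eta>. \<eta> \<in> cell X (R, L) \<Longrightarrow> \<exists>F a b. near_on (X \<inter> cwin R) \<delta> \<gamma> \<eta> F a b"
proof -
  let ?W = "X \<inter> cwin R"
  have W: "?W \<in> sets borel" "compact ?W" using X by (auto intro: closed_Int_compact)
  obtain I :: "nat set" and x where x: "\<gamma> = csum I x" using config_csumE[OF \<gamma>] by blast
  let ?F = "{i \<in> I. x i \<in> ?W}"
  have F: "finite ?F" using \<gamma> W(2) unfolding x by (rule config_finite_compact) auto
  let ?P = "x ` ?F"
  have P: "finite ?P" using F by simp
  obtain s where s: "s > 0" "\<And>p q. p \<in> ?P \<Longrightarrow> q \<in> ?P \<Longrightarrow> p \<noteq> q \<Longrightarrow> s \<le> \<bar>p - q\<bar>"
    by (rule finite_real_separated[OF P]) blast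
  \<comment> \<open>Half of the least gap keeps the intervals about distinct points disjoint, and
    half of \<open>\<delta>\<close> makes any two points of one interval closer than
    \<open>\<delta>\<close>.\<close>
  define \<rho> where "\<rho> = min (\<delta> / 2) (s / 2)"
  have \<rho>: "\<rho> > 0" "2 * \<rho> \<le> \<delta>" "2 * \<rho> \<le> s" using s(1) \<delta> by (auto simp: \<rho>_def)
  have "\<exists>q. p - \<rho> < real_of_rat q \<and> real_of_rat q < p" "\<exists>r. p < real_of_rat r \<and> real_of_rat r < p + \<rho>" for p
    using of_rat_dense[of "p - \<rho>" p] of_rat_dense[of p "p + \<rho>"] \<rho>(1) by auto
  then obtain q r where q: "\<And>p. p - \<rho> < real_of_rat (q p)" "\<And>p. real_of_rat (q p) < p"
    and r: "\<And>p. p < real_of_rat (r p)" "\<And>p. real_of_rat (r p) < p + \<rho>" by metis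
  define T where "T p = {real_of_rat (q p)<..<real_of_rat (r p)} \<inter> ?W" for p
  define k where "k p = card {i \<in> ?F. x i = p}" for p
  obtain xs where xs: "set xs = ?P" "distinct xs" using finite_distinct_list[OF P] by blast
  let ?L = "map (\<lambda>p. (q p, r p, k p)) xs"
  have Tsub: "\<bar>t - p\<bar> < \<rho>" if "t \<in> T p" for t p
    using that q(1)[of p] r(2)[of p] by (auto simp: T_def abs_less_iff)
  have xT: "x i \<in> T p \<longleftrightarrow> x i = p" if "i \<in> ?F" "p \<in> ?P" for i p
  proof
    assume "x i \<in> T p"
    then have "\<bar>x i - p\<bar> < s" using Tsub[of "x i" p] \<rho> by linarith
    then show "x i = p" using s(2)[of "x i" p] that by force
  next
    assume "x i = p"
    then show "x i \<in> T p" using that q(2)[of p] r(1)[of p] by (auto simp: T_def)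
  qed
  have Tb: "T p \<in> sets borel" for p using W(1) by (simp add: T_def)
  have kT: "emeasure \<gamma> (T p) = of_nat (k p)" if p: "p \<in> ?P" for p
  proof -
    have "{i \<in> I. x i \<in> T p} = {i \<in> ?F. x i = p}"
      using xT[OF _ p] by (auto simp: T_def)
    then have "emeasure \<gamma> (T p) = emeasure (count_space UNIV) {i \<in> ?F. x i = p}"
      unfolding x using Tb by (simp add: emeasure_csum)
    also have "\<dots> = of_nat (k p)" unfolding k_def using F by (subst emeasure_count_space) (auto elim: rev_finite_subset)
    finally show ?thesis .
  qed
  have kW: "emeasure \<gamma> ?W = of_nat (\<Sum>p\<in>?P. k p)"
  proof -
    have "card ?F = (\<Sum>p\<in>?P. k p)"
      unfolding k_def using sum.image_gen[OF F, of "\<lambda>_. 1::nat" x] F by simp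
    moreover have "emeasure \<gamma> ?W = of_nat (card ?F)"
      unfolding x using W(1) F by (simp add: emeasure_csum emeasure_count_space)
    ultimately show ?thesis by simp
  qed
  have sumL: "(\<Sum>(q, r, k)\<leftarrow>?L. k) = (\<Sum>p\<in>?P. k p)"
    using xs by (simp add: comp_def sum_list_distinct_conv_sum_set)
  show ?thesis
  proof
    show "\<gamma> \<in> cell X (R, ?L)"
      using \<gamma> kT kW sumL xs(1) unfolding cell_def T_def by auto
    fix \<eta> assume "\<eta> \<in> cell X (R, ?L)"
    then have \<eta>: "\<eta> \<in> configs X" "emeasure \<eta> ?W = of_nat (\<Sum>p\<in>?P. k p)"
      and \<eta>T: "\<And>p. p \<in> ?P \<Longrightarrow> emeasure \<eta> (T p) = of_nat (k p)"
      using sumL xs(1) unfolding cell_def T_def by auto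
    show "\<exists>F a b. near_on ?W \<delta> \<gamma> \<eta> F a b"
    proof (rule near_on_of_counts[OF \<gamma> \<eta>(1) W(1) P Tb])
      show "T p \<subseteq> ?W" for p by (auto simp: T_def)
      show "disjoint_family_on T ?P"
        unfolding disjoint_family_on_def
      proof (intro ballI impI)
        fix p p' assume pp: "p \<in> ?P" "p' \<in> ?P" "p \<noteq> p'"
        show "T p \<inter> T p' = {}"
        proof (rule ccontr)
          assume "T p \<inter> T p' \<noteq> {}"
          then obtain t where "t \<in> T p" "t \<in> T p'" by blast
          then have "\<bar>p - p'\<bar> < s" using Tsub[of t p] Tsub[of t p'] \<rho> by linarith
          then show False using s(2)[OF pp] by linarith
        qed
      qed
      show "\<bar>u - t\<bar> < \<delta>" if "u \<in> T p" "t \<in> T p" for p u t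
        using Tsub[OF that(1)] Tsub[OF that(2)] \<rho> by linarith
    qed (use kT kW \<eta>T \<eta>(2) in auto)
  qed
qed

lemma integral_csum:
  fixes f :: "real \<Rightarrow> real"
  assumes f: "f \<in> borel_measurable borel" and F: "finite F" "F \<subseteq> I" "\<And>i. i \<in> I - F \<Longrightarrow> f (x i) = 0"
  shows "integral\<^sup>L (csum I x) f = (\<Sum>i\<in>F. f (x i))"
proof -
  have fin: "finite {i \<in> I. f (x i) \<noteq> 0}" using F by (auto intro: rev_finite_subset[OF F(1)])
  have "integral\<^sup>L (csum I x) f = (\<integral>i. f (x i) \<partial>count_space I)"
    unfolding csum_def using f by (subst integral_distr) auto
  also have "\<dots> = (\<Sum>i | i \<in> I \<and> f (x i) \<noteq> 0. f (x i))"
    using fin by (rule lebesgue_integral_count_space_finite_support)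
  also have "\<dots> = (\<Sum>i\<in>F. f (x i))"
    using F by (intro sum.mono_neutral_left) auto
  finally show ?thesis .
qed

lemma vague_test_measurable:
  assumes "f \<in> vague_test X" "closed X"
  shows "f \<in> borel_measurable borel"
proof -
  have "(\<lambda>t. indicator X t *\<^sub>R f t) \<in> borel_measurable borel"
    using assms by (intro borel_measurable_continuous_on_indicator) (auto simp: vague_test_def)
  also have "(\<lambda>t. indicator X t *\<^sub>R f t) = f"
    using assms by (force simp: vague_test_def fun_eq_iff)
  finally show ?thesis .
qed

lemma integral_near_on:
  assumes near: "near_on W \<delta> \<gamma> \<eta> F a b" and conf: "\<gamma> \<in> configs X" "\<eta> \<in> configs X"
    and f: "f \<in> borel_measurable borel" "\<And>t. t \<notin> W \<Longrightarrow> f t = (0::real)" and W: "W \<in> sets borel"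
  shows "integral\<^sup>L \<gamma> f = (\<Sum>i\<in>F. f (a i))" "integral\<^sup>L \<eta> f = (\<Sum>i\<in>F. f (b i))"
proof -
  have F: "finite F" using near by (simp add: near_on_def)
  have *: "integral\<^sup>L \<zeta> f = (\<Sum>i\<in>F. f (z i))" if z: "restrict_config W \<zeta> = csum F z" "\<zeta> \<in> configs X" for \<zeta> z
  proof -
    obtain I :: "nat set" and x where x: "\<zeta> = csum I x" using config_csumE[OF z(2)] by blast
    let ?I = "{i \<in> I. x i \<in> W}"
    have eq: "csum F z = csum ?I x" using z(1) W by (simp add: x restrict_config_csum)
    obtain h where h: "bij_betw h F ?I" using csum_eq_bij[OF F eq] by blast
    then have fin: "finite ?I" using F bij_betw_finite by blast
    have "integral\<^sup>L \<zeta> f = (\<Sum>i\<in>?I. f (x i))"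
      unfolding x using f fin by (intro integral_csum) auto
    also have "\<dots> = integral\<^sup>L (csum ?I x) f"
      using f fin by (intro integral_csum[symmetric]) auto
    also have "\<dots> = (\<Sum>i\<in>F. f (z i))"
      unfolding eq[symmetric] using f F by (intro integral_csum) auto
    finally show ?thesis .
  qed
  show "integral\<^sup>L \<gamma> f = (\<Sum>i\<in>F. f (a i))" "integral\<^sup>L \<eta> f = (\<Sum>i\<in>F. f (b i))"
    using near conf * by (auto simp: near_on_def)
qed

lemma topspace_vague_topology [simp]: "topspace (vague_topology X) = configs X"
proof -
  have "(\<lambda>_. 0) \<in> vague_test X" by (auto simp: vague_test_def intro!: exI[of _ "{}"])
  then have "configs X \<in> {{\<gamma> \<in> configs X. integral\<^sup>L \<gamma> f \<in> V} |f V. f \<in> vague_test X \<and> open V}"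
    by (intro CollectI exI[of _ "\<lambda>_. 0"] exI[of _ UNIV]) auto
  then show ?thesis
    unfolding vague_topology_def topology_generated_by_topspace by blast
qed

text \<open>Uniform continuity on the compact window turns displacements below
  \<open>\<delta>\<close> into changes of the summands by at most
  \<open>\<epsilon> / (N + 1)\<close>, and there are exactly \<open>N\<close> summands. The
  \<open>+ 1\<close> gives strictness and covers \<open>N = 0\<close>.\<close>

lemma vague_subbasic_cell:
  assumes X: "closed X" and f: "f \<in> vague_test X" and V: "open V"
    and \<gamma>: "\<gamma> \<in> configs X" "integral\<^sup>L \<gamma> f \<in> V"
  shows "\<exists>c. \<gamma> \<in> cell X c \<and> cell X c \<subseteq> {\<eta> \<in> configs X. integral\<^sup>L \<eta> f \<in> V}"
proof -
  obtain K where K: "compact K" "K \<subseteq> X" "\<And>t. t \<notin> K \<Longrightarrow> f t = 0" and fc: "continuous_on X f"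
    using f by (auto simp: vague_test_def)
  obtain B where "\<And>t. t \<in> K \<Longrightarrow> \<bar>t\<bar> \<le> B"
    using compact_imp_bounded[OF K(1)] by (auto simp: bounded_real)
  moreover obtain R :: nat where "B \<le> real R" using real_arch_simple by blast
  ultimately have KR: "K \<subseteq> cwin R" by (force simp: abs_le_iff)
  let ?W = "X \<inter> cwin R"
  have W: "?W \<in> sets borel" "compact ?W" using X by (auto intro: closed_Int_compact)
  have f0: "f t = 0" if "t \<notin> ?W" for t using that K(2,3) KR by blast
  obtain \<epsilon> where \<epsilon>: "\<epsilon> > 0" "\<And>u. \<bar>u - integral\<^sup>L \<gamma> f\<bar> < \<epsilon> \<Longrightarrow> u \<in> V"
    using V \<gamma>(2) unfolding open_dist dist_real_def by meson
  have fin: "emeasure \<gamma> ?W < \<infinity>" using \<gamma>(1) W(2) by (auto simp: configs_def)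
  define N where "N = enn2real (emeasure \<gamma> ?W)"
  have N: "emeasure \<gamma> ?W = ennreal N" "N \<ge> 0" using fin by (auto simp: N_def)
  have "uniformly_continuous_on ?W f"
    using W(2) continuous_on_subset[OF fc] by (intro compact_uniformly_continuous) auto
  moreover have "\<epsilon> / (N + 1) > 0" using \<epsilon> N by simp
  ultimately obtain \<delta> where \<delta>: "\<delta> > 0"
    and uc: "\<And>s t. s \<in> ?W \<Longrightarrow> t \<in> ?W \<Longrightarrow> \<bar>s - t\<bar> < \<delta> \<Longrightarrow> \<bar>f s - f t\<bar> < \<epsilon> / (N + 1)"
    unfolding uniformly_continuous_on_def dist_real_def by metis
  obtain L where L: "\<gamma> \<in> cell X (R, L)"
    "\<And>\<eta>. \<eta> \<in> cell X (R, L) \<Longrightarrow> \<exists>F a b. near_on ?W \<delta> \<gamma> \<eta> F a b"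
    using cell_neighbourhood[OF X \<gamma>(1) \<delta>, of R] by blast
  have "integral\<^sup>L \<eta> f \<in> V" if \<eta>: "\<eta> \<in> cell X (R, L)" for \<eta>
  proof -
    obtain F a b where near: "near_on ?W \<delta> \<gamma> \<eta> F a b" using L(2)[OF \<eta>] by blast
    have \<eta>c: "\<eta> \<in> configs X" using \<eta> by (simp add: cell_def)
    have F: "finite F" using near by (simp add: near_on_def)
    have fm: "f \<in> borel_measurable borel" using f X by (rule vague_test_measurable)
    have I: "integral\<^sup>L \<gamma> f = (\<Sum>i\<in>F. f (a i))" "integral\<^sup>L \<eta> f = (\<Sum>i\<in>F. f (b i))"
      by (rule integral_near_on[OF near \<gamma>(1) \<eta>c fm f0 W(1)]; simp)+
    have "real (card F) = N"
    proof -
      have "emeasure (restrict_config ?W \<gamma>) UNIV = emeasure (csum F a) UNIV"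
        using near by (simp add: near_on_def)
      then have "emeasure \<gamma> ?W = of_nat (card F)"
        using W(1) \<gamma>(1) F by (simp add: emeasure_restrict_config emeasure_csum emeasure_count_space)
      then show ?thesis using N by (simp add: ennreal_of_nat_eq_real_of_nat)
    qed
    have "\<bar>integral\<^sup>L \<eta> f - integral\<^sup>L \<gamma> f\<bar> = \<bar>\<Sum>i\<in>F. f (b i) - f (a i)\<bar>"
      unfolding I by (simp add: sum_subtractf)
    also have "\<dots> \<le> (\<Sum>i\<in>F. \<bar>f (b i) - f (a i)\<bar>)" by (rule sum_abs)
    also have "\<dots> \<le> (\<Sum>i\<in>F. \<epsilon> / (N + 1))"
    proof (rule sum_mono)
      fix i assume "i \<in> F"
      then have "\<bar>f (a i) - f (b i)\<bar> < \<epsilon> / (N + 1)"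
        using near by (intro uc) (auto simp: near_on_def)
      then show "\<bar>f (b i) - f (a i)\<bar> \<le> \<epsilon> / (N + 1)" by (simp add: abs_minus_commute)
    qed
    also have "\<dots> = N * (\<epsilon> / (N + 1))" using \<open>real (card F) = N\<close> by simp
    also have "\<dots> < \<epsilon>" using N \<epsilon> by (simp add: field_simps)
    finally show ?thesis by (rule \<epsilon>(2))
  qed
  then show ?thesis using L(1) by (intro exI[of _ "(R, L)"]) (auto simp: cell_def)
qed

text \<open>The explicit membership in \<open>configs X\<close> gives the empty family its value,
  the whole space.\<close>

definition cells :: "real set \<Rightarrow> cell_code set \<Rightarrow> real measure set" where
  "cells X S = {\<eta> \<in> configs X. \<forall>c\<in>S. \<eta> \<in> cell X c}"

lemma vague_open_cells:
  assumes X: "closed X" and U: "openin (vague_topology X) U" and "\<gamma> \<in> U"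
  shows "\<exists>S. finite S \<and> \<gamma> \<in> cells X S \<and> cells X S \<subseteq> U"
proof -
  have "generate_topology_on {{\<gamma> \<in> configs X. integral\<^sup>L \<gamma> f \<in> V} |f V. f \<in> vague_test X \<and> open V} U"
    using U unfolding vague_topology_def openin_topology_generated_by_iff .
  then show ?thesis using \<open>\<gamma> \<in> U\<close>
  proof (induction arbitrary: \<gamma>)
    case (Int A B)
    obtain S where S: "finite S" "\<gamma> \<in> cells X S" "cells X S \<subseteq> A" using Int.IH(1) Int.prems by blast
    obtain S' where S': "finite S'" "\<gamma> \<in> cells X S'" "cells X S' \<subseteq> B" using Int.IH(2) Int.prems by blast
    have "cells X (S \<union> S') = cells X S \<inter> cells X S'" unfolding cells_def by blast
    then show ?case using S S' by (intro exI[of _ "S \<union> S'"]) auto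
  next
    case (UN \<K>)
    then show ?case by (meson Sup_upper UnionE subset_trans)
  next
    case (Basis B)
    then obtain f V where "f \<in> vague_test X" "open V" "B = {\<gamma> \<in> configs X. integral\<^sup>L \<gamma> f \<in> V}"
      by blast
    then obtain c where "\<gamma> \<in> cell X c" "cell X c \<subseteq> B"
      using vague_subbasic_cell[OF X, of f V \<gamma>] \<open>\<gamma> \<in> B\<close> by blast
    moreover have "cells X {c} = cell X c" unfolding cells_def cell_def by auto
    ultimately show ?case by (intro exI[of _ "{c}"]) auto
  qed simp
qed

text \<open>There are only countably many finite sets of cell codes, so \<open>U\<close> is a
  countable union no matter how many points it has. It serves for vague open sets and for preimages
  of open sets of the window spaces.\<close>

lemma countable_union_of_cells_measurable:
  assumes sp: "space N = configs X" and cell: "\<And>c. cell X c \<in> sets N"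
    and U: "\<And>\<gamma>. \<gamma> \<in> U \<Longrightarrow> \<exists>S. finite S \<and> \<gamma> \<in> cells X S \<and> cells X S \<subseteq> U"
  shows "U \<in> sets N"
proof -
  have "U = (\<Union>S\<in>{S. finite S \<and> cells X S \<subseteq> U}. cells X S)"
    using U by blast
  also have "\<dots> \<in> sets N"
  proof (rule sets.countable_UN'')
    show "countable {S. finite S \<and> cells X S \<subseteq> U}"
      by (rule countable_subset[OF _ countable_Collect_finite]) auto
    show "cells X S \<in> sets N" if "S \<in> {S. finite S \<and> cells X S \<subseteq> U}" for S
    proof -
      have "finite S" using that by simp
      have "cells X S = (if S = {} then space N else (\<Inter>c\<in>S. cell X c))"
        unfolding cells_def sp by (auto simp: cell_def)
      then show ?thesis using \<open>finite S\<close> cell by auto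
    qed
  qed
  finally show ?thesis .
qed

lemma config_count_cases:
  assumes "\<gamma> \<in> configs X" "A \<in> sets borel"
  shows "emeasure \<gamma> A = \<infinity> \<or> (\<exists>n::nat. emeasure \<gamma> A = of_nat n)"
proof -
  obtain I :: "nat set" and x where x: "\<gamma> = csum I x" using config_csumE[OF assms(1)] by blast
  show ?thesis unfolding x using assms(2) by (simp add: emeasure_csum emeasure_count_space)
qed

text \<open>Counts are natural numbers or infinite: if all stages stayed below \<open>k\<close>,
  they would be at most \<open>k - 1\<close>, and so would their supremum.\<close>

lemma config_count_ge_sup:
  assumes \<gamma>: "\<gamma> \<in> configs X" and A: "\<And>j. A j \<in> sets borel" "incseq A"
  shows "of_nat k \<le> emeasure \<gamma> (\<Union>j. A j) \<longleftrightarrow> (\<exists>j. of_nat k \<le> emeasure \<gamma> (A j))"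
proof
  assume "\<exists>j. of_nat k \<le> emeasure \<gamma> (A j)"
  then obtain j where j: "of_nat k \<le> emeasure \<gamma> (A j)" ..
  have "emeasure \<gamma> (A j) \<le> emeasure \<gamma> (\<Union>j. A j)"
    using A \<gamma> by (intro emeasure_mono) auto
  with j show "of_nat k \<le> emeasure \<gamma> (\<Union>j. A j)" by order
next
  assume k: "of_nat k \<le> emeasure \<gamma> (\<Union>j. A j)"
  show "\<exists>j. of_nat k \<le> emeasure \<gamma> (A j)"
  proof (cases k)
    case (Suc m)
    show ?thesis
    proof (rule ccontr)
      assume none: "\<not> ?thesis"
      have "emeasure \<gamma> (A j) \<le> of_nat m" for j
      proof -
        have "emeasure \<gamma> (A j) < of_nat k" using none by (simp add: not_le)
        then show ?thesis
          using config_count_cases[OF \<gamma> A(1)[of j]] Suc by (auto simp del: of_nat_Suc)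
      qed
      then have "(SUP j. emeasure \<gamma> (A j)) \<le> of_nat m" by (rule SUP_least)
      moreover have "(SUP j. emeasure \<gamma> (A j)) = emeasure \<gamma> (\<Union>j. A j)"
        using A \<gamma> by (intro SUP_emeasure_incseq) auto
      ultimately have "(of_nat k :: ennreal) \<le> of_nat m" using k by order
      then show False using Suc by (simp del: of_nat_Suc)
    qed
  qed simp
qed

text \<open>Reduces counts on open intervals to counts on closed ones, on which all measurability
  statements are based.\<close>

lemma open_interval_Int_cwin:
  "{q<..<r} \<inter> cwin R = (\<Union>j. {max (q + 1 / real (Suc j)) (- real R)..min (r - 1 / real (Suc j)) (real R)})"
    (is "_ = (\<Union>j. ?A j)")
  and open_interval_Int_cwin_incseq:
  "incseq (\<lambda>j. {max (q + 1 / real (Suc j)) (- real R)..min (r - 1 / real (Suc j)) (real R)})"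
proof -
  have dec: "1 / real (Suc n) \<le> 1 / real (Suc m)" if "m \<le> n" for m n
    using that by (intro divide_left_mono) auto
  show "incseq ?A"
  proof (rule monoI)
    fix m n :: nat assume "m \<le> n"
    then show "?A m \<le> ?A n"
      using dec[of m n] by (intro atLeastatMost_subset_iff[THEN iffD2] disjI2) (auto simp del: of_nat_Suc)
  qed
  show "{q<..<r} \<inter> cwin R = (\<Union>j. ?A j)"
  proof
    show "(\<Union>j. ?A j) \<subseteq> {q<..<r} \<inter> cwin R"
    proof
      fix t assume "t \<in> (\<Union>j. ?A j)"
      then obtain j where "t \<in> ?A j" by blast
      moreover define e where "e = 1 / real (Suc j)"
      ultimately have "q + e \<le> t" "t \<le> r - e" "t \<in> cwin R" by auto
      moreover have "0 < e" by (simp add: e_def)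
      ultimately show "t \<in> {q<..<r} \<inter> cwin R" by auto
    qed
    show "{q<..<r} \<inter> cwin R \<subseteq> (\<Union>j. ?A j)"
    proof
      fix t assume t: "t \<in> {q<..<r} \<inter> cwin R"
      then have "min (t - q) (r - t) > 0" by auto
      then obtain j where "1 / real (Suc j) < min (t - q) (r - t)" by (metis nat_approx_posE)
      then have "t \<in> ?A j" using t by (auto simp del: of_nat_Suc)
      then show "t \<in> (\<Union>j. ?A j)" by blast
    qed
  qed
qed

text \<open>The line and the closed windows are treated together; in both cases intersecting with a
  closed window yields a closed window.\<close>

definition admissible_window :: "real set \<Rightarrow> bool" where
  "admissible_window X \<longleftrightarrow> X = UNIV \<or> (\<exists>n. X = cwin n)"

lemma admissible_windowI [simp]: "admissible_window UNIV" "admissible_window (cwin n)"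
  by (auto simp: admissible_window_def)

lemma admissible_window_closed: "admissible_window X \<Longrightarrow> closed X"
  by (auto simp: admissible_window_def)

lemma admissible_window_Int:
  assumes "admissible_window X" obtains R' where "X \<inter> cwin R = cwin R'"
proof -
  from assms consider "X = UNIV" | n where "X = cwin n" by (auto simp: admissible_window_def)
  then show ?thesis
  proof cases
    case 1 then show ?thesis using that[of R] by simp
  next
    case 2
    then show ?thesis using that[of "min n R"] by (auto simp: min_def)
  qed
qed

text \<open>A count equals \<open>k\<close> iff it is at least \<open>k\<close> but not at least
  \<open>Suc k\<close>. The sigma-algebra \<open>N\<close> is arbitrary, so that the lemma serves
  the vague Borel sets as well as sigma-algebras given by counts.\<close>

lemma cell_measurable:
  assumes X: "admissible_window X" and sp: "space N = configs X"
    and cnt: "\<And>a b k. {\<gamma> \<in> configs X. of_nat k \<le> emeasure \<gamma> {a..b}} \<in> sets N"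
  shows "cell X c \<in> sets N"
proof -
  obtain R' where R': "X \<inter> cwin (fst c) = cwin R'" using admissible_window_Int[OF X] by blast
  have eq: "{\<gamma> \<in> configs X. emeasure \<gamma> T = of_nat k} \<in> sets N"
    if "\<And>k. {\<gamma> \<in> configs X. of_nat k \<le> emeasure \<gamma> T} \<in> sets N" "T \<in> sets borel" for T k
  proof -
    have "emeasure \<gamma> T = of_nat k \<longleftrightarrow> of_nat k \<le> emeasure \<gamma> T \<and> \<not> of_nat (Suc k) \<le> emeasure \<gamma> T"
      if "\<gamma> \<in> configs X" for \<gamma>
      using config_count_cases[OF that \<open>T \<in> sets borel\<close>] by (auto simp del: of_nat_Suc)
    then have "{\<gamma> \<in> configs X. emeasure \<gamma> T = of_nat k} =
        {\<gamma> \<in> configs X. of_nat k \<le> emeasure \<gamma> T} - {\<gamma> \<in> configs X. of_nat (Suc k) \<le> emeasure \<gamma> T}"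
      by blast
    then show ?thesis by (simp only:) (intro sets.Diff that(1))
  qed
  have ge: "{\<gamma> \<in> configs X. of_nat k \<le> emeasure \<gamma> ({q<..<r} \<inter> cwin R')} \<in> sets N" for q r k
  proof -
    let ?A = "\<lambda>j. {max (q + 1 / real (Suc j)) (- real R')..min (r - 1 / real (Suc j)) (real R')}"
    have "of_nat k \<le> emeasure \<gamma> ({q<..<r} \<inter> cwin R') \<longleftrightarrow> (\<exists>j. of_nat k \<le> emeasure \<gamma> (?A j))"
      if "\<gamma> \<in> configs X" for \<gamma>
      unfolding open_interval_Int_cwin
      by (rule config_count_ge_sup[OF that _ open_interval_Int_cwin_incseq]) simp
    then have "{\<gamma> \<in> configs X. of_nat k \<le> emeasure \<gamma> ({q<..<r} \<inter> cwin R')} =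
        (\<Union>j. {\<gamma> \<in> configs X. of_nat k \<le> emeasure \<gamma> (?A j)})"
      by blast
    also have "\<dots> \<in> sets N" using cnt by (intro sets.countable_UN) blast
    finally show ?thesis .
  qed
  have "cell X c = {\<eta> \<in> configs X. emeasure \<eta> (cwin R') = of_nat (\<Sum>(q, r, k)\<leftarrow>snd c. k)} \<inter>
      (\<Inter>z\<in>set (snd c). {\<eta> \<in> configs X.
        emeasure \<eta> ({real_of_rat (fst z)<..<real_of_rat (fst (snd z))} \<inter> cwin R') = of_nat (snd (snd z))})"
    unfolding cell_def R' by (auto simp: case_prod_beta)
  also have "\<dots> \<in> sets N"
  proof -
    have 1: "{\<eta> \<in> configs X. emeasure \<eta> (cwin R') = of_nat k} \<in> sets N" for k
      by (rule eq[OF cnt]) simp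
    have 2: "{\<eta> \<in> configs X. emeasure \<eta> ({q<..<r} \<inter> cwin R') = of_nat k} \<in> sets N" for q r k
      by (rule eq[OF ge]) simp
    show ?thesis
    proof (cases "snd c = []")
      case True
      then show ?thesis using 1[of 0] by simp
    next
      case False
      then show ?thesis by (intro sets.Int sets.finite_INT 1 2) simp_all
    qed
  qed
  finally show ?thesis .
qed

text \<open>For \<open>m \<ge> 1\<close> a trapezoid: 1 on \<open>{a..b}\<close>, with slopes
  \<open>m\<close> and support within distance \<open>1 / m\<close>. It is a continuous majorant of
  the indicator.\<close>

definition bump :: "nat \<Rightarrow> real \<Rightarrow> real \<Rightarrow> real \<Rightarrow> real" where
  "bump m a b t = max 0 (1 - real m * max 0 (max (a - t) (t - b)))"

lemma bump: "0 \<le> bump m a b t" "t \<in> {a..b} \<Longrightarrow> bump m a b t = 1"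
  "m \<ge> 1 \<Longrightarrow> t \<notin> {a - 1..b + 1} \<Longrightarrow> bump m a b t = 0"
  "real m * max (a - t) (t - b) \<ge> 1 \<Longrightarrow> bump m a b t = 0"
proof -
  show "0 \<le> bump m a b t" "t \<in> {a..b} \<Longrightarrow> bump m a b t = 1"
    by (auto simp: bump_def max_def)
  show *: "bump m a b t = 0" if "real m * max (a - t) (t - b) \<ge> 1" for m t
  proof -
    have "max (a - t) (t - b) > 0"
      using that by (smt (verit) mult_nonneg_nonpos of_nat_0_le_iff)
    then show ?thesis using that by (simp add: bump_def max_def split: if_splits)
  qed
  show "bump m a b t = 0" if "m \<ge> 1" "t \<notin> {a - 1..b + 1}"
  proof (rule *)
    have "max (a - t) (t - b) \<ge> 1" using that(2) by auto
    then show "1 \<le> real m * max (a - t) (t - b)" using that(1) mult_mono[of 1 "real m" 1 "max (a - t) (t - b)"] by simp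
  qed
qed

text \<open>The count on \<open>{a..b}\<close> is the minimum over m of the integrals of the bumps.
  As it is an integer, it falls below \<open>k\<close> iff some of these integrals falls below
  \<open>k - 1/2\<close>, which is a vaguely open condition.\<close>

lemma vague_count_measurable:
  assumes X: "closed X"
  shows "{\<gamma> \<in> configs X. of_nat k \<le> emeasure \<gamma> {a..b}} \<in> sets (borel_on (vague_topology X))"
proof -
  let ?N = "borel_on (vague_topology X)"
  let ?f = "\<lambda>m t. indicator X t * bump (Suc m) a b t"
  have test: "?f m \<in> vague_test X" for m
    unfolding vague_test_def
  proof (intro CollectI conjI exI[of _ "X \<inter> {a - 1..b + 1}"])
    have "continuous_on X (bump (Suc m) a b)" unfolding bump_def by (intro continuous_intros)
    then show "continuous_on X (?f m)" by (rule continuous_on_eq) simp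
    show "compact (X \<inter> {a - 1..b + 1})" using X by (intro closed_Int_compact) auto
    show "\<forall>t. t \<notin> X \<inter> {a - 1..b + 1} \<longrightarrow> ?f m t = 0" using bump(3)[of "Suc m" _ a b] by (auto simp: indicator_def)
  qed auto
  have sp: "space ?N = configs X" using space_borel_on by simp
  have iff: "of_nat k \<le> emeasure \<gamma> {a..b} \<longleftrightarrow> \<not> (\<exists>m. integral\<^sup>L \<gamma> (?f m) < real k - 1/2)"
    if \<gamma>: "\<gamma> \<in> configs X" for \<gamma>
  proof -
    obtain I :: "nat set" and x where xX: "\<And>i. i \<in> I \<Longrightarrow> x i \<in> X" and x: "\<gamma> = csum I x"
      using config_csumE[OF \<gamma>] by blast
    let ?F = "{i \<in> I. x i \<in> X \<inter> {a - 1..b + 1}}"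
    let ?K = "{i \<in> I. x i \<in> {a..b}}"
    have F: "finite ?F"
      using \<gamma> unfolding x by (rule config_finite_compact) (use X in \<open>auto intro: closed_Int_compact\<close>)
    have KF: "?K \<subseteq> ?F" using xX by auto
    then have K: "finite ?K" using F by (rule finite_subset)
    have cK: "emeasure \<gamma> {a..b} = of_nat (card ?K)"
      unfolding x using K by (simp add: emeasure_csum emeasure_count_space)
    have int: "integral\<^sup>L \<gamma> (?f m) = (\<Sum>i\<in>?F. bump (Suc m) a b (x i))" for m
    proof -
      have "integral\<^sup>L \<gamma> (?f m) = (\<Sum>i\<in>?F. ?f m (x i))"
        unfolding x
      proof (rule integral_csum[OF vague_test_measurable[OF test X] F])
        show "?f m (x i) = 0" if "i \<in> I - ?F" for i
          using that bump(3)[of "Suc m" "x i" a b] by (auto simp: indicator_def)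
      qed auto
      also have "\<dots> = (\<Sum>i\<in>?F. bump (Suc m) a b (x i))"
        by (intro sum.cong) auto
      finally show ?thesis .
    qed
    have ge: "real (card ?K) \<le> integral\<^sup>L \<gamma> (?f m)" for m
    proof -
      have "real (card ?K) = (\<Sum>i\<in>?K. bump (Suc m) a b (x i))"
        using bump(2)[of _ a b "Suc m"] by simp
      also have "\<dots> \<le> (\<Sum>i\<in>?F. bump (Suc m) a b (x i))"
        using F KF by (intro sum_mono2) (auto simp: bump(1))
      finally show ?thesis using int by simp
    qed
    \<comment> \<open>The minimum is attained: only finitely many points lie near
      \<open>{a..b}\<close> without belonging to it, and a steep bump misses them all.\<close>
    have "\<exists>m. integral\<^sup>L \<gamma> (?f m) = real (card ?K)"
    proof -
      let ?g = "\<lambda>i. max (a - x i) (x i - b)"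
      have fin: "finite (insert 1 (?g ` (?F - ?K)))" using F by simp
      have "Min (insert 1 (?g ` (?F - ?K))) > 0"
        by (subst Min_gr_iff[OF fin]) auto
      then obtain m where m: "1 / real (Suc m) < Min (insert 1 (?g ` (?F - ?K)))" by (rule nat_approx_posE)
      have "bump (Suc m) a b (x i) = 0" if "i \<in> ?F - ?K" for i
      proof (rule bump(4))
        have "1 / real (Suc m) < ?g i"
        proof -
          have "?g i \<in> insert 1 (?g ` (?F - ?K))" using that by blast
          from Min_le[OF fin this] m show ?thesis by linarith
        qed
        then have "1 < ?g i * real (Suc m)" by (subst (asm) pos_divide_less_eq) simp_all
        then show "1 \<le> real (Suc m) * ?g i" by (simp add: mult.commute del: of_nat_Suc)
      qed
      then have "(\<Sum>i\<in>?F. bump (Suc m) a b (x i)) = (\<Sum>i\<in>?K. bump (Suc m) a b (x i))"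
        using F KF by (intro sum.mono_neutral_right) auto
      also have "\<dots> = real (card ?K)" using bump(2)[of _ a b "Suc m"] by simp
      finally show ?thesis using int[of m] by (intro exI[of _ m]) simp
    qed
    then obtain m where m: "integral\<^sup>L \<gamma> (?f m) = real (card ?K)" ..
    show ?thesis
    proof
      assume "of_nat k \<le> emeasure \<gamma> {a..b}"
      then have "k \<le> card ?K" unfolding cK by simp
      then show "\<not> (\<exists>m. integral\<^sup>L \<gamma> (?f m) < real k - 1/2)"
        using ge by (smt (verit) of_nat_mono field_sum_of_halves)
    next
      assume "\<not> (\<exists>m. integral\<^sup>L \<gamma> (?f m) < real k - 1/2)"
      then have "real k - 1/2 \<le> real (card ?K)" using m by (metis not_less)
      then have "k \<le> card ?K" by linarith
      then show "of_nat k \<le> emeasure \<gamma> {a..b}" unfolding cK by simp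
    qed
  qed
  have "{\<gamma> \<in> configs X. integral\<^sup>L \<gamma> (?f m) \<in> {..<real k - 1/2}} \<in> sets ?N" for m
    unfolding vague_topology_def
    by (intro openin_in_sets_borel_on topology_generated_by_Basis)
      (use test in \<open>auto intro!: exI[of _ "?f m"] exI[of _ "{..<real k - 1/2}"]\<close>)
  then have "space ?N - (\<Union>m. {\<gamma> \<in> configs X. integral\<^sup>L \<gamma> (?f m) \<in> {..<real k - 1/2}}) \<in> sets ?N"
    by (intro sets.Diff sets.top sets.countable_UN) blast
  also have "space ?N - (\<Union>m. {\<gamma> \<in> configs X. integral\<^sup>L \<gamma> (?f m) \<in> {..<real k - 1/2}}) =
      {\<gamma> \<in> configs X. of_nat k \<le> emeasure \<gamma> {a..b}}"
    unfolding sp using iff by auto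
  finally show ?thesis .
qed

text \<open>The counts on closed intervals generate the vague Borel sets. Measurability of
  restrictions and inner regularity thus need checking for these counts only.\<close>

lemma vague_borel_subset:
  assumes X: "admissible_window X" and sp: "space N = configs X"
    and cnt: "\<And>a b k. {\<gamma> \<in> configs X. of_nat k \<le> emeasure \<gamma> {a..b}} \<in> sets N"
  shows "sets (borel_on (vague_topology X)) \<subseteq> sets N"
proof -
  have "U \<in> sets N" if U: "openin (vague_topology X) U" for U
    using X by (intro countable_union_of_cells_measurable[OF sp cell_measurable[OF X sp cnt]]
      vague_open_cells[OF admissible_window_closed U])
  then have "sigma_sets (space N) {U. openin (vague_topology X) U} \<subseteq> sets N"
    by (intro sets.sigma_sets_subset) blast
  then show ?thesis by (simp add: sets_borel_on sp)
qed

lemma configs_cwin_subset: "configs (cwin n) \<subseteq> configs UNIV"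
proof
  fix \<gamma> assume g: "\<gamma> \<in> configs (cwin n)"
  then obtain I :: "nat set" and x where x: "\<And>i. i \<in> I \<Longrightarrow> x i \<in> cwin n" "\<gamma> = csum I x"
    using config_csumE by blast
  have "finite {i \<in> I. x i \<in> cwin n}"
    using g unfolding x(2) by (rule config_finite_compact) auto
  moreover have "{i \<in> I. x i \<in> cwin n} = I" using x(1) by blast
  ultimately show "\<gamma> \<in> configs UNIV"
    unfolding x(2) by (intro csum_config_finite) auto
qed

lemma restrict_config_in_configs:
  assumes "\<gamma> \<in> configs UNIV"
  shows "restrict_config (cwin n) \<gamma> \<in> configs (cwin n)"
proof -
  obtain I :: "nat set" and x where x: "\<gamma> = csum I x" using config_csumE[OF assms] by blast
  have fin: "finite {i \<in> I. x i \<in> cwin n}"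
    using assms unfolding x by (rule config_finite_compact) auto
  have "restrict_config (cwin n) \<gamma> = csum {i \<in> I. x i \<in> cwin n} x"
    unfolding x by (rule restrict_config_csum) simp
  then show ?thesis using fin by (auto intro: csum_config_finite)
qed

lemma measurable_restrict_config:
  "restrict_config (cwin n) \<in> measurable (borel_on (vague_topology UNIV)) (borel_on (vague_topology (cwin n)))"
proof -
  let ?M = "borel_on (vague_topology UNIV)"
  let ?G = "{{\<gamma> \<in> configs (cwin n). of_nat k \<le> emeasure \<gamma> {a..b}} |a b k. True}"
  let ?N = "sigma (configs (cwin n)) ?G"
  have G: "?G \<subseteq> Pow (configs (cwin n))" by auto
  have sp: "space ?N = configs (cwin n)" and sN: "sets ?N = sigma_sets (configs (cwin n)) ?G"
    using G by (simp_all add: space_measure_of sets_measure_of)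
  have sub: "sets (borel_on (vague_topology (cwin n))) \<subseteq> sets ?N"
    by (rule vague_borel_subset[OF _ sp]) (auto simp: sN)
  have "restrict_config (cwin n) \<in> measurable ?M ?N"
  proof (rule measurable_measure_of[OF G])
    show "restrict_config (cwin n) \<in> space ?M \<rightarrow> configs (cwin n)"
      using restrict_config_in_configs by simp
    fix A assume "A \<in> ?G"
    then obtain a b and k :: nat where A: "A = {\<gamma> \<in> configs (cwin n). of_nat k \<le> emeasure \<gamma> {a..b}}" by blast
    have "restrict_config (cwin n) -` A \<inter> space ?M = {\<gamma> \<in> configs UNIV. of_nat k \<le> emeasure \<gamma> {max (- real n) a..min (real n) b}}"
      unfolding A using restrict_config_in_configs
      by (auto simp: emeasure_restrict_config)
    then show "restrict_config (cwin n) -` A \<inter> space ?M \<in> sets ?M"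
      using vague_count_measurable[of UNIV] by simp
  qed
  moreover have "measurable ?M ?N \<subseteq> measurable ?M (borel_on (vague_topology (cwin n)))"
    by (rule measurable_mono) (use sub sp in auto)
  ultimately show ?thesis by blast
qed

text \<open>Clamping turns the matching inside \<open>W\<close> into a window matching with at most
  as many pairs as \<open>\<gamma>\<close> has points in \<open>W\<close>, each of length at most
  \<open>\<delta>\<close>.\<close>

lemma wdist_near_on:
  assumes near: "near_on W \<delta> \<gamma> \<eta> F a b" and conf: "\<gamma> \<in> configs UNIV" "\<eta> \<in> configs UNIV"
    and W: "W = {- real n - \<theta>..real n + \<theta>}" "0 \<le> \<theta>" and \<delta>: "0 \<le> \<delta>"
  shows "wdist n \<gamma> \<eta> \<le> sqrt (enn2real (emeasure \<gamma> W)) * \<delta>"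
proof -
  have F: "finite F" and r: "restrict_config W \<gamma> = csum F a" "restrict_config W \<eta> = csum F b"
    and ab: "\<And>i. i \<in> F \<Longrightarrow> \<bar>a i - b i\<bar> \<le> \<delta>"
    using near by (auto simp: near_on_def less_imp_le)
  have Wb: "W \<in> sets borel" "owin n \<subseteq> W" using W by auto
  have rr: "restrict_config (owin n) \<zeta> = csum {i \<in> F. z i \<in> owin n} z"
    if "restrict_config W \<zeta> = csum F z" "\<zeta> \<in> configs UNIV" for \<zeta> z
  proof -
    have "restrict_config (owin n) \<zeta> = restrict_config (owin n) (restrict_config W \<zeta>)"
      by (rule restrict_restrict_config[symmetric]) (use that(2) Wb in simp_all)
    also have "\<dots> = csum {i \<in> F. z i \<in> owin n} z"
      unfolding that(1) by (rule restrict_config_csum) simp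
    finally show ?thesis .
  qed
  let ?F = "{i \<in> F. a i \<in> owin n \<or> b i \<in> owin n}"
  have "wdist n \<gamma> \<eta> \<le> L2_set (\<lambda>i. clamp_win n (a i) - clamp_win n (b i)) ?F"
    using F rr[OF r(1) conf(1)] rr[OF r(2) conf(2)] by (intro wdist_le clamp_matching) auto
  also have "\<dots> = L2_set (\<lambda>i. \<bar>clamp_win n (a i) - clamp_win n (b i)\<bar>) ?F" by (simp add: L2_set_def)
  also have "\<dots> \<le> L2_set (\<lambda>i. \<delta>) ?F"
    using order_trans[OF clamp_win(4) ab] by (intro L2_set_mono) simp_all
  also have "\<dots> \<le> L2_set (\<lambda>i. \<delta>) F"
    using F unfolding L2_set_def by (intro real_sqrt_le_mono sum_mono2) auto
  also have "\<dots> = sqrt (real (card F)) * \<delta>"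
    using \<delta> by (simp add: L2_set_def real_sqrt_mult)
  also have "real (card F) = enn2real (emeasure \<gamma> W)"
  proof -
    have "emeasure (restrict_config W \<gamma>) UNIV = emeasure (csum F a) UNIV" by (simp add: r)
    then have "emeasure \<gamma> W = of_nat (card F)"
      using Wb conf F by (simp add: emeasure_restrict_config emeasure_csum emeasure_count_space)
    then show ?thesis by (simp add: ennreal_of_nat_eq_real_of_nat)
  qed
  finally show ?thesis .
qed

section \<open>Window spaces and the maps onto them\<close>

lemma window_rel_wdist: "window_rel n = {(\<gamma>, \<eta>). \<gamma> \<in> configs UNIV \<and> \<eta> \<in> configs UNIV \<and> wdist n \<gamma> \<eta> = 0}"
  unfolding window_rel_def by (auto simp: window_dist_eq_wdist)

lemma window_metric_wdist: "window_metric n = quotient_metric (configs UNIV) (window_rel n) (wdist n)"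
  unfolding window_metric_def wdist_def[abs_def] ..

lemma mspace_window_metric: "mspace (window_metric n) = configs UNIV // window_rel n"
  and mdist_window_metric: "\<gamma> \<in> configs UNIV \<Longrightarrow> \<eta> \<in> configs UNIV \<Longrightarrow>
    mdist (window_metric n) (window_rel n `` {\<gamma>}) (window_rel n `` {\<eta>}) = wdist n \<gamma> \<eta>"
proof -
  note * = quotient_metric_pseudo[where S = "configs UNIV" and d = "wdist n" and r = "window_rel n",
    OF wdist_nonneg wdist_commute wdist_triangle wdist_refl window_rel_wdist]
  show "mspace (window_metric n) = configs UNIV // window_rel n"
    unfolding window_metric_wdist by (rule *(1))
  show "\<gamma> \<in> configs UNIV \<Longrightarrow> \<eta> \<in> configs UNIV \<Longrightarrow>
    mdist (window_metric n) (window_rel n `` {\<gamma>}) (window_rel n `` {\<eta>}) = wdist n \<gamma> \<eta>"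
    unfolding window_metric_wdist by (rule *(2))
qed

lemma window_class_in_mspace: "\<gamma> \<in> configs UNIV \<Longrightarrow> window_rel n `` {\<gamma>} \<in> mspace (window_metric n)"
  unfolding mspace_window_metric by (rule quotientI)

text \<open>About each point of the preimage of an open set there is a cell inside the preimage,
  because configurations of one cell are matched with small displacements; countability of the cells
  does the rest.\<close>

lemma measurable_window_class:
  "(\<lambda>\<gamma>. window_rel n `` {\<gamma>}) \<in> measurable (borel_on (vague_topology (cwin n))) (borel_on (mtopology_of (window_metric n)))"
proof (rule measurable_borel_onI)
  fix \<gamma> assume "\<gamma> \<in> space (borel_on (vague_topology (cwin n)))"
  then show "window_rel n `` {\<gamma>} \<in> topspace (mtopology_of (window_metric n))"
    using configs_cwin_subset by (auto intro: window_class_in_mspace)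
next
  fix U assume U: "openin (mtopology_of (window_metric n)) U"
  let ?N = "borel_on (vague_topology (cwin n))"
  let ?A = "(\<lambda>\<gamma>. window_rel n `` {\<gamma>}) -` U \<inter> space ?N"
  interpret Metric_space "mspace (window_metric n)" "mdist (window_metric n)" by simp
  show "?A \<in> sets ?N"
  proof (rule countable_union_of_cells_measurable[where X = "cwin n"])
    show "cell (cwin n) c \<in> sets ?N" for c
      by (rule cell_measurable) (auto intro: vague_count_measurable)
    fix \<gamma> assume "\<gamma> \<in> ?A"
    then have g: "\<gamma> \<in> configs (cwin n)" "window_rel n `` {\<gamma>} \<in> U" by auto
    have gU: "\<gamma> \<in> configs UNIV" using g configs_cwin_subset by blast
    obtain r where r: "r > 0" "mball (window_rel n `` {\<gamma>}) r \<subseteq> U"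
      using U g(2) unfolding mtopology_of_def openin_mtopology by blast
    \<comment> \<open>The factor by which a displacement bound has to be multiplied to bound the
      window distance.\<close>
    define s where "s = sqrt (enn2real (emeasure \<gamma> (cwin n)))"
    have s: "s \<ge> 0" by (simp add: s_def)
    define \<delta> where "\<delta> = r / (s + 1)"
    have \<delta>: "\<delta> > 0" "s * \<delta> < r" using r s by (auto simp: \<delta>_def field_simps)
    obtain L where L: "\<gamma> \<in> cell (cwin n) (n, L)"
      "\<And>\<eta>. \<eta> \<in> cell (cwin n) (n, L) \<Longrightarrow> \<exists>F a b. near_on (cwin n \<inter> cwin n) \<delta> \<gamma> \<eta> F a b"
      by (rule cell_neighbourhood[OF closed_real_atLeastAtMost g(1) \<delta>(1), of n]) blast
    have "cell (cwin n) (n, L) \<subseteq> ?A"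
    proof
      fix \<eta> assume \<eta>: "\<eta> \<in> cell (cwin n) (n, L)"
      then have \<eta>c: "\<eta> \<in> configs (cwin n)" by (simp add: cell_def)
      then have \<eta>U: "\<eta> \<in> configs UNIV" using configs_cwin_subset by blast
      obtain F a b where "near_on (cwin n) \<delta> \<gamma> \<eta> F a b" using L(2)[OF \<eta>] by auto
      then have "wdist n \<gamma> \<eta> \<le> s * \<delta>"
        unfolding s_def by (rule wdist_near_on[OF _ gU \<eta>U, of _ _ _ _ _ n 0]) (use \<delta> in auto)
      then have "window_rel n `` {\<eta>} \<in> mball (window_rel n `` {\<gamma>}) r"
        using \<delta> gU \<eta>U by (simp add: window_class_in_mspace mdist_window_metric)
      then show "\<eta> \<in> ?A" using r \<eta>c by auto
    qed
    then show "\<exists>S. finite S \<and> \<gamma> \<in> cells (cwin n) S \<and> cells (cwin n) S \<subseteq> ?A"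
      using L(1) by (intro exI[of _ "{(n, L)}"]) (auto simp: cells_def cell_def)
  qed simp
qed

text \<open>Restriction, class and embedding into the completion in one map; since
  \<open>\<pi>\<close> has the prescribed marginals, its law is the measure of
  \<open>window_mm n\<close>.\<close>

definition window_map :: "nat \<Rightarrow> real measure \<Rightarrow> (nat \<Rightarrow> real measure set) set" where
  "window_map n \<gamma> = completion_embed (window_metric n) (window_rel n `` {restrict_config (cwin n) \<gamma>})"

lemma wdist_restrict_config:
  assumes "\<gamma> \<in> configs UNIV" "\<eta> \<in> configs UNIV"
  shows "wdist n (restrict_config (cwin n) \<gamma>) (restrict_config (cwin n) \<eta>) = wdist n \<gamma> \<eta>"
proof -
  have "restrict_config (owin n) (restrict_config (cwin n) \<zeta>) = restrict_config (owin n) \<zeta>"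
    if "\<zeta> \<in> configs UNIV" for \<zeta>
    by (rule restrict_restrict_config) (use that in auto)
  then show ?thesis using assms unfolding wdist_def window_dist_def by simp
qed

lemma window_map_in_mspace:
  assumes "\<gamma> \<in> configs UNIV" shows "window_map n \<gamma> \<in> mspace (fst (window_mm n))"
  unfolding window_map_def window_mm_def fst_conv
  using restrict_config_in_configs[OF assms, of n] configs_cwin_subset[of n]
  by (intro completion_embed_in_mspace window_class_in_mspace) blast

lemma mdist_window_map:
  assumes "\<gamma> \<in> configs UNIV" "\<eta> \<in> configs UNIV"
  shows "mdist (fst (window_mm n)) (window_map n \<gamma>) (window_map n \<eta>) = wdist n \<gamma> \<eta>"
proof -
  have r: "restrict_config (cwin n) \<gamma> \<in> configs UNIV" "restrict_config (cwin n) \<eta> \<in> configs UNIV"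
    using restrict_config_in_configs[of _ n] configs_cwin_subset[of n] assms by blast+
  show ?thesis
    unfolding window_map_def window_mm_def fst_conv
    by (simp add: mdist_completion_embed window_class_in_mspace mdist_window_metric wdist_restrict_config r assms)
qed

section \<open>Window laws and void probabilities of the Poisson measure\<close>

context
  fixes \<pi> :: "real measure measure"
  assumes \<pi>: "poisson_measure \<pi>"
begin

lemma poisson_prob_space: "prob_space \<pi>"
  and poisson_sets: "sets \<pi> = sets (borel_on (vague_topology UNIV))"
  and poisson_space: "space \<pi> = configs UNIV"
proof -
  show "prob_space \<pi>" and s: "sets \<pi> = sets (borel_on (vague_topology UNIV))"
    using \<pi> by (auto simp: poisson_measure_def)
  show "space \<pi> = configs UNIV" using sets_eq_imp_space_eq[OF s] by simp
qed

lemma poisson_restrict [measurable]: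
  "restrict_config (cwin n) \<in> measurable \<pi> (borel_on (vague_topology (cwin n)))"
  using measurable_restrict_config measurable_cong_sets[OF poisson_sets refl] by blast

lemma poisson_window_distr:
  "n \<ge> 1 \<Longrightarrow> poisson_window n = distr \<pi> (borel_on (vague_topology (cwin n))) (restrict_config (cwin n))"
  using \<pi> by (simp add: poisson_measure_def)

lemma window_map_law:
  assumes n: "n \<ge> 1"
  shows "window_map n \<in> measurable \<pi> (snd (window_mm n))"
    and "distr \<pi> (snd (window_mm n)) (window_map n) = snd (window_mm n)"
    and "sets (snd (window_mm n)) = sets (borel_on (mtopology_of (fst (window_mm n))))"
proof -
  let ?C = "borel_on (mtopology_of (completion (window_metric n)))"
  let ?U = "borel_on (mtopology_of (window_metric n))"
  have emb: "completion_embed (window_metric n) \<in> measurable ?U ?C"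
    by (intro measurable_borel_on_continuous continuous_map_nonexpansive)
      (auto simp: completion_embed_in_mspace mdist_completion_embed)
  have q: "(\<lambda>\<gamma>. window_rel n `` {\<gamma>}) \<in> measurable (borel_on (vague_topology (cwin n))) ?U"
    by (rule measurable_window_class)
  have m: "window_map n \<in> measurable \<pi> ?C"
    unfolding window_map_def
    by (rule measurable_compose[OF measurable_compose[OF poisson_restrict q] emb])
  have law: "snd (window_mm n) = distr \<pi> ?C (window_map n)"
  proof -
    have "window_poisson n = distr \<pi> ?U (\<lambda>\<gamma>. window_rel n `` {restrict_config (cwin n) \<gamma>})"
      unfolding window_poisson_def poisson_window_distr[OF n]
      by (subst distr_distr[OF q poisson_restrict]) (simp add: comp_def)
    then have "snd (window_mm n) = distr (distr \<pi> ?U (\<lambda>\<gamma>. window_rel n `` {restrict_config (cwin n) \<gamma>})) ?C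
        (completion_embed (window_metric n))"
      by (simp add: window_mm_def)
    also have "\<dots> = distr \<pi> ?C (window_map n)"
      by (subst distr_distr[OF emb measurable_compose[OF poisson_restrict q]])
        (simp add: comp_def window_map_def[abs_def])
    finally show ?thesis .
  qed
  then show s: "sets (snd (window_mm n)) = sets (borel_on (mtopology_of (fst (window_mm n))))"
    by (simp add: window_mm_def)
  show "window_map n \<in> measurable \<pi> (snd (window_mm n))"
    using m s by (simp add: window_mm_def cong: measurable_cong_sets)
  show "distr \<pi> (snd (window_mm n)) (window_map n) = snd (window_mm n)"
  proof -
    have "distr \<pi> (snd (window_mm n)) (window_map n) = distr \<pi> ?C (window_map n)"
      by (rule distr_cong) (simp_all add: s window_mm_def[of n])
    then show ?thesis using law by simp
  qed
qed

lemma poisson_count_measurable: "{\<gamma> \<in> configs UNIV. of_nat k \<le> emeasure \<gamma> {a..b}} \<in> sets \<pi>"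
  unfolding poisson_sets by (rule vague_count_measurable) simp

lemma exp_series_ennreal:
  fixes t :: real assumes "t \<ge> 0"
  shows "(\<Sum>k. ennreal (1 / fact k) * ennreal (t ^ k)) = ennreal (exp t)"
proof -
  have "(\<Sum>k. ennreal (1 / fact k) * ennreal (t ^ k)) = (\<Sum>k. ennreal (t ^ k /\<^sub>R fact k))"
    using assms by (intro suminf_cong) (simp add: ennreal_mult[symmetric] divide_inverse)
  also have "\<dots> = ennreal (\<Sum>k. t ^ k /\<^sub>R fact k)"
    using assms summable_exp_generic[of t] by (intro suminf_ennreal2) auto
  finally show ?thesis by (simp add: exp_def)
qed

text \<open>All of k points in the window avoid \<open>A\<close> with weight
  \<open>(2 * real n - measure lborel A) ^ k\<close>; the exponential series against the
  normalisation \<open>exp (- (2 * real n))\<close> leaves \<open>exp (- measure lborel A)\<close>.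
  Either interval may be empty, which includes the case of a single interval.\<close>

lemma poisson_void:
  assumes n: "n \<ge> 1" and ab: "{a..b} \<subseteq> cwin n" "{c..d} \<subseteq> cwin n"
  defines "A \<equiv> {a..b} \<union> {c..d}"
  shows "emeasure \<pi> {\<gamma> \<in> configs UNIV. emeasure \<gamma> A = 0} = ennreal (exp (- measure lborel A))"
proof -
  interpret prob_space \<pi> by (rule poisson_prob_space)
  let ?B = "borel_on (vague_topology (cwin n))"
  define V where "V = {\<gamma> \<in> configs (cwin n). emeasure \<gamma> A = 0}"
  have A: "A \<in> sets borel" "A \<subseteq> cwin n" using ab by (auto simp: A_def)
  have V: "V \<in> sets ?B"
  proof -
    have "V = space ?B - {\<gamma> \<in> configs (cwin n). of_nat 1 \<le> emeasure \<gamma> {a..b}} - {\<gamma> \<in> configs (cwin n). of_nat 1 \<le> emeasure \<gamma> {c..d}}"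
    proof (intro set_eqI)
      fix \<gamma>
      have "emeasure \<gamma> A = 0 \<longleftrightarrow> \<not> of_nat 1 \<le> emeasure \<gamma> {a..b} \<and> \<not> of_nat 1 \<le> emeasure \<gamma> {c..d}"
        if g: "\<gamma> \<in> configs (cwin n)"
      proof -
        have z: "emeasure \<gamma> S = 0 \<longleftrightarrow> \<not> of_nat 1 \<le> emeasure \<gamma> S" if "S \<in> sets borel" for S
          using config_count_cases[OF g that] by (auto simp: Suc_le_eq)
        have "emeasure \<gamma> A = 0 \<longleftrightarrow> emeasure \<gamma> {a..b} = 0 \<and> emeasure \<gamma> {c..d} = 0"
        proof
          assume "emeasure \<gamma> A = 0"
          then show "emeasure \<gamma> {a..b} = 0 \<and> emeasure \<gamma> {c..d} = 0"
            using emeasure_mono[of "{a..b}" A \<gamma>] emeasure_mono[of "{c..d}" A \<gamma>] g A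
            by (auto simp: A_def)
        next
          assume "emeasure \<gamma> {a..b} = 0 \<and> emeasure \<gamma> {c..d} = 0"
          then have "A \<in> null_sets \<gamma>" unfolding A_def using g by (intro null_sets.Un null_setsI) auto
          then show "emeasure \<gamma> A = 0" by auto
        qed
        then show ?thesis using z[of "{a..b}"] z[of "{c..d}"] by simp
      qed
      then show "\<gamma> \<in> V \<longleftrightarrow> \<gamma> \<in> space ?B - {\<gamma> \<in> configs (cwin n). of_nat 1 \<le> emeasure \<gamma> {a..b}} - {\<gamma> \<in> configs (cwin n). of_nat 1 \<le> emeasure \<gamma> {c..d}}"
        unfolding V_def by auto
    qed
    also have "\<dots> \<in> sets ?B"
      by (intro sets.Diff sets.top vague_count_measurable) auto
    finally show ?thesis .
  qed
  have pre: "restrict_config (cwin n) -` V \<inter> space \<pi> = {\<gamma> \<in> configs UNIV. emeasure \<gamma> A = 0}"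
    using A restrict_config_in_configs unfolding V_def poisson_space
    by (auto simp: emeasure_restrict_config Int_absorb1 simp del: atLeastAtMost_iff)
  have "emeasure \<pi> {\<gamma> \<in> configs UNIV. emeasure \<gamma> A = 0} = emeasure (poisson_window n) V"
    unfolding poisson_window_distr[OF n] using V by (subst emeasure_distr) (auto simp: pre)
  also have "\<dots> = ennreal (exp (- measure lborel (cwin n))) *
        (\<Sum>k. ennreal (1 / fact k) *
           (\<integral>\<^sup>+ x. indicator V (dirac_sum (enat k) x) \<partial>(PiM {..<k} (\<lambda>_. restrict_space lborel (cwin n)))))"
    (is "_ = ?\<mu> V")
  proof -
    \<comment> \<open>\<^const>\<open>measure_of\<close> is zero if its set function is not a measure; total mass 1 excludes this,
      so the defining formula holds without checking countable additivity\<close>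
    have "emeasure (poisson_window n) (configs (cwin n)) = 1"
      unfolding poisson_window_distr[OF n]
      using prob_space.emeasure_space_1[OF prob_space_distr[OF poisson_restrict[of n]]] by simp
    then have "measure_space (configs (cwin n)) (sigma_sets (configs (cwin n)) (sets ?B)) ?\<mu>"
      unfolding poisson_window_def
      by (subst (asm) emeasure_measure_of_conv) (auto split: if_splits)
    then show ?thesis
      unfolding poisson_window_def using V by (subst emeasure_measure_of_conv) auto
  qed
  also have "\<dots> = ennreal (exp (- measure lborel A))"
  proof -
    let ?L = "restrict_space lborel (cwin n)"
    have L: "emeasure ?L B = emeasure lborel B" if "B \<in> sets borel" "B \<subseteq> cwin n" for B
      using that by (subst emeasure_restrict_space) auto
    have "finite_measure ?L"
      by (rule finite_measureI) (simp add: space_restrict_space L)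
    then interpret product_sigma_finite "\<lambda>_::nat. ?L"
      by (intro product_sigma_finite.intro finite_measure.axioms(1)[of ?L])
    have mA: "measure lborel A \<le> 2 * real n"
    proof -
      have "measure lborel A \<le> measure lborel (cwin n)"
        using A by (intro measure_mono_fmeasurable fmeasurableI) auto
      then show ?thesis by simp
    qed
    have LA: "emeasure ?L (cwin n - A) = ennreal (2 * real n - measure lborel A)"
    proof -
      have "emeasure ?L (cwin n - A) = emeasure lborel (cwin n - A)" using A by (intro L) auto
      also have "\<dots> = emeasure lborel (cwin n) - emeasure lborel A"
      proof (rule emeasure_Diff)
        have "emeasure lborel A \<le> emeasure lborel (cwin n)" using A by (intro emeasure_mono) auto
        then show "emeasure lborel A \<noteq> \<infinity>" by (auto simp: top_unique)
      qed (use A in auto)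
      also have "emeasure lborel A = ennreal (measure lborel A)"
      proof -
        have "emeasure lborel A \<le> emeasure lborel (cwin n)" using A by (intro emeasure_mono) auto
        then show ?thesis by (intro emeasure_eq_ennreal_measure) (auto simp: top_unique)
      qed
      finally show ?thesis by (simp add: ennreal_minus)
    qed
    have int: "(\<integral>\<^sup>+ x. indicator V (dirac_sum (enat k) x) \<partial>(PiM {..<k} (\<lambda>_. ?L))) = ennreal ((2 * real n - measure lborel A) ^ k)" for k
    proof -
      have "(\<integral>\<^sup>+ x. indicator V (dirac_sum (enat k) x) \<partial>(PiM {..<k} (\<lambda>_. ?L))) =
        (\<integral>\<^sup>+ x. indicator (PiE {..<k} (\<lambda>_. cwin n - A)) x \<partial>(PiM {..<k} (\<lambda>_. ?L)))"
      proof (rule nn_integral_cong)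
        fix x assume "x \<in> space (PiM {..<k} (\<lambda>_. ?L))"
        then have x: "x \<in> PiE {..<k} (\<lambda>_. cwin n)" by (simp add: space_PiM space_restrict_space)
        have e: "{i. enat i < enat k} = {..<k}" by auto
        have "dirac_sum (enat k) x \<in> configs (cwin n)"
          unfolding dirac_sum_csum e using x by (intro csum_config_finite) (auto simp: PiE_iff)
        moreover have "emeasure (dirac_sum (enat k) x) A = 0 \<longleftrightarrow> (\<forall>i<k. x i \<notin> A)"
          unfolding dirac_sum_csum e emeasure_csum[OF A(1)] by (auto simp: emeasure_count_space)
        ultimately have "dirac_sum (enat k) x \<in> V \<longleftrightarrow> x \<in> PiE {..<k} (\<lambda>_. cwin n - A)"
          using x by (auto simp: V_def PiE_iff)
        then show "indicator V (dirac_sum (enat k) x) = (indicator (PiE {..<k} (\<lambda>_. cwin n - A)) x :: ennreal)"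
          by (simp add: indicator_def)
      qed
      also have "\<dots> = emeasure (PiM {..<k} (\<lambda>_. ?L)) (PiE {..<k} (\<lambda>_. cwin n - A))"
        using A by (intro nn_integral_indicator sets_PiM_I_finite) (auto simp: sets_restrict_space_iff)
      also have "\<dots> = (\<Prod>i\<in>{..<k}. emeasure ?L (cwin n - A))"
        using A by (intro emeasure_PiM) (auto simp: sets_restrict_space_iff)
      also have "\<dots> = ennreal ((2 * real n - measure lborel A) ^ k)"
        unfolding LA using mA by (simp add: ennreal_power)
      finally show ?thesis .
    qed
    have "?\<mu> V = ennreal (exp (- (2 * real n))) * ennreal (exp (2 * real n - measure lborel A))"
      unfolding int using mA by (simp add: exp_series_ennreal)
    also have "\<dots> = ennreal (exp (- measure lborel A))"
      by (simp add: ennreal_mult[symmetric] exp_add[symmetric])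
    finally show ?thesis .
  qed
  finally show ?thesis .
qed

end

section \<open>Compactness and regularity\<close>

text \<open>A sequential form of vague convergence after the portmanteau theorem. Counts are
  integers, so semicontinuity can be demanded as an inequality for all large j instead of a bound on
  limits.\<close>

definition vconv :: "(nat \<Rightarrow> real measure) \<Rightarrow> real measure \<Rightarrow> bool" where
  "vconv u \<gamma> \<longleftrightarrow> (\<forall>a b. (\<forall>\<^sub>F j in sequentially. emeasure (u j) {a..b} \<le> emeasure \<gamma> {a..b}) \<and>
     (\<forall>\<^sub>F j in sequentially. emeasure \<gamma> {a<..<b} \<le> emeasure (u j) {a<..<b}))"

lemma vconv_subseq:
  assumes "vconv u \<gamma>" "strict_mono (r :: nat \<Rightarrow> nat)"
  shows "vconv (\<lambda>j. u (r j)) \<gamma>"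
  using assms(1) eventually_subseq[OF assms(2)] unfolding vconv_def by blast

lemma finite_atoms_gap:
  fixes g :: "'i \<Rightarrow> real"
  assumes "finite F" "\<And>i. i \<in> F \<Longrightarrow> 0 < g i"
  obtains \<theta> where "0 < \<theta>" "\<theta> \<le> 1" "\<And>i. i \<in> F \<Longrightarrow> \<theta> < g i"
proof -
  have fin: "finite (insert 1 (g ` F))" using assms by simp
  have "Min (insert 1 (g ` F)) > 0" using assms by (subst Min_gr_iff[OF fin]) auto
  moreover have "Min (insert 1 (g ` F)) \<le> 1" using fin by (rule Min_le) simp
  moreover have "Min (insert 1 (g ` F)) \<le> g i" if "i \<in> F" for i using fin that by (intro Min_le) auto
  ultimately show ?thesis by (intro that[of "Min (insert 1 (g ` F)) / 2"]) fastforce+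
qed

text \<open>Small open intervals about the points of \<open>\<gamma>\<close> do not lose points
  eventually, while the closed interval \<open>W\<close> does not gain any. Since the former account
  for all points of \<open>\<gamma>\<close> in \<open>W\<close>, all these counts agree eventually,
  and points are matched within the small intervals.\<close>

lemma wdist_tendsto_of_vconv:
  assumes conf: "\<And>j. u j \<in> configs UNIV" "\<gamma> \<in> configs UNIV" and v: "vconv u \<gamma>"
  shows "(\<lambda>j. wdist n \<gamma> (u j)) \<longlonglongrightarrow> 0"
proof -
  obtain I :: "nat set" and x where x: "\<gamma> = csum I x" using config_csumE[OF conf(2)] by blast
  let ?G = "{i \<in> I. x i \<in> {- real n - 1..real n + 1}}"
  have G: "finite ?G" using conf(2) unfolding x by (rule config_finite_compact) auto
  let ?F = "{i \<in> I. x i \<in> cwin n}"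
  have F: "finite ?F" using conf(2) unfolding x by (rule config_finite_compact) auto
  \<comment> \<open>No point of \<open>\<gamma>\<close> has modulus in the range from n, exclusive,
    to \<open>real n + \<theta>\<close>. So the end points of \<open>W\<close> carry no mass,
    although those of the window may.\<close>
  obtain \<theta> where \<theta>: "0 < \<theta>" "\<theta> \<le> 1" "\<And>i. i \<in> ?G - ?F \<Longrightarrow> \<theta> < \<bar>x i\<bar> - real n"
    by (rule finite_atoms_gap[of "?G - ?F" "\<lambda>i. \<bar>x i\<bar> - real n"]) (use G in auto)
  define W where "W = {- real n - \<theta>..real n + \<theta>}"
  have FW: "{i \<in> I. x i \<in> W} = ?F"
  proof
    show "{i \<in> I. x i \<in> W} \<subseteq> ?F"
    proof
      fix i assume i: "i \<in> {i \<in> I. x i \<in> W}"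
      then have "i \<in> ?G" using \<theta>(2) by (auto simp: W_def)
      show "i \<in> ?F"
      proof (rule ccontr)
        assume "i \<notin> ?F"
        then have "\<theta> < \<bar>x i\<bar> - real n" using \<theta>(3) \<open>i \<in> ?G\<close> by blast
        then show False using i by (auto simp: W_def)
      qed
    qed
    show "?F \<subseteq> {i \<in> I. x i \<in> W}" using \<theta>(1) by (auto simp: W_def)
  qed
  let ?P = "x ` ?F"
  have P: "finite ?P" using F by simp
  obtain s where s: "s > 0" "\<And>p q. p \<in> ?P \<Longrightarrow> q \<in> ?P \<Longrightarrow> p \<noteq> q \<Longrightarrow> s \<le> \<bar>p - q\<bar>"
    by (rule finite_real_separated[OF P]) blast
  define M where "M = sqrt (enn2real (emeasure \<gamma> W))"
  have M: "M \<ge> 0" by (simp add: M_def)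
  show ?thesis
  proof (rule LIMSEQ_I)
    fix e :: real assume e: "e > 0"
    define \<delta> where "\<delta> = e / (M + 1)"
    have \<delta>: "\<delta> > 0" "M * \<delta> < e" using e M by (auto simp: \<delta>_def field_simps)
    \<comment> \<open>The three bounds make the intervals short, mutually disjoint, and contained in
      \<open>W\<close>.\<close>
    define \<rho> where "\<rho> = min (\<delta> / 2) (min (s / 2) \<theta>)"
    have \<rho>: "\<rho> > 0" "2 * \<rho> \<le> \<delta>" "2 * \<rho> \<le> s" "\<rho> \<le> \<theta>" using s(1) \<delta> \<theta> by (auto simp: \<rho>_def)
    define T where "T p = {p - \<rho><..<p + \<rho>}" for p
    have Tb: "T p \<in> sets borel" for p by (simp add: T_def)
    have TW: "T p \<subseteq> W" if "p \<in> ?P" for p using that \<rho> by (auto simp: T_def W_def)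
    have disj: "disjoint_family_on T ?P"
      unfolding disjoint_family_on_def
    proof (intro ballI impI)
      fix p p' assume pp: "p \<in> ?P" "p' \<in> ?P" "p \<noteq> p'"
      show "T p \<inter> T p' = {}"
      proof (rule ccontr)
        assume "T p \<inter> T p' \<noteq> {}"
        then obtain t where "t \<in> T p" "t \<in> T p'" by blast
        then have "\<bar>p - p'\<bar> < s" using \<rho> by (auto simp: T_def abs_less_iff)
        then show False using s(2)[OF pp] by linarith
      qed
    qed
    define k where "k p = card {i \<in> ?F. x i = p}" for p
    have kT: "emeasure \<gamma> (T p) = of_nat (k p)" if p: "p \<in> ?P" for p
    proof -
      have "{i \<in> I. x i \<in> T p} = {i \<in> ?F. x i = p}"
      proof
        show "{i \<in> I. x i \<in> T p} \<subseteq> {i \<in> ?F. x i = p}"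
        proof
          fix i assume i: "i \<in> {i \<in> I. x i \<in> T p}"
          then have "i \<in> {i \<in> I. x i \<in> W}" using TW[OF p] by blast
          then have iF: "i \<in> ?F" unfolding FW .
          have "\<bar>x i - p\<bar> < s" using i \<rho> by (auto simp: T_def abs_less_iff)
          then have "x i = p" using s(2)[of "x i" p] p iF by force
          then show "i \<in> {i \<in> ?F. x i = p}" using iF by blast
        qed
        show "{i \<in> ?F. x i = p} \<subseteq> {i \<in> I. x i \<in> T p}" using \<rho>(1) by (auto simp: T_def)
      qed
      then have "emeasure \<gamma> (T p) = emeasure (count_space UNIV) {i \<in> ?F. x i = p}"
        unfolding x using Tb by (simp add: emeasure_csum)
      also have "\<dots> = of_nat (k p)" unfolding k_def using F by (subst emeasure_count_space) (auto elim: rev_finite_subset)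
      finally show ?thesis .
    qed
    have kW: "emeasure \<gamma> W = of_nat (\<Sum>p\<in>?P. k p)"
    proof -
      have "card ?F = (\<Sum>p\<in>?P. k p)"
        unfolding k_def using sum.image_gen[OF F, of "\<lambda>_. 1::nat" x] F by simp
      moreover have "emeasure \<gamma> W = of_nat (card ?F)"
        unfolding x using F by (subst emeasure_csum) (auto simp: FW emeasure_count_space W_def[symmetric], simp add: W_def)
      ultimately show ?thesis by simp
    qed
    have "\<forall>\<^sub>F j in sequentially. \<forall>p\<in>?P. emeasure \<gamma> (T p) \<le> emeasure (u j) (T p)"
      using v unfolding vconv_def T_def by (intro eventually_ball_finite[OF P] ballI) blast
    moreover have "\<forall>\<^sub>F j in sequentially. emeasure (u j) W \<le> emeasure \<gamma> W"
      using v unfolding vconv_def W_def by blast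
    ultimately have "\<forall>\<^sub>F j in sequentially. wdist n \<gamma> (u j) < e"
    proof eventually_elim
      case (elim j)
      have sub: "emeasure (u j) (T p) \<le> emeasure (u j) W" if "p \<in> ?P" for p
        using TW[OF that] conf(1)[of j] by (intro emeasure_mono) (auto simp: W_def)
      have "\<exists>m::nat. emeasure (u j) (T p) = of_nat m" if "p \<in> ?P" for p
      proof -
        have "emeasure (u j) (T p) \<le> of_nat (\<Sum>p\<in>?P. k p)"
          using sub[OF that] elim(2) kW by order
        then have "emeasure (u j) (T p) \<noteq> \<infinity>"
          using of_nat_less_top[of "\<Sum>p\<in>?P. k p"] by (auto simp only: infinity_ennreal_def top_unique)
        then show ?thesis
          using config_count_cases[OF conf(1)[of j] Tb[of p]] by blast
      qed
      then obtain k' where k': "\<And>p. p \<in> ?P \<Longrightarrow> emeasure (u j) (T p) = of_nat (k' p :: nat)" by metis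
      have ge: "k p \<le> k' p" if "p \<in> ?P" for p
        using elim(1) that k'[OF that] kT[OF that] by force
      have UN: "of_nat (\<Sum>p\<in>?P. k' p) = emeasure (u j) (\<Union>p\<in>?P. T p)"
      proof -
        have "(\<Sum>p\<in>?P. emeasure (u j) (T p)) = emeasure (u j) (\<Union>p\<in>?P. T p)"
          using Tb conf(1)[of j] by (intro sum_emeasure disj P) auto
        then show ?thesis using k' by simp
      qed
      also have le: "\<dots> \<le> emeasure (u j) W"
        using TW conf(1)[of j] by (intro emeasure_mono) (auto simp: W_def)
      finally have "(of_nat (\<Sum>p\<in>?P. k' p) :: ennreal) \<le> of_nat (\<Sum>p\<in>?P. k p)"
        using elim(2) kW by order
      then have "(\<Sum>p\<in>?P. k' p) \<le> (\<Sum>p\<in>?P. k p)" by (simp only: of_nat_le_iff)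
      moreover have "(\<Sum>p\<in>?P. k p) \<le> (\<Sum>p\<in>?P. k' p)" using ge by (rule sum_mono)
      ultimately have seq: "(\<Sum>p\<in>?P. k p) = (\<Sum>p\<in>?P. k' p)" by simp
      \<comment> \<open>Termwise inequalities with equal sums are equalities.\<close>
      have keq: "k p = k' p" if "p \<in> ?P" for p
        using sum_mono_inv[OF seq ge that P] .
      have uW: "emeasure (u j) W = of_nat (\<Sum>p\<in>?P. k p)"
        using UN le elim(2) kW unfolding seq by (metis order_antisym)
      have "\<exists>Q a b. near_on W \<delta> \<gamma> (u j) Q a b"
      proof (rule near_on_of_counts[OF conf(2) conf(1)[of j] _ P Tb TW disj])
        show "W \<in> sets borel" by (simp add: W_def)
        show "\<bar>t - t'\<bar> < \<delta>" if "t \<in> T p" "t' \<in> T p" for p t t'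
          using that \<rho> by (auto simp: T_def abs_less_iff)
        show "emeasure (u j) (T p) = of_nat (k p)" if "p \<in> ?P" for p
          using k'[OF that] keq[OF that] by simp
      qed (assumption | rule kT kW uW)+
      then obtain Q a b where "near_on W \<delta> \<gamma> (u j) Q a b" by blast
      then have "wdist n \<gamma> (u j) \<le> M * \<delta>"
        unfolding M_def using \<delta> \<theta> by (intro wdist_near_on[OF _ conf(2) conf(1) W_def]) auto
      then show ?case using \<delta> by simp
    qed
    then show "\<exists>no. \<forall>j\<ge>no. norm (wdist n \<gamma> (u j) - 0) < e"
      by (simp add: eventually_sequentially)
  qed
qed

text \<open>A label consists of the modulus rounded up and a slot below the count bound of that
  level. All configurations with the same bounds \<open>C\<close> then share one set of labels, with
  positions bounded label by label, as needed for extracting subsequences.\<close>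

lemma config_level_enumeration:
  assumes u: "u \<in> configs UNIV" and C: "\<And>R. emeasure u (cwin R) \<le> of_nat (C R :: nat)"
  obtains D :: "(nat \<times> nat) set" and y where "u = csum D y" "\<And>k. k \<in> D \<Longrightarrow> snd k < C (fst k)"
    "\<And>k. k \<in> D \<Longrightarrow> real (fst k) - 1 < \<bar>y k\<bar>" "\<And>k. \<bar>y k\<bar> \<le> real (fst k)"
proof -
  obtain I :: "nat set" and x where x: "u = csum I x" using config_csumE[OF u] by blast
  define lev where "lev i = nat \<lceil>\<bar>x i\<bar>\<rceil>" for i
  have lev: "real (lev i) - 1 < \<bar>x i\<bar>" "\<bar>x i\<bar> \<le> real (lev i)" for i
    by (auto simp: lev_def) linarith+
  have "\<exists>e. inj_on e {i \<in> I. lev i = R} \<and> e ` {i \<in> I. lev i = R} \<subseteq> {..<C R}" for R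
  proof -
    have fin: "finite {i \<in> I. x i \<in> cwin R}" using u unfolding x by (rule config_finite_compact) auto
    have sub: "{i \<in> I. lev i = R} \<subseteq> {i \<in> I. x i \<in> cwin R}"
    proof
      fix i assume "i \<in> {i \<in> I. lev i = R}"
      then show "i \<in> {i \<in> I. x i \<in> cwin R}" using lev(2)[of i] by (auto simp: abs_le_iff)
    qed
    have "card {i \<in> I. x i \<in> cwin R} \<le> C R"
      using C[of R] fin unfolding x by (simp add: emeasure_csum emeasure_count_space)
    then have "finite {i \<in> I. lev i = R}" "card {i \<in> I. lev i = R} \<le> card {..<C R}"
      using finite_subset[OF sub fin] card_mono[OF fin sub] by simp_all
    then show ?thesis using card_le_inj[of "{i \<in> I. lev i = R}" "{..<C R}"] by auto
  qed
  then obtain e where e: "\<And>R. inj_on (e R) {i \<in> I. lev i = R}" "\<And>R. e R ` {i \<in> I. lev i = R} \<subseteq> {..<C R}" by metis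
  define h where "h i = (lev i, e (lev i) i)" for i
  have inj: "inj_on h I"
  proof (rule inj_onI)
    fix i i' assume i: "i \<in> I" "i' \<in> I" "h i = h i'"
    then have "lev i' = lev i" "e (lev i) i = e (lev i) i'" by (auto simp: h_def)
    then show "i = i'" using e(1)[of "lev i"] i by (auto dest: inj_onD)
  qed
  \<comment> \<open>Labels not in use get position 0, so that the bound on positions holds for every
    label.\<close>
  define y where "y k = (if k \<in> h ` I then x (the_inv_into I h k) else 0)" for k
  have y: "y (h i) = x i" if "i \<in> I" for i using that by (simp add: y_def the_inv_into_f_f[OF inj])
  show ?thesis
  proof
    have "csum I x = csum (h ` I) y"
      by (rule csum_reindex[of h]) (use inj y in \<open>auto simp: bij_betw_def\<close>)
    then show "u = csum (h ` I) y" using x by simp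
    fix k
    show "snd k < C (fst k)" if "k \<in> h ` I"
    proof -
      obtain i where i: "i \<in> I" "k = h i" using \<open>k \<in> h ` I\<close> by blast
      then have "e (lev i) i \<in> {..<C (lev i)}" using e(2)[of "lev i"] by blast
      then show ?thesis using i by (simp add: h_def)
    qed
    show "real (fst k) - 1 < \<bar>y k\<bar>" if "k \<in> h ` I"
      using that y lev(1) by (auto simp: h_def)
    show "\<bar>y k\<bar> \<le> real (fst k)"
    proof (cases "k \<in> h ` I")
      case True
      then show ?thesis using y lev(2) by (auto simp: h_def)
    qed (simp add: y_def)
  qed
qed

text \<open>Along a subsequence both the use and the position of every label converge. The lower
  bound on the modulus keeps points of high levels away from a bounded interval, so only finitely
  many labels matter for a given count and their limits may be taken together.\<close>

lemma vconv_compact: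
  assumes u: "\<And>j. u j \<in> configs UNIV" and C: "\<And>j R. emeasure (u j) (cwin R) \<le> of_nat (C R :: nat)"
  obtains r \<gamma> where "strict_mono (r :: nat \<Rightarrow> nat)" "\<gamma> \<in> configs UNIV" "vconv (\<lambda>j. u (r j)) \<gamma>"
proof -
  have "\<exists>D y. u j = csum D y \<and> (\<forall>k\<in>D. snd k < C (fst k)) \<and> (\<forall>k\<in>D. real (fst k) - 1 < \<bar>y k\<bar>) \<and>
      (\<forall>k. \<bar>y k\<bar> \<le> real (fst k))" for j
    by (rule config_level_enumeration[OF u C, of j]) blast
  then obtain D :: "nat \<Rightarrow> (nat \<times> nat) set" and y where D: "\<And>j. u j = csum (D j) (y j)"
    "\<And>j k. k \<in> D j \<Longrightarrow> snd k < C (fst k)" "\<And>j k. k \<in> D j \<Longrightarrow> real (fst k) - 1 < \<bar>y j k\<bar>"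
    "\<And>j k. \<bar>y j k\<bar> \<le> real (fst k)"
    by metis
  \<comment> \<open>Use and position of the labels, combined into one bounded family for a single
    extraction.\<close>
  define f :: "nat \<Rightarrow> (nat \<times> nat) \<times> bool \<Rightarrow> real" where
    "f j = (\<lambda>(k, b). if b then of_bool (k \<in> D j) else y j k)" for j
  have "\<bar>f j k\<bar> \<le> real (fst (fst k)) + 1" for j k
    using D(4)[of j "fst k"] by (auto simp: f_def case_prod_beta)
  then obtain r l where r: "strict_mono (r :: nat \<Rightarrow> nat)" and l: "\<And>k. (\<lambda>n. f (r n) k) \<longlonglongrightarrow> l k"
    using pointwise_convergent_subsequence[of f "\<lambda>k. real (fst (fst k)) + 1"] by blast
  define D' where "D' = {k. l (k, True) = 1}"
  define y' where "y' k = l (k, False)" for k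
  have evD: "\<forall>\<^sub>F j in sequentially. k \<in> D (r j) \<longleftrightarrow> k \<in> D'" for k
    using indicator_limit[of "\<lambda>n. k \<in> D (r n)" "l (k, True)"] l[of "(k, True)"] by (simp add: f_def D'_def)
  have yl: "(\<lambda>j. y (r j) k) \<longlonglongrightarrow> y' k" for k
    using l[of "(k, False)"] by (simp add: f_def y'_def)
  have D'1: "snd k < C (fst k)" "real (fst k) - 1 \<le> \<bar>y' k\<bar>" if "k \<in> D'" for k
  proof -
    have ev: "\<forall>\<^sub>F j in sequentially. k \<in> D (r j)" using evD[of k] that by simp
    then have "\<forall>\<^sub>F j in sequentially. snd k < C (fst k)" by (rule eventually_mono) (rule D(2))
    then show "snd k < C (fst k)" by simp
    have "(\<lambda>j. \<bar>y (r j) k\<bar>) \<longlonglongrightarrow> \<bar>y' k\<bar>" using yl by (rule tendsto_rabs)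
    moreover have "\<forall>\<^sub>F j in sequentially. real (fst k) - 1 \<le> \<bar>y (r j) k\<bar>"
      using ev by (rule eventually_mono) (intro less_imp_le D(3))
    ultimately show "real (fst k) - 1 \<le> \<bar>y' k\<bar>"
      by (rule tendsto_lowerbound) simp
  qed
  \<comment> \<open>The labels that can carry a point of modulus at most \<open>B\<close>. The
    strict lower bound on the modulus becomes weak in the limit, hence levels up to
    \<open>Suc B\<close>.\<close>
  define Q where "Q B = (SIGMA R:{..Suc B}. {..<C R})" for B
  have Qfin: "finite (Q B)" for B unfolding Q_def by (intro finite_SigmaI) auto
  have QI: "k \<in> Q B" if "snd k < C (fst k)" "real (fst k) - 1 \<le> real B" for k B
  proof -
    have "real (fst k) \<le> real (Suc B)" using that(2) by simp
    then have "fst k \<le> Suc B" by (simp only: of_nat_le_iff)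
    then show ?thesis using that(1) by (cases k) (auto simp: Q_def)
  qed
  let ?\<gamma> = "csum D' y'"
  show ?thesis
  proof
    show "strict_mono r" by fact
    show "?\<gamma> \<in> configs UNIV"
    proof (rule csum_configI)
      fix K :: "real set" assume "compact K"
      then obtain B0 where B0: "\<And>t. t \<in> K \<Longrightarrow> \<bar>t\<bar> \<le> B0"
        using compact_imp_bounded[OF \<open>compact K\<close>] by (auto simp: bounded_real)
      obtain B :: nat where B: "B0 \<le> real B" using real_arch_simple by blast
      have "{k \<in> D'. y' k \<in> K} \<subseteq> Q B"
      proof
        fix k assume k: "k \<in> {k \<in> D'. y' k \<in> K}"
        then have "real (fst k) - 1 \<le> real B" using D'1(2)[of k] B0[of "y' k"] B by force
        then show "k \<in> Q B" using k D'1(1) by (intro QI) auto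
      qed
      then show "finite {k \<in> D'. y' k \<in> K}" using Qfin by (rule finite_subset)
    qed auto
    show "vconv (\<lambda>j. u (r j)) ?\<gamma>"
      unfolding vconv_def
    proof (intro allI conjI)
      fix a b :: real
      obtain B :: nat where B: "max \<bar>a\<bar> \<bar>b\<bar> \<le> real B" using real_arch_simple by blast
      have DQ: "k \<in> Q B" if "k \<in> D j" "y j k \<in> {a..b}" for k j
      proof (rule QI)
        show "snd k < C (fst k)" using that D(2) by blast
        have "\<bar>y j k\<bar> \<le> real B" using that(2) B by auto
        then show "real (fst k) - 1 \<le> real B" using D(3)[OF that(1)] by linarith
      qed
      have D'Q: "k \<in> Q B" if "k \<in> D'" "y' k \<in> {a<..<b}" for k
      proof (rule QI)
        show "snd k < C (fst k)" using that D'1(1) by blast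
        have "\<bar>y' k\<bar> \<le> real B" using that(2) B by auto
        then show "real (fst k) - 1 \<le> real B" using D'1(2)[OF that(1)] by linarith
      qed
      have evD_Q: "\<forall>\<^sub>F j in sequentially. \<forall>k\<in>Q B. k \<in> D (r j) \<longleftrightarrow> k \<in> D'"
        using Qfin evD by (simp add: eventually_ball_finite)
      have "\<forall>\<^sub>F j in sequentially. y (r j) k \<in> {a..b} \<longrightarrow> y' k \<in> {a..b}" for k
      proof (cases "y' k \<in> {a..b}")
        case False
        then have "\<forall>\<^sub>F j in sequentially. y (r j) k \<in> - {a..b}"
          using topological_tendstoD[OF yl[of k], of "- {a..b}"] by auto
        then show ?thesis by (rule eventually_mono) auto
      qed simp
      then have "\<forall>\<^sub>F j in sequentially. \<forall>k\<in>Q B. y (r j) k \<in> {a..b} \<longrightarrow> y' k \<in> {a..b}"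
        using Qfin by (simp add: eventually_ball_finite)
      with evD_Q show "\<forall>\<^sub>F j in sequentially. emeasure (u (r j)) {a..b} \<le> emeasure ?\<gamma> {a..b}"
      proof eventually_elim
        case (elim j)
        have "{k \<in> D (r j). y (r j) k \<in> {a..b}} \<subseteq> {k \<in> D'. y' k \<in> {a..b}}"
          using DQ elim by blast
        then show ?case unfolding D(1) by (simp add: emeasure_csum emeasure_mono del: atLeastAtMost_iff)
      qed
      have "\<forall>\<^sub>F j in sequentially. y' k \<in> {a<..<b} \<longrightarrow> y (r j) k \<in> {a<..<b}" for k
      proof (cases "y' k \<in> {a<..<b}")
        case True
        then have "\<forall>\<^sub>F j in sequentially. y (r j) k \<in> {a<..<b}"
          using topological_tendstoD[OF yl[of k], of "{a<..<b}"] by auto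
        then show ?thesis by (rule eventually_mono) auto
      qed (simp del: greaterThanLessThan_iff)
      then have "\<forall>\<^sub>F j in sequentially. \<forall>k\<in>Q B. y' k \<in> {a<..<b} \<longrightarrow> y (r j) k \<in> {a<..<b}"
        using Qfin by (simp add: eventually_ball_finite)
      with evD_Q show "\<forall>\<^sub>F j in sequentially. emeasure ?\<gamma> {a<..<b} \<le> emeasure (u (r j)) {a<..<b}"
      proof eventually_elim
        case (elim j)
        have "{k \<in> D'. y' k \<in> {a<..<b}} \<subseteq> {k \<in> D (r j). y (r j) k \<in> {a<..<b}}"
          using D'Q elim by blast
        then show ?case unfolding D(1) by (simp add: emeasure_csum emeasure_mono del: greaterThanLessThan_iff)
      qed
    qed
  qed
qed

section \<open>Inner regularity and tightness of the Poisson measure\<close>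

context
  fixes \<pi> :: "real measure measure"
  assumes \<pi>: "poisson_measure \<pi>"
begin

definition vclosed :: "real measure set \<Rightarrow> bool" where
  "vclosed F \<longleftrightarrow> F \<in> sets \<pi> \<and> (\<forall>u \<gamma>. (\<forall>j. u j \<in> F) \<longrightarrow> \<gamma> \<in> configs UNIV \<longrightarrow> vconv u \<gamma> \<longrightarrow> \<gamma> \<in> F)"

definition inner_closed :: "real measure set \<Rightarrow> bool" where
  "inner_closed A \<longleftrightarrow> A \<in> sets \<pi> \<and> (\<forall>\<epsilon>>0. \<exists>F. vclosed F \<and> F \<subseteq> A \<and> measure \<pi> (A - F) < \<epsilon>)"

lemma vclosedD:
  assumes "vclosed F" "\<And>j. u j \<in> F" "\<gamma> \<in> configs UNIV" "vconv u \<gamma>"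
  shows "\<gamma> \<in> F"
  using assms(1)[unfolded vclosed_def, THEN conjunct2, rule_format, of u \<gamma>] assms(2-) by blast

lemma vclosed_Un:
  assumes "vclosed F" "vclosed G" shows "vclosed (F \<union> G)"
  unfolding vclosed_def
proof (intro conjI allI impI)
  show "F \<union> G \<in> sets \<pi>" using assms by (auto simp: vclosed_def)
  \<comment> \<open>A sequence in the union visits one of the two sets infinitely often; a
    subsequence stays there and has the same limit.\<close>
  have *: "\<gamma> \<in> H" if H: "vclosed H" and inf: "infinite {j. u j \<in> H}" and c: "\<gamma> \<in> configs UNIV" "vconv u \<gamma>"
    for H u \<gamma>
  proof -
    obtain r :: "nat \<Rightarrow> nat" where r: "strict_mono r" "\<And>j. r j \<in> {j. u j \<in> H}"
      using infinite_enumerate[OF inf] by blast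
    have "\<forall>j. u (r j) \<in> H" using r(2) by simp
    then show ?thesis
      using vclosedD[OF H _ c(1) vconv_subseq[OF c(2) r(1)]] by blast
  qed
  fix u \<gamma> assume u: "\<forall>j. u j \<in> F \<union> G" and c: "\<gamma> \<in> configs UNIV" "vconv u \<gamma>"
  have "{j. u j \<in> F} \<union> {j. u j \<in> G} = UNIV" using u by blast
  then have "infinite {j. u j \<in> F} \<or> infinite {j. u j \<in> G}"
    by (metis finite_UnI infinite_UNIV_nat)
  then show "\<gamma> \<in> F \<union> G" using *[OF assms(1) _ c] *[OF assms(2) _ c] by blast
qed

lemma vclosed_empty: "vclosed {}"
  by (simp add: vclosed_def)

lemma vclosed_UN: "finite S \<Longrightarrow> (\<And>i. i \<in> S \<Longrightarrow> vclosed (F i)) \<Longrightarrow> vclosed (\<Union>i\<in>S. F i)"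
  by (induction rule: finite_induct) (auto intro: vclosed_Un vclosed_empty)

lemma vclosed_INT:
  assumes "\<And>i::nat. vclosed (F i)" shows "vclosed (\<Inter>i. F i)"
  unfolding vclosed_def
proof (intro conjI allI impI)
  show "(\<Inter>i. F i) \<in> sets \<pi>" using assms by (intro sets.countable_INT) (auto simp: vclosed_def)
  fix u \<gamma> assume u: "\<forall>j. u j \<in> (\<Inter>i. F i)" and c: "\<gamma> \<in> configs UNIV" "vconv u \<gamma>"
  have "\<gamma> \<in> F i" for i by (rule vclosedD[OF assms _ c]) (use u in blast)
  then show "\<gamma> \<in> (\<Inter>i. F i)" by blast
qed

lemma inner_closed_vclosed: "vclosed F \<Longrightarrow> inner_closed F"
  unfolding inner_closed_def by (auto simp: vclosed_def intro!: exI[of _ F])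

text \<open>A countable union of closed sets need not be closed. Finitely many of the sets exhaust
  the union up to half of the error, and the other half is shared among their closed
  approximations.\<close>

lemma inner_closed_UN:
  assumes A: "\<And>i::nat. inner_closed (A i)" shows "inner_closed (\<Union>i. A i)"
  unfolding inner_closed_def
proof (intro conjI allI impI)
  interpret prob_space \<pi> by (rule poisson_prob_space[OF \<pi>])
  have As [measurable]: "A i \<in> sets \<pi>" for i using A by (simp add: inner_closed_def)
  show "(\<Union>i. A i) \<in> sets \<pi>" by measurable
  fix \<epsilon> :: real assume \<epsilon>: "\<epsilon> > 0"
  let ?U = "\<lambda>n. \<Union>i\<le>n. A i"
  have "(\<lambda>n. measure \<pi> (?U n)) \<longlonglongrightarrow> measure \<pi> (\<Union>n. ?U n)"
    by (intro finite_Lim_measure_incseq) (auto simp: incseq_def intro: order_trans)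
  moreover have "(\<Union>n. ?U n) = (\<Union>i. A i)" by auto
  ultimately have "\<forall>\<^sub>F n in sequentially. measure \<pi> (\<Union>i. A i) - \<epsilon> / 2 < measure \<pi> (?U n)"
    using \<epsilon> by (intro order_tendstoD) auto
  then obtain n where n: "measure \<pi> (\<Union>i. A i) - \<epsilon> / 2 < measure \<pi> (?U n)"
    by (auto simp: eventually_sequentially)
  have "\<epsilon> / (2 * real (Suc n)) > 0" using \<epsilon> by simp
  then have "\<exists>F. vclosed F \<and> F \<subseteq> A i \<and> measure \<pi> (A i - F) < \<epsilon> / (2 * real (Suc n))" for i
    using A[of i] unfolding inner_closed_def by blast
  then obtain F where F: "\<And>i. vclosed (F i)" "\<And>i. F i \<subseteq> A i"
    "\<And>i. measure \<pi> (A i - F i) < \<epsilon> / (2 * real (Suc n))" by metis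
  have Fs [measurable]: "F i \<in> sets \<pi>" for i using F(1) by (simp add: vclosed_def)
  have "measure \<pi> ((\<Union>i. A i) - (\<Union>i\<le>n. F i)) \<le> measure \<pi> (((\<Union>i. A i) - ?U n) \<union> (\<Union>i\<le>n. A i - F i))"
    by (intro finite_measure_mono) auto
  also have "\<dots> \<le> measure \<pi> ((\<Union>i. A i) - ?U n) + measure \<pi> (\<Union>i\<le>n. A i - F i)"
    by (intro measure_Un_le) auto
  also have "measure \<pi> ((\<Union>i. A i) - ?U n) = measure \<pi> (\<Union>i. A i) - measure \<pi> (?U n)"
    by (intro finite_measure_Diff) auto
  also have "measure \<pi> (\<Union>i\<le>n. A i - F i) \<le> (\<Sum>i\<le>n. measure \<pi> (A i - F i))"
    by (intro finite_measure_subadditive_finite) auto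
  also have "\<dots> \<le> (\<Sum>i\<le>n. \<epsilon> / (2 * real (Suc n)))"
    using F(3) by (intro sum_mono less_imp_le)
  also have "\<dots> = \<epsilon> / 2" by (simp del: of_nat_Suc)
  finally have "measure \<pi> ((\<Union>i. A i) - (\<Union>i\<le>n. F i)) < \<epsilon>" using n by simp
  then show "\<exists>F. vclosed F \<and> F \<subseteq> (\<Union>i. A i) \<and> measure \<pi> ((\<Union>i. A i) - F) < \<epsilon>"
    using F by (intro exI[of _ "\<Union>i\<le>n. F i"] conjI vclosed_UN) auto
qed

text \<open>Closed sets are stable under countable intersections, so all the sets are approximated
  at once, with errors halving from one to the next.\<close>

lemma inner_closed_INT:
  assumes A: "\<And>i::nat. inner_closed (A i)" shows "inner_closed (\<Inter>i. A i)"
  unfolding inner_closed_def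
proof (intro conjI allI impI)
  interpret prob_space \<pi> by (rule poisson_prob_space[OF \<pi>])
  have As [measurable]: "A i \<in> sets \<pi>" for i using A by (simp add: inner_closed_def)
  show "(\<Inter>i. A i) \<in> sets \<pi>" by measurable
  fix \<epsilon> :: real assume \<epsilon>: "\<epsilon> > 0"
  have "\<epsilon> / 2 * (1/2) ^ Suc i > 0" for i using \<epsilon> by simp
  then have "\<exists>F. vclosed F \<and> F \<subseteq> A i \<and> measure \<pi> (A i - F) < \<epsilon> / 2 * (1/2) ^ Suc i" for i
    using A[of i] unfolding inner_closed_def by blast
  then obtain F where F: "\<And>i. vclosed (F i)" "\<And>i. F i \<subseteq> A i"
    "\<And>i. measure \<pi> (A i - F i) < \<epsilon> / 2 * (1/2) ^ Suc i" by metis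
  have Fs [measurable]: "F i \<in> sets \<pi>" for i using F(1) by (simp add: vclosed_def)
  have sums: "(\<lambda>i. \<epsilon> / 2 * (1/2) ^ Suc i) sums (\<epsilon> / 2 * 1)"
    by (intro sums_mult power_half_series)
  have summ: "summable (\<lambda>i. measure \<pi> (A i - F i))"
    by (rule summable_comparison_test'[OF sums_summable[OF sums], of 0]) (use F(3) in \<open>auto intro: less_imp_le\<close>)
  have "measure \<pi> ((\<Inter>i. A i) - (\<Inter>i. F i)) \<le> measure \<pi> (\<Union>i. A i - F i)"
    by (intro finite_measure_mono) auto
  also have "\<dots> \<le> (\<Sum>i. measure \<pi> (A i - F i))"
    using summ by (intro finite_measure_subadditive_countably) auto
  also have "\<dots> \<le> (\<Sum>i. \<epsilon> / 2 * (1/2) ^ Suc i)"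
    using F(3) by (intro suminf_le summ sums_summable[OF sums]) (auto intro: less_imp_le)
  also have "\<dots> = \<epsilon> / 2" using sums_unique[OF sums] by simp
  finally have "measure \<pi> ((\<Inter>i. A i) - (\<Inter>i. F i)) < \<epsilon>" using \<epsilon> by simp
  then show "\<exists>F. vclosed F \<and> F \<subseteq> (\<Inter>i. A i) \<and> measure \<pi> ((\<Inter>i. A i) - F) < \<epsilon>"
    using F by (intro exI[of _ "\<Inter>i. F i"] conjI vclosed_INT) blast+
qed

lemma vclosed_count_ge: "vclosed {\<gamma> \<in> configs UNIV. of_nat k \<le> emeasure \<gamma> {a..b}}"
  unfolding vclosed_def
proof (intro conjI allI impI)
  show "{\<gamma> \<in> configs UNIV. of_nat k \<le> emeasure \<gamma> {a..b}} \<in> sets \<pi>"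
    by (rule poisson_count_measurable[OF \<pi>])
  fix u \<gamma> assume u: "\<forall>j. u j \<in> {\<gamma> \<in> configs UNIV. of_nat k \<le> emeasure \<gamma> {a..b}}"
    and \<gamma>: "\<gamma> \<in> configs UNIV" and v: "vconv u \<gamma>"
  have "\<forall>\<^sub>F j in sequentially. emeasure (u j) {a..b} \<le> emeasure \<gamma> {a..b}"
    using v unfolding vconv_def by blast
  then have "\<forall>\<^sub>F j in sequentially. of_nat k \<le> emeasure \<gamma> {a..b}"
    by (rule eventually_mono) (use u in \<open>auto intro: order_trans\<close>)
  then show "\<gamma> \<in> {\<gamma> \<in> configs UNIV. of_nat k \<le> emeasure \<gamma> {a..b}}" using \<gamma> by simp
qed

text \<open>Uses the half of \<open>vconv\<close> for open intervals, as the preceding lemma uses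
  the half for closed ones; together they supply the generators and their complements.\<close>

lemma vclosed_count_open_less: "vclosed {\<gamma> \<in> configs UNIV. emeasure \<gamma> {a<..<b} < of_nat k}"
  unfolding vclosed_def
proof (intro conjI allI impI)
  obtain R :: nat where "max \<bar>a\<bar> \<bar>b\<bar> \<le> real R" using real_arch_simple by blast
  then have R: "{a<..<b} \<inter> cwin R = {a<..<b}" by auto
  let ?A = "\<lambda>j. {max (a + 1 / real (Suc j)) (- real R)..min (b - 1 / real (Suc j)) (real R)}"
  have "of_nat k \<le> emeasure \<gamma> ({a<..<b} \<inter> cwin R) \<longleftrightarrow> (\<exists>j. of_nat k \<le> emeasure \<gamma> (?A j))"
    if "\<gamma> \<in> configs UNIV" for \<gamma>
    unfolding open_interval_Int_cwin
    by (rule config_count_ge_sup[OF that _ open_interval_Int_cwin_incseq]) simp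
  note this[unfolded R]
  then have "{\<gamma> \<in> configs UNIV. emeasure \<gamma> {a<..<b} < of_nat k} =
      space \<pi> - (\<Union>j. {\<gamma> \<in> configs UNIV. of_nat k \<le> emeasure \<gamma> (?A j)})"
    unfolding poisson_space[OF \<pi>] by (auto simp: not_le[symmetric])
  also have "\<dots> \<in> sets \<pi>"
    using poisson_count_measurable[OF \<pi>] by (intro sets.Diff sets.top sets.countable_UN) blast
  finally show "{\<gamma> \<in> configs UNIV. emeasure \<gamma> {a<..<b} < of_nat k} \<in> sets \<pi>" .
  fix u \<gamma> assume u: "\<forall>j. u j \<in> {\<gamma> \<in> configs UNIV. emeasure \<gamma> {a<..<b} < of_nat k}"
    and \<gamma>: "\<gamma> \<in> configs UNIV" and v: "vconv u \<gamma>"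
  have "\<forall>\<^sub>F j in sequentially. emeasure \<gamma> {a<..<b} \<le> emeasure (u j) {a<..<b}"
    using v unfolding vconv_def by blast
  then have "\<forall>\<^sub>F j in sequentially. emeasure \<gamma> {a<..<b} < of_nat k"
    by (rule eventually_mono) (use u in \<open>auto intro: order.strict_trans1\<close>)
  then show "\<gamma> \<in> {\<gamma> \<in> configs UNIV. emeasure \<gamma> {a<..<b} < of_nat k}" using \<gamma> by simp
qed

text \<open>By local finiteness a slightly larger open interval contains no new points. This
  exhibits the complement of a generator as a countable union of closed sets.\<close>

lemma count_less_iff_open:
  assumes "\<gamma> \<in> configs UNIV"
  shows "emeasure \<gamma> {a..b} < of_nat k \<longleftrightarrow>
    (\<exists>m. emeasure \<gamma> {a - 1 / real (Suc m)<..<b + 1 / real (Suc m)} < of_nat k)"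
proof
  assume "\<exists>m. emeasure \<gamma> {a - 1 / real (Suc m)<..<b + 1 / real (Suc m)} < of_nat k"
  then obtain m where m: "emeasure \<gamma> {a - 1 / real (Suc m)<..<b + 1 / real (Suc m)} < of_nat k" ..
  define e where "e = 1 / real (Suc m)"
  have "0 < e" by (simp add: e_def)
  then have "emeasure \<gamma> {a..b} \<le> emeasure \<gamma> {a - e<..<b + e}"
    using assms by (intro emeasure_mono) auto
  then show "emeasure \<gamma> {a..b} < of_nat k" using m unfolding e_def by order
next
  assume k: "emeasure \<gamma> {a..b} < of_nat k"
  obtain I :: "nat set" and x where x: "\<gamma> = csum I x" using config_csumE[OF assms] by blast
  let ?F = "{i \<in> I. x i \<in> {a - 1..b + 1}}" and ?K = "{i \<in> I. x i \<in> {a..b}}"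
  have F: "finite ?F" using assms unfolding x by (rule config_finite_compact) auto
  obtain \<theta> where \<theta>: "0 < \<theta>" "\<theta> \<le> 1" "\<And>i. i \<in> ?F - ?K \<Longrightarrow> \<theta> < max (a - x i) (x i - b)"
    by (rule finite_atoms_gap[of "?F - ?K" "\<lambda>i. max (a - x i) (x i - b)"]) (use F in auto)
  obtain m where m: "1 / real (Suc m) < \<theta>" using \<theta>(1) by (rule nat_approx_posE)
  define e where "e = 1 / real (Suc m)"
  have e: "0 < e" "e < \<theta>" using m by (auto simp: e_def)
  have "{i \<in> I. x i \<in> {a - e<..<b + e}} \<subseteq> ?K"
  proof
    fix i assume i: "i \<in> {i \<in> I. x i \<in> {a - e<..<b + e}}"
    then have "i \<in> ?F" using e \<theta>(2) by auto
    moreover have "\<not> \<theta> < max (a - x i) (x i - b)" using i e by auto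
    ultimately show "i \<in> ?K" using \<theta>(3) by blast
  qed
  then have "emeasure \<gamma> {a - e<..<b + e} \<le> emeasure \<gamma> {a..b}"
    unfolding x by (simp add: emeasure_csum emeasure_mono del: greaterThanLessThan_iff atLeastAtMost_iff)
  then show "\<exists>m. emeasure \<gamma> {a - 1 / real (Suc m)<..<b + 1 / real (Suc m)} < of_nat k"
    using k unfolding e_def by (intro exI[of _ m]) order
qed

text \<open>The sets which are inner closed together with their complements form a sigma-algebra;
  the complement is built in because closed approximation from inside does not pass to complements.
  Generators are closed, and their complements are countable unions of closed sets.\<close>

lemma poisson_inner_regular:
  assumes "A \<in> sets \<pi>" shows "inner_closed A"
proof -
  let ?\<Omega> = "configs (UNIV :: real set)"
  let ?R = "{A. inner_closed A \<and> inner_closed (?\<Omega> - A)}"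
  have sub: "A \<subseteq> ?\<Omega>" if "inner_closed A" for A
    using that sets.sets_into_space[of A \<pi>] unfolding inner_closed_def poisson_space[OF \<pi>] by blast
  have top: "inner_closed ?\<Omega>"
  proof -
    have "inner_closed {\<gamma> \<in> configs UNIV. of_nat 0 \<le> emeasure \<gamma> {0..0}}"
      by (rule inner_closed_vclosed[OF vclosed_count_ge])
    then show ?thesis by simp
  qed
  have "sigma_algebra ?\<Omega> ?R"
    unfolding sigma_algebra_iff2
  proof (intro conjI ballI allI impI)
    show "?R \<subseteq> Pow ?\<Omega>" using sub by blast
    show "{} \<in> ?R" using top inner_closed_vclosed[OF vclosed_empty] by simp
    show "?\<Omega> - A \<in> ?R" if "A \<in> ?R" for A
      using that sub[of A] by (auto simp: double_diff)
    fix A :: "nat \<Rightarrow> real measure set" assume A: "range A \<subseteq> ?R"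
    have "?\<Omega> - (\<Union>i. A i) = (\<Inter>i. ?\<Omega> - A i)" by auto
    then show "(\<Union>i. A i) \<in> ?R"
      using A inner_closed_UN[of A] inner_closed_INT[of "\<lambda>i. ?\<Omega> - A i"] by auto
  qed
  then interpret R: sigma_algebra ?\<Omega> ?R .
  let ?N = "sigma ?\<Omega> ?R"
  have sN: "sets ?N = ?R" using R.sets_measure_of_eq by simp
  have spN: "space ?N = ?\<Omega>" by (rule space_measure_of) (use sub in blast)
  have "{\<gamma> \<in> ?\<Omega>. of_nat k \<le> emeasure \<gamma> {a..b}} \<in> ?R" for a b k
  proof -
    have "?\<Omega> - {\<gamma> \<in> ?\<Omega>. of_nat k \<le> emeasure \<gamma> {a..b}} =
        (\<Union>m. {\<gamma> \<in> ?\<Omega>. emeasure \<gamma> {a - 1 / real (Suc m)<..<b + 1 / real (Suc m)} < of_nat k})"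
    proof -
      have "\<not> of_nat k \<le> emeasure \<gamma> {a..b} \<longleftrightarrow>
          (\<exists>m. emeasure \<gamma> {a - 1 / real (Suc m)<..<b + 1 / real (Suc m)} < of_nat k)" if "\<gamma> \<in> ?\<Omega>" for \<gamma>
        using count_less_iff_open[OF that] unfolding not_le .
      then show ?thesis by blast
    qed
    moreover have "inner_closed (\<Union>m. {\<gamma> \<in> ?\<Omega>. emeasure \<gamma> {a - 1 / real (Suc m)<..<b + 1 / real (Suc m)} < of_nat k})"
      by (intro inner_closed_UN inner_closed_vclosed vclosed_count_open_less)
    ultimately show ?thesis
      using inner_closed_vclosed[OF vclosed_count_ge[of k a b]] by simp
  qed
  then have "sets (borel_on (vague_topology UNIV)) \<subseteq> sets ?N"
    by (intro vague_borel_subset[OF _ spN]) (simp_all add: sN)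
  then show ?thesis using assms poisson_sets[OF \<pi>] sN by auto
qed

text \<open>Counts on each window are finite, so a level \<open>C R\<close> is exceeded or reached
  only with probability below \<open>\<epsilon> * (1/2) ^ Suc R\<close>, and these add up to
  \<open>\<epsilon>\<close>. Uniform count bounds are what \<open>vconv_compact\<close> asks
  for.\<close>

lemma poisson_tight:
  assumes "\<epsilon> > 0"
  obtains C :: "nat \<Rightarrow> nat" where "{\<gamma> \<in> configs UNIV. \<forall>R. emeasure \<gamma> (cwin R) \<le> of_nat (C R)} \<in> sets \<pi>"
    "1 - \<epsilon> \<le> measure \<pi> {\<gamma> \<in> configs UNIV. \<forall>R. emeasure \<gamma> (cwin R) \<le> of_nat (C R)}"
proof -
  interpret prob_space \<pi> by (rule poisson_prob_space[OF \<pi>])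
  let ?B = "\<lambda>R k. {\<gamma> \<in> configs UNIV. of_nat k \<le> emeasure \<gamma> (cwin R)}"
  have B: "?B R k \<in> sets \<pi>" for R k by (rule poisson_count_measurable[OF \<pi>])
  have lim: "(\<lambda>k. measure \<pi> (?B R k)) \<longlonglongrightarrow> 0" for R
  proof -
    have "(\<lambda>k. measure \<pi> (?B R k)) \<longlonglongrightarrow> measure \<pi> (\<Inter>k. ?B R k)"
    proof (rule finite_Lim_measure_decseq)
      show "decseq (?B R)" unfolding decseq_def by (auto intro: order_trans[rotated])
    qed (use B in blast)
    moreover have "(\<Inter>k. ?B R k) = {}"
    proof -
      have "\<exists>k. \<not> of_nat k \<le> emeasure \<gamma> (cwin R)" if g: "\<gamma> \<in> configs UNIV" for \<gamma>
      proof -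
        have "emeasure \<gamma> (cwin R) < \<infinity>" using g by (auto simp: configs_def)
        then obtain k where "emeasure \<gamma> (cwin R) < of_nat k" using ennreal_Ex_less_of_nat by auto
        then show ?thesis by (auto simp: not_le)
      qed
      then show ?thesis by blast
    qed
    ultimately show ?thesis by simp
  qed
  have "\<exists>k. measure \<pi> (?B R k) < \<epsilon> * (1/2) ^ Suc R" for R
  proof -
    have "\<forall>\<^sub>F k in sequentially. measure \<pi> (?B R k) < \<epsilon> * (1/2) ^ Suc R"
      using lim assms by (intro order_tendstoD(2)) auto
    then show ?thesis by (auto simp: eventually_sequentially)
  qed
  then obtain C where C: "\<And>R. measure \<pi> (?B R (C R)) < \<epsilon> * (1/2) ^ Suc R" by metis
  have sums: "(\<lambda>i. \<epsilon> * (1/2) ^ Suc i) sums (\<epsilon> * 1)"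
    by (intro sums_mult power_half_series)
  have summ: "summable (\<lambda>R. measure \<pi> (?B R (C R)))"
    by (rule summable_comparison_test'[OF sums_summable[OF sums], of 0]) (use C in \<open>auto intro: less_imp_le\<close>)
  let ?U = "\<Union>R. ?B R (C R)"
  have U: "?U \<in> sets \<pi>" using B by (intro sets.countable_UN) blast
  have "measure \<pi> ?U \<le> (\<Sum>R. measure \<pi> (?B R (C R)))"
    using summ B by (intro finite_measure_subadditive_countably) blast+
  also have "\<dots> \<le> (\<Sum>i. \<epsilon> * (1/2) ^ Suc i)"
    using C by (intro suminf_le summ sums_summable[OF sums]) (auto intro: less_imp_le)
  also have "\<dots> = \<epsilon>" using sums_unique[OF sums] by simp
  finally have "1 - \<epsilon> \<le> measure \<pi> (space \<pi> - ?U)" using prob_compl[OF U] by simp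
  moreover have sub: "space \<pi> - ?U \<subseteq> {\<gamma> \<in> configs UNIV. \<forall>R. emeasure \<gamma> (cwin R) \<le> of_nat (C R)}"
    unfolding poisson_space[OF \<pi>] by (auto simp: not_le intro: less_imp_le)
  moreover have "{\<gamma> \<in> configs UNIV. \<forall>R. emeasure \<gamma> (cwin R) \<le> of_nat (C R)} \<in> sets \<pi>"
  proof -
    have "emeasure \<gamma> (cwin R) \<le> of_nat (C R) \<longleftrightarrow> \<not> of_nat (Suc (C R)) \<le> emeasure \<gamma> (cwin R)"
      if g: "\<gamma> \<in> configs UNIV" for \<gamma> R
    proof -
      have "emeasure \<gamma> (cwin R) < \<infinity>" using g by (auto simp: configs_def)
      then obtain k :: nat where "emeasure \<gamma> (cwin R) = of_nat k"
        using config_count_cases[OF g, of "cwin R"] by auto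
      then show ?thesis by (auto simp del: of_nat_Suc)
    qed
    then have "{\<gamma> \<in> configs UNIV. \<forall>R. emeasure \<gamma> (cwin R) \<le> of_nat (C R)} = space \<pi> - (\<Union>R. ?B R (Suc (C R)))"
      unfolding poisson_space[OF \<pi>] by blast
    also have "\<dots> \<in> sets \<pi>" using B by (intro sets.Diff sets.top sets.countable_UN) blast
    finally show ?thesis .
  qed
  moreover from this sub have "measure \<pi> (space \<pi> - ?U) \<le> measure \<pi> {\<gamma> \<in> configs UNIV. \<forall>R. emeasure \<gamma> (cwin R) \<le> of_nat (C R)}"
    by (intro finite_measure_mono)
  ultimately show ?thesis by (intro that[of C]) auto
qed

text \<open>
  On a compact set of near continuity, a sequence of violating pairs would converge to a pair
  violating the Lipschitz bound, because the matching distance is the supremum of the window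
  distances.
\<close>

lemma lipschitz_up_to_window:
  fixes Y :: "'b mm"
  assumes Y: "mm_space Y" and \<phi>: "\<phi> \<in> measurable \<pi> (snd Y)"
    and E: "E \<in> sets \<pi>" "emeasure \<pi> E = 1"
    and lip: "\<And>u v. u \<in> E \<Longrightarrow> v \<in> E \<Longrightarrow> ennreal (mdist (fst Y) (\<phi> u) (\<phi> v)) \<le> config_dist UNIV u v"
    and \<epsilon>: "\<epsilon> > 0"
  obtains K n y N where "K \<in> sets \<pi>" "1 - \<epsilon> \<le> measure \<pi> K" "n \<ge> 1"
    "\<And>u v. u \<in> K \<Longrightarrow> v \<in> K \<Longrightarrow> mdist (fst Y) (\<phi> u) (\<phi> v) \<le> wdist n u v + 3 * \<epsilon>"
    "\<And>i. y i \<in> mspace (fst Y)" "\<And>u. u \<in> K \<Longrightarrow> \<exists>i<N::nat. mdist (fst Y) (y i) (\<phi> u) < \<epsilon>"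
proof -
  interpret prob_space \<pi> by (rule poisson_prob_space[OF \<pi>])
  let ?d = "mdist (fst Y)"
  have E\<Omega>: "E \<subseteq> configs UNIV" using sets.sets_into_space[OF E(1)] by (simp add: poisson_space[OF \<pi>])
  have \<phi>m: "\<phi> u \<in> mspace (fst Y)" if "u \<in> configs UNIV" for u
    using measurable_space[OF \<phi>, of u] that by (simp add: poisson_space[OF \<pi>] space_mm_space[OF Y])
  have "separable_space (mtopology_of (fst Y))" using Y by (simp add: mm_space_def)
  then obtain y :: "nat \<Rightarrow> _" where y: "\<And>i. y i \<in> mspace (fst Y)"
    and dense: "\<And>x e. x \<in> mspace (fst Y) \<Longrightarrow> e > 0 \<Longrightarrow> \<exists>i. ?d (y i) x < e"
    using dense_sequence mm_space_nonempty[OF Y] by metis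
  define h where "h = \<epsilon> / 2"
  have h: "h > 0" "h + h = \<epsilon>" using \<epsilon> by (auto simp: h_def)
  define n where "n x = (LEAST i. ?d (y i) x < h)" for x
  have n: "?d (y (n x)) x < h" if "x \<in> mspace (fst Y)" for x
    unfolding n_def using dense[OF that h(1)] by (rule LeastI_ex)
  have [measurable]: "Measurable.pred (snd Y) (\<lambda>x. ?d (y i) x < h)" for i
    using mball_in_sets[OF y] Y by (simp add: pred_def space_mm_space mm_space_def)
  have nm: "n \<in> measurable (snd Y) (count_space UNIV)" unfolding n_def by measurable
  \<comment> \<open>On each piece the map varies by less than \<open>\<epsilon>\<close>. Closed
    subsets of finitely many pieces take the place of a set of continuity as in Lusin's theorem, and
    they stay inside \<open>E\<close>.\<close>
  define A where "A i = E \<inter> ((\<lambda>u. n (\<phi> u)) -` {i} \<inter> space \<pi>)" for i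
  have A [measurable]: "A i \<in> sets \<pi>" for i
    unfolding A_def using E(1) measurable_sets[OF measurable_compose[OF \<phi> nm], of "{i}"] by auto
  have AE: "u \<in> E" "n (\<phi> u) = i" if "u \<in> A i" for u i using that by (auto simp: A_def)
  have "(\<lambda>k. measure \<pi> (\<Union>i\<le>k. A i)) \<longlonglongrightarrow> measure \<pi> (\<Union>k. \<Union>i\<le>k. A i)"
    by (intro finite_Lim_measure_incseq) (auto simp: incseq_def intro: order_trans)
  moreover have "(\<Union>k. \<Union>i\<le>k. A i) = E"
    using E\<Omega> by (auto simp: A_def poisson_space[OF \<pi>])
  moreover have "measure \<pi> E = 1" using E by (simp add: measure_def)
  ultimately have "\<forall>\<^sub>F k in sequentially. 1 - \<epsilon> / 3 < measure \<pi> (\<Union>i\<le>k. A i)"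
    using \<epsilon> by (intro order_tendstoD(1)) auto
  then obtain N where N: "1 - \<epsilon> / 3 < measure \<pi> (\<Union>i\<le>N. A i)"
    by (auto simp: eventually_sequentially)
  have "\<epsilon> / (3 * real (Suc N)) > 0" using \<epsilon> by simp
  then have "\<exists>F. vclosed F \<and> F \<subseteq> A i \<and> measure \<pi> (A i - F) < \<epsilon> / (3 * real (Suc N))" for i
    using poisson_inner_regular[OF A[of i]] unfolding inner_closed_def by blast
  then obtain F where F: "\<And>i. vclosed (F i)" "\<And>i. F i \<subseteq> A i"
    "\<And>i. measure \<pi> (A i - F i) < \<epsilon> / (3 * real (Suc N))" by metis
  have Fs [measurable]: "F i \<in> sets \<pi>" for i using F(1) by (simp add: vclosed_def)
  obtain C :: "nat \<Rightarrow> nat" where C: "{\<gamma> \<in> configs UNIV. \<forall>R. emeasure \<gamma> (cwin R) \<le> of_nat (C R)} \<in> sets \<pi>"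
    "1 - \<epsilon> / 3 \<le> measure \<pi> {\<gamma> \<in> configs UNIV. \<forall>R. emeasure \<gamma> (cwin R) \<le> of_nat (C R)}"
    by (rule poisson_tight[of "\<epsilon> / 3"]) (use \<epsilon> in auto)
  define T where "T = {\<gamma> \<in> configs UNIV. \<forall>R. emeasure \<gamma> (cwin R) \<le> of_nat (C R)}"
  have T [measurable]: "T \<in> sets \<pi>" "1 - \<epsilon> / 3 \<le> measure \<pi> T" using C by (auto simp: T_def)
  \<comment> \<open>Each third of \<open>\<epsilon>\<close> pays for one loss: the pieces beyond
    \<open>N\<close>, the passage to closed subsets, and the configurations without the count
    bounds.\<close>
  let ?K = "T \<inter> (\<Union>i\<le>N. F i)"
  have Km: "?K \<in> sets \<pi>" by measurable
  have "1 - \<epsilon> \<le> measure \<pi> ?K"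
  proof -
    have "measure \<pi> (space \<pi> - ?K) \<le> measure \<pi> ((space \<pi> - T) \<union> ((space \<pi> - (\<Union>i\<le>N. A i)) \<union> (\<Union>i\<le>N. A i - F i)))"
      by (intro finite_measure_mono) auto
    also have "\<dots> \<le> measure \<pi> (space \<pi> - T) + measure \<pi> ((space \<pi> - (\<Union>i\<le>N. A i)) \<union> (\<Union>i\<le>N. A i - F i))"
      by (intro measure_Un_le) auto
    also have "measure \<pi> ((space \<pi> - (\<Union>i\<le>N. A i)) \<union> (\<Union>i\<le>N. A i - F i))
        \<le> measure \<pi> (space \<pi> - (\<Union>i\<le>N. A i)) + measure \<pi> (\<Union>i\<le>N. A i - F i)"
      by (intro measure_Un_le) auto
    also have "measure \<pi> (\<Union>i\<le>N. A i - F i) \<le> (\<Sum>i\<le>N. measure \<pi> (A i - F i))"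
      by (intro finite_measure_subadditive_finite) auto
    also have "\<dots> \<le> (\<Sum>i\<le>N. \<epsilon> / (3 * real (Suc N)))"
      using F(3) by (intro sum_mono less_imp_le)
    also have "\<dots> = \<epsilon> / 3" by (simp del: of_nat_Suc)
    also have "measure \<pi> (space \<pi> - T) = 1 - measure \<pi> T" by (rule prob_compl) simp
    also have "measure \<pi> (space \<pi> - (\<Union>i\<le>N. A i)) = 1 - measure \<pi> (\<Union>i\<le>N. A i)" by (rule prob_compl) auto
    finally have "measure \<pi> (space \<pi> - ?K) \<le> \<epsilon>" using N T(2) by simp
    then show ?thesis using prob_compl[OF Km] by simp
  qed
  have KE: "u \<in> E" "u \<in> configs UNIV" if "u \<in> ?K" for u
    using that F(2) AE(1) by (auto simp: T_def)
  have near: "?d (\<phi> u) (\<phi> v) < \<epsilon>" if "u \<in> F i" "v \<in> F i" for u v i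
  proof -
    have uv: "u \<in> A i" "v \<in> A i" using that F(2) by auto
    then have m: "\<phi> u \<in> mspace (fst Y)" "\<phi> v \<in> mspace (fst Y)" using AE(1) E\<Omega> \<phi>m by blast+
    have "?d (\<phi> u) (\<phi> v) \<le> ?d (\<phi> u) (y i) + ?d (y i) (\<phi> v)" using m y by (intro mdist_triangle)
    moreover have "?d (y i) (\<phi> u) < h" "?d (y i) (\<phi> v) < h"
      using n[OF m(1)] n[OF m(2)] AE(2)[OF uv(1)] AE(2)[OF uv(2)] by auto
    ultimately show ?thesis using mdist_commute[of "fst Y" "\<phi> u" "y i"] h by linarith
  qed
  have "\<exists>m\<ge>1. \<forall>u\<in>?K. \<forall>v\<in>?K. ?d (\<phi> u) (\<phi> v) \<le> wdist m u v + 3 * \<epsilon>"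
  proof (rule ccontr)
    assume none: "\<not> ?thesis"
    have "\<exists>u v. u \<in> ?K \<and> v \<in> ?K \<and> wdist (Suc m) u v + 3 * \<epsilon> < ?d (\<phi> u) (\<phi> v)" for m
    proof (rule ccontr)
      assume "\<not> ?thesis"
      then have "\<forall>u\<in>?K. \<forall>v\<in>?K. ?d (\<phi> u) (\<phi> v) \<le> wdist (Suc m) u v + 3 * \<epsilon>" by (meson not_less)
      with none show False by (metis le_add1 plus_1_eq_Suc)
    qed
    then obtain u v where uK: "\<And>m. u m \<in> ?K" and vK: "\<And>m. v m \<in> ?K"
      and viol: "\<And>m. wdist (Suc m) (u m) (v m) + 3 * \<epsilon> < ?d (\<phi> (u m)) (\<phi> (v m))" by metis
    have "\<exists>i\<le>N. u m \<in> F i" "\<exists>i\<le>N. v m \<in> F i" for m using uK[of m] vK[of m] by auto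
    then obtain iu iv where iu: "\<And>m. iu m \<le> N" "\<And>m. u m \<in> F (iu m)"
      and iv: "\<And>m. iv m \<le> N" "\<And>m. v m \<in> F (iv m)" by metis
    \<comment> \<open>By pigeonhole both sequences stay in fixed closed pieces along a subsequence.
      Their limits lie in the same pieces, where the map is within \<open>\<epsilon>\<close> of its
      values along the sequence.\<close>
    let ?p = "\<lambda>m. (iu m, iv m)"
    have "finite (range ?p)" by (rule finite_subset[of _ "{..N} \<times> {..N}"]) (use iu iv in auto)
    then obtain m0 where "infinite {m \<in> UNIV. ?p m = ?p m0}"
      using pigeonhole_infinite[of "UNIV :: nat set" ?p] by auto
    then have "infinite {m. iu m = iu m0 \<and> iv m = iv m0}" by simp
    then obtain r0 :: "nat \<Rightarrow> nat" where r0: "strict_mono r0"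
      and r0i: "\<And>j. iu (r0 j) = iu m0" "\<And>j. iv (r0 j) = iv m0"
      using infinite_enumerate by blast
    have ub: "w \<in> configs UNIV" "emeasure w (cwin R) \<le> of_nat (C R)" if "w \<in> ?K" for w R
      using that by (auto simp: T_def)
    obtain r1 \<gamma> where r1: "strict_mono (r1 :: nat \<Rightarrow> nat)" "\<gamma> \<in> configs UNIV" "vconv (\<lambda>j. u (r0 (r1 j))) \<gamma>"
      by (rule vconv_compact[of "\<lambda>j. u (r0 j)" C, OF ub(1)[OF uK] ub(2)[OF uK]])
    obtain r2 \<eta> where r2: "strict_mono (r2 :: nat \<Rightarrow> nat)" "\<eta> \<in> configs UNIV" "vconv (\<lambda>j. v (r0 (r1 (r2 j)))) \<eta>"
      by (rule vconv_compact[of "\<lambda>j. v (r0 (r1 j))" C, OF ub(1)[OF vK] ub(2)[OF vK]])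
    define r where "r j = r0 (r1 (r2 j))" for j
    have r: "strict_mono r" using r0 r1(1) r2(1) by (auto simp: r_def strict_mono_def)
    have cu: "vconv (\<lambda>j. u (r j)) \<gamma>" unfolding r_def by (rule vconv_subseq[OF r1(3) r2(1)])
    have cv: "vconv (\<lambda>j. v (r j)) \<eta>" unfolding r_def by (rule r2(3))
    have uF: "u (r j) \<in> F (iu m0)" and vF: "v (r j) \<in> F (iv m0)" for j
      using iu(2)[of "r j"] iv(2)[of "r j"] r0i unfolding r_def by auto
    have \<gamma>F: "\<gamma> \<in> F (iu m0)" and \<eta>F: "\<eta> \<in> F (iv m0)"
      using vclosedD[OF F(1) uF r1(2) cu] vclosedD[OF F(1) vF r2(2) cv] .
    have \<gamma>E: "\<gamma> \<in> E" and \<eta>E: "\<eta> \<in> E" using \<gamma>F \<eta>F F(2) AE(1) by blast+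
    \<comment> \<open>Of the margin \<open>3 * \<epsilon>\<close>, the two moves to the limits
      consume \<open>2 * \<epsilon>\<close>; the remaining \<open>\<epsilon>\<close> gives the
      contradiction.\<close>
    define c where "c = ?d (\<phi> \<gamma>) (\<phi> \<eta>) - \<epsilon>"
    have small: "wdist (Suc (r j)) (u (r j)) (v (r j)) \<le> c" for j
    proof -
      have ms: "\<phi> \<gamma> \<in> mspace (fst Y)" "\<phi> \<eta> \<in> mspace (fst Y)" "\<phi> (u (r j)) \<in> mspace (fst Y)" "\<phi> (v (r j)) \<in> mspace (fst Y)"
        using \<phi>m r1(2) r2(2) ub(1)[OF uK] ub(1)[OF vK] by blast+
      have "\<bar>?d (\<phi> \<gamma>) (\<phi> \<eta>) - ?d (\<phi> (u (r j))) (\<phi> (v (r j)))\<bar> \<le> 2 * \<epsilon>"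
        using near[OF uF \<gamma>F] near[OF vF \<eta>F] by (intro mdist_perturb ms less_imp_le)
      then show ?thesis using viol[of "r j"] by (simp add: c_def abs_le_iff)
    qed
    \<comment> \<open>For fixed m the violated bounds belong to larger windows eventually and
      dominate \<open>wdist m\<close>, which passes to the limit.\<close>
    have "wdist m \<gamma> \<eta> \<le> c" for m
    proof (rule LIMSEQ_le_const)
      have "(\<lambda>j. wdist m \<gamma> (u (r j)) + c + wdist m \<eta> (v (r j))) \<longlonglongrightarrow> 0 + c + 0"
        using cu cv ub(1)[OF uK] ub(1)[OF vK] r1(2) r2(2)
        by (intro tendsto_add tendsto_const wdist_tendsto_of_vconv) auto
      then show "(\<lambda>j. wdist m \<gamma> (u (r j)) + c + wdist m \<eta> (v (r j))) \<longlonglongrightarrow> c" by simp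
      have "wdist m \<gamma> \<eta> \<le> wdist m \<gamma> (u (r j)) + c + wdist m \<eta> (v (r j))" if "m \<le> j" for j
      proof -
        note uc = ub(1)[OF uK[of "r j"]] and vc = ub(1)[OF vK[of "r j"]]
        have "m \<le> Suc (r j)" using that seq_suble[OF r, of j] by simp
        then have "wdist m (u (r j)) (v (r j)) \<le> c"
          using wdist_le_window[OF uc vc] small[of j] by (meson order_trans)
        moreover have "wdist m \<gamma> \<eta> \<le> wdist m \<gamma> (u (r j)) + wdist m (u (r j)) \<eta>"
          by (intro wdist_triangle r1(2) r2(2) uc)
        moreover have "wdist m (u (r j)) \<eta> \<le> wdist m (u (r j)) (v (r j)) + wdist m (v (r j)) \<eta>"
          by (intro wdist_triangle r2(2) uc vc)
        moreover have "wdist m (v (r j)) \<eta> = wdist m \<eta> (v (r j))"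
          by (intro wdist_commute r2(2) vc)
        ultimately show ?thesis by linarith
      qed
      then show "\<exists>M. \<forall>j\<ge>M. wdist m \<gamma> \<eta> \<le> wdist m \<gamma> (u (r j)) + c + wdist m \<eta> (v (r j))" by blast
    qed
    then have "config_dist UNIV \<gamma> \<eta> \<le> ennreal c" "0 \<le> c"
      using config_dist_le_of_wdist_le[OF r1(2) r2(2)] wdist_nonneg order_trans by blast+
    then have "ennreal (?d (\<phi> \<gamma>) (\<phi> \<eta>)) \<le> ennreal c"
      using lip[OF \<gamma>E \<eta>E] by order
    then have "?d (\<phi> \<gamma>) (\<phi> \<eta>) \<le> c" using \<open>0 \<le> c\<close> by (simp add: ennreal_le_iff)
    then show False using \<epsilon> by (simp add: c_def)
  qed
  then obtain m where m: "m \<ge> 1" "\<And>u v. u \<in> ?K \<Longrightarrow> v \<in> ?K \<Longrightarrow> ?d (\<phi> u) (\<phi> v) \<le> wdist m u v + 3 * \<epsilon>" by blast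
  show ?thesis
  proof (rule that[OF Km \<open>1 - \<epsilon> \<le> measure \<pi> ?K\<close> m y])
    fix u assume u: "u \<in> ?K"
    then obtain i where "i \<le> N" "u \<in> F i" by blast
    then have "?d (y i) (\<phi> u) < h"
      using n[OF \<phi>m[OF KE(2)[OF u]]] AE(2)[of u i] F(2) by auto
    then have "?d (y i) (\<phi> u) < \<epsilon>" using h by linarith
    then show "\<exists>i<Suc N. ?d (y i) (\<phi> u) < \<epsilon>" using \<open>i \<le> N\<close> by (intro exI[of _ i]) auto
  qed
qed

end

section \<open>Observables\<close>

context prob_space
begin

definition ky_fan_bound :: "('a \<Rightarrow> real) \<Rightarrow> ('a \<Rightarrow> real) \<Rightarrow> real set" where
  "ky_fan_bound f g = {\<epsilon>. \<epsilon> > 0 \<and> measure M {x \<in> space M. \<bar>f x - g x\<bar> > \<epsilon>} \<le> \<epsilon>}"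

lemma ky_fan_bound_nonempty: "1 \<in> ky_fan_bound f g"
  by (simp add: ky_fan_bound_def)

lemma ky_fan_bdd: "bdd_below (ky_fan_bound f g)"
  by (rule bdd_belowI[of _ 0]) (auto simp: ky_fan_bound_def)

lemma ky_fan_Inf: "ky_fan M f g = Inf (ky_fan_bound f g)"
  by (simp add: ky_fan_def ky_fan_bound_def)

lemma ky_fan_nonneg: "0 \<le> ky_fan M f g"
  unfolding ky_fan_Inf
proof (rule cInf_greatest)
  show "ky_fan_bound f g \<noteq> {}" using ky_fan_bound_nonempty[of f g] by blast
qed (simp add: ky_fan_bound_def)

lemma ky_fan_lessD:
  assumes "ky_fan M f g < e" "f \<in> borel_measurable M" "g \<in> borel_measurable M"
  shows "measure M {x \<in> space M. \<bar>f x - g x\<bar> > e} \<le> e"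
proof -
  have "ky_fan_bound f g \<noteq> {}" using ky_fan_bound_nonempty[of f g] by blast
  then obtain d where d: "d \<in> ky_fan_bound f g" "d < e"
    using assms(1) unfolding ky_fan_Inf cInf_less_iff[OF \<open>ky_fan_bound f g \<noteq> {}\<close> ky_fan_bdd] by blast
  have [measurable]: "f \<in> borel_measurable M" "g \<in> borel_measurable M" by fact+
  have "measure M {x \<in> space M. \<bar>f x - g x\<bar> > e} \<le> measure M {x \<in> space M. \<bar>f x - g x\<bar> > d}"
    using d(2) by (intro finite_measure_mono) auto
  then show ?thesis using d by (simp add: ky_fan_bound_def)
qed

lemma ky_fan_le: "e > 0 \<Longrightarrow> measure M {x \<in> space M. \<bar>f x - g x\<bar> > e} \<le> e \<Longrightarrow> ky_fan M f g \<le> e"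
  unfolding ky_fan_Inf by (intro cInf_lower ky_fan_bdd) (simp add: ky_fan_bound_def)

lemma ky_fan_commute: "ky_fan M f g = ky_fan M g f"
  by (simp add: ky_fan_def abs_minus_commute)

lemma ky_fan_cong_AE:
  assumes f: "f \<in> borel_measurable M" "f' \<in> borel_measurable M" and g: "g \<in> borel_measurable M" "g' \<in> borel_measurable M"
    and ae: "AE x in M. f x - g x = f' x - g' x"
  shows "ky_fan M f g = ky_fan M f' g'"
proof -
  have [measurable]: "f \<in> borel_measurable M" "f' \<in> borel_measurable M" "g \<in> borel_measurable M" "g' \<in> borel_measurable M"
    by fact+
  have "measure M {x \<in> space M. \<bar>f x - g x\<bar> > e} = measure M {x \<in> space M. \<bar>f' x - g' x\<bar> > e}" for e
    by (rule finite_measure_eq_AE) (use ae in \<open>auto elim: eventually_mono\<close>)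
  then show ?thesis by (simp add: ky_fan_def)
qed

lemma ky_fan_triangle:
  assumes [measurable]: "f \<in> borel_measurable M" "g \<in> borel_measurable M" "h \<in> borel_measurable M"
  shows "ky_fan M f h \<le> ky_fan M f g + ky_fan M g h"
proof (rule field_le_epsilon)
  fix e :: real assume e: "e > 0"
  define a where "a = ky_fan M f g + e / 2"
  define b where "b = ky_fan M g h + e / 2"
  have ab: "a > 0" "b > 0" using e ky_fan_nonneg[of f g] ky_fan_nonneg[of g h] by (auto simp: a_def b_def)
  have "measure M {x \<in> space M. \<bar>f x - h x\<bar> > a + b}
      \<le> measure M ({x \<in> space M. \<bar>f x - g x\<bar> > a} \<union> {x \<in> space M. \<bar>g x - h x\<bar> > b})"
    by (intro finite_measure_mono) auto
  also have "\<dots> \<le> measure M {x \<in> space M. \<bar>f x - g x\<bar> > a} + measure M {x \<in> space M. \<bar>g x - h x\<bar> > b}"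
    by (intro measure_Un_le) auto
  also have "measure M {x \<in> space M. \<bar>f x - g x\<bar> > a} \<le> a"
    using e by (intro ky_fan_lessD) (auto simp: a_def)
  also have "measure M {x \<in> space M. \<bar>g x - h x\<bar> > b} \<le> b"
    using e by (intro ky_fan_lessD) (auto simp: b_def)
  finally have "ky_fan M f h \<le> a + b" using ab by (intro ky_fan_le) auto
  then show "ky_fan M f h \<le> ky_fan M f g + ky_fan M g h + e" by (simp add: a_def b_def)
qed

text \<open>The distance between classes modulo constants. Shifting one argument is enough, because
  the Ky Fan distance depends on the difference of its arguments only.\<close>

definition ky_fan_mod :: "('a \<Rightarrow> real) \<Rightarrow> ('a \<Rightarrow> real) \<Rightarrow> real" where
  "ky_fan_mod f g = (INF c. ky_fan M f (\<lambda>x. g x + c))"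

lemma ky_fan_mod_bdd: "bdd_below (range (\<lambda>c. ky_fan M f (\<lambda>x. g x + c)))"
  by (rule bdd_belowI[of _ 0]) (auto simp: ky_fan_nonneg)

lemma ky_fan_mod_nonneg: "0 \<le> ky_fan_mod f g"
  unfolding ky_fan_mod_def by (rule cINF_greatest) (auto simp: ky_fan_nonneg)

lemma ky_fan_mod_le: "ky_fan_mod f g \<le> ky_fan M f (\<lambda>x. g x + c)"
  unfolding ky_fan_mod_def by (rule cINF_lower[OF ky_fan_mod_bdd]) simp

lemma ky_fan_mod_lessD: "ky_fan_mod f g < e \<Longrightarrow> \<exists>c. ky_fan M f (\<lambda>x. g x + c) < e"
  unfolding ky_fan_mod_def by (subst (asm) cINF_less_iff[OF _ ky_fan_mod_bdd]) auto

lemma ky_fan_mod_commute: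
  assumes [measurable]: "f \<in> borel_measurable M" "g \<in> borel_measurable M"
  shows "ky_fan_mod f g = ky_fan_mod g f"
proof -
  have *: "ky_fan_mod f g \<le> ky_fan_mod g f"
    if [measurable]: "f \<in> borel_measurable M" "g \<in> borel_measurable M" for f g
    unfolding ky_fan_mod_def[of g f]
  proof (rule cINF_greatest)
    fix c
    have "ky_fan_mod f g \<le> ky_fan M f (\<lambda>x. g x + - c)" by (rule ky_fan_mod_le)
    also have "\<dots> = ky_fan M (\<lambda>x. f x + c) g" by (rule ky_fan_cong_AE) auto
    also have "\<dots> = ky_fan M g (\<lambda>x. f x + c)" by (rule ky_fan_commute)
    finally show "ky_fan_mod f g \<le> ky_fan M g (\<lambda>x. f x + c)" .
  qed simp
  show ?thesis using *[of f g] *[of g f] assms by simp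
qed

lemma ky_fan_mod_triangle:
  assumes [measurable]: "f \<in> borel_measurable M" "g \<in> borel_measurable M" "h \<in> borel_measurable M"
  shows "ky_fan_mod f h \<le> ky_fan_mod f g + ky_fan_mod g h"
proof (rule field_le_epsilon)
  fix e :: real assume e: "e > 0"
  obtain c where c: "ky_fan M f (\<lambda>x. g x + c) < ky_fan_mod f g + e / 2"
    using ky_fan_mod_lessD[of f g "ky_fan_mod f g + e / 2"] e by auto
  obtain d where d: "ky_fan M g (\<lambda>x. h x + d) < ky_fan_mod g h + e / 2"
    using ky_fan_mod_lessD[of g h "ky_fan_mod g h + e / 2"] e by auto
  have "ky_fan_mod f h \<le> ky_fan M f (\<lambda>x. h x + (c + d))" by (rule ky_fan_mod_le)
  also have "\<dots> \<le> ky_fan M f (\<lambda>x. g x + c) + ky_fan M (\<lambda>x. g x + c) (\<lambda>x. h x + (c + d))"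
    by (rule ky_fan_triangle) auto
  also have "ky_fan M (\<lambda>x. g x + c) (\<lambda>x. h x + (c + d)) = ky_fan M g (\<lambda>x. h x + d)"
    by (rule ky_fan_cong_AE) auto
  finally show "ky_fan_mod f h \<le> ky_fan_mod f g + ky_fan_mod g h + e" using c d by simp
qed

text \<open>It is not clear beforehand that an optimal constant exists. Near-optimal constants form
  a Cauchy sequence, since two exceptional sets of probability below 1/2 leave a common point at
  which the constants can be compared; the limit is the required constant.\<close>

lemma ky_fan_mod_zero:
  assumes [measurable]: "f \<in> borel_measurable M" "g \<in> borel_measurable M" and z: "ky_fan_mod f g = 0"
  shows "\<exists>c. AE x in M. f x = g x + c"
proof -
  \<comment> \<open>Starting at 1/3 keeps all terms below 1/2, so that two exceptional sets never
    cover the space.\<close>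
  define e where "e n = 1 / real (n + 3)" for n :: nat
  have e: "0 < e n" "e n < 1/2" for n by (auto simp: e_def divide_simps)
  have "\<exists>c. ky_fan M f (\<lambda>x. g x + c) < e n" for n
    using ky_fan_mod_lessD[of f g "e n"] e(1)[of n] z by simp
  then obtain c where c: "\<And>n. ky_fan M f (\<lambda>x. g x + c n) < e n" by metis
  have P: "measure M {x \<in> space M. \<bar>f x - (g x + c n)\<bar> > e n} \<le> e n" for n
    by (rule ky_fan_lessD[OF c]) auto
  have cc: "\<bar>c n - c m\<bar> \<le> e n + e m" for n m
  proof (rule ccontr)
    assume far: "\<not> ?thesis"
    have "space M \<subseteq> {x \<in> space M. \<bar>f x - (g x + c n)\<bar> > e n} \<union> {x \<in> space M. \<bar>f x - (g x + c m)\<bar> > e m}"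
      using far by auto
    then have "measure M (space M) \<le> measure M ({x \<in> space M. \<bar>f x - (g x + c n)\<bar> > e n} \<union> {x \<in> space M. \<bar>f x - (g x + c m)\<bar> > e m})"
      by (intro finite_measure_mono) auto
    also have "\<dots> \<le> measure M {x \<in> space M. \<bar>f x - (g x + c n)\<bar> > e n} + measure M {x \<in> space M. \<bar>f x - (g x + c m)\<bar> > e m}"
      by (intro measure_Un_le) auto
    also have "\<dots> < 1" using P[of n] P[of m] e(2)[of n] e(2)[of m] by linarith
    finally show False by (simp add: prob_space)
  qed
  have e0: "e \<longlonglongrightarrow> 0"
    using LIMSEQ_ignore_initial_segment[OF lim_inverse_n', of 3] by (simp add: e_def[abs_def])
  have "Cauchy c"
  proof (rule metric_CauchyI)
    fix d :: real assume "d > 0"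
    then obtain N where N: "\<And>n. n \<ge> N \<Longrightarrow> e n < d / 2"
      using order_tendstoD(2)[OF e0, of "d / 2"] by (auto simp: eventually_sequentially)
    have "dist (c m) (c n) < d" if "m \<ge> N" "n \<ge> N" for m n
      using cc[of m n] N[OF that(1)] N[OF that(2)] by (simp add: dist_real_def)
    then show "\<exists>N. \<forall>m\<ge>N. \<forall>n\<ge>N. dist (c m) (c n) < d" by blast
  qed
  then obtain k where k: "c \<longlonglongrightarrow> k" using Cauchy_convergent_iff convergent_def by blast
  have ck: "\<bar>c n - k\<bar> \<le> e n" for n
  proof (rule LIMSEQ_le)
    show "(\<lambda>m. \<bar>c n - c m\<bar>) \<longlonglongrightarrow> \<bar>c n - k\<bar>" by (intro tendsto_intros k)
    have "(\<lambda>m. e n + e m) \<longlonglongrightarrow> e n + 0" by (intro tendsto_intros e0)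
    then show "(\<lambda>m. e n + e m) \<longlonglongrightarrow> e n" by simp
  qed (use cc in blast)
  have "AE x in M. \<bar>f x - (g x + k)\<bar> \<le> d" if "d > 0" for d
  proof -
    let ?B = "{x \<in> space M. \<bar>f x - (g x + k)\<bar> > d}"
    have "measure M ?B \<le> 0"
    proof (rule LIMSEQ_le_const[OF e0])
      obtain N where N: "\<And>n. n \<ge> N \<Longrightarrow> e n < d / 2"
        using order_tendstoD(2)[OF e0, of "d / 2"] \<open>d > 0\<close> by (auto simp: eventually_sequentially)
      have "measure M ?B \<le> e n" if "n \<ge> N" for n
      proof -
        have "measure M ?B \<le> measure M {x \<in> space M. \<bar>f x - (g x + c n)\<bar> > e n}"
          using N[OF that] ck[of n] by (intro finite_measure_mono) auto
        then show ?thesis using P[of n] by linarith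
      qed
      then show "\<exists>N. \<forall>n\<ge>N. measure M ?B \<le> e n" by blast
    qed
    then have "measure M ?B = 0" by (simp add: order_antisym)
    then have "?B \<in> null_sets M" by (intro null_setsI) (auto simp: emeasure_eq_measure)
    then show ?thesis by (rule AE_I') auto
  qed
  then have "AE x in M. \<forall>n. \<bar>f x - (g x + k)\<bar> \<le> 1 / real (Suc n)"
    by (subst AE_all_countable) simp
  then have "AE x in M. f x = g x + k"
  proof eventually_elim
    case (elim x)
    show ?case
    proof (rule ccontr)
      assume "f x \<noteq> g x + k"
      then have "\<bar>f x - (g x + k)\<bar> > 0" by simp
      then obtain n where "1 / real (Suc n) < \<bar>f x - (g x + k)\<bar>" by (rule nat_approx_posE)
      then show False using elim by (meson not_le)
    qed
  qed
  then show ?thesis by blast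
qed

end

lemma Lip1_add_const: "f \<in> Lip1 X \<Longrightarrow> (\<lambda>x. f x + c) \<in> Lip1 X"
  by (auto simp: Lip1_def)

lemma L1_space_metric:
  fixes X :: "'a emm"
  assumes "prob_space (emm_meas X)"
  shows "mspace (L1_space X) = Lip1 X // ae_const_rel X"
    and "f \<in> Lip1 X \<Longrightarrow> g \<in> Lip1 X \<Longrightarrow> mdist (L1_space X) (ae_const_rel X `` {f}) (ae_const_rel X `` {g}) =
      prob_space.ky_fan_mod (emm_meas X) f g"
proof -
  interpret prob_space "emm_meas X" by fact
  let ?S = "Lip1 X" and ?r = "ae_const_rel X"
  have meas: "f \<in> borel_measurable (emm_meas X)" if "f \<in> ?S" for f using that by (simp add: Lip1_def)
  have r: "(f, g) \<in> ?r \<longleftrightarrow> f \<in> ?S \<and> g \<in> ?S \<and> (\<exists>c. AE x in emm_meas X. f x = g x + c)" for f g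
    by (simp add: ae_const_rel_def)
  have equiv: "equiv ?S ?r"
  proof (rule equivI)
    show "?r \<subseteq> ?S \<times> ?S" by (auto simp: r)
    show "refl_on ?S ?r" by (auto simp: refl_on_def r intro: exI[of _ 0])
    show "sym ?r"
    proof (rule symI)
      fix f g assume "(f, g) \<in> ?r"
      then obtain c where c: "AE x in emm_meas X. f x = g x + c" "f \<in> ?S" "g \<in> ?S" by (auto simp: r)
      have "AE x in emm_meas X. g x = f x + (- c)" using c(1) by eventually_elim simp
      then show "(g, f) \<in> ?r" using c unfolding r by blast
    qed
    show "trans ?r"
    proof (rule transI)
      fix f g h assume "(f, g) \<in> ?r" "(g, h) \<in> ?r"
      then obtain c d where c: "AE x in emm_meas X. f x = g x + c" "f \<in> ?S" and d: "AE x in emm_meas X. g x = h x + d" "h \<in> ?S"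
        by (auto simp: r)
      have "AE x in emm_meas X. f x = h x + (c + d)" using c(1) d(1) by eventually_elim simp
      then show "(f, h) \<in> ?r" using c d unfolding r by blast
    qed
  qed
  \<comment> \<open>Members of a class are its shifts up to null sets, so the infimum over two
    classes runs through the same values as the infimum over one constant.\<close>
  have cls: "class_dist (ky_fan (emm_meas X)) (?r `` {f}) (?r `` {g}) = ky_fan_mod f g"
    if f: "f \<in> ?S" and g: "g \<in> ?S" for f g
  proof -
    have "(\<lambda>(f', g'). ky_fan (emm_meas X) f' g') ` (?r `` {f} \<times> ?r `` {g}) = range (\<lambda>c. ky_fan (emm_meas X) f (\<lambda>x. g x + c))"
    proof
      show "(\<lambda>(f', g'). ky_fan (emm_meas X) f' g') ` (?r `` {f} \<times> ?r `` {g}) \<subseteq> range (\<lambda>c. ky_fan (emm_meas X) f (\<lambda>x. g x + c))"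
      proof
        fix t assume "t \<in> (\<lambda>(f', g'). ky_fan (emm_meas X) f' g') ` (?r `` {f} \<times> ?r `` {g})"
        then obtain f' g' where *: "(f, f') \<in> ?r" "(g, g') \<in> ?r" "t = ky_fan (emm_meas X) f' g'" by auto
        then obtain c d where c: "AE x in emm_meas X. f x = f' x + c" "f' \<in> ?S" and d: "AE x in emm_meas X. g x = g' x + d" "g' \<in> ?S"
          by (auto simp: r)
        have "ky_fan (emm_meas X) f' g' = ky_fan (emm_meas X) f (\<lambda>x. g x + (c - d))"
        proof (rule ky_fan_cong_AE)
          show "AE x in emm_meas X. f' x - g' x = f x - (g x + (c - d))"
            using c(1) d(1) by eventually_elim simp
        qed (use meas f g c d in auto)
        then show "t \<in> range (\<lambda>c. ky_fan (emm_meas X) f (\<lambda>x. g x + c))" using * by blast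
      qed
      show "range (\<lambda>c. ky_fan (emm_meas X) f (\<lambda>x. g x + c)) \<subseteq> (\<lambda>(f', g'). ky_fan (emm_meas X) f' g') ` (?r `` {f} \<times> ?r `` {g})"
      proof
        fix t assume "t \<in> range (\<lambda>c. ky_fan (emm_meas X) f (\<lambda>x. g x + c))"
        then obtain c where t: "t = ky_fan (emm_meas X) f (\<lambda>x. g x + c)" by blast
        have "(f, f) \<in> ?r" using f by (auto simp: r intro: exI[of _ 0])
        moreover have "(g, \<lambda>x. g x + c) \<in> ?r"
          using g Lip1_add_const[OF g, of c] by (auto simp: r intro!: exI[of _ "- c"])
        ultimately show "t \<in> (\<lambda>(f', g'). ky_fan (emm_meas X) f' g') ` (?r `` {f} \<times> ?r `` {g})"
          unfolding t by (intro image_eqI[of _ _ "(f, \<lambda>x. g x + c)"]) auto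
      qed
    qed
    then show ?thesis unfolding class_dist_def ky_fan_mod_def by simp
  qed
  have zero: "ky_fan_mod f g = 0 \<longleftrightarrow> (f, g) \<in> ?r" if f: "f \<in> ?S" and g: "g \<in> ?S" for f g
  proof
    assume "ky_fan_mod f g = 0"
    then show "(f, g) \<in> ?r" using ky_fan_mod_zero[OF meas[OF f] meas[OF g]] f g by (simp add: r)
  next
    assume "(f, g) \<in> ?r"
    then obtain c where c: "AE x in emm_meas X. f x = g x + c" by (auto simp: r)
    have "ky_fan_mod f g \<le> ky_fan (emm_meas X) f (\<lambda>x. g x + c)" by (rule ky_fan_mod_le)
    also have "\<dots> = ky_fan (emm_meas X) f f"
    proof (rule ky_fan_cong_AE)
      show "AE x in emm_meas X. f x - (g x + c) = f x - f x" using c by eventually_elim simp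
    qed (use meas f g in auto)
    also have "\<dots> \<le> 0"
      by (rule field_le_epsilon) (use ky_fan_le[of _ f f] in simp)
    finally show "ky_fan_mod f g = 0" using ky_fan_mod_nonneg[of f g] by simp
  qed
  show "mspace (L1_space X) = Lip1 X // ae_const_rel X"
    unfolding L1_space_def
    by (rule mspace_quotient_metric[OF equiv cls])
      (use meas zero in \<open>auto intro: ky_fan_mod_nonneg ky_fan_mod_commute ky_fan_mod_triangle\<close>)
  show "mdist (L1_space X) (ae_const_rel X `` {f}) (ae_const_rel X `` {g}) = ky_fan_mod f g"
    if "f \<in> Lip1 X" "g \<in> Lip1 X"
    unfolding L1_space_def
    by (rule mdist_quotient_metric[OF equiv cls])
      (use meas zero that in \<open>auto intro: ky_fan_mod_nonneg ky_fan_mod_commute ky_fan_mod_triangle\<close>)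
qed

section \<open>Separated observables: truncated distances to the configuration\<close>

lemma separated_not_compact:
  fixes m :: "'a metric"
  assumes p: "\<And>j::nat. p j \<in> mspace m" and \<delta>: "\<delta> > 0" and sep: "\<And>i j. i \<noteq> j \<Longrightarrow> \<delta> \<le> mdist m (p i) (p j)"
  shows "\<not> compact_space (mtopology_of m)"
proof
  assume comp: "compact_space (mtopology_of m)"
  interpret Metric_space "mspace m" "mdist m" by simp
  have "mtotally_bounded (mspace m)"
    using comp by (intro compactin_imp_mtotally_bounded) (simp add: compact_space_def mtopology_of_def)
  then obtain K where K: "finite K" "K \<subseteq> mspace m" "mspace m \<subseteq> (\<Union>x\<in>K. mball x (\<delta> / 2))"
    using \<delta> unfolding mtotally_bounded_def by (meson half_gt_zero)
  have "\<exists>x\<in>K. p j \<in> mball x (\<delta> / 2)" for j using K(3) p[of j] by blast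
  then obtain q where q: "\<And>j. q j \<in> K" "\<And>j. p j \<in> mball (q j) (\<delta> / 2)" by metis
  \<comment> \<open>Infinitely many points share finitely many centres, so two of them lie in one
    ball of radius \<open>\<delta> / 2\<close>.\<close>
  have "finite (range q)" by (rule finite_subset[OF _ K(1)]) (use q in auto)
  then have "\<not> inj q" using finite_imageD[of q UNIV] by auto
  then obtain i j where ij: "i \<noteq> j" "q i = q j" unfolding inj_def by blast
  have "mdist m (p i) (p j) \<le> mdist m (p i) (q i) + mdist m (q i) (p j)"
    using p q K(2) by (intro triangle) auto
  also have "\<dots> < \<delta> / 2 + \<delta> / 2"
    using q(2)[of i] q(2)[of j] ij by (intro add_strict_mono) (auto simp: commute)
  finally show False using sep[OF ij(1)] by simp
qed

text \<open>The minimum of 1/2 and the distance from \<open>c\<close> to the configuration. The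
  inserted 1/2 also gives the value at configurations without any points.\<close>

definition nearest :: "real \<Rightarrow> real measure \<Rightarrow> real" where
  "nearest c \<gamma> = Inf (insert (1/2) {t. 0 \<le> t \<and> 1 \<le> emeasure \<gamma> {c - t..c + t}})"

lemma nearest_bdd: "bdd_below (insert (1/2) {t::real. 0 \<le> t \<and> P t})"
  by (rule bdd_belowI[of _ 0]) auto

lemma nearest_le_half: "nearest c \<gamma> \<le> 1/2"
  unfolding nearest_def by (intro cInf_lower nearest_bdd) simp

lemma nearest_le: "0 \<le> t \<Longrightarrow> 1 \<le> emeasure \<gamma> {c - t..c + t} \<Longrightarrow> nearest c \<gamma> \<le> t"
  unfolding nearest_def by (intro cInf_lower nearest_bdd) simp

lemma nearest_lessD:
  assumes "nearest c \<gamma> < a" "a \<le> 1/2"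
  shows "\<exists>t. 0 \<le> t \<and> t < a \<and> 1 \<le> emeasure \<gamma> {c - t..c + t}"
  using assms unfolding nearest_def by (subst (asm) cInf_less_iff[OF _ nearest_bdd]) auto

text \<open>Serves measurability: the strict inequality becomes a countable union of conditions on
  counts of closed intervals. A negative radius does no harm, since the interval is then
  empty.\<close>

lemma nearest_less_iff:
  assumes "\<gamma> \<in> configs UNIV" "a \<le> 1/2"
  shows "nearest c \<gamma> < a \<longleftrightarrow> (\<exists>m. of_nat 1 \<le> emeasure \<gamma> {c - (a - 1 / real (Suc m))..c + (a - 1 / real (Suc m))})"
proof
  assume "nearest c \<gamma> < a"
  then obtain t where t: "0 \<le> t" "t < a" "1 \<le> emeasure \<gamma> {c - t..c + t}"
    using nearest_lessD assms(2) by blast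
  then have "a - t > 0" by simp
  then obtain m where m: "1 / real (Suc m) < a - t" by (rule nat_approx_posE)
  define e where "e = 1 / real (Suc m)"
  have "emeasure \<gamma> {c - t..c + t} \<le> emeasure \<gamma> {c - (a - e)..c + (a - e)}"
  proof (rule emeasure_mono)
    have "e < a - t" using m unfolding e_def .
    then show "{c - t..c + t} \<subseteq> {c - (a - e)..c + (a - e)}" by auto
  qed (use assms(1) in simp)
  then show "\<exists>m. of_nat 1 \<le> emeasure \<gamma> {c - (a - 1 / real (Suc m))..c + (a - 1 / real (Suc m))}"
    using t(3) unfolding e_def of_nat_1 by (intro exI[of _ m]) (rule order_trans)
next
  assume "\<exists>m. of_nat 1 \<le> emeasure \<gamma> {c - (a - 1 / real (Suc m))..c + (a - 1 / real (Suc m))}"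
  then obtain m where m: "of_nat 1 \<le> emeasure \<gamma> {c - (a - 1 / real (Suc m))..c + (a - 1 / real (Suc m))}" ..
  define e where "e = 1 / real (Suc m)"
  have e: "e > 0" by (simp add: e_def)
  have e2: "1 \<le> emeasure \<gamma> {c - (a - e)..c + (a - e)}" using m unfolding e_def of_nat_1 .
  have "0 \<le> a - e"
  proof (rule ccontr)
    assume "\<not> ?thesis"
    then have "{c - (a - e)..c + (a - e)} = {}" by auto
    then show False using e2 by simp
  qed
  then have "nearest c \<gamma> \<le> a - e" using e2 by (rule nearest_le)
  then show "nearest c \<gamma> < a" using e by simp
qed

text \<open>A coupling of total cost below \<open>r\<^sup>2\<close> moves every single point by less
  than \<open>r\<close>; hence a point near \<open>c\<close> has a partner almost as near.\<close>

lemma nearest_lipschitz: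
  assumes conf: "\<gamma> \<in> configs UNIV" "\<eta> \<in> configs UNIV"
  shows "ennreal \<bar>nearest c \<gamma> - nearest c \<eta>\<bar> \<le> config_dist UNIV \<gamma> \<eta>"
proof (rule ccontr)
  assume "\<not> ?thesis"
  then have less: "config_dist UNIV \<gamma> \<eta> < ennreal \<bar>nearest c \<gamma> - nearest c \<eta>\<bar>" by simp
  define r where "r = \<bar>nearest c \<gamma> - nearest c \<eta>\<bar>"
  obtain I :: "nat set" and x y where xy: "\<gamma> = csum I x" "\<eta> = csum I y"
    and cost: "(\<integral>\<^sup>+ i. ennreal (\<bar>x i - y i\<bar>\<^sup>2) \<partial>count_space I) < ennreal (r\<^sup>2)"
    using config_dist_lessE[OF _ conf less] unfolding r_def by auto
  have "\<exists>s<r. \<forall>i\<in>I. \<bar>x i - y i\<bar> \<le> s"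
  proof -
    define s where "s = sqrt (enn2real (\<integral>\<^sup>+ i. ennreal (\<bar>x i - y i\<bar>\<^sup>2) \<partial>count_space I))"
    have fin: "(\<integral>\<^sup>+ i. ennreal (\<bar>x i - y i\<bar>\<^sup>2) \<partial>count_space I) < \<infinity>"
      using cost by (rule order.strict_trans) simp
    then have S: "(\<integral>\<^sup>+ i. ennreal (\<bar>x i - y i\<bar>\<^sup>2) \<partial>count_space I) = ennreal (s\<^sup>2)" by (simp add: s_def)
    have s0: "s \<ge> 0" by (simp add: s_def)
    have "s\<^sup>2 < r\<^sup>2" using cost unfolding S by (simp add: ennreal_less_iff)
    then have "s < r" by (rule power2_less_imp_less) (simp add: r_def)
    moreover have "\<bar>x i - y i\<bar> \<le> s" if i: "i \<in> I" for i
    proof -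
      have "ennreal (\<bar>x i - y i\<bar>\<^sup>2) \<le> (\<integral>\<^sup>+ j. ennreal (\<bar>x j - y j\<bar>\<^sup>2) \<partial>count_space I)"
        using i by (rule nn_integral_ge_point)
      then have "\<bar>x i - y i\<bar>\<^sup>2 \<le> s\<^sup>2" unfolding S by (simp add: ennreal_le_iff)
      then show ?thesis using s0 by (rule power2_le_imp_le)
    qed
    ultimately show ?thesis by blast
  qed
  then obtain s where s: "s < r" "\<And>i. i \<in> I \<Longrightarrow> \<bar>x i - y i\<bar> \<le> s" by blast
  \<comment> \<open>Only \<open>s < r\<close> has been recorded about \<open>s\<close>, not its
    sign, hence \<open>max s 0\<close>.\<close>
  have one: "nearest c (csum I b) \<le> max s 0 + nearest c (csum I a)"
    if ab: "\<And>i. i \<in> I \<Longrightarrow> \<bar>a i - b i\<bar> \<le> s" and ca: "csum I a \<in> configs UNIV" and cb: "csum I b \<in> configs UNIV" for a b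
  proof (rule field_le_epsilon)
    fix e :: real assume e: "e > 0"
    show "nearest c (csum I b) \<le> max s 0 + nearest c (csum I a) + e"
    proof (cases "nearest c (csum I a) + e \<le> 1/2")
      case False
      then show ?thesis using nearest_le_half[of c "csum I b"] by linarith
    next
      case True
      obtain t where t: "0 \<le> t" "t < nearest c (csum I a) + e" "1 \<le> emeasure (csum I a) {c - t..c + t}"
        using nearest_lessD[OF _ True, of c "csum I a"] e by auto
      then have "emeasure (count_space UNIV) {i \<in> I. a i \<in> {c - t..c + t}} \<noteq> 0"
        by (auto simp: emeasure_csum simp del: atLeastAtMost_iff)
      then have "{i \<in> I. a i \<in> {c - t..c + t}} \<noteq> {}" by (metis emeasure_empty)
      then obtain i where i: "i \<in> I" "a i \<in> {c - t..c + t}" by blast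
      let ?T = "{c - (t + max s 0)..c + (t + max s 0)}"
      have bi: "b i \<in> ?T" using ab[OF i(1)] i(2) by auto
      have "1 = emeasure (count_space UNIV) {i}" by simp
      also have "\<dots> \<le> emeasure (count_space UNIV) {i \<in> I. b i \<in> ?T}"
        using i(1) bi by (intro emeasure_mono) auto
      also have "\<dots> = emeasure (csum I b) ?T" by (simp add: emeasure_csum)
      finally have "nearest c (csum I b) \<le> t + max s 0" using t(1) by (intro nearest_le) auto
      then show ?thesis using t(2) by simp
    qed
  qed
  have "r \<le> max s 0"
    using one[of x y] one[of y x] s(2) conf unfolding xy r_def by (auto simp: abs_minus_commute)
  moreover have "r > 0" using less unfolding r_def by (auto simp: not_le intro: ccontr)
  ultimately show False using s(1) by auto
qed

lemma poisson_not_concentrated: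
  assumes \<pi>: "poisson_measure \<pi>"
  shows "\<not> concentrated (config_emm \<pi>)"
proof -
  interpret prob_space \<pi> by (rule poisson_prob_space[OF \<pi>])
  note sp = poisson_space[OF \<pi>]
  let ?X = "config_emm \<pi>"
  have X: "emm_meas ?X = \<pi>" "emm_dist ?X = config_dist UNIV" by (auto simp: config_emm_def)
  define f where "f j = nearest (3 * real j)" for j :: nat
  have fm [measurable]: "nearest c \<in> borel_measurable \<pi>" for c
    unfolding borel_measurable_iff_less
  proof
    fix a
    show "{\<gamma> \<in> space \<pi>. nearest c \<gamma> < a} \<in> sets \<pi>"
    proof (cases "a \<le> 1/2")
      case True
      have "{\<gamma> \<in> space \<pi>. nearest c \<gamma> < a} =
          (\<Union>m. {\<gamma> \<in> configs UNIV. of_nat 1 \<le> emeasure \<gamma> {c - (a - 1 / real (Suc m))..c + (a - 1 / real (Suc m))}})"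
        unfolding sp using nearest_less_iff[OF _ True] by blast
      also have "\<dots> \<in> sets \<pi>"
        using poisson_count_measurable[OF \<pi>] by (intro sets.countable_UN) blast
      finally show ?thesis .
    next
      case False
      then have "nearest c \<gamma> < a" for \<gamma> using nearest_le_half[of c \<gamma>] by linarith
      then have "{\<gamma> \<in> space \<pi>. nearest c \<gamma> < a} = space \<pi>" by auto
      then show ?thesis by simp
    qed
  qed
  have fL: "f j \<in> Lip1 ?X" for j
    unfolding Lip1_def X f_def
    using nearest_lipschitz sp by (auto intro!: bexI[of _ "space \<pi>"] simp: emeasure_space_1)
  \<comment> \<open>The probability of no point within 1/2 of one centre but some point within 1/4
    of another: the void probability of a set of length 1 minus that of a set of length 3/2. On this
    event the two observables differ by at least 1/4.\<close>
  define p where "p = exp (-1) - exp (- (3/2 :: real))"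
  have p: "p > 0" by (simp add: p_def)
  have event: "p \<le> measure \<pi> {\<gamma> \<in> space \<pi>. nearest (3 * real i) \<gamma> - nearest (3 * real j) \<gamma> \<ge> 1/4}"
    if ij: "i \<noteq> j" for i j :: nat
  proof -
    let ?a = "3 * real i" and ?b = "3 * real j"
    let ?A = "{?a - 1/2..?a + 1/2}" and ?B = "{?b - 1/4..?b + 1/4}"
    obtain n :: nat where n: "max ?a ?b + 1 \<le> real n" using real_arch_simple by blast
    have n1: "n \<ge> 1" using n by (cases n) auto
    have sub: "?A \<subseteq> cwin n" "?B \<subseteq> cwin n" using n by auto
    have apart: "\<bar>?a - ?b\<bar> \<ge> 3"
    proof -
      have "\<bar>real i - real j\<bar> \<ge> 1" using ij by linarith
      then show ?thesis by linarith
    qed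
    let ?V = "\<lambda>S. {\<gamma> \<in> configs UNIV. emeasure \<gamma> S = 0}"
    have "emeasure \<pi> (?V (?A \<union> {1..0})) = ennreal (exp (- measure lborel (?A \<union> {1..0})))"
      \<comment> \<open>The empty interval \<open>{1..0}\<close> reduces the formula for two
        intervals to one.\<close>
      by (rule poisson_void[OF \<pi> n1 sub(1)]) simp
    then have vA: "emeasure \<pi> (?V ?A) = ennreal (exp (-1))" by simp
    have lAB: "measure lborel (?A \<union> ?B) = 3/2"
    proof -
      have "?A \<inter> ?B = {}" using apart by auto
      then have "measure lborel (?A \<union> ?B) = measure lborel ?A + measure lborel ?B"
        by (intro measure_Union) auto
      then show ?thesis by simp
    qed
    have vAB: "emeasure \<pi> (?V (?A \<union> ?B)) = ennreal (exp (- (3/2)))"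
      using poisson_void[OF \<pi> n1 sub] unfolding lAB .
    have mA: "?V ?A \<in> sets \<pi>" "?V (?A \<union> ?B) \<in> sets \<pi>"
    proof -
      \<comment> \<open>A set outside the sigma-algebra would have measure 0 by convention, so a
        positive value already proves measurability.\<close>
      have inS: "S \<in> sets \<pi>" if S: "emeasure \<pi> S = ennreal r" "r > 0" for S r
      proof (rule ccontr)
        assume "S \<notin> sets \<pi>"
        then have "emeasure \<pi> S = 0" by (rule emeasure_notin_sets)
        then show False using S by simp
      qed
      show "?V ?A \<in> sets \<pi>" by (rule inS[OF vA exp_gt_zero])
      show "?V (?A \<union> ?B) \<in> sets \<pi>" by (rule inS[OF vAB exp_gt_zero])
    qed
    have "measure \<pi> (?V ?A - ?V (?A \<union> ?B)) = measure \<pi> (?V ?A) - measure \<pi> (?V (?A \<union> ?B))"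
    proof (rule finite_measure_Diff[OF mA])
      show "?V (?A \<union> ?B) \<subseteq> ?V ?A"
      proof
        fix \<gamma> assume g: "\<gamma> \<in> ?V (?A \<union> ?B)"
        then have "emeasure \<gamma> ?A \<le> emeasure \<gamma> (?A \<union> ?B)" by (intro emeasure_mono) auto
        then show "\<gamma> \<in> ?V ?A" using g by simp
      qed
    qed
    also have "\<dots> = p" using vA vAB by (simp add: measure_def p_def)
    finally have eq: "measure \<pi> (?V ?A - ?V (?A \<union> ?B)) = p" .
    have le: "measure \<pi> (?V ?A - ?V (?A \<union> ?B)) \<le> measure \<pi> {\<gamma> \<in> space \<pi>. nearest ?a \<gamma> - nearest ?b \<gamma> \<ge> 1/4}"
    proof (rule finite_measure_mono)
      show "?V ?A - ?V (?A \<union> ?B) \<subseteq> {\<gamma> \<in> space \<pi>. nearest ?a \<gamma> - nearest ?b \<gamma> \<ge> 1/4}"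
      proof
        fix \<gamma> assume g: "\<gamma> \<in> ?V ?A - ?V (?A \<union> ?B)"
        then have gc: "\<gamma> \<in> configs UNIV" "emeasure \<gamma> ?A = 0" "emeasure \<gamma> (?A \<union> ?B) \<noteq> 0" by auto
        have "emeasure \<gamma> (?A \<union> ?B) \<le> emeasure \<gamma> ?A + emeasure \<gamma> ?B"
          using gc(1) by (intro emeasure_subadditive) auto
        then have "emeasure \<gamma> ?B \<noteq> 0" using gc by auto
        then have "1 \<le> emeasure \<gamma> ?B"
          using config_count_cases[OF gc(1), of ?B] by (auto simp: Suc_le_eq)
        then have b: "nearest ?b \<gamma> \<le> 1/4" by (intro nearest_le) auto
        have a: "nearest ?a \<gamma> \<ge> 1/2"
        proof (rule ccontr)
          assume "\<not> ?thesis"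
          then obtain t where t: "0 \<le> t" "t < 1/2" "1 \<le> emeasure \<gamma> {?a - t..?a + t}"
            using nearest_lessD[of ?a \<gamma> "1/2"] by auto
          have "emeasure \<gamma> {?a - t..?a + t} \<le> emeasure \<gamma> ?A"
            using t gc(1) by (intro emeasure_mono) auto
          then show False using t(3) gc(2) by simp
        qed
        show "\<gamma> \<in> {\<gamma> \<in> space \<pi>. nearest ?a \<gamma> - nearest ?b \<gamma> \<ge> 1/4}"
          using a b gc(1) sp by auto
      qed
    qed measurable
    show ?thesis using le unfolding eq .
  qed
  have sep: "min (1/4) p \<le> ky_fan_mod (f i) (f j)" if ij: "i \<noteq> j" for i j
    unfolding ky_fan_mod_def
  proof (rule cINF_greatest)
    fix c :: real
    show "min (1/4) p \<le> ky_fan \<pi> (f i) (\<lambda>x. f j x + c)"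
      unfolding ky_fan_Inf
    proof (rule cInf_greatest)
      fix e assume e: "e \<in> ky_fan_bound (f i) (\<lambda>x. f j x + c)"
      show "min (1/4) p \<le> e"
      proof (cases "e < 1/4")
        case True
        let ?E = "{x \<in> space \<pi>. e < \<bar>f i x - (f j x + c)\<bar>}"
        have "p \<le> measure \<pi> ?E"
        \<comment> \<open>No constant can compensate: according to its sign, one of the two events
          obtained by exchanging \<open>i\<close> and \<open>j\<close> has a difference that the
          constant only enlarges.\<close>
        proof (cases "c \<le> 0")
          case c: True
          have "measure \<pi> {\<gamma> \<in> space \<pi>. nearest (3 * real i) \<gamma> - nearest (3 * real j) \<gamma> \<ge> 1/4} \<le> measure \<pi> ?E"
            unfolding f_def using True c by (intro finite_measure_mono) auto
          with event[OF ij] show ?thesis by linarith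
        next
          case c: False
          have "measure \<pi> {\<gamma> \<in> space \<pi>. nearest (3 * real j) \<gamma> - nearest (3 * real i) \<gamma> \<ge> 1/4} \<le> measure \<pi> ?E"
            unfolding f_def using True c by (intro finite_measure_mono) auto
          with event[OF ij[symmetric]] show ?thesis by linarith
        qed
        moreover have "measure \<pi> ?E \<le> e" using e by (simp add: ky_fan_bound_def)
        ultimately show ?thesis by (meson min.coboundedI2 order_trans)
      qed simp
    qed (use ky_fan_bound_nonempty in blast)
  qed simp
  note L1 = L1_space_metric[of ?X, unfolded X, OF prob_space_axioms]
  show ?thesis
    unfolding concentrated_def
  proof (rule separated_not_compact)
    show "ae_const_rel ?X `` {f j} \<in> mspace (L1_space ?X)" for j
      unfolding L1(1) using fL by (rule quotientI)
    show "min (1/4) p > 0" using p by simp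
    show "min (1/4) p \<le> mdist (L1_space ?X) (ae_const_rel ?X `` {f i}) (ae_const_rel ?X `` {f j})" if "i \<noteq> j" for i j
      unfolding L1(2)[OF fL fL] using that by (rule sep)
  qed
qed

section \<open>Approximation by windows\<close>

text \<open>The N-dimensional space with the maximum norm, as sequences vanishing from N on, so that
  one type serves all N. The 0 inserted in \<open>sup_dist\<close> covers
  \<open>N = 0\<close>.\<close>

definition sup_carrier :: "nat \<Rightarrow> (nat \<Rightarrow> real) set" where
  "sup_carrier N = {f. \<forall>i\<ge>N. f i = 0}"

definition sup_dist :: "nat \<Rightarrow> (nat \<Rightarrow> real) \<Rightarrow> (nat \<Rightarrow> real) \<Rightarrow> real" where
  "sup_dist N f g = Max (insert 0 ((\<lambda>i. \<bar>f i - g i\<bar>) ` {..<N}))"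

lemma sup_dist_le_iff: "sup_dist N f g \<le> e \<longleftrightarrow> 0 \<le> e \<and> (\<forall>i<N. \<bar>f i - g i\<bar> \<le> e)"
  and sup_dist_less_iff: "sup_dist N f g < e \<longleftrightarrow> 0 < e \<and> (\<forall>i<N. \<bar>f i - g i\<bar> < e)"
  unfolding sup_dist_def by (subst Max_le_iff Max_less_iff; auto)+

lemma sup_dist_nonneg: "0 \<le> sup_dist N f g"
  unfolding sup_dist_def by (intro Max_ge) auto

lemma sup_dist_ge: "i < N \<Longrightarrow> \<bar>f i - g i\<bar> \<le> sup_dist N f g"
  unfolding sup_dist_def by (intro Max_ge) auto

lemma Metric_space_sup: "Metric_space (sup_carrier N) (sup_dist N)"
proof
  fix f g h
  show "0 \<le> sup_dist N f g" by (rule sup_dist_nonneg)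
  show "sup_dist N f g = sup_dist N g f" by (simp add: sup_dist_def abs_minus_commute)
  show "sup_dist N f g = 0 \<longleftrightarrow> f = g" if "f \<in> sup_carrier N" "g \<in> sup_carrier N"
  proof
    assume "sup_dist N f g = 0"
    then have "\<forall>i<N. f i = g i" using sup_dist_le_iff[of N f g 0] by auto
    then show "f = g" using that by (intro ext) (metis (mono_tags) mem_Collect_eq not_less sup_carrier_def)
  next
    assume "f = g"
    then have "sup_dist N f g \<le> 0" by (simp add: sup_dist_le_iff)
    then show "sup_dist N f g = 0" using sup_dist_nonneg[of N f g] by linarith
  qed
  show "sup_dist N f h \<le> sup_dist N f g + sup_dist N g h"
    unfolding sup_dist_le_iff[of N f h]
  proof (intro conjI allI impI)
    fix i assume "i < N"
    then show "\<bar>f i - h i\<bar> \<le> sup_dist N f g + sup_dist N g h"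
      using sup_dist_ge[of i N f g] sup_dist_ge[of i N g h] by linarith
  qed (simp add: sup_dist_nonneg)
qed

definition sup_metric :: "nat \<Rightarrow> (nat \<Rightarrow> real) metric" where
  "sup_metric N = metric (sup_carrier N, sup_dist N)"

lemma mspace_sup_metric [simp]: "mspace (sup_metric N) = sup_carrier N"
  and mdist_sup_metric [simp]: "mdist (sup_metric N) = sup_dist N"
  unfolding sup_metric_def
  by (simp_all add: Metric_space.mspace_metric[OF Metric_space_sup] Metric_space.mdist_metric[OF Metric_space_sup])

lemma mcomplete_sup_metric: "mcomplete_of (sup_metric N)"
  unfolding mcomplete_of_def mspace_sup_metric mdist_sup_metric
proof -
  interpret Metric_space "sup_carrier N" "sup_dist N" by (rule Metric_space_sup)
  show mcomplete
    unfolding mcomplete_def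
  proof (intro allI impI)
    fix \<sigma> assume C: "MCauchy \<sigma>"
    then have \<sigma>: "\<sigma> n \<in> sup_carrier N" for n by (auto simp: MCauchy_def)
    have "convergent (\<lambda>n. \<sigma> n i)" if i: "i < N" for i
    proof -
      have "Cauchy (\<lambda>n. \<sigma> n i)"
      proof (rule metric_CauchyI)
        fix e :: real assume "e > 0"
        then obtain M where M: "\<And>n n'. M \<le> n \<Longrightarrow> M \<le> n' \<Longrightarrow> sup_dist N (\<sigma> n) (\<sigma> n') < e"
          using C unfolding MCauchy_def by meson
        have "dist (\<sigma> m i) (\<sigma> n i) < e" if "m \<ge> M" "n \<ge> M" for m n
          using sup_dist_ge[OF i, of "\<sigma> m" "\<sigma> n"] M[OF that] by (simp add: dist_real_def)
        then show "\<exists>M. \<forall>m\<ge>M. \<forall>n\<ge>M. dist (\<sigma> m i) (\<sigma> n i) < e" by blast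
      qed
      then show ?thesis by (simp add: Cauchy_convergent_iff)
    qed
    then have lim: "(\<lambda>n. \<sigma> n i) \<longlonglongrightarrow> lim (\<lambda>n. \<sigma> n i)" if "i < N" for i
      using that by (simp add: convergent_LIMSEQ_iff)
    define l where "l i = (if i < N then lim (\<lambda>n. \<sigma> n i) else 0)" for i
    have "limitin mtopology \<sigma> l sequentially"
      unfolding limit_metric_sequentially
    proof (intro conjI allI impI)
      show "l \<in> sup_carrier N" by (simp add: l_def sup_carrier_def)
      fix e :: real assume e: "e > 0"
      have "\<forall>\<^sub>F n in sequentially. \<forall>i\<in>{..<N}. \<bar>\<sigma> n i - l i\<bar> < e"
      proof (intro eventually_ball_finite ballI)
        fix i assume "i \<in> {..<N}"
        then have i: "i < N" by simp
        from tendstoD[OF lim[OF i] e] show "\<forall>\<^sub>F n in sequentially. \<bar>\<sigma> n i - l i\<bar> < e"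
          using i by (simp add: l_def dist_real_def)
      qed simp
      then show "\<exists>M. \<forall>n\<ge>M. \<sigma> n \<in> sup_carrier N \<and> sup_dist N (\<sigma> n) l < e"
        using e \<sigma> by (auto simp: eventually_sequentially sup_dist_less_iff)
    qed
    then show "\<exists>x. limitin mtopology \<sigma> x sequentially" by blast
  qed
qed

lemma separable_sup_metric: "separable_space (mtopology_of (sup_metric N))"
proof -
  interpret Metric_space "sup_carrier N" "sup_dist N" by (rule Metric_space_sup)
  let ?D = "(\<lambda>f i. if i < N then f i else 0) ` PiE {..<N} (\<lambda>_. \<rat> :: real set)"
  have "countable ?D" by (intro countable_image countable_PiE) (auto simp: countable_rat)
  moreover have sub: "?D \<subseteq> sup_carrier N"
  proof
    fix f assume "f \<in> ?D"
    then obtain h where "f = (\<lambda>i. if i < N then h i else 0)" by blast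
    then show "f \<in> sup_carrier N" by (simp add: sup_carrier_def)
  qed
  moreover have "mtopology closure_of ?D = sup_carrier N"
    unfolding metric_closure_of
  proof (intro equalityI subsetI CollectI conjI allI impI)
    fix f and r :: real assume f: "f \<in> sup_carrier N" and r: "r > 0"
    have "\<exists>q\<in>\<rat>. f i < q \<and> q < f i + r" for i using Rats_dense_in_real[of "f i" "f i + r"] r by simp
    then obtain q where q: "\<And>i. q i \<in> \<rat>" "\<And>i. f i < q i" "\<And>i. q i < f i + r" by metis
    let ?q = "restrict q {..<N}"
    let ?g = "\<lambda>i. if i < N then ?q i else 0"
    have "?g \<in> ?D" using q(1) by (intro image_eqI[of _ _ ?q]) auto
    moreover have "sup_dist N f ?g < r"
      unfolding sup_dist_less_iff using q(2,3) r by (auto simp: abs_less_iff less_imp_le) (smt (verit))+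
    moreover have "?g \<in> sup_carrier N" by (simp add: sup_carrier_def)
    ultimately show "\<exists>y\<in>?D. y \<in> mball f r" using f unfolding in_mball by (intro bexI[of _ ?g] conjI)
  qed blast
  ultimately show ?thesis
    unfolding separable_space_def mtopology_of_def by auto
qed

text \<open>The metric is transported along an injective real code. This is how a constructed space
  becomes a representative in \<open>mm_classes\<close>; its topology has nothing to do with that of
  the line.\<close>

lemma real_isometric_copy:
  fixes m :: "'a metric"
  assumes compl: "mcomplete_of m" and sep: "separable_space (mtopology_of m)" and ne: "mspace m \<noteq> {}"
  obtains m' :: "real metric" and c where "mcomplete_of m'" "separable_space (mtopology_of m')"
    "\<And>x. x \<in> mspace m \<Longrightarrow> c x \<in> mspace m'"
    "\<And>x y. x \<in> mspace m \<Longrightarrow> y \<in> mspace m \<Longrightarrow> mdist m' (c x) (c y) = mdist m x y"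
proof -
  obtain c :: "'a \<Rightarrow> real" and D where D: "\<And>x. x \<in> mspace m \<Longrightarrow> D (c x) = x"
    by (rule metric_code[OF compl sep ne]) blast
  let ?S = "c ` mspace m" and ?d = "\<lambda>s t. mdist m (D s) (D t)"
  have M: "Metric_space ?S ?d"
  proof
    fix s t u
    show "0 \<le> ?d s t" "?d s t = ?d t s" by (simp_all add: mdist_commute)
    show "?d s t = 0 \<longleftrightarrow> s = t" if "s \<in> ?S" "t \<in> ?S" using that D by auto
    show "?d s u \<le> ?d s t + ?d t u" if "s \<in> ?S" "t \<in> ?S" "u \<in> ?S"
      using that D by (auto intro: mdist_triangle)
  qed
  define m' where "m' = metric (?S, ?d)"
  have sp: "mspace m' = ?S" and di: "mdist m' = ?d"
    unfolding m'_def by (simp_all add: Metric_space.mspace_metric[OF M] Metric_space.mdist_metric[OF M])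
  have 1: "c x \<in> mspace m'" if "x \<in> mspace m" for x using that by (simp add: sp)
  have 2: "mdist m' (c x) (c y) = mdist m x y" if "x \<in> mspace m" "y \<in> mspace m" for x y
    using that by (simp add: di D)
  have "continuous_map (mtopology_of m) (mtopology_of m') c"
    by (rule continuous_map_nonexpansive) (simp_all add: 1 2)
  then have "separable_space (mtopology_of m')"
    by (rule separable_space_continuous_map_image[OF sep]) (simp add: sp)
  moreover have "mcomplete_of m'"
    unfolding mcomplete_of_def Metric_space.mcomplete_def[OF Metric_space_mspace_mdist]
  proof (intro allI impI)
    interpret A: Metric_space "mspace m" "mdist m" by simp
    interpret B: Metric_space "mspace m'" "mdist m'" by simp
    fix \<sigma> assume C: "B.MCauchy \<sigma>"
    have "\<sigma> n \<in> mspace m'" for n using C unfolding B.MCauchy_def by blast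
    then have \<sigma>: "\<sigma> n \<in> ?S" for n by (simp only: sp)
    have D\<sigma>: "D (\<sigma> n) \<in> mspace m" "c (D (\<sigma> n)) = \<sigma> n" for n using \<sigma>[of n] D by auto
    have "A.MCauchy (\<lambda>n. D (\<sigma> n))"
      using C D\<sigma>(1) unfolding A.MCauchy_def B.MCauchy_def by (auto simp: di)
    then obtain x where x: "limitin A.mtopology (\<lambda>n. D (\<sigma> n)) x sequentially"
      using compl unfolding mcomplete_of_def A.mcomplete_def by blast
    have "limitin B.mtopology \<sigma> (c x) sequentially"
      unfolding B.limit_metric_sequentially
    proof (intro conjI allI impI)
      have xm: "x \<in> mspace m" using x by (simp add: A.limit_metric_sequentially)
      then show "c x \<in> mspace m'" by (rule 1)
      fix \<epsilon> :: real assume "\<epsilon> > 0"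
      then obtain N where "\<forall>n\<ge>N. mdist m (D (\<sigma> n)) x < \<epsilon>"
        using x unfolding A.limit_metric_sequentially by meson
      then show "\<exists>N. \<forall>n\<ge>N. \<sigma> n \<in> mspace m' \<and> mdist m' (\<sigma> n) (c x) < \<epsilon>"
        using \<sigma> D[OF xm] unfolding sp di by (intro exI[of _ N]) simp
    qed
    then show "\<exists>x. limitin B.mtopology \<sigma> x sequentially" by blast
  qed
  ultimately show ?thesis using that[of m' c] 1 2 by blast
qed

lemma lip_dominatedI:
  assumes "\<phi> \<in> measurable (emm_meas X) (emm_meas Y)"
    "distr (emm_meas X) (emm_meas Y) \<phi> = emm_meas Y"
    "E \<in> sets (emm_meas X)" "emeasure (emm_meas X) E = 1"
    "\<And>x y. x \<in> E \<Longrightarrow> y \<in> E \<Longrightarrow> emm_dist Y (\<phi> x) (\<phi> y) \<le> emm_dist X x y"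
  shows "Y \<prec>\<^sub>L X"
  unfolding lip_dominated_def using assms by blast

lemma emm_of_mm_simps [simp]:
  "emm_meas (emm_of_mm X) = snd X" "emm_dist (emm_of_mm X) x y = ennreal (mdist (fst X) x y)"
  "emm_meas (config_emm \<pi>) = \<pi>" "emm_dist (config_emm \<pi>) = config_dist UNIV"
  by (simp_all add: emm_of_mm_def config_emm_def)

text \<open>The map onto the window preserves measure and does not increase distances, so it can be
  put before any map out of the window.\<close>

lemma pyramid_window_subset:
  assumes \<pi>: "poisson_measure \<pi>" and n: "n \<ge> 1"
  shows "pyramid (emm_of_mm (window_mm n)) \<subseteq> pyramid (config_emm \<pi>)"
proof -
  have "emm_of_mm Y \<prec>\<^sub>L config_emm \<pi>" if dom: "emm_of_mm Y \<prec>\<^sub>L emm_of_mm (window_mm n)" for Y :: "real mm"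
  proof -
    obtain \<psi> E where \<psi>: "\<psi> \<in> measurable (snd (window_mm n)) (snd Y)"
      "distr (snd (window_mm n)) (snd Y) \<psi> = snd Y" "E \<in> sets (snd (window_mm n))"
      "emeasure (snd (window_mm n)) E = 1"
      and lip: "\<And>x y. x \<in> E \<Longrightarrow> y \<in> E \<Longrightarrow> ennreal (mdist (fst Y) (\<psi> x) (\<psi> y)) \<le> ennreal (mdist (fst (window_mm n)) x y)"
      using dom unfolding lip_dominated_def emm_of_mm_simps by blast
    note W = window_map_law[OF \<pi> n]
    let ?E = "window_map n -` E \<inter> space \<pi>"
    show ?thesis
    proof (rule lip_dominatedI[of "\<lambda>u. \<psi> (window_map n u)" _ _ ?E])
      show "(\<lambda>u. \<psi> (window_map n u)) \<in> measurable (emm_meas (config_emm \<pi>)) (emm_meas (emm_of_mm Y))"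
        using measurable_compose[OF W(1) \<psi>(1)] by simp
      have "distr \<pi> (snd Y) (\<psi> \<circ> window_map n) = distr (distr \<pi> (snd (window_mm n)) (window_map n)) (snd Y) \<psi>"
        using \<psi>(1) W(1) by (rule distr_distr[symmetric])
      then show "distr (emm_meas (config_emm \<pi>)) (emm_meas (emm_of_mm Y)) (\<lambda>u. \<psi> (window_map n u)) = emm_meas (emm_of_mm Y)"
        using W(2) \<psi>(2) by (simp add: comp_def)
      show "?E \<in> sets (emm_meas (config_emm \<pi>))" using measurable_sets[OF W(1) \<psi>(3)] by simp
      have "emeasure \<pi> ?E = emeasure (distr \<pi> (snd (window_mm n)) (window_map n)) E"
        using emeasure_distr[OF W(1) \<psi>(3)] by simp
      then show "emeasure (emm_meas (config_emm \<pi>)) ?E = 1" using W(2) \<psi>(4) by simp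
      fix u v assume uv: "u \<in> ?E" "v \<in> ?E"
      then have c: "u \<in> configs UNIV" "v \<in> configs UNIV" by (auto simp: poisson_space[OF \<pi>])
      have "ennreal (mdist (fst Y) (\<psi> (window_map n u)) (\<psi> (window_map n v)))
          \<le> ennreal (mdist (fst (window_mm n)) (window_map n u) (window_map n v))"
        using uv by (intro lip) auto
      also have "\<dots> \<le> config_dist UNIV u v"
        unfolding mdist_window_map[OF c] by (rule wdist_le_config_dist[OF c])
      finally show "emm_dist (emm_of_mm Y) (\<psi> (window_map n u)) (\<psi> (window_map n v)) \<le> emm_dist (config_emm \<pi>) u v"
        by simp
    qed
  qed
  then show ?thesis unfolding pyramid_def by blast
qed

text \<open>
  Kuratowski-type embedding: distances to a finite net of the image, extended from \<open>K\<close> to the whole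
  window space by McShane's formula.
\<close>

lemma window_approximation:
  fixes Y :: "'b mm"
  assumes \<pi>: "poisson_measure \<pi>" and Y: "mm_space Y" and dom: "emm_of_mm Y \<prec>\<^sub>L config_emm \<pi>"
    and \<epsilon>: "0 < \<epsilon>" "\<epsilon> < 1"
  obtains n and Z :: "real mm" where "n \<ge> 1" "mm_space Z" "emm_of_mm Z \<prec>\<^sub>L emm_of_mm (window_mm n)" "box_mm Y Z \<le> 5 * \<epsilon>"
proof -
  interpret prob_space \<pi> by (rule poisson_prob_space[OF \<pi>])
  let ?d = "mdist (fst Y)"
  obtain \<phi> E where \<phi>: "\<phi> \<in> measurable \<pi> (snd Y)" "distr \<pi> (snd Y) \<phi> = snd Y" and E: "E \<in> sets \<pi>" "emeasure \<pi> E = 1"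
    and lip: "\<And>u v. u \<in> E \<Longrightarrow> v \<in> E \<Longrightarrow> ennreal (?d (\<phi> u) (\<phi> v)) \<le> config_dist UNIV u v"
    using dom unfolding lip_dominated_def emm_of_mm_simps by blast
  obtain K n y N where K: "K \<in> sets \<pi>" "1 - \<epsilon> \<le> measure \<pi> K" and n: "n \<ge> 1"
    and near: "\<And>u v. u \<in> K \<Longrightarrow> v \<in> K \<Longrightarrow> ?d (\<phi> u) (\<phi> v) \<le> wdist n u v + 3 * \<epsilon>"
    and y: "\<And>i. y i \<in> mspace (fst Y)" and net: "\<And>u. u \<in> K \<Longrightarrow> \<exists>i<N::nat. ?d (y i) (\<phi> u) < \<epsilon>"
    subgoal premises that
      by (rule lipschitz_up_to_window[OF \<pi> Y \<phi>(1) E _ \<epsilon>(1)]) (erule (1) lip, rule that)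
    done
  have Kc: "u \<in> configs UNIV" if "u \<in> K" for u
    using that sets.sets_into_space[OF K(1)] by (auto simp: poisson_space[OF \<pi>])
  have \<phi>m: "\<phi> u \<in> mspace (fst Y)" if "u \<in> K" for u
    using measurable_space[OF \<phi>(1), of u] Kc[OF that] by (simp add: poisson_space[OF \<pi>] space_mm_space[OF Y])
  \<comment> \<open>\<open>\<epsilon> < 1\<close> makes \<open>K\<close> nonempty, as the infima in
    \<open>g\<close> require.\<close>
  have "measure \<pi> K > 0" using K(2) \<epsilon> by linarith
  then have Kne: "K \<noteq> {}" by auto
  let ?W = "fst (window_mm n)" and ?\<mu> = "snd (window_mm n)"
  let ?\<Phi> = "window_map n"
  note law = window_map_law[OF \<pi> n]
  define g where "g i \<xi> = (INF u\<in>K. ?d (\<phi> u) (y i) + mdist ?W \<xi> (?\<Phi> u))" for i \<xi>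
  have bdd: "bdd_below ((\<lambda>u. ?d (\<phi> u) (y i) + mdist ?W \<xi> (?\<Phi> u)) ` K)" for i \<xi>
    by (rule bdd_belowI[of _ 0]) auto
  have g_lip1: "g i \<xi> \<le> mdist ?W \<xi> \<xi>' + g i \<xi>'" if "\<xi> \<in> mspace ?W" "\<xi>' \<in> mspace ?W" for i \<xi> \<xi>'
  proof -
    have "g i \<xi> - mdist ?W \<xi> \<xi>' \<le> g i \<xi>'"
      unfolding g_def[of i \<xi>']
    proof (rule cINF_greatest[OF Kne])
      fix u assume u: "u \<in> K"
      have "g i \<xi> \<le> ?d (\<phi> u) (y i) + mdist ?W \<xi> (?\<Phi> u)"
        unfolding g_def by (rule cINF_lower[OF bdd u])
      also have "mdist ?W \<xi> (?\<Phi> u) \<le> mdist ?W \<xi> \<xi>' + mdist ?W \<xi>' (?\<Phi> u)"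
        using that window_map_in_mspace[OF Kc[OF u]] by (intro mdist_triangle)
      finally show "g i \<xi> - mdist ?W \<xi> \<xi>' \<le> ?d (\<phi> u) (y i) + mdist ?W \<xi>' (?\<Phi> u)" by simp
    qed
    then show ?thesis by simp
  qed
  have g_lip: "\<bar>g i \<xi> - g i \<xi>'\<bar> \<le> mdist ?W \<xi> \<xi>'" if "\<xi> \<in> mspace ?W" "\<xi>' \<in> mspace ?W" for i \<xi> \<xi>'
    using g_lip1[OF that, of i] g_lip1[OF that(2,1), of i] mdist_commute[of ?W \<xi>' \<xi>] by (simp add: abs_le_iff)
  have g_upper: "g i (?\<Phi> u) \<le> ?d (\<phi> u) (y i)" if u: "u \<in> K" for i u
  proof -
    have "g i (?\<Phi> u) \<le> ?d (\<phi> u) (y i) + mdist ?W (?\<Phi> u) (?\<Phi> u)"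
      unfolding g_def by (rule cINF_lower[OF bdd u])
    moreover have "mdist ?W (?\<Phi> u) (?\<Phi> u) = 0" using window_map_in_mspace[OF Kc[OF u], of n] by simp
    ultimately show ?thesis by linarith
  qed
  \<comment> \<open>The additive error in the bound on \<open>K\<close> is the only defect of the
    extension: on \<open>K\<close> it falls short of the given distance by at most
    \<open>3 * \<epsilon>\<close>.\<close>
  have g_lower: "?d (\<phi> u) (y i) - 3 * \<epsilon> \<le> g i (?\<Phi> u)" if u: "u \<in> K" for i u
    unfolding g_def
  proof (rule cINF_greatest[OF Kne])
    fix v assume v: "v \<in> K"
    have "?d (\<phi> u) (y i) \<le> ?d (\<phi> u) (\<phi> v) + ?d (\<phi> v) (y i)"
      using \<phi>m u v y by (intro mdist_triangle) auto
    then show "?d (\<phi> u) (y i) - 3 * \<epsilon> \<le> ?d (\<phi> v) (y i) + mdist ?W (?\<Phi> u) (?\<Phi> v)"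
      using near[OF u v] mdist_window_map[OF Kc[OF u] Kc[OF v], of n] by linarith
  qed
  define G where "G \<xi> i = (if i < N then g i \<xi> else 0)" for \<xi> i
  have GC: "G \<xi> \<in> mspace (sup_metric N)" for \<xi> by (simp add: G_def sup_carrier_def)
  then have ne: "mspace (sup_metric N) \<noteq> {}" by blast
  obtain m' :: "real metric" and c where m': "mcomplete_of m'" "separable_space (mtopology_of m')"
    and c: "\<And>f. f \<in> mspace (sup_metric N) \<Longrightarrow> c f \<in> mspace m'"
    and iso: "\<And>f g. f \<in> mspace (sup_metric N) \<Longrightarrow> g \<in> mspace (sup_metric N) \<Longrightarrow> mdist m' (c f) (c g) = mdist (sup_metric N) f g"
    subgoal premises that by (rule real_isometric_copy[OF mcomplete_sup_metric separable_sup_metric ne]) (rule that)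
    done
  let ?G = "\<lambda>\<xi>. c (G \<xi>)"
  have G_dist: "mdist m' (?G \<xi>) (?G \<xi>') = sup_dist N (G \<xi>) (G \<xi>')" for \<xi> \<xi>'
    using iso[OF GC GC] by simp
  have G_lip: "mdist m' (?G \<xi>) (?G \<xi>') \<le> mdist ?W \<xi> \<xi>'" if "\<xi> \<in> mspace ?W" "\<xi>' \<in> mspace ?W" for \<xi> \<xi>'
    unfolding G_dist sup_dist_le_iff using g_lip[OF that] by (simp add: G_def)
  have G_meas: "?G \<in> measurable ?\<mu> (borel_on (mtopology_of m'))"
  proof -
    have "?G \<in> measurable (borel_on (mtopology_of ?W)) (borel_on (mtopology_of m'))"
      by (intro measurable_borel_on_continuous continuous_map_nonexpansive c GC G_lip)
    then show ?thesis using measurable_cong_sets[OF law(3) refl] by blast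
  qed
  define Z where "Z = (m', distr ?\<mu> (borel_on (mtopology_of m')) ?G)"
  have Z: "fst Z = m'" "snd Z = distr ?\<mu> (borel_on (mtopology_of m')) ?G" by (simp_all add: Z_def)
  have \<mu>: "prob_space ?\<mu>"
    using prob_space_distr[OF law(1)] law(2) by simp
  have Zmm: "mm_space Z"
    unfolding mm_space_def Z using m' prob_space.prob_space_distr[OF \<mu> G_meas] by simp
  have sp\<mu>: "space ?\<mu> = mspace ?W"
    using sets_eq_imp_space_eq[OF law(3)] by simp
  have GZ: "?G \<in> measurable ?\<mu> (snd Z)" using G_meas by (simp add: Z)
  have "emm_of_mm Z \<prec>\<^sub>L emm_of_mm (window_mm n)"
  proof (rule lip_dominatedI[of ?G _ _ "space ?\<mu>"])
    show "?G \<in> measurable (emm_meas (emm_of_mm (window_mm n))) (emm_meas (emm_of_mm Z))" using GZ by simp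
    show "distr (emm_meas (emm_of_mm (window_mm n))) (emm_meas (emm_of_mm Z)) ?G = emm_meas (emm_of_mm Z)"
      unfolding emm_of_mm_simps by (subst (2) Z(2), rule distr_cong) (simp_all add: Z)
    show "emeasure (emm_meas (emm_of_mm (window_mm n))) (space ?\<mu>) = 1"
      using prob_space.emeasure_space_1[OF \<mu>] by simp
    show "emm_dist (emm_of_mm Z) (?G \<xi>) (?G \<xi>') \<le> emm_dist (emm_of_mm (window_mm n)) \<xi> \<xi>'"
      if "\<xi> \<in> space ?\<mu>" "\<xi>' \<in> space ?\<mu>" for \<xi> \<xi>'
      using G_lip that by (simp add: sp\<mu> Z ennreal_leI)
  qed simp
  moreover have "box_mm Y Z \<le> 5 * \<epsilon>"
  proof (rule box_mm_le[OF Y Zmm prob_space_axioms \<phi>, of "\<lambda>u. ?G (?\<Phi> u)" K])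
    show "(\<lambda>u. ?G (?\<Phi> u)) \<in> measurable \<pi> (snd Z)" by (rule measurable_compose[OF law(1) GZ])
    have "distr \<pi> (snd Z) (?G \<circ> ?\<Phi>) = distr (distr \<pi> ?\<mu> ?\<Phi>) (snd Z) ?G"
      using GZ law(1) by (rule distr_distr[symmetric])
    also have "\<dots> = distr ?\<mu> (snd Z) ?G" using law(2) by simp
    also have "\<dots> = snd Z" by (subst (2) Z(2), rule distr_cong) (simp_all add: Z)
    finally show "distr \<pi> (snd Z) (\<lambda>u. ?G (?\<Phi> u)) = snd Z" by (simp add: comp_def)
    show "K \<in> sets \<pi>" "1 - 5 * \<epsilon> \<le> measure \<pi> K" "0 \<le> 5 * \<epsilon>" using K \<epsilon> by auto
    fix u v assume u: "u \<in> K" and v: "v \<in> K"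
    have tri: "\<bar>?d (\<phi> u) (y i) - ?d (\<phi> v) (y i)\<bar> \<le> ?d (\<phi> u) (\<phi> v)" for i
    proof -
      have "?d (\<phi> u) (y i) \<le> ?d (\<phi> u) (\<phi> v) + ?d (\<phi> v) (y i)" "?d (\<phi> v) (y i) \<le> ?d (\<phi> v) (\<phi> u) + ?d (\<phi> u) (y i)"
        using \<phi>m u v y by (auto intro!: mdist_triangle)
      then show ?thesis using mdist_commute[of "fst Y" "\<phi> v" "\<phi> u"] by linarith
    qed
    have "sup_dist N (G (?\<Phi> u)) (G (?\<Phi> v)) \<le> ?d (\<phi> u) (\<phi> v) + 3 * \<epsilon>"
      unfolding sup_dist_le_iff
    proof (intro conjI allI impI)
      fix i assume "i < N"
      then show "\<bar>G (?\<Phi> u) i - G (?\<Phi> v) i\<bar> \<le> ?d (\<phi> u) (\<phi> v) + 3 * \<epsilon>"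
        using g_upper[OF u, of i] g_upper[OF v, of i] g_lower[OF u, of i] g_lower[OF v, of i] tri[of i]
        by (simp add: G_def)
    qed (use \<epsilon> in simp)
    \<comment> \<open>A net point within \<open>\<epsilon>\<close> of the image of \<open>u\<close>
      sees the distance to the image of \<open>v\<close> up to \<open>2 * \<epsilon>\<close>; the
      defect of the extension at \<open>v\<close> adds \<open>3 * \<epsilon>\<close>. This is the
      origin of the factor 5.\<close>
    moreover have "?d (\<phi> u) (\<phi> v) - 5 * \<epsilon> \<le> sup_dist N (G (?\<Phi> u)) (G (?\<Phi> v))"
    proof -
      obtain i where i: "i < N" "?d (y i) (\<phi> u) < \<epsilon>" using net[OF u] by blast
      have "?d (\<phi> u) (\<phi> v) \<le> ?d (\<phi> u) (y i) + ?d (y i) (\<phi> v)"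
        using \<phi>m u v y by (intro mdist_triangle) auto
      moreover have "\<bar>G (?\<Phi> u) i - G (?\<Phi> v) i\<bar> \<le> sup_dist N (G (?\<Phi> u)) (G (?\<Phi> v))"
        using i(1) by (rule sup_dist_ge)
      ultimately show ?thesis
        using g_upper[OF u, of i] g_lower[OF v, of i] i
          mdist_commute[of "fst Y" "\<phi> u" "y i"] mdist_commute[of "fst Y" "\<phi> v" "y i"]
        by (simp add: G_def)
    qed
    ultimately show "\<bar>?d (\<phi> u) (\<phi> v) - mdist (fst Z) (?G (?\<Phi> u)) (?G (?\<Phi> v))\<bar> \<le> 5 * \<epsilon>"
      unfolding Z G_dist using \<epsilon> by (simp add: abs_le_iff)
  qed
  ultimately show ?thesis using that n Zmm by blast
qed

lemma mm_rel_refl: "mm_space X \<Longrightarrow> (X, X) \<in> mm_rel"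
  unfolding mm_rel_def mm_iso_def by (auto intro!: exI[of _ "\<lambda>x. x"] simp: distr_id)

lemma box_dist_bdd:
  assumes "\<And>X. X \<in> P \<Longrightarrow> mm_space X" "\<And>X. X \<in> Q \<Longrightarrow> mm_space X"
  shows "bdd_below ((\<lambda>(X, Y). box_mm X Y) ` (P \<times> Q))"
proof (rule bdd_belowI[of _ 0])
  fix t assume "t \<in> (\<lambda>(X, Y). box_mm X Y) ` (P \<times> Q)"
  then obtain z where "z \<in> P \<times> Q" "t = (case z of (X, Y) \<Rightarrow> box_mm X Y)" by blast
  then have "fst z \<in> P" "snd z \<in> Q" "t = box_mm (fst z) (snd z)"
    by (simp_all add: mem_Times_iff case_prod_beta)
  then show "0 \<le> t" using box_mm_nonneg[OF assms] by simp
qed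

lemma box_closure_mono: "A \<subseteq> B \<Longrightarrow> box_closure A \<subseteq> box_closure B"
  unfolding box_closure_def by blast

lemma box_closure_pyramid_subset:
  assumes \<pi>: "poisson_measure \<pi>"
  shows "box_closure (pyramid (config_emm \<pi>)) \<subseteq> box_closure (\<Union>n\<in>{1..}. pyramid (emm_of_mm (window_mm n)))"
proof
  fix P assume P: "P \<in> box_closure (pyramid (config_emm \<pi>))"
  then have Pc: "P \<in> mm_classes" by (simp add: box_closure_def)
  then obtain X0 where X0: "mm_space X0" "P = mm_rel `` {X0}"
    unfolding mm_classes_def by (auto elim: quotientE)
  have Pmm: "mm_space X" if "X \<in> P" for X using that X0 by (auto simp: mm_rel_def)
  show "P \<in> box_closure (\<Union>n\<in>{1..}. pyramid (emm_of_mm (window_mm n)))"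
    unfolding box_closure_def
  proof (intro CollectI conjI Pc allI impI)
    fix \<epsilon> :: real assume \<epsilon>: "\<epsilon> > 0"
    then have "\<epsilon> / 2 > 0" by simp
    then obtain Q where Q: "Q \<in> pyramid (config_emm \<pi>)" "box_dist P Q < \<epsilon> / 2"
      using P unfolding box_closure_def by blast
    then obtain Y :: "real mm" where Y: "mm_space Y" "emm_of_mm Y \<prec>\<^sub>L config_emm \<pi>" "Q = mm_rel `` {Y}"
      unfolding pyramid_def by blast
    have Qmm: "mm_space X" if "X \<in> Q" for X using that Y by (auto simp: mm_rel_def)
    have "X0 \<in> P" "Y \<in> Q" using X0 Y mm_rel_refl[OF X0(1)] mm_rel_refl[OF Y(1)] by simp_all
    then have ne: "P \<times> Q \<noteq> {}" by blast
    have "(INF (X, Y)\<in>P \<times> Q. box_mm X Y) < \<epsilon> / 2"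
      using Q(2) by (simp add: box_dist_def class_dist_def)
    \<comment> \<open>\<open>box_dist\<close> is an infimum over representatives, so closeness of
      the classes comes with some representatives \<open>X\<close> and \<open>Y1\<close> rather than
      with the given ones.\<close>
    then obtain X Y1 where XY1: "X \<in> P" "Y1 \<in> Q" "box_mm X Y1 < \<epsilon> / 2"
    proof -
      assume a: "(INF (X, Y)\<in>P \<times> Q. box_mm X Y) < \<epsilon> / 2"
        and t: "\<And>X Y1. X \<in> P \<Longrightarrow> Y1 \<in> Q \<Longrightarrow> box_mm X Y1 < \<epsilon> / 2 \<Longrightarrow> thesis"
      obtain z where "z \<in> P \<times> Q" "(case z of (X, Y) \<Rightarrow> box_mm X Y) < \<epsilon> / 2"
        using a cINF_less_iff[OF ne box_dist_bdd[OF Pmm Qmm]] by blast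
      then show thesis using t[of "fst z" "snd z"] by (simp add: mem_Times_iff case_prod_beta)
    qed
    \<comment> \<open>The dominated space is \<open>Y\<close>, not \<open>Y1\<close>; they are at
      box distance zero, and the triangle inequality passes from one to the other. Symmetry of the
      box distance makes one direction of the isomorphism enough.\<close>
    have "mm_iso Y Y1" using XY1(2) Y(3) by (auto simp: mm_rel_def)
    then have "box_mm Y1 Y < \<epsilon> / 8"
      using mm_iso_box[OF Y(1) Qmm[OF XY1(2)]] box_mm_commute[OF Y(1) Qmm[OF XY1(2)]] \<epsilon> by simp
    with XY1 have XY: "box_mm X Y < \<epsilon> / 2 + \<epsilon> / 8"
      using box_mm_triangle_less[OF Pmm[OF XY1(1)] Qmm[OF XY1(2)] Y(1)] by blast
    \<comment> \<open>The window approximation then costs less than \<open>\<epsilon> / 4\<close>,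
      and \<open>\<epsilon> / 2 + \<epsilon> / 8 + \<epsilon> / 4\<close> stays below
      \<open>\<epsilon>\<close>. The bound 1/2 secures \<open>\<delta> < 1\<close>.\<close>
    define \<delta> where "\<delta> = min (\<epsilon> / 40) (1 / 2)"
    have \<delta>: "0 < \<delta>" "\<delta> < 1" "5 * \<delta> < \<epsilon> / 4" using \<epsilon> by (auto simp: \<delta>_def)
    obtain n and Z :: "real mm" where Z: "n \<ge> 1" "mm_space Z" "emm_of_mm Z \<prec>\<^sub>L emm_of_mm (window_mm n)" "box_mm Y Z \<le> 5 * \<delta>"
      by (rule window_approximation[OF \<pi> Y(1,2) \<delta>(1,2)])
    have "box_mm Y Z < \<epsilon> / 4" using Z(4) \<delta>(3) by linarith
    with XY have XZ: "box_mm X Z < \<epsilon> / 2 + \<epsilon> / 8 + \<epsilon> / 4"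
      by (rule box_mm_triangle_less[OF Pmm[OF XY1(1)] Y(1) Z(2)])
    let ?R = "mm_rel `` {Z}"
    have Rmm: "mm_space X" if "X \<in> ?R" for X using that by (auto simp: mm_rel_def)
    have "(X, Z) \<in> P \<times> ?R" using XY1(1) mm_rel_refl[OF Z(2)] by simp
    from cINF_lower[OF box_dist_bdd[OF Pmm Rmm] this] have "box_dist P ?R \<le> box_mm X Z"
      by (simp add: box_dist_def class_dist_def)
    moreover have "?R \<in> (\<Union>n\<in>{1..}. pyramid (emm_of_mm (window_mm n)))"
    proof
      show "n \<in> {1..}" using Z(1) by simp
      show "?R \<in> pyramid (emm_of_mm (window_mm n))" using Z(2,3) unfolding pyramid_def by blast
    qed
    ultimately show "\<exists>Q\<in>(\<Union>n\<in>{1..}. pyramid (emm_of_mm (window_mm n))). box_dist P Q < \<epsilon>"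
      using XZ \<epsilon> by (intro bexI[of _ ?R]) auto
  qed
qed

theorem corollary1p12:
  fixes \<pi> :: "real measure measure"
  assumes "poisson_measure \<pi>"
  shows "box_closure (pyramid (config_emm \<pi>))
           = box_closure (\<Union>n\<in>{1..}. pyramid (emm_of_mm (window_mm n)))
         \<and> \<not> concentrated (config_emm \<pi>)"
proof
  have "(\<Union>n\<in>{1..}. pyramid (emm_of_mm (window_mm n))) \<subseteq> pyramid (config_emm \<pi>)"
    using pyramid_window_subset[OF assms] by auto
  then show "box_closure (pyramid (config_emm \<pi>))
      = box_closure (\<Union>n\<in>{1..}. pyramid (emm_of_mm (window_mm n)))"
    using box_closure_mono box_closure_pyramid_subset[OF assms] by (intro equalityI) auto
  show "\<not> concentrated (config_emm \<pi>)"
    by (rule poisson_not_concentrated[OF assms])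
qed

end
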